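(* Let $\alpha\in(1,2)$ and $p\in(1,\infty]$ satisfy $\alpha p>2$. Then there exist a compact metric space $X$ with an Ahlfors regular measure $\mu$ and a Laplacian operator $\mathcal{L}$ which is densely defined on $L^{2}(X,\mu)$, non-negative definite, self-adjoint, Markovian and strongly local, such that neither $W^{\alpha,p}_{\mathcal{L}}$ nor $\dot{W}^{\alpha,p}_{\mathcal{L}}\cap L^{\infty}$ is an algebra under the pointwise product.
   Context: For a measure space $(X,\mu)$ with a non-negative definite, self-adjoint, Markovian operator $\mathcal{L}$ with dense domain in $L^2(\mu)$, the homogeneous and inhomogeneous (Bessel potential) Sobolev spaces are $$\dot{W}_{\mathcal{L}}^{\alpha,p}=\{f\in L^p_{\mathrm{loc}}(X,\mu):\mathcal{L}^{\alpha/2}f\in L^p(X,\mu)\},\qquad \|f\|_{\dot W^{\alpha,p}_{\mathcal{L}}}=\|\mathcal{L}^{\alpha/2}f\|_p,$$ $$W_{\mathcal{L}}^{\alpha,p}=\{f\in L^p(X,\mu):\mathcal{L}^{\alpha/2}f\in L^p(X,\mu)\},\qquad \|f\|_{W^{\alpha,p}_{\mathcal{L}}}=\|f\|_p+\|\mathcal{L}^{\alpha/2}f\|_p.$$ "Laplacian operator" means the generator of a Dirichlet form: there is a Dirichlet form $\mathcal{E}$ on $L^2(X,\mu)$ such that $\mathcal{E}(u,v)=\int(\mathcal{L}u)v\,d\mu$ for $u$ in the domain of $\mathcal{L}$ and $v$ in the domain of $\mathcal{E}$. "Markovian" and "strongly local" mean that the associated form is Markovian and strongly local. The examples are compact self-similar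 fractals on which $\mathcal{L}$ is the Dirichlet Laplacian of a self-similar resistance form; its spectrum is bounded below by some $\lambda_1>0$, and "$\mathcal{L}^{\alpha/2}f\in L^p$" is understood as $f=\mathcal{L}^{-\alpha/2}g$ for some $g\in L^p(X,\mu)$, where $\mathcal{L}^{-s}$ ($0<s<1$) is the integral operator with kernel $\Gamma(s)^{-1}\int_0^\infty t^{s-1}h_t(x,y)\,dt$ and $h_t$ is the heat kernel of $e^{-t\mathcal{L}}$. A function space is an algebra if it is closed under pointwise multiplication. *)

theory Defs
  imports "HOL-Analysis.Analysis"
begin

section \<open>Metric measure spaces\<close>

definition borel_measure_on :: "'a metric \<Rightarrow> 'a measure \<Rightarrow> bool" where
  "borel_measure_on X \<mu> \<longleftrightarrow>
     space \<mu> = mspace X \<and>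
     sets \<mu> = sigma_sets (mspace X) {U. openin (mtopology_of X) U}"

text \<open>The condition \<open>r < d(y,z)\<close> for some points \<open>y\<close>, \<open>z\<close> says \<open>r < diam X\<close>.\<close>

definition ahlfors_regular :: "'a metric \<Rightarrow> 'a measure \<Rightarrow> bool" where
  "ahlfors_regular X \<mu> \<longleftrightarrow>
     (\<exists>Q>0. \<exists>c>0. \<exists>C>0. \<forall>x\<in>mspace X. \<forall>r>0.
        (\<exists>y\<in>mspace X. \<exists>z\<in>mspace X. r < mdist X y z) \<longrightarrow>
          ennreal (c * r powr Q) \<le> emeasure \<mu> (mball_of X x r) \<and>
          emeasure \<mu> (mball_of X x r) \<le> ennreal (C * r powr Q))"

section \<open>Lebesgue spaces\<close>

text \<open>Elements of \<open>L\<^sup>p\<close> are represented by measurable real functions; equality of classes is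
  equality almost everywhere. Only the values on \<open>space \<mu>\<close> matter.\<close>

definition ae_eq :: "'a measure \<Rightarrow> ('a \<Rightarrow> real) \<Rightarrow> ('a \<Rightarrow> real) \<Rightarrow> bool" where
  "ae_eq \<mu> f g \<longleftrightarrow> (AE x in \<mu>. f x = g x)"

definition Lp :: "ennreal \<Rightarrow> 'a measure \<Rightarrow> ('a \<Rightarrow> real) set" where
  "Lp p \<mu> = {f \<in> borel_measurable \<mu>.
     if p = \<infinity> then \<exists>C. AE x in \<mu>. \<bar>f x\<bar> \<le> C
     else integrable \<mu> (\<lambda>x. \<bar>f x\<bar> powr enn2real p)}"

definition Lp_loc :: "ennreal \<Rightarrow> 'a metric \<Rightarrow> 'a measure \<Rightarrow> ('a \<Rightarrow> real) set" where
  "Lp_loc p X \<mu> = {f \<in> borel_measurable \<mu>.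
     \<forall>K. compactin (mtopology_of X) K \<longrightarrow> (\<lambda>x. indicator K x * f x) \<in> Lp p \<mu>}"

definition inner_L2 :: "'a measure \<Rightarrow> ('a \<Rightarrow> real) \<Rightarrow> ('a \<Rightarrow> real) \<Rightarrow> real" where
  "inner_L2 \<mu> f g = (\<integral>x. f x * g x \<partial>\<mu>)"

definition norm_L2 :: "'a measure \<Rightarrow> ('a \<Rightarrow> real) \<Rightarrow> real" where
  "norm_L2 \<mu> f = sqrt (inner_L2 \<mu> f f)"

definition subspace_L2 :: "'a measure \<Rightarrow> ('a \<Rightarrow> real) set \<Rightarrow> bool" where
  "subspace_L2 \<mu> V \<longleftrightarrow>
     V \<subseteq> Lp 2 \<mu> \<and> (\<lambda>_. 0) \<in> V \<and>
     (\<forall>f\<in>V. \<forall>g\<in>V. \<forall>a b. (\<lambda>x. a * f x + b * g x) \<in> V) \<and>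
     (\<forall>f\<in>V. \<forall>g\<in>borel_measurable \<mu>. ae_eq \<mu> f g \<longrightarrow> g \<in> V)"

definition dense_L2 :: "'a measure \<Rightarrow> ('a \<Rightarrow> real) set \<Rightarrow> bool" where
  "dense_L2 \<mu> V \<longleftrightarrow>
     (\<forall>f\<in>Lp 2 \<mu>. \<forall>e>0. \<exists>g\<in>V. norm_L2 \<mu> (\<lambda>x. f x - g x) < e)"

definition linear_L2 ::
  "'a measure \<Rightarrow> ('a \<Rightarrow> real) set \<Rightarrow> (('a \<Rightarrow> real) \<Rightarrow> 'a \<Rightarrow> real) \<Rightarrow> bool" where
  "linear_L2 \<mu> V A \<longleftrightarrow>
     (\<forall>f\<in>V. A f \<in> Lp 2 \<mu>) \<and>
     (\<forall>f\<in>V. \<forall>g\<in>V. ae_eq \<mu> f g \<longrightarrow> ae_eq \<mu> (A f) (A g)) \<and>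
     (\<forall>f\<in>V. \<forall>g\<in>V. \<forall>a b.
        ae_eq \<mu> (A (\<lambda>x. a * f x + b * g x)) (\<lambda>x. a * A f x + b * A g x))"

section \<open>Unbounded operators on \<open>L\<^sup>2\<close>\<close>

text \<open>An operator is given by its domain \<open>D\<close> and its action \<open>L\<close> on \<open>D\<close>; the values of \<open>L\<close>
  outside \<open>D\<close> are irrelevant.\<close>

definition operator_L2 ::
  "'a measure \<Rightarrow> ('a \<Rightarrow> real) set \<Rightarrow> (('a \<Rightarrow> real) \<Rightarrow> 'a \<Rightarrow> real) \<Rightarrow> bool" where
  "operator_L2 \<mu> D L \<longleftrightarrow> subspace_L2 \<mu> D \<and> linear_L2 \<mu> D L"

definition nonneg_definite ::
  "'a measure \<Rightarrow> ('a \<Rightarrow> real) set \<Rightarrow> (('a \<Rightarrow> real) \<Rightarrow> 'a \<Rightarrow> real) \<Rightarrow> bool" where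
  "nonneg_definite \<mu> D L \<longleftrightarrow> (\<forall>u\<in>D. 0 \<le> inner_L2 \<mu> (L u) u)"

text \<open>The left-hand side of the equivalence says that \<open>(v, w)\<close> lies in the graph of the adjoint.\<close>

definition self_adjoint ::
  "'a measure \<Rightarrow> ('a \<Rightarrow> real) set \<Rightarrow> (('a \<Rightarrow> real) \<Rightarrow> 'a \<Rightarrow> real) \<Rightarrow> bool" where
  "self_adjoint \<mu> D L \<longleftrightarrow>
     (\<forall>v\<in>Lp 2 \<mu>. \<forall>w\<in>Lp 2 \<mu>.
        (\<forall>u\<in>D. inner_L2 \<mu> (L u) v = inner_L2 \<mu> u w) \<longleftrightarrow> v \<in> D \<and> ae_eq \<mu> (L v) w)"

text \<open>Only real spectral values are considered; a self-adjoint operator has no others.\<close>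

definition resolvent_set_L2 ::
  "'a measure \<Rightarrow> ('a \<Rightarrow> real) set \<Rightarrow> (('a \<Rightarrow> real) \<Rightarrow> 'a \<Rightarrow> real) \<Rightarrow> real set" where
  "resolvent_set_L2 \<mu> D L = {z. \<exists>C. \<forall>w\<in>Lp 2 \<mu>. \<exists>u\<in>D.
     ae_eq \<mu> (\<lambda>x. L u x - z * u x) w \<and> norm_L2 \<mu> u \<le> C * norm_L2 \<mu> w \<and>
     (\<forall>v\<in>D. ae_eq \<mu> (\<lambda>x. L v x - z * v x) w \<longrightarrow> ae_eq \<mu> v u)}"

definition spectrum_L2 ::
  "'a measure \<Rightarrow> ('a \<Rightarrow> real) set \<Rightarrow> (('a \<Rightarrow> real) \<Rightarrow> 'a \<Rightarrow> real) \<Rightarrow> real set" where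
  "spectrum_L2 \<mu> D L = - resolvent_set_L2 \<mu> D L"

section \<open>Dirichlet forms\<close>

definition closed_symmetric_form ::
  "'a measure \<Rightarrow> ('a \<Rightarrow> real) set \<Rightarrow> (('a \<Rightarrow> real) \<Rightarrow> ('a \<Rightarrow> real) \<Rightarrow> real) \<Rightarrow> bool" where
  "closed_symmetric_form \<mu> F E \<longleftrightarrow>
     subspace_L2 \<mu> F \<and> dense_L2 \<mu> F \<and>
     (\<forall>u\<in>F. \<forall>u'\<in>F. \<forall>v\<in>F. ae_eq \<mu> u u' \<longrightarrow> E u v = E u' v) \<and>
     (\<forall>u\<in>F. \<forall>u'\<in>F. \<forall>v\<in>F. \<forall>a b. E (\<lambda>x. a * u x + b * u' x) v = a * E u v + b * E u' v) \<and>
     (\<forall>u\<in>F. \<forall>v\<in>F. E u v = E v u) \<and>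
     (\<forall>u\<in>F. 0 \<le> E u u) \<and>
     (let N = (\<lambda>u. E u u + inner_L2 \<mu> u u) in
        \<forall>U. (\<forall>n. U n \<in> F) \<and>
            (\<forall>e>0. \<exists>M. \<forall>m\<ge>M. \<forall>n\<ge>M. N (\<lambda>x. U m x - U n x) < e) \<longrightarrow>
            (\<exists>u\<in>F. (\<lambda>n::nat. N (\<lambda>x. U n x - u x)) \<longlonglongrightarrow> 0))"

definition markovian ::
  "('a \<Rightarrow> real) set \<Rightarrow> (('a \<Rightarrow> real) \<Rightarrow> ('a \<Rightarrow> real) \<Rightarrow> real) \<Rightarrow> bool" where
  "markovian F E \<longleftrightarrow>
     (\<forall>u\<in>F. let v = (\<lambda>x. min (max (u x) 0) 1) in v \<in> F \<and> E v v \<le> E u u)"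

definition dirichlet_form ::
  "'a measure \<Rightarrow> ('a \<Rightarrow> real) set \<Rightarrow> (('a \<Rightarrow> real) \<Rightarrow> ('a \<Rightarrow> real) \<Rightarrow> real) \<Rightarrow> bool" where
  "dirichlet_form \<mu> F E \<longleftrightarrow> closed_symmetric_form \<mu> F E \<and> markovian F E"

text \<open>The support of the measure \<open>u \<mu>\<close>.\<close>

definition ess_support :: "'a metric \<Rightarrow> 'a measure \<Rightarrow> ('a \<Rightarrow> real) \<Rightarrow> 'a set" where
  "ess_support X \<mu> u =
     mspace X - \<Union>{U. openin (mtopology_of X) U \<and> (AE x in \<mu>. x \<in> U \<longrightarrow> u x = 0)}"

definition strongly_local ::
  "'a metric \<Rightarrow> 'a measure \<Rightarrow> ('a \<Rightarrow> real) set \<Rightarrow>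
     (('a \<Rightarrow> real) \<Rightarrow> ('a \<Rightarrow> real) \<Rightarrow> real) \<Rightarrow> bool" where
  "strongly_local X \<mu> F E \<longleftrightarrow>
     (\<forall>u\<in>F. \<forall>v\<in>F.
        compactin (mtopology_of X) (ess_support X \<mu> u) \<longrightarrow>
        compactin (mtopology_of X) (ess_support X \<mu> v) \<longrightarrow>
        (\<exists>V c. openin (mtopology_of X) V \<and> ess_support X \<mu> u \<subseteq> V \<and>
               (AE x in \<mu>. x \<in> V \<longrightarrow> v x = c)) \<longrightarrow>
        E u v = 0)"

text \<open>The domain of the generator is maximal: it consists of all \<open>u\<close> for which \<open>E(u,\<cdot>)\<close> is
  represented by an element of \<open>L\<^sup>2\<close>.\<close>

definition generator_of_form ::
  "'a measure \<Rightarrow> ('a \<Rightarrow> real) set \<Rightarrow> (('a \<Rightarrow> real) \<Rightarrow> ('a \<Rightarrow> real) \<Rightarrow> real) \<Rightarrow>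
     ('a \<Rightarrow> real) set \<Rightarrow> (('a \<Rightarrow> real) \<Rightarrow> 'a \<Rightarrow> real) \<Rightarrow> bool" where
  "generator_of_form \<mu> F E D L \<longleftrightarrow>
     (\<forall>u. \<forall>w\<in>Lp 2 \<mu>.
        u \<in> D \<and> ae_eq \<mu> (L u) w \<longleftrightarrow> u \<in> F \<and> (\<forall>v\<in>F. E u v = inner_L2 \<mu> w v))"

section \<open>Heat semigroup and heat kernel\<close>

text \<open>\<open>T t = exp (- t L)\<close>: the (unique) strongly continuous contraction semigroup on \<open>L\<^sup>2\<close> with
  infinitesimal generator \<open>- L\<close>.\<close>

definition heat_semigroup ::
  "'a measure \<Rightarrow> ('a \<Rightarrow> real) set \<Rightarrow> (('a \<Rightarrow> real) \<Rightarrow> 'a \<Rightarrow> real) \<Rightarrow>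
     (real \<Rightarrow> ('a \<Rightarrow> real) \<Rightarrow> 'a \<Rightarrow> real) \<Rightarrow> bool" where
  "heat_semigroup \<mu> D L T \<longleftrightarrow>
     (\<forall>t\<ge>0. linear_L2 \<mu> (Lp 2 \<mu>) (T t) \<and> (\<forall>f\<in>Lp 2 \<mu>. norm_L2 \<mu> (T t f) \<le> norm_L2 \<mu> f)) \<and>
     (\<forall>f\<in>Lp 2 \<mu>. ae_eq \<mu> (T 0 f) f) \<and>
     (\<forall>s\<ge>0. \<forall>t\<ge>0. \<forall>f\<in>Lp 2 \<mu>. ae_eq \<mu> (T (s + t) f) (T s (T t f))) \<and>
     (\<forall>f\<in>Lp 2 \<mu>. ((\<lambda>t. norm_L2 \<mu> (\<lambda>x. T t f x - f x)) \<longlongrightarrow> 0) (at_right 0)) \<and>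
     (\<forall>u\<in>Lp 2 \<mu>. \<forall>w\<in>Lp 2 \<mu>.
        u \<in> D \<and> ae_eq \<mu> (L u) w \<longleftrightarrow>
        ((\<lambda>t. norm_L2 \<mu> (\<lambda>x. (u x - T t u x) / t - w x)) \<longlongrightarrow> 0) (at_right 0))"

definition heat_kernel ::
  "'a measure \<Rightarrow> ('a \<Rightarrow> real) set \<Rightarrow> (('a \<Rightarrow> real) \<Rightarrow> 'a \<Rightarrow> real) \<Rightarrow>
     (real \<Rightarrow> 'a \<Rightarrow> 'a \<Rightarrow> real) \<Rightarrow> bool" where
  "heat_kernel \<mu> D L h \<longleftrightarrow>
     (\<lambda>(t, x, y). h t x y) \<in>
        borel_measurable (restrict_space borel {0<..} \<Otimes>\<^sub>M (\<mu> \<Otimes>\<^sub>M \<mu>)) \<and>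
     (\<forall>t>0. \<forall>x\<in>space \<mu>. \<forall>y\<in>space \<mu>. 0 \<le> h t x y) \<and>
     (\<exists>T. heat_semigroup \<mu> D L T \<and>
        (\<forall>t>0. \<forall>f\<in>Lp 2 \<mu>. AE x in \<mu>.
           integrable \<mu> (\<lambda>y. h t x y * f y) \<and> T t f x = (\<integral>y. h t x y * f y \<partial>\<mu>)))"

section \<open>Negative fractional powers and Sobolev spaces\<close>

text \<open>If the spectrum of \<open>L\<close> is bounded below by a positive number and \<open>\<mu>\<close> is finite, the integral
  in the kernel of \<open>L\<^sup>-\<^sup>s\<close> is finite for almost every \<open>(x, y)\<close>; the value \<open>0\<close> it gets elsewhere by
  convention does not affect the operator, and neither does the choice of \<open>h\<close> (a heat kernel is
  determined by \<open>L\<close> up to null sets).\<close>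

definition neg_power_kernel ::
  "(real \<Rightarrow> 'a \<Rightarrow> 'a \<Rightarrow> real) \<Rightarrow> real \<Rightarrow> 'a \<Rightarrow> 'a \<Rightarrow> real" where
  "neg_power_kernel h s x y =
     (LINT t:{0<..}|lborel. t powr (s - 1) * h t x y) / Gamma s"

definition neg_power ::
  "'a measure \<Rightarrow> (real \<Rightarrow> 'a \<Rightarrow> 'a \<Rightarrow> real) \<Rightarrow> real \<Rightarrow> ('a \<Rightarrow> real) \<Rightarrow> 'a \<Rightarrow> real" where
  "neg_power \<mu> h s g x = (\<integral>y. neg_power_kernel h s x y * g y \<partial>\<mu>)"

text \<open>The condition \<open>\<exists>g\<in>Lp p \<mu>. f = L\<^sup>-\<^sup>\<alpha>\<^sup>/\<^sup>2 g\<close> is the meaning of \<open>L\<^sup>\<alpha>\<^sup>/\<^sup>2 f \<in> L\<^sup>p\<close>; the operator \<open>L\<close> enters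
  through its heat kernel \<open>h\<close>.\<close>

definition sobolev_homogeneous ::
  "'a metric \<Rightarrow> 'a measure \<Rightarrow> (real \<Rightarrow> 'a \<Rightarrow> 'a \<Rightarrow> real) \<Rightarrow> real \<Rightarrow> ennreal \<Rightarrow> ('a \<Rightarrow> real) set" where
  "sobolev_homogeneous X \<mu> h \<alpha> p =
     {f \<in> Lp_loc p X \<mu>. \<exists>g\<in>Lp p \<mu>. ae_eq \<mu> f (neg_power \<mu> h (\<alpha> / 2) g)}"

definition sobolev ::
  "'a measure \<Rightarrow> (real \<Rightarrow> 'a \<Rightarrow> 'a \<Rightarrow> real) \<Rightarrow> real \<Rightarrow> ennreal \<Rightarrow> ('a \<Rightarrow> real) set" where
  "sobolev \<mu> h \<alpha> p =
     {f \<in> Lp p \<mu>. \<exists>g\<in>Lp p \<mu>. ae_eq \<mu> f (neg_power \<mu> h (\<alpha> / 2) g)}"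

definition closed_under_mult :: "('a \<Rightarrow> real) set \<Rightarrow> bool" where
  "closed_under_mult A \<longleftrightarrow> (\<forall>f\<in>A. \<forall>g\<in>A. (\<lambda>x. f x * g x) \<in> A)"

end

theory Submission
  imports Defs "HOL-Probability.Distribution_Functions"
begin

text \<open>
  The operator that proves the theorem is the Laguerre diffusion killed at the origin. For \<open>0 < \<nu> < 1\<close>
  let \<open>\<mu>\<close> be the measure \<open>x powr (- \<nu>) * exp (- x) dx\<close> on the half-line and let
  \<open>E(u,v) = \<integral> x powr (1 - \<nu>) * exp (- x) * u' * v' dx\<close> with a Dirichlet condition at \<open>0\<close>. The
  generator is \<open>L u = - (x u'' + (1 - \<nu> - x) u')\<close>. Near \<open>0\<close> the natural scale of this diffusion is
  \<open>x powr \<nu>\<close>, so for small \<open>\<nu>\<close> energy concentrates at the origin, where \<open>\<mu>\<close> has almost no mass. A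
  function that behaves like \<open>x powr \<nu>\<close> at \<open>0\<close> may have a bounded image under \<open>L\<close>, but
  \<open>L (x powr (2 \<nu>))\<close> has the leading term \<open>- 2 \<nu>\<^sup>2 x powr (2 \<nu> - 1)\<close>, which comes from the
  square of the gradient and is too singular for \<open>L\<^sup>p\<close> when \<open>\<nu>\<close> is small. As \<open>\<nu>\<close> may depend on
  \<open>\<alpha>\<close> and \<open>p\<close>, a single singular point suffices.

  Put \<open>\<sigma> = \<alpha> / 2\<close> and \<open>\<Phi>\<^sub>s = x powr \<nu> * exp (- s x)\<close>, which
  is \<open>mono_exp \<nu> 0 s\<close> below. The function \<open>sing\<close>, which is \<open>L\<close> to the power \<open>- \<sigma>\<close> applied to
  \<open>\<Phi>\<^sub>1\<close>, is bounded and equals \<open>x powr \<nu>\<close> times a factor with a positive limit at \<open>0\<close>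
  (\<open>sing_eq\<close>, \<open>amp_bounds\<close>, \<open>sing_bounded\<close>). Suppose that its square were \<open>L\<close> to the power \<open>- \<sigma>\<close>
  applied to some \<open>k \<in> L\<^sup>p\<close>, and test both expressions against \<open>L \<Phi>\<^sub>s\<close> for \<open>s \<rightarrow> \<infinity>\<close>. The square
  gives Gamma integrals of exact order \<open>s powr (- 2 \<nu>)\<close> (\<open>pairing_lower_bound\<close>). On the other
  side the negative power is a time integral of the semigroup, the semigroup acts explicitly on
  \<open>L \<Phi>\<^sub>s\<close>, and Hoelder's inequality for each time bounds the pairing by a multiple of
  \<open>s powr ((1 - \<nu>) / p - \<sigma> + \<nu>)\<close> (\<open>pairing_upper_bound\<close>). With \<open>4 \<nu> = \<sigma> - 1 / p\<close> the two bounds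
  contradict each other, and \<open>\<sigma> > 1 / p\<close> is the hypothesis \<open>\<alpha> p > 2\<close>.

  The semigroup maps each \<open>\<Phi>\<^sub>s\<close> to a multiple of \<open>\<Phi>\<^sub>r\<close>, where \<open>r / (1 + r)\<close> is
  \<open>exp (- t)\<close> times \<open>s / (1 + s)\<close> (\<open>heat_ker_exp\<close>); its kernel is a series with nonnegative
  terms. The inner product of \<open>\<Phi>\<^sub>s\<close> with the \<open>n\<close>-th Laguerre function is, up to a factor independent of
  \<open>n\<close>, the \<open>n\<close>-th power of \<open>s / (1 + s)\<close>, so the Laguerre functions are eigenfunctions with eigenvalues
  \<open>\<nu> + n\<close> (\<open>heat_op_lag\<close>). They form an orthonormal basis after normalisation (\<open>eigfun_complete\<close>), so
  self-adjointness, the spectral gap, closedness of the form and the semigroup property are facts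
  about weighted sequence spaces (locale \<open>diagonal_operator\<close>). The form is Markovian because the
  kernel is symmetric and has mass at most \<open>1\<close> (\<open>heat_ker_mass\<close>, \<open>energy_kop_contraction\<close>). It is
  strongly local because the derivatives of the Laguerre functions are orthogonal too
  (\<open>inner_dlag\<close>), which represents the form by weak derivatives, and these vanish where the function
  is constant (\<open>weak_deriv_zero\<close>).

  With one additional point for infinity and the distance \<open>\<bar>F x - F y\<bar>\<close>, where \<open>F\<close> is
  the distribution function of \<open>\<mu>\<close>, the closed half-line becomes isometric to a compact interval, and \<open>\<mu>\<close>
  becomes Lebesgue measure.
\<close>

section \<open>The Hilbert space of square integrable functions\<close>

lemma Lp_2_iff: "f \<in> Lp 2 M \<longleftrightarrow> f \<in> borel_measurable M \<and> integrable M (\<lambda>x. (f x)\<^sup>2)"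
  by (simp add: Lp_def powr_numeral)

lemma L2_measurable [measurable_dest]: "f \<in> Lp 2 M \<Longrightarrow> f \<in> borel_measurable M"
  by (simp add: Lp_2_iff)

lemma abs_mult_le_sum_squares: "\<bar>a * b\<bar> \<le> a\<^sup>2 + b\<^sup>2" for a b :: real
proof -
  have "0 \<le> (\<bar>a\<bar> - \<bar>b\<bar>)\<^sup>2" by simp
  then have "2 * (\<bar>a\<bar> * \<bar>b\<bar>) \<le> a\<^sup>2 + b\<^sup>2" by (simp add: power2_diff)
  moreover have "0 \<le> \<bar>a\<bar> * \<bar>b\<bar>" by simp
  ultimately show ?thesis unfolding abs_mult by linarith
qed

lemma L2_mult_integrable:
  assumes "f \<in> Lp 2 M" "g \<in> Lp 2 M"
  shows "integrable M (\<lambda>x. f x * g x)"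
proof (rule Bochner_Integration.integrable_bound)
  show "integrable M (\<lambda>x. (f x)\<^sup>2 + (g x)\<^sup>2)" using assms by (auto simp: Lp_2_iff)
  show "(\<lambda>x. f x * g x) \<in> borel_measurable M" using assms by (auto simp: Lp_2_iff)
  show "AE x in M. norm (f x * g x) \<le> norm ((f x)\<^sup>2 + (g x)\<^sup>2)"
    by (simp add: abs_mult_le_sum_squares)
qed

lemma L2_lincomb:
  assumes "f \<in> Lp 2 M" "g \<in> Lp 2 M"
  shows "(\<lambda>x. a * f x + b * g x) \<in> Lp 2 M"
proof -
  have "(\<lambda>x. (a * f x + b * g x)\<^sup>2) = (\<lambda>x. a\<^sup>2 * (f x)\<^sup>2 + (2*a*b) * (f x * g x) + b\<^sup>2 * (g x)\<^sup>2)"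
    by (simp add: fun_eq_iff power2_eq_square algebra_simps)
  moreover have "integrable M \<dots>"
    using assms L2_mult_integrable[OF assms] by (auto simp: Lp_2_iff)
  ultimately show ?thesis using assms by (auto simp: Lp_2_iff)
qed

lemma L2_zero: "(\<lambda>x. 0) \<in> Lp 2 M" by (simp add: Lp_2_iff)

lemma L2_scale: "f \<in> Lp 2 M \<Longrightarrow> (\<lambda>x. a * f x) \<in> Lp 2 M"
  using L2_lincomb[of f M f a 0] by simp

lemma L2_add: "f \<in> Lp 2 M \<Longrightarrow> g \<in> Lp 2 M \<Longrightarrow> (\<lambda>x. f x + g x) \<in> Lp 2 M"
  using L2_lincomb[of f M g 1 1] by simp

lemma L2_diff: "f \<in> Lp 2 M \<Longrightarrow> g \<in> Lp 2 M \<Longrightarrow> (\<lambda>x. f x - g x) \<in> Lp 2 M"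
  using L2_lincomb[of f M g 1 "-1"] by simp

lemma L2_sum: "(\<And>i. i \<in> I \<Longrightarrow> f i \<in> Lp 2 M) \<Longrightarrow> (\<lambda>x. \<Sum>i\<in>I. c i * f i x) \<in> Lp 2 M"
proof (induction I rule: infinite_finite_induct)
  case (insert i I)
  then show ?case by (simp add: L2_add L2_scale)
qed (simp_all add: L2_zero)

lemma L2_cong_ae:
  assumes "f \<in> Lp 2 M" "g \<in> borel_measurable M" "ae_eq M f g"
  shows "g \<in> Lp 2 M"
proof -
  have "integrable M (\<lambda>x. (g x)\<^sup>2)"
    by (rule integrable_cong_AE_imp[of M "\<lambda>x. (f x)\<^sup>2"])
       (use assms in \<open>auto simp: Lp_2_iff ae_eq_def\<close>)
  then show ?thesis using assms by (simp add: Lp_2_iff)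
qed

lemma (in finite_measure) L2_integrable:
  assumes "f \<in> Lp 2 M" shows "integrable M f"
  using assms by (auto simp: Lp_2_iff intro: square_integrable_imp_integrable)

lemma ae_eq_refl: "ae_eq M f f" by (simp add: ae_eq_def)

lemma inner_L2_commute: "inner_L2 M f g = inner_L2 M g f"
  by (simp add: inner_L2_def mult.commute)

lemma inner_L2_lincomb:
  assumes "f \<in> Lp 2 M" "g \<in> Lp 2 M" "k \<in> Lp 2 M"
  shows "inner_L2 M (\<lambda>x. a * f x + b * g x) k = a * inner_L2 M f k + b * inner_L2 M g k"
proof -
  have "inner_L2 M (\<lambda>x. a * f x + b * g x) k = (\<integral>x. a * (f x * k x) + b * (g x * k x) \<partial>M)"
    unfolding inner_L2_def by (rule Bochner_Integration.integral_cong) (simp_all add: algebra_simps)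
  also have "\<dots> = a * inner_L2 M f k + b * inner_L2 M g k"
    unfolding inner_L2_def
    using L2_mult_integrable[OF assms(1,3)] L2_mult_integrable[OF assms(2,3)] by simp
  finally show ?thesis .
qed

lemma inner_L2_diff:
  assumes "f \<in> Lp 2 M" "g \<in> Lp 2 M" "k \<in> Lp 2 M"
  shows "inner_L2 M (\<lambda>x. f x - g x) k = inner_L2 M f k - inner_L2 M g k"
  using inner_L2_lincomb[OF assms, of 1 "-1"] by simp

lemma inner_L2_diff_right:
  assumes "f \<in> Lp 2 M" "g \<in> Lp 2 M" "k \<in> Lp 2 M"
  shows "inner_L2 M k (\<lambda>x. f x - g x) = inner_L2 M k f - inner_L2 M k g"
  using inner_L2_diff[OF assms] by (simp add: inner_L2_commute[of M k])

lemma inner_L2_zero: "inner_L2 M (\<lambda>x. 0) k = 0" by (simp add: inner_L2_def)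

lemma inner_L2_sum:
  assumes "\<And>i. i \<in> I \<Longrightarrow> f i \<in> Lp 2 M" "k \<in> Lp 2 M"
  shows "inner_L2 M (\<lambda>x. \<Sum>i\<in>I. c i * f i x) k = (\<Sum>i\<in>I. c i * inner_L2 M (f i) k)"
  using assms(1)
proof (induction I rule: infinite_finite_induct)
  case (insert i I)
  have "inner_L2 M (\<lambda>x. c i * f i x + 1 * (\<Sum>i\<in>I. c i * f i x)) k
      = c i * inner_L2 M (f i) k + 1 * inner_L2 M (\<lambda>x. \<Sum>i\<in>I. c i * f i x) k"
    by (intro inner_L2_lincomb assms L2_sum insert) auto
  then show ?case using insert by simp
qed (auto simp: inner_L2_zero)

lemma inner_L2_cong_ae:
  assumes "ae_eq M f g" "f \<in> borel_measurable M" "g \<in> borel_measurable M" "k \<in> borel_measurable M"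
  shows "inner_L2 M f k = inner_L2 M g k"
  unfolding inner_L2_def by (rule integral_cong_AE) (use assms in \<open>auto simp: ae_eq_def\<close>)

lemma inner_L2_nonneg: "0 \<le> inner_L2 M f f"
  by (simp add: inner_L2_def integral_nonneg)

lemma norm_L2_nonneg: "0 \<le> norm_L2 M f" by (simp add: norm_L2_def inner_L2_nonneg)

lemma norm_L2_power2: "(norm_L2 M f)\<^sup>2 = inner_L2 M f f"
  by (simp add: norm_L2_def inner_L2_nonneg)

lemma norm_L2_diff_commute: "norm_L2 M (\<lambda>x. f x - g x) = norm_L2 M (\<lambda>x. g x - f x)"
  by (simp add: norm_L2_def inner_L2_def algebra_simps)

lemma inner_L2_eq_0_iff:
  assumes "f \<in> Lp 2 M"
  shows "inner_L2 M f f = 0 \<longleftrightarrow> ae_eq M f (\<lambda>x. 0)"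
proof -
  have "inner_L2 M f f = 0 \<longleftrightarrow> (AE x in M. f x * f x = 0)"
    unfolding inner_L2_def
    by (rule integral_nonneg_eq_0_iff_AE) (auto intro: L2_mult_integrable assms)
  then show ?thesis by (simp add: ae_eq_def)
qed

lemma Cauchy_Schwarz_L2:
  assumes f: "f \<in> Lp 2 M" and g: "g \<in> Lp 2 M"
  shows "\<bar>inner_L2 M f g\<bar> \<le> norm_L2 M f * norm_L2 M g"
proof -
  define A B C where "A = inner_L2 M f f" and "B = inner_L2 M f g" and "C = inner_L2 M g g"
  have quad: "0 \<le> A + 2 * t * B + t\<^sup>2 * C" for t
  proof -
    have "0 \<le> inner_L2 M (\<lambda>x. 1 * f x + t * g x) (\<lambda>x. 1 * f x + t * g x)"
      by (rule inner_L2_nonneg)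
    also have "\<dots> = 1 * inner_L2 M f (\<lambda>x. 1 * f x + t * g x) + t * inner_L2 M g (\<lambda>x. 1 * f x + t * g x)"
      by (intro inner_L2_lincomb L2_lincomb f g)
    also have "inner_L2 M f (\<lambda>x. 1 * f x + t * g x) = A + t * B"
      unfolding A_def B_def
      by (subst inner_L2_commute, subst inner_L2_lincomb[OF f g f]) (simp add: inner_L2_commute)
    also have "inner_L2 M g (\<lambda>x. 1 * f x + t * g x) = B + t * C"
      unfolding C_def B_def
      by (subst inner_L2_commute, subst inner_L2_lincomb[OF f g g]) simp
    finally show ?thesis by (simp add: algebra_simps power2_eq_square)
  qed
  have C: "0 \<le> C" and A: "0 \<le> A" by (auto simp: A_def C_def inner_L2_nonneg)
  have "B\<^sup>2 \<le> A * C"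
  proof (cases "C = 0")
    case True
    then have "ae_eq M g (\<lambda>x. 0)" using inner_L2_eq_0_iff[OF g] by (simp add: C_def)
    then have "inner_L2 M g f = inner_L2 M (\<lambda>x. 0) f"
      using f g by (intro inner_L2_cong_ae) (auto simp: Lp_2_iff)
    then have "B = 0" using inner_L2_commute[of M f g] by (simp add: B_def inner_L2_zero)
    with True show ?thesis by simp
  next
    case False
    with C have "C > 0" by simp
    have "0 \<le> A + 2 * (- B / C) * B + (- B / C)\<^sup>2 * C" by (rule quad)
    also have "\<dots> = A - B\<^sup>2 / C" using \<open>C > 0\<close> by (simp add: field_simps power2_eq_square)
    finally show ?thesis using \<open>C > 0\<close> by (simp add: field_simps)
  qed
  then have "sqrt (B\<^sup>2) \<le> sqrt (A * C)" by (rule real_sqrt_le_mono)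
  then show ?thesis by (simp add: A_def B_def C_def norm_L2_def real_sqrt_mult)
qed

lemma inner_L2_tendsto:
  assumes lim: "(\<lambda>N. norm_L2 M (\<lambda>x. S N x - f x)) \<longlonglongrightarrow> 0"
    and S: "\<And>N. S N \<in> Lp 2 M" and f: "f \<in> Lp 2 M" and g: "g \<in> Lp 2 M"
  shows "(\<lambda>N. inner_L2 M (S N) g) \<longlonglongrightarrow> inner_L2 M f g"
proof -
  have "(\<lambda>N. inner_L2 M (S N) g - inner_L2 M f g) \<longlonglongrightarrow> 0"
  proof (rule Lim_null_comparison)
    show "\<forall>\<^sub>F N in sequentially. norm (inner_L2 M (S N) g - inner_L2 M f g)
        \<le> norm_L2 M (\<lambda>x. S N x - f x) * norm_L2 M g"
      using Cauchy_Schwarz_L2[OF L2_diff[OF S f] g] by (simp add: inner_L2_diff[OF S f g])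
    show "(\<lambda>N. norm_L2 M (\<lambda>x. S N x - f x) * norm_L2 M g) \<longlonglongrightarrow> 0"
      using tendsto_mult_right[OF lim, of "norm_L2 M g"] by simp
  qed
  then show ?thesis by (simp add: LIM_zero_iff)
qed

lemma inner_L2_tendsto2:
  assumes limS: "(\<lambda>N. norm_L2 M (\<lambda>x. S N x - f x)) \<longlonglongrightarrow> 0"
    and limT: "(\<lambda>N. norm_L2 M (\<lambda>x. T N x - g x)) \<longlonglongrightarrow> 0"
    and S: "\<And>N. S N \<in> Lp 2 M" and f: "f \<in> Lp 2 M"
    and T: "\<And>N. T N \<in> Lp 2 M" and g: "g \<in> Lp 2 M"
  shows "(\<lambda>N. inner_L2 M (S N) (T N)) \<longlonglongrightarrow> inner_L2 M f g"
proof -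
  have *: "inner_L2 M (S N) (T N) = inner_L2 M (\<lambda>x. S N x - f x) (\<lambda>x. T N x - g x)
     + inner_L2 M (T N) f + inner_L2 M (S N) g - inner_L2 M f g" for N
    using S[of N] T[of N] f g
    by (simp add: inner_L2_diff inner_L2_diff_right L2_diff inner_L2_commute[of M "T N" f])
  have "(\<lambda>N. inner_L2 M (\<lambda>x. S N x - f x) (\<lambda>x. T N x - g x)) \<longlonglongrightarrow> 0"
  proof (rule Lim_null_comparison)
    show "\<forall>\<^sub>F N in sequentially. norm (inner_L2 M (\<lambda>x. S N x - f x) (\<lambda>x. T N x - g x))
        \<le> norm_L2 M (\<lambda>x. S N x - f x) * norm_L2 M (\<lambda>x. T N x - g x)"
      using Cauchy_Schwarz_L2[OF L2_diff[OF S f] L2_diff[OF T g]] by simp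
    show "(\<lambda>N. norm_L2 M (\<lambda>x. S N x - f x) * norm_L2 M (\<lambda>x. T N x - g x)) \<longlonglongrightarrow> 0"
      using tendsto_mult[OF limS limT] by simp
  qed
  from tendsto_diff[OF tendsto_add[OF tendsto_add[OF this inner_L2_tendsto[OF limT T g f]]
     inner_L2_tendsto[OF limS S f g]] tendsto_const[of "inner_L2 M f g"]]
  show ?thesis unfolding * by (simp add: inner_L2_commute)
qed

section \<open>Orthonormal systems\<close>

locale orthonormal_system = finite_measure M for M :: "'a measure" +
  fixes e :: "nat \<Rightarrow> 'a \<Rightarrow> real"
  assumes e_L2: "e n \<in> Lp 2 M"
    and e_orthonormal: "inner_L2 M (e m) (e n) = (if m = n then 1 else 0)"
begin

definition coeff :: "('a \<Rightarrow> real) \<Rightarrow> nat \<Rightarrow> real" where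
  "coeff f n = inner_L2 M f (e n)"

definition psum :: "(nat \<Rightarrow> real) \<Rightarrow> nat \<Rightarrow> 'a \<Rightarrow> real" where
  "psum c N x = (\<Sum>n<N. c n * e n x)"

lemma psum_L2: "psum c N \<in> Lp 2 M"
  unfolding psum_def by (intro L2_sum e_L2)

lemma inner_comb:
  assumes "finite I" "f \<in> Lp 2 M"
  shows "inner_L2 M (\<lambda>x. \<Sum>n\<in>I. c n * e n x) f = (\<Sum>n\<in>I. c n * coeff f n)"
  unfolding coeff_def inner_L2_commute[of M f]
  using assms by (intro inner_L2_sum e_L2)

lemma coeff_comb:
  assumes "finite I"
  shows "coeff (\<lambda>x. \<Sum>n\<in>I. c n * e n x) m = (if m \<in> I then c m else 0)"
  using assms by (simp add: coeff_def inner_L2_sum e_L2 e_orthonormal if_distrib sum.delta cong: if_cong)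

lemma coeff_psum: "coeff (psum c N) m = (if m < N then c m else 0)"
  using coeff_comb[of "{..<N}" c m] by (simp add: psum_def[abs_def])

lemma inner_comb_self:
  assumes "finite I"
  shows "inner_L2 M (\<lambda>x. \<Sum>n\<in>I. c n * e n x) (\<lambda>x. \<Sum>n\<in>I. c n * e n x) = (\<Sum>n\<in>I. (c n)\<^sup>2)"
  using assms by (simp add: inner_comb coeff_comb L2_sum e_L2 power2_eq_square)

lemma coeff_cong_ae:
  "ae_eq M f g \<Longrightarrow> f \<in> borel_measurable M \<Longrightarrow> g \<in> borel_measurable M \<Longrightarrow> coeff f n = coeff g n"
  unfolding coeff_def by (rule inner_L2_cong_ae) (auto intro: L2_measurable e_L2)

lemma coeff_lincomb:
  "f \<in> Lp 2 M \<Longrightarrow> g \<in> Lp 2 M \<Longrightarrow> coeff (\<lambda>x. a * f x + b * g x) n = a * coeff f n + b * coeff g n"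
  unfolding coeff_def by (intro inner_L2_lincomb e_L2)

lemma coeff_diff:
  "f \<in> Lp 2 M \<Longrightarrow> g \<in> Lp 2 M \<Longrightarrow> coeff (\<lambda>x. f x - g x) n = coeff f n - coeff g n"
  unfolding coeff_def by (intro inner_L2_diff e_L2)

lemma coeff_scale: "f \<in> Lp 2 M \<Longrightarrow> coeff (\<lambda>x. a * f x) n = a * coeff f n"
  using coeff_lincomb[of f f a 0 n] by simp

lemma coeff_zero: "coeff (\<lambda>x. 0) n = 0"
  by (simp add: coeff_def inner_L2_zero)

lemma Bessel_finite:
  assumes f: "f \<in> Lp 2 M"
  shows "(\<Sum>n<N. (coeff f n)\<^sup>2) \<le> inner_L2 M f f"
proof -
  let ?S = "\<lambda>x. \<Sum>n<N. coeff f n * e n x"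
  have S: "?S \<in> Lp 2 M" by (intro L2_sum e_L2)
  have "0 \<le> inner_L2 M (\<lambda>x. f x - ?S x) (\<lambda>x. f x - ?S x)" by (rule inner_L2_nonneg)
  also have "\<dots> = inner_L2 M f f - 2 * inner_L2 M ?S f + inner_L2 M ?S ?S"
    using f S
    by (simp add: inner_L2_diff inner_L2_diff_right L2_diff inner_L2_commute[of M f ?S])
  also have "\<dots> = inner_L2 M f f - (\<Sum>n<N. (coeff f n)\<^sup>2)"
    using f by (simp add: inner_comb inner_comb_self power2_eq_square)
  finally show ?thesis by simp
qed

lemma Bessel_summable:
  assumes f: "f \<in> Lp 2 M"
  shows "summable (\<lambda>n. (coeff f n)\<^sup>2)"
  by (rule summableI_nonneg_bounded[of _ "inner_L2 M f f"]) (auto intro: Bessel_finite f)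

text \<open>Along a subsequence the partial sums converge so fast that their increments are summable in
  \<open>L\<^sup>1\<close>, hence almost everywhere; Fatou's lemma turns the pointwise limit into a limit in \<open>L\<^sup>2\<close>.
  Finiteness of the measure enters through the comparison of the two norms.\<close>

theorem Riesz_Fischer:
  assumes c: "summable (\<lambda>n. (c n)\<^sup>2)"
  shows "\<exists>f\<in>Lp 2 M. (\<lambda>N. norm_L2 M (\<lambda>x. psum c N x - f x)) \<longlonglongrightarrow> 0 \<and> (\<forall>n. coeff f n = c n)"
proof -
  have "\<exists>R. \<forall>k. \<forall>m\<ge>R k. \<forall>n. (\<Sum>i\<in>{m..<n}. (c i)\<^sup>2) < (1/4::real)^k"
  proof (rule choice, rule allI)
    fix k
    have "\<exists>N. \<forall>m\<ge>N. \<forall>n. norm (\<Sum>i\<in>{m..<n}. (c i)\<^sup>2) < (1/4::real)^k"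
      using c unfolding summable_Cauchy by simp
    moreover have "norm (\<Sum>i\<in>{m..<n}. (c i)\<^sup>2) = (\<Sum>i\<in>{m..<n}. (c i)\<^sup>2)" for m n
      by (simp add: sum_nonneg)
    ultimately show "\<exists>N. \<forall>m\<ge>N. \<forall>n. (\<Sum>i\<in>{m..<n}. (c i)\<^sup>2) < (1/4::real)^k" by metis
  qed
  then obtain R where R: "\<And>k m n. R k \<le> m \<Longrightarrow> (\<Sum>i\<in>{m..<n}. (c i)\<^sup>2) < (1/4::real)^k" by blast
  \<comment> \<open>Monotone, at least \<open>R k\<close>, and unbounded even if \<open>R\<close> vanishes.\<close>
  define r where "r k = (\<Sum>i\<le>k. R i) + k" for k
  have rR: "R k \<le> r k" for k unfolding r_def by (simp add: member_le_sum trans_le_add1)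
  have rk: "k \<le> r k" for k by (simp add: r_def)
  have rmono: "r k \<le> r (Suc k)" for k by (simp add: r_def)
  define d where "d k x = (\<Sum>n\<in>{r k..<r (Suc k)}. c n * e n x)" for k x
  have dL2: "d k \<in> Lp 2 M" for k unfolding d_def by (intro L2_sum e_L2)
  have [measurable]: "d k \<in> borel_measurable M" for k using dL2 by (simp add: Lp_2_iff)
  have e_meas [measurable]: "e k \<in> borel_measurable M" for k using e_L2 by (simp add: Lp_2_iff)
  have norm_d: "norm_L2 M (d k) \<le> (1/2)^k" for k
  proof (rule power2_le_imp_le)
    have "(norm_L2 M (d k))\<^sup>2 = (\<Sum>n\<in>{r k..<r (Suc k)}. (c n)\<^sup>2)"
      unfolding norm_L2_power2 d_def by (rule inner_comb_self) simp
    also have "\<dots> \<le> (1/4)^k" using R[OF rR] by (simp add: less_imp_le)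
    also have "\<dots> = ((1/2)^k)\<^sup>2" by (simp flip: power_mult power_mult_distrib add: power2_eq_square)
    finally show "(norm_L2 M (d k))\<^sup>2 \<le> ((1/2)^k)\<^sup>2" .
  qed simp
  define K where "K = norm_L2 M (\<lambda>x. 1)"
  have int_d: "(\<integral>\<^sup>+x. ennreal \<bar>d k x\<bar> \<partial>M) \<le> ennreal ((1/2)^k * K)" for k
  proof -
    have absd: "(\<lambda>x. \<bar>d k x\<bar>) \<in> Lp 2 M" using dL2[of k] by (simp add: Lp_2_iff)
    have one: "(\<lambda>x. 1) \<in> Lp 2 M" by (simp add: Lp_2_iff)
    have "(\<integral>\<^sup>+x. ennreal \<bar>d k x\<bar> \<partial>M) = ennreal (\<integral>x. \<bar>d k x\<bar> \<partial>M)"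
      by (intro nn_integral_eq_integral L2_integrable absd) auto
    also have "(\<integral>x. \<bar>d k x\<bar> \<partial>M) = inner_L2 M (\<lambda>x. \<bar>d k x\<bar>) (\<lambda>x. 1)" by (simp add: inner_L2_def)
    also have "\<dots> \<le> norm_L2 M (\<lambda>x. \<bar>d k x\<bar>) * K"
      using Cauchy_Schwarz_L2[OF absd one] by (simp add: K_def)
    also have "norm_L2 M (\<lambda>x. \<bar>d k x\<bar>) = norm_L2 M (d k)"
      by (simp add: norm_L2_def inner_L2_def)
    also have "\<dots> * K \<le> (1/2)^k * K"
      by (intro mult_right_mono norm_d) (simp add: K_def norm_L2_nonneg)
    finally show ?thesis by (simp add: ennreal_leI)
  qed
  have "(\<integral>\<^sup>+x. (\<Sum>k. ennreal \<bar>d k x\<bar>) \<partial>M) = (\<Sum>k. \<integral>\<^sup>+x. ennreal \<bar>d k x\<bar> \<partial>M)"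
    by (rule nn_integral_suminf) simp
  also have "\<dots> \<le> (\<Sum>k. ennreal ((1/2)^k * K))" by (intro suminf_le int_d) auto
  also have "\<dots> = ennreal (\<Sum>k. (1/2)^k * K)"
    by (intro suminf_ennreal2 summable_mult2 summable_geometric) (auto simp: K_def norm_L2_nonneg)
  finally have "(\<integral>\<^sup>+x. (\<Sum>k. ennreal \<bar>d k x\<bar>) \<partial>M) \<noteq> \<infinity>" by (auto simp: top_unique)
  then have "AE x in M. (\<Sum>k. ennreal \<bar>d k x\<bar>) \<noteq> \<infinity>"
    by (intro nn_integral_noteq_infinite) auto
  then have summ: "AE x in M. summable (\<lambda>k. d k x)"
  proof eventually_elim
    case (elim x)
    then have "summable (\<lambda>k. \<bar>d k x\<bar>)" by (intro summable_suminf_not_top) auto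
    then show ?case by (rule summable_rabs_cancel)
  qed
  define f where "f x = psum c (r 0) x + (\<Sum>k. d k x)" for x
  have [measurable]: "psum c N \<in> borel_measurable M" for N using psum_L2 by (simp add: Lp_2_iff)
  have [measurable]: "f \<in> borel_measurable M" unfolding f_def by measurable
  have tel: "psum c (r N) x = psum c (r 0) x + (\<Sum>k<N. d k x)" for N x
  proof (induction N)
    case (Suc N)
    have "psum c (r (Suc N)) x = psum c (r N) x + d N x"
      unfolding psum_def d_def using rmono[of N]
      by (simp add: sum.atLeastLessThan_concat lessThan_atLeast0)
    with Suc show ?case by simp
  qed simp
  have conv: "AE x in M. (\<lambda>N. psum c (r N) x) \<longlonglongrightarrow> f x"
    using summ
  proof eventually_elim
    case (elim x)
    then have "(\<lambda>N. psum c (r 0) x + (\<Sum>k<N. d k x)) \<longlonglongrightarrow> f x"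
      unfolding f_def by (intro tendsto_add tendsto_const summable_LIMSEQ)
    moreover have "(\<lambda>N. psum c (r N) x) = (\<lambda>N. psum c (r 0) x + (\<Sum>k<N. d k x))"
      by (rule ext) (rule tel)
    ultimately show ?case by simp
  qed
  have key: "(\<integral>\<^sup>+x. ennreal ((psum c N x - f x)\<^sup>2) \<partial>M) \<le> ennreal b"
    if b: "\<And>n. (\<Sum>i\<in>{N..<n}. (c i)\<^sup>2) \<le> b" for N b
  proof -
    have "(\<integral>\<^sup>+x. ennreal ((psum c N x - f x)\<^sup>2) \<partial>M)
        = (\<integral>\<^sup>+x. liminf (\<lambda>k. ennreal ((psum c N x - psum c (r k) x)\<^sup>2)) \<partial>M)"
    proof (rule nn_integral_cong_AE, use conv in eventually_elim)
      case (elim x)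
      have "(\<lambda>k. ennreal ((psum c N x - psum c (r k) x)\<^sup>2)) \<longlonglongrightarrow> ennreal ((psum c N x - f x)\<^sup>2)"
        by (intro tendsto_intros elim)
      from lim_imp_Liminf[OF sequentially_bot this] show ?case by simp
    qed
    also have "\<dots> \<le> liminf (\<lambda>k. \<integral>\<^sup>+x. ennreal ((psum c N x - psum c (r k) x)\<^sup>2) \<partial>M)"
      by (rule nn_integral_liminf) measurable
    also have "\<dots> \<le> limsup (\<lambda>k. \<integral>\<^sup>+x. ennreal ((psum c N x - psum c (r k) x)\<^sup>2) \<partial>M)"
      by (rule Liminf_le_Limsup) simp
    also have "\<dots> \<le> ennreal b"
    proof (rule Limsup_bounded)
      show "\<forall>\<^sub>F k in sequentially. (\<integral>\<^sup>+x. ennreal ((psum c N x - psum c (r k) x)\<^sup>2) \<partial>M) \<le> ennreal b"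
        using eventually_ge_at_top[of N]
      proof eventually_elim
        case (elim k)
        then have Nk: "N \<le> r k" using rk[of k] by linarith
        have "(psum c N x - psum c (r k) x) = - (\<Sum>n\<in>{N..<r k}. c n * e n x)" for x
          unfolding psum_def using Nk sum.atLeastLessThan_concat[of 0 N "r k" "\<lambda>n. c n * e n x"]
          by (simp add: lessThan_atLeast0)
        then have eq: "(psum c N x - psum c (r k) x)\<^sup>2
            = (\<Sum>n\<in>{N..<r k}. c n * e n x) * (\<Sum>n\<in>{N..<r k}. c n * e n x)" for x
          by (simp add: power2_eq_square)
        have "(\<integral>\<^sup>+x. ennreal ((psum c N x - psum c (r k) x)\<^sup>2) \<partial>M)
            = ennreal (inner_L2 M (\<lambda>x. \<Sum>n\<in>{N..<r k}. c n * e n x) (\<lambda>x. \<Sum>n\<in>{N..<r k}. c n * e n x))"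
          unfolding eq inner_L2_def
          by (intro nn_integral_eq_integral L2_mult_integrable L2_sum e_L2) auto
        also have "\<dots> \<le> ennreal b"
          by (subst inner_comb_self) (auto intro!: ennreal_leI b)
        finally show ?case .
      qed
    qed
    finally show ?thesis .
  qed
  have diffL2: "(\<lambda>x. psum c N x - f x) \<in> Lp 2 M" for N
  proof -
    have "(\<integral>\<^sup>+x. ennreal ((psum c N x - f x)\<^sup>2) \<partial>M) \<le> ennreal (suminf (\<lambda>i. (c i)\<^sup>2))"
      by (rule key) (auto intro!: sum_le_suminf c)
    then have "integrable M (\<lambda>x. (psum c N x - f x)\<^sup>2)"
      by (intro integrableI_nonneg) (auto simp: le_less_trans)
    then show ?thesis by (simp add: Lp_2_iff)
  qed
  have fL2: "f \<in> Lp 2 M"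
    using L2_diff[OF psum_L2[of c 0] diffL2[of 0]] by simp
  have lim: "(\<lambda>N. norm_L2 M (\<lambda>x. psum c N x - f x)) \<longlonglongrightarrow> 0"
  proof (rule LIMSEQ_I)
    fix \<epsilon> :: real assume "\<epsilon> > 0"
    then have "0 < (\<epsilon>/2)\<^sup>2" by simp
    then obtain N0 where N0: "\<And>m n. m \<ge> N0 \<Longrightarrow> norm (\<Sum>i\<in>{m..<n}. (c i)\<^sup>2) < (\<epsilon>/2)\<^sup>2"
      using c unfolding summable_Cauchy by meson
    have "norm (norm_L2 M (\<lambda>x. psum c N x - f x) - 0) < \<epsilon>" if "N \<ge> N0" for N
    proof -
      have "(\<Sum>i\<in>{N..<n}. (c i)\<^sup>2) \<le> (\<epsilon>/2)\<^sup>2" for n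
        using N0[OF that, of n] by simp
      then have "(\<integral>\<^sup>+x. ennreal ((psum c N x - f x)\<^sup>2) \<partial>M) \<le> ennreal ((\<epsilon>/2)\<^sup>2)"
        by (rule key)
      also have "(\<integral>\<^sup>+x. ennreal ((psum c N x - f x)\<^sup>2) \<partial>M)
          = ennreal ((norm_L2 M (\<lambda>x. psum c N x - f x))\<^sup>2)"
        unfolding norm_L2_power2 inner_L2_def power2_eq_square[of "psum c N _ - f _"]
        by (intro nn_integral_eq_integral L2_mult_integrable diffL2) auto
      finally have "(norm_L2 M (\<lambda>x. psum c N x - f x))\<^sup>2 \<le> (\<epsilon>/2)\<^sup>2" by simp
      then have "norm_L2 M (\<lambda>x. psum c N x - f x) \<le> \<epsilon>/2"
        by (rule power2_le_imp_le) (use \<open>\<epsilon> > 0\<close> in simp)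
      then show ?thesis using \<open>\<epsilon> > 0\<close> norm_L2_nonneg[of M "\<lambda>x. psum c N x - f x"] by simp
    qed
    then show "\<exists>N0. \<forall>N\<ge>N0. norm (norm_L2 M (\<lambda>x. psum c N x - f x) - 0) < \<epsilon>" by blast
  qed
  have "coeff f n = c n" for n
  proof -
    have "(\<lambda>N. coeff (psum c N) n) \<longlonglongrightarrow> coeff f n"
      unfolding coeff_def by (rule inner_L2_tendsto[OF lim psum_L2 fL2 e_L2])
    moreover have "(\<lambda>N. coeff (psum c N) n) \<longlonglongrightarrow> c n"
    proof (rule tendsto_eventually)
      show "\<forall>\<^sub>F N in sequentially. coeff (psum c N) n = c n"
        using eventually_gt_at_top[of n]
        by eventually_elim (simp add: coeff_psum)
    qed
    ultimately show ?thesis by (rule LIMSEQ_unique)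
  qed
  with fL2 lim show ?thesis by blast
qed

end

locale orthonormal_basis = orthonormal_system +
  assumes complete: "\<lbrakk>f \<in> Lp 2 M; \<And>n. coeff f n = 0\<rbrakk> \<Longrightarrow> ae_eq M f (\<lambda>x. 0)"
begin

lemma coeff_eqI:
  assumes f: "f \<in> Lp 2 M" and g: "g \<in> Lp 2 M" and eq: "\<And>n. coeff f n = coeff g n"
  shows "ae_eq M f g"
proof -
  have "ae_eq M (\<lambda>x. f x - g x) (\<lambda>x. 0)"
    by (rule complete) (auto intro: L2_diff f g simp: coeff_diff f g eq)
  then show ?thesis by (simp add: ae_eq_def)
qed

lemma psum_tendsto:
  assumes f: "f \<in> Lp 2 M"
  shows "(\<lambda>N. norm_L2 M (\<lambda>x. psum (coeff f) N x - f x)) \<longlonglongrightarrow> 0"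
proof -
  obtain g where g: "g \<in> Lp 2 M" "(\<lambda>N. norm_L2 M (\<lambda>x. psum (coeff f) N x - g x)) \<longlonglongrightarrow> 0"
    "\<And>n. coeff g n = coeff f n"
    using Riesz_Fischer[OF Bessel_summable[OF f]] by auto
  have ae: "ae_eq M g f" by (rule coeff_eqI) (use f g in auto)
  have "norm_L2 M (\<lambda>x. psum (coeff f) N x - g x) = norm_L2 M (\<lambda>x. psum (coeff f) N x - f x)" for N
    unfolding norm_L2_def inner_L2_def
    by (intro arg_cong[where f=sqrt] integral_cong_AE)
       (use ae f g psum_L2[of "coeff f" N] in \<open>auto simp: ae_eq_def Lp_2_iff\<close>)
  with g(2) show ?thesis by simp
qed

theorem Parseval:
  assumes f: "f \<in> Lp 2 M" and g: "g \<in> Lp 2 M"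
  shows "(\<lambda>n. coeff f n * coeff g n) sums inner_L2 M f g"
proof -
  have "(\<lambda>N. inner_L2 M (psum (coeff f) N) g) \<longlonglongrightarrow> inner_L2 M f g"
    by (rule inner_L2_tendsto[OF psum_tendsto[OF f] psum_L2 f g])
  then show ?thesis
    unfolding sums_def psum_def by (simp add: inner_comb g)
qed

lemma Parseval_norm:
  "f \<in> Lp 2 M \<Longrightarrow> (\<lambda>n. (coeff f n)\<^sup>2) sums inner_L2 M f f"
  using Parseval[of f f] by (simp add: power2_eq_square)

end

section \<open>Self-adjoint operators given by their eigenvalues\<close>

lemma summable_weighted_square_lincomb:
  fixes w x y :: "nat \<Rightarrow> real"
  assumes w: "\<And>n. 0 \<le> w n"
    and x: "summable (\<lambda>n. w n * (x n)\<^sup>2)" and y: "summable (\<lambda>n. w n * (y n)\<^sup>2)"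
  shows "summable (\<lambda>n. w n * (a * x n + b * y n)\<^sup>2)"
proof (rule summable_comparison_test')
  show "summable (\<lambda>n. 2 * a\<^sup>2 * (w n * (x n)\<^sup>2) + 2 * b\<^sup>2 * (w n * (y n)\<^sup>2))"
    by (intro summable_add summable_mult x y)
  fix n :: nat
  have "(a * x n + b * y n)\<^sup>2 \<le> 2 * (a * x n)\<^sup>2 + 2 * (b * y n)\<^sup>2"
    using zero_le_power2[of "a * x n - b * y n"] by (simp add: power2_sum power2_diff)
  from mult_left_mono[OF this w[of n]]
  show "norm (w n * (a * x n + b * y n)\<^sup>2) \<le> 2 * a\<^sup>2 * (w n * (x n)\<^sup>2) + 2 * b\<^sup>2 * (w n * (y n)\<^sup>2)"
    by (simp add: w power_mult_distrib algebra_simps)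
qed

lemma summable_weighted_product:
  fixes w x y :: "nat \<Rightarrow> real"
  assumes w: "\<And>n. 0 \<le> w n"
    and x: "summable (\<lambda>n. w n * (x n)\<^sup>2)" and y: "summable (\<lambda>n. w n * (y n)\<^sup>2)"
  shows "summable (\<lambda>n. w n * x n * y n)"
proof (rule summable_comparison_test')
  show "summable (\<lambda>n. w n * (x n)\<^sup>2 + w n * (y n)\<^sup>2)" by (intro summable_add x y)
  fix n :: nat
  from mult_left_mono[OF abs_mult_le_sum_squares[of "x n" "y n"] w[of n]]
  show "norm (w n * x n * y n) \<le> w n * (x n)\<^sup>2 + w n * (y n)\<^sup>2"
    by (simp add: w abs_mult algebra_simps)
qed

text \<open>An orthonormal basis identifies \<open>L\<^sup>2\<close> with square summable sequences. The operator, its form and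
  its semigroup become multiplication by \<open>lam n\<close>, by \<open>lam n\<close> and by \<open>exp (- lam n * t)\<close>, and every
  claim about them becomes a claim about series.\<close>

locale diagonal_operator = orthonormal_basis +
  fixes lam :: "nat \<Rightarrow> real" and l :: real
  assumes l_pos: "l > 0" and lam_ge: "l \<le> lam n"
begin

lemma lam_pos: "lam n > 0" using l_pos lam_ge[of n] by linarith

definition opD :: "('a \<Rightarrow> real) set" where
  "opD = {f \<in> Lp 2 M. summable (\<lambda>n. (lam n * coeff f n)\<^sup>2)}"

text \<open>Any function with the prescribed coefficients will do; it is unique up to null sets.\<close>

definition opL :: "('a \<Rightarrow> real) \<Rightarrow> 'a \<Rightarrow> real" where
  "opL f = (SOME g. g \<in> Lp 2 M \<and> (\<forall>n. coeff g n = lam n * coeff f n))"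

definition formD :: "('a \<Rightarrow> real) set" where
  "formD = {f \<in> Lp 2 M. summable (\<lambda>n. lam n * (coeff f n)\<^sup>2)}"

definition formE :: "('a \<Rightarrow> real) \<Rightarrow> ('a \<Rightarrow> real) \<Rightarrow> real" where
  "formE f g = (\<Sum>n. lam n * coeff f n * coeff g n)"

lemma coeff_e: "coeff (e m) n = (if m = n then 1 else 0)"
  by (simp add: coeff_def e_orthonormal)

lemma ae_eq_iff_coeff:
  assumes "f \<in> Lp 2 M" "g \<in> Lp 2 M"
  shows "ae_eq M f g \<longleftrightarrow> (\<forall>n. coeff f n = coeff g n)"
  using coeff_eqI[OF assms] coeff_cong_ae[of f g] assms by (auto intro: L2_measurable)

lemma opL:
  assumes "f \<in> opD"
  shows "opL f \<in> Lp 2 M" "coeff (opL f) n = lam n * coeff f n"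
proof -
  have "\<exists>g. g \<in> Lp 2 M \<and> (\<forall>n. coeff g n = lam n * coeff f n)"
    using Riesz_Fischer[of "\<lambda>n. lam n * coeff f n"] assms by (auto simp: opD_def)
  from someI_ex[OF this] show "opL f \<in> Lp 2 M" "coeff (opL f) n = lam n * coeff f n"
    by (auto simp: opL_def)
qed

lemma opD_L2: "f \<in> opD \<Longrightarrow> f \<in> Lp 2 M" by (simp add: opD_def)
lemma formD_L2: "f \<in> formD \<Longrightarrow> f \<in> Lp 2 M" by (simp add: formD_def)

lemma opL_eq_iff:
  assumes "u \<in> Lp 2 M" "w \<in> Lp 2 M"
  shows "u \<in> opD \<and> ae_eq M (opL u) w \<longleftrightarrow> (\<forall>n. coeff w n = lam n * coeff u n)"
proof
  assume "u \<in> opD \<and> ae_eq M (opL u) w"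
  then show "\<forall>n. coeff w n = lam n * coeff u n"
    using ae_eq_iff_coeff[of "opL u" w] opL[of u] assms by auto
next
  assume *: "\<forall>n. coeff w n = lam n * coeff u n"
  then have "u \<in> opD"
    using Bessel_summable[OF assms(2)] assms by (simp add: opD_def)
  then show "u \<in> opD \<and> ae_eq M (opL u) w"
    using * ae_eq_iff_coeff[of "opL u" w] opL[of u] assms by auto
qed

lemma summable_coeff_diag:
  "summable (\<lambda>n. c n * (coeff (psum d N) n)\<^sup>2)"
  by (rule summable_finite[of "{..<N}"]) (auto simp: coeff_psum)

lemma psum_opD: "psum d N \<in> opD"
  using psum_L2 summable_coeff_diag[of "\<lambda>n. (lam n)\<^sup>2" d N] by (simp add: opD_def power_mult_distrib)

lemma psum_formD: "psum d N \<in> formD"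
  using psum_L2 summable_coeff_diag[of lam d N] by (simp add: formD_def)

lemma e_opD: "e n \<in> opD"
proof -
  have "summable (\<lambda>m. (lam m * coeff (e n) m)\<^sup>2)"
    by (rule summable_finite[of "{n}"]) (auto simp: coeff_e)
  then show ?thesis by (simp add: opD_def e_L2)
qed

lemma e_formD: "e n \<in> formD"
proof -
  have "summable (\<lambda>m. lam m * (coeff (e n) m)\<^sup>2)"
    by (rule summable_finite[of "{n}"]) (auto simp: coeff_e)
  then show ?thesis by (simp add: formD_def e_L2)
qed

lemma subspace_opD: "subspace_L2 M opD"
  unfolding subspace_L2_def
proof (intro conjI ballI allI impI)
  show "opD \<subseteq> Lp 2 M" by (auto simp: opD_def)
  show "(\<lambda>_. 0) \<in> opD" by (simp add: opD_def L2_zero coeff_zero)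
  show "(\<lambda>x. a * f x + b * g x) \<in> opD" if "f \<in> opD" "g \<in> opD" for f g a b
    using that summable_weighted_square_lincomb[of "\<lambda>n. (lam n)\<^sup>2" "coeff f" "coeff g" a b]
    by (simp add: opD_def L2_lincomb coeff_lincomb power_mult_distrib)
  show "g \<in> opD" if "f \<in> opD" "g \<in> borel_measurable M" "ae_eq M f g" for f g
  proof -
    have "g \<in> Lp 2 M" by (rule L2_cong_ae[OF opD_L2[OF that(1)] that(2,3)])
    with that show ?thesis using ae_eq_iff_coeff[of f g] by (simp add: opD_def)
  qed
qed

lemma subspace_formD: "subspace_L2 M formD"
  unfolding subspace_L2_def
proof (intro conjI ballI allI impI)
  show "formD \<subseteq> Lp 2 M" by (auto simp: formD_def)
  show "(\<lambda>_. 0) \<in> formD" by (simp add: formD_def L2_zero coeff_zero)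
  show "(\<lambda>x. a * f x + b * g x) \<in> formD" if "f \<in> formD" "g \<in> formD" for f g a b
    using that summable_weighted_square_lincomb[of lam "coeff f" "coeff g" a b] lam_pos
    by (simp add: formD_def L2_lincomb coeff_lincomb less_imp_le)
  show "g \<in> formD" if "f \<in> formD" "g \<in> borel_measurable M" "ae_eq M f g" for f g
  proof -
    have "g \<in> Lp 2 M" by (rule L2_cong_ae[OF formD_L2[OF that(1)] that(2,3)])
    with that show ?thesis using ae_eq_iff_coeff[of f g] by (simp add: formD_def)
  qed
qed

lemma operator_opL: "operator_L2 M opD opL"
  unfolding operator_L2_def linear_L2_def
proof (intro conjI ballI allI impI subspace_opD)
  fix f g a b assume fg: "f \<in> opD" "g \<in> opD"
  show "opL f \<in> Lp 2 M" using opL fg by blast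
  show "ae_eq M (opL f) (opL g)" if "ae_eq M f g"
    using that fg opL by (subst ae_eq_iff_coeff) (auto simp: ae_eq_iff_coeff opD_L2)
  have *: "(\<lambda>x. a * f x + b * g x) \<in> opD"
    using subspace_opD fg unfolding subspace_L2_def by blast
  show "ae_eq M (opL (\<lambda>x. a * f x + b * g x)) (\<lambda>x. a * opL f x + b * opL g x)"
    using opL[OF *] opL[OF fg(1)] opL[OF fg(2)] fg
    by (subst ae_eq_iff_coeff) (auto simp: L2_lincomb coeff_lincomb opD_L2 algebra_simps)
qed

lemma dense_if_psum:
  assumes "\<And>d N. psum d N \<in> V" shows "dense_L2 M V"
  unfolding dense_L2_def
proof (intro ballI allI impI)
  fix f \<epsilon> assume f: "f \<in> Lp 2 M" and "(\<epsilon>::real) > 0"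
  then obtain N where "norm (norm_L2 M (\<lambda>x. psum (coeff f) N x - f x) - 0) < \<epsilon>"
    using LIMSEQ_D[OF psum_tendsto[OF f]] by blast
  then have "norm_L2 M (\<lambda>x. f x - psum (coeff f) N x) < \<epsilon>"
    by (simp add: norm_L2_diff_commute)
  then show "\<exists>g\<in>V. norm_L2 M (\<lambda>x. f x - g x) < \<epsilon>" using assms by blast
qed

lemma nonneg_opL: "nonneg_definite M opD opL"
  unfolding nonneg_definite_def
proof
  fix u assume u: "u \<in> opD"
  have "0 \<le> coeff (opL u) n * coeff u n" for n
    using lam_pos[of n] by (simp add: opL[OF u] mult.assoc less_imp_le)
  then show "0 \<le> inner_L2 M (opL u) u"
    by (rule sums_le[OF _ sums_zero Parseval[OF opL(1)[OF u] opD_L2[OF u]]])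
qed

lemma self_adjoint_opL: "self_adjoint M opD opL"
  unfolding self_adjoint_def
proof (intro ballI)
  fix v w assume v: "v \<in> Lp 2 M" and w: "w \<in> Lp 2 M"
  have "(\<forall>u\<in>opD. inner_L2 M (opL u) v = inner_L2 M u w) \<longleftrightarrow> (\<forall>n. coeff w n = lam n * coeff v n)"
  proof safe
    fix n assume *: "\<forall>u\<in>opD. inner_L2 M (opL u) v = inner_L2 M u w"
    have "ae_eq M (opL (e n)) (\<lambda>x. lam n * e n x + 0 * e n x)"
      by (rule coeff_eqI[OF opL(1)[OF e_opD] L2_lincomb[OF e_L2 e_L2]])
         (simp add: opL(2)[OF e_opD] coeff_scale[OF e_L2] coeff_e)
    then have "inner_L2 M (opL (e n)) v = inner_L2 M (\<lambda>x. lam n * e n x + 0 * e n x) v"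
      by (rule inner_L2_cong_ae) (intro L2_measurable opL e_opD L2_lincomb e_L2 v)+
    also have "\<dots> = lam n * coeff v n"
      by (subst inner_L2_lincomb) (auto simp: e_L2 v coeff_def inner_L2_commute)
    finally show "coeff w n = lam n * coeff v n"
      using * e_opD[of n] by (simp add: coeff_def inner_L2_commute)
  next
    fix u assume *: "\<forall>n. coeff w n = lam n * coeff v n" and u: "u \<in> opD"
    have "(\<lambda>n. coeff (opL u) n * coeff v n) sums inner_L2 M (opL u) v"
      by (rule Parseval) (use opL u v in auto)
    moreover have "(\<lambda>n. coeff u n * coeff w n) sums inner_L2 M u w"
      by (rule Parseval) (use u w opD_L2 in auto)
    moreover have "coeff (opL u) n * coeff v n = coeff u n * coeff w n" for n
      using * by (simp add: opL[OF u])
    ultimately show "inner_L2 M (opL u) v = inner_L2 M u w"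
      by (auto dest: sums_unique2)
  qed
  then show "(\<forall>u\<in>opD. inner_L2 M (opL u) v = inner_L2 M u w) \<longleftrightarrow> v \<in> opD \<and> ae_eq M (opL v) w"
    using opL_eq_iff[OF v w] by blast
qed

text \<open>For \<open>z < l\<close> division of the coefficients by \<open>lam n - z\<close> is bounded by \<open>1 / (l - z)\<close>.\<close>

lemma spectrum_opL: "spectrum_L2 M opD opL \<subseteq> {l..}"
proof -
  have "z \<in> resolvent_set_L2 M opD opL" if z: "z < l" for z
    unfolding resolvent_set_L2_def mem_Collect_eq
  proof (intro exI[of _ "1 / (l - z)"] ballI)
    fix w assume w: "w \<in> Lp 2 M"
    define c where "c n = coeff w n / (lam n - z)" for n
    have gap: "l - z \<le> lam n - z" for n using lam_ge[of n] by simp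
    have c_le: "(c n)\<^sup>2 \<le> (1 / (l - z))\<^sup>2 * (coeff w n)\<^sup>2" for n
    proof -
      have "\<bar>c n\<bar> \<le> \<bar>coeff w n\<bar> / (l - z)"
        unfolding c_def abs_divide using gap[of n] z by (intro frac_le) auto
      then have "\<bar>c n\<bar>\<^sup>2 \<le> (\<bar>coeff w n\<bar> / (l - z))\<^sup>2" by (intro power_mono) auto
      then show ?thesis by (simp add: power_divide)
    qed
    have sw: "summable (\<lambda>n. (coeff w n)\<^sup>2)" by (rule Bessel_summable[OF w])
    have "summable (\<lambda>n. (c n)\<^sup>2)"
      by (rule summable_comparison_test'[OF summable_mult[OF sw]]) (use c_le in auto)
    then obtain u where u: "u \<in> Lp 2 M" "\<And>n. coeff u n = c n" using Riesz_Fischer by blast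
    have rel: "lam n * coeff v n = coeff w n + z * coeff v n \<longleftrightarrow> coeff v n = c n" for v n
      using gap[of n] z by (auto simp: c_def field_simps)
    have v_iff: "v \<in> opD \<and> ae_eq M (\<lambda>x. opL v x - z * v x) w \<longleftrightarrow> (\<forall>n. coeff v n = c n)"
      if v: "v \<in> Lp 2 M" for v
    proof -
      have "v \<in> opD \<and> ae_eq M (\<lambda>x. opL v x - z * v x) w
         \<longleftrightarrow> v \<in> opD \<and> ae_eq M (opL v) (\<lambda>x. 1 * w x + z * v x)"
        by (auto simp: ae_eq_def algebra_simps)
      also have "\<dots> \<longleftrightarrow> (\<forall>n. coeff (\<lambda>x. 1 * w x + z * v x) n = lam n * coeff v n)"
        by (rule opL_eq_iff) (intro v w L2_lincomb)+
      also have "\<dots> \<longleftrightarrow> (\<forall>n. lam n * coeff v n = coeff w n + z * coeff v n)"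
        using coeff_lincomb[OF w v, of 1 z] by (simp add: eq_commute)
      finally show ?thesis unfolding rel .
    qed
    have uD: "u \<in> opD" "ae_eq M (\<lambda>x. opL u x - z * u x) w" using v_iff[OF u(1)] u(2) by auto
    have "inner_L2 M u u \<le> (1 / (l - z))\<^sup>2 * inner_L2 M w w"
      using sums_le[OF _ Parseval_norm[OF u(1)] sums_mult[OF Parseval_norm[OF w]]] c_le
      by (simp add: u(2))
    then have "(norm_L2 M u)\<^sup>2 \<le> (1 / (l - z) * norm_L2 M w)\<^sup>2"
      by (simp only: norm_L2_power2 power_mult_distrib)
    then have "norm_L2 M u \<le> 1 / (l - z) * norm_L2 M w"
      by (rule power2_le_imp_le) (use z norm_L2_nonneg[of M w] in simp)
    moreover have "ae_eq M v u" if "v \<in> opD" "ae_eq M (\<lambda>x. opL v x - z * v x) w" for v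
      using v_iff[of v] that u opD_L2[of v] by (intro coeff_eqI) auto
    ultimately show "\<exists>u\<in>opD. ae_eq M (\<lambda>x. opL u x - z * u x) w \<and>
        norm_L2 M u \<le> 1 / (l - z) * norm_L2 M w \<and>
        (\<forall>v\<in>opD. ae_eq M (\<lambda>x. opL v x - z * v x) w \<longrightarrow> ae_eq M v u)"
      using uD by blast
  qed
  then show ?thesis unfolding spectrum_L2_def by (metis ComplD atLeast_iff not_le subsetI)
qed

subsection \<open>The quadratic form\<close>

lemma formE_summable:
  "u \<in> formD \<Longrightarrow> v \<in> formD \<Longrightarrow> summable (\<lambda>n. lam n * coeff u n * coeff v n)"
  by (intro summable_weighted_product) (auto simp: formD_def lam_pos less_imp_le)

lemma formE_self: "formE u u = (\<Sum>n. lam n * (coeff u n)\<^sup>2)"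
  by (simp add: formE_def power2_eq_square mult.assoc)

text \<open>Completeness of a weighted sequence space: the coefficients of a Cauchy sequence converge, and the
  bounds on finite partial sums survive the limit.\<close>

lemma closed_formE: "closed_symmetric_form M formD formE"
  unfolding closed_symmetric_form_def Let_def
proof (intro conjI ballI allI impI subspace_formD)
  show "dense_L2 M formD" by (rule dense_if_psum) (rule psum_formD)
  show "formE u v = formE u' v" if "u \<in> formD" "u' \<in> formD" "v \<in> formD" "ae_eq M u u'" for u u' v
    using that ae_eq_iff_coeff[of u u'] by (simp add: formE_def formD_L2)
  show "formE (\<lambda>x. a * u x + b * u' x) v = a * formE u v + b * formE u' v"
    if "u \<in> formD" "u' \<in> formD" "v \<in> formD" for u u' v a b
  proof -
    have "formE (\<lambda>x. a * u x + b * u' x) v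
      = (\<Sum>n. a * (lam n * coeff u n * coeff v n) + b * (lam n * coeff u' n * coeff v n))"
      unfolding formE_def using that
      by (intro suminf_cong) (simp add: coeff_lincomb formD_L2 algebra_simps)
    also have "\<dots> = (\<Sum>n. a * (lam n * coeff u n * coeff v n)) + (\<Sum>n. b * (lam n * coeff u' n * coeff v n))"
      by (intro suminf_add [symmetric] summable_mult formE_summable that)
    also have "\<dots> = a * formE u v + b * formE u' v"
      unfolding formE_def
      using suminf_mult[OF formE_summable[OF that(1,3)], of a]
        suminf_mult[OF formE_summable[OF that(2,3)], of b] by simp
    finally show ?thesis .
  qed
  show "formE u v = formE v u" for u v
    by (simp add: formE_def mult.assoc mult.left_commute mult.commute)
  show "0 \<le> formE u u" if "u \<in> formD" for u
    unfolding formE_self using that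
    by (intro suminf_nonneg) (auto simp: formD_def lam_pos less_imp_le)
  fix U :: "nat \<Rightarrow> 'a \<Rightarrow> real"
  assume "(\<forall>n. U n \<in> formD) \<and>
     (\<forall>\<epsilon>>0. \<exists>K. \<forall>m\<ge>K. \<forall>n\<ge>K. formE (\<lambda>x. U m x - U n x) (\<lambda>x. U m x - U n x) +
          inner_L2 M (\<lambda>x. U m x - U n x) (\<lambda>x. U m x - U n x) < \<epsilon>)"
  then have U: "\<And>n. U n \<in> formD" and Cau: "\<And>\<epsilon>. \<epsilon> > 0 \<Longrightarrow> \<exists>K. \<forall>m\<ge>K. \<forall>n\<ge>K.
       formE (\<lambda>x. U m x - U n x) (\<lambda>x. U m x - U n x) +
       inner_L2 M (\<lambda>x. U m x - U n x) (\<lambda>x. U m x - U n x) < \<epsilon>" by auto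
  have UL: "U n \<in> Lp 2 M" for n using U formD_L2 by blast
  \<comment> \<open>In the coordinates \<open>coeff\<close> the form norm is a weighted sequence norm.\<close>
  have N_sums: "(\<lambda>n. (lam n + 1) * (coeff w n)\<^sup>2) sums (formE w w + inner_L2 M w w)"
    if w: "w \<in> formD" for w
  proof -
    have "(\<lambda>n. lam n * (coeff w n)\<^sup>2) sums formE w w"
      unfolding formE_self using w by (intro summable_sums) (simp add: formD_def)
    from sums_add[OF this Parseval_norm[OF formD_L2[OF w]]] show ?thesis
      by (simp add: algebra_simps)
  qed
  have diff: "(\<lambda>x. f x - g x) \<in> formD" if "f \<in> formD" "g \<in> formD" for f g
  proof -
    have "(\<lambda>x. 1 * f x + (-1) * g x) \<in> formD"
      using subspace_formD that unfolding subspace_L2_def by blast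
    then show ?thesis by simp
  qed
  have fin_le: "(\<Sum>n<K. (lam n + 1) * (coeff w n)\<^sup>2) \<le> formE w w + inner_L2 M w w"
    if w: "w \<in> formD" for w K
    unfolding sums_unique[OF N_sums[OF w]]
    by (rule sum_le_suminf[OF sums_summable[OF N_sums[OF w]]])
       (use lam_pos in \<open>auto simp: less_imp_le add_nonneg_nonneg\<close>)
  have "\<exists>c. (\<lambda>m. coeff (U m) n) \<longlonglongrightarrow> c" for n
  proof -
    have "Cauchy (\<lambda>m. coeff (U m) n)"
    proof (rule metric_CauchyI)
      fix \<epsilon> :: real assume "\<epsilon> > 0"
      then obtain K where K: "\<And>m k. m \<ge> K \<Longrightarrow> k \<ge> K \<Longrightarrow>
       formE (\<lambda>x. U m x - U k x) (\<lambda>x. U m x - U k x) +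
       inner_L2 M (\<lambda>x. U m x - U k x) (\<lambda>x. U m x - U k x) < \<epsilon>\<^sup>2"
        using Cau[of "\<epsilon>\<^sup>2"] by auto
      have "dist (coeff (U m) n) (coeff (U k) n) < \<epsilon>" if "m \<ge> K" "k \<ge> K" for m k
      proof -
        let ?w = "\<lambda>x. U m x - U k x"
        have "(coeff ?w n)\<^sup>2 \<le> (lam n + 1) * (coeff ?w n)\<^sup>2"
          using mult_right_mono[of 1 "lam n + 1" "(coeff ?w n)\<^sup>2"] lam_pos[of n] by simp
        also have "\<dots> \<le> (\<Sum>i<Suc n. (lam i + 1) * (coeff ?w i)\<^sup>2)"
          using lam_pos by (intro member_le_sum) (auto simp: less_imp_le add_nonneg_nonneg)
        also have "\<dots> < \<epsilon>\<^sup>2" using fin_le[OF diff[OF U U], of m k "Suc n"] K[OF that] by linarith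
        finally have "\<bar>coeff ?w n\<bar>\<^sup>2 < \<epsilon>\<^sup>2" by simp
        then have "\<bar>coeff ?w n\<bar> < \<epsilon>" by (rule power2_less_imp_less) (use \<open>\<epsilon> > 0\<close> in simp)
        then show ?thesis by (simp add: coeff_diff UL dist_real_def)
      qed
      then show "\<exists>K. \<forall>m\<ge>K. \<forall>k\<ge>K. dist (coeff (U m) n) (coeff (U k) n) < \<epsilon>" by blast
    qed
    then show ?thesis by (simp add: Cauchy_convergent_iff convergent_def)
  qed
  then obtain c where c: "\<And>n. (\<lambda>m. coeff (U m) n) \<longlonglongrightarrow> c n" by metis
  have tail: "(\<Sum>n<K. (lam n + 1) * (coeff (U m) n - c n)\<^sup>2) \<le> \<epsilon>"
    if "\<And>k. k \<ge> m \<Longrightarrow> formE (\<lambda>x. U m x - U k x) (\<lambda>x. U m x - U k x) +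
       inner_L2 M (\<lambda>x. U m x - U k x) (\<lambda>x. U m x - U k x) < \<epsilon>" for m K \<epsilon>
  proof (rule LIMSEQ_le_const2)
    show "(\<lambda>k. \<Sum>n<K. (lam n + 1) * (coeff (U m) n - coeff (U k) n)\<^sup>2)
        \<longlonglongrightarrow> (\<Sum>n<K. (lam n + 1) * (coeff (U m) n - c n)\<^sup>2)"
      by (intro tendsto_intros c)
    have "(\<Sum>n<K. (lam n + 1) * (coeff (U m) n - coeff (U k) n)\<^sup>2) \<le> \<epsilon>" if "k \<ge> m" for k
      using fin_le[OF diff[OF U U], of m k K] \<open>\<And>k. k \<ge> m \<Longrightarrow> _\<close>[OF that]
      by (simp add: coeff_diff UL)
    then show "\<exists>N. \<forall>k\<ge>N. (\<Sum>n<K. (lam n + 1) * (coeff (U m) n - coeff (U k) n)\<^sup>2) \<le> \<epsilon>"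
      by blast
  qed
  have summ_tail: "summable (\<lambda>n. (lam n + 1) * (coeff (U m) n - c n)\<^sup>2)"
    if "\<And>k. k \<ge> m \<Longrightarrow> formE (\<lambda>x. U m x - U k x) (\<lambda>x. U m x - U k x) +
       inner_L2 M (\<lambda>x. U m x - U k x) (\<lambda>x. U m x - U k x) < \<epsilon>" for m \<epsilon>
    using lam_pos
    by (intro summableI_nonneg_bounded[of _ \<epsilon>] tail that) (auto simp: less_imp_le add_nonneg_nonneg)
  obtain K1 where K1: "\<And>m k. m \<ge> K1 \<Longrightarrow> k \<ge> K1 \<Longrightarrow>
       formE (\<lambda>x. U m x - U k x) (\<lambda>x. U m x - U k x) +
       inner_L2 M (\<lambda>x. U m x - U k x) (\<lambda>x. U m x - U k x) < 1"
    using Cau[of 1] by auto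
  have "summable (\<lambda>n. (lam n + 1) * (1 * coeff (U K1) n + (-1) * (coeff (U K1) n - c n))\<^sup>2)"
  proof (rule summable_weighted_square_lincomb)
    show "0 \<le> lam n + 1" for n using lam_pos[of n] by simp
    show "summable (\<lambda>n. (lam n + 1) * (coeff (U K1) n)\<^sup>2)" using N_sums[OF U] by (simp add: sums_iff)
    show "summable (\<lambda>n. (lam n + 1) * (coeff (U K1) n - c n)\<^sup>2)"
      by (rule summ_tail[of K1 1]) (use K1 in auto)
  qed
  then have sc: "summable (\<lambda>n. (lam n + 1) * (c n)\<^sup>2)" by simp
  have sc2: "summable (\<lambda>n. (c n)\<^sup>2)"
    by (rule summable_comparison_test'[OF sc])
       (use lam_pos in \<open>auto simp: algebra_simps less_imp_le\<close>)
  have sc1: "summable (\<lambda>n. lam n * (c n)\<^sup>2)"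
    by (rule summable_comparison_test'[OF sc])
       (use lam_pos in \<open>auto simp: algebra_simps less_imp_le abs_mult\<close>)
  obtain u where u: "u \<in> Lp 2 M" "\<And>n. coeff u n = c n" using Riesz_Fischer[OF sc2] by blast
  have uF: "u \<in> formD" using u sc1 by (simp add: formD_def)
  have "(\<lambda>n. formE (\<lambda>x. U n x - u x) (\<lambda>x. U n x - u x) +
            inner_L2 M (\<lambda>x. U n x - u x) (\<lambda>x. U n x - u x)) \<longlonglongrightarrow> 0"
  proof (rule LIMSEQ_I)
    fix \<epsilon> :: real assume "\<epsilon> > 0"
    then obtain K where K: "\<And>m k. m \<ge> K \<Longrightarrow> k \<ge> K \<Longrightarrow>
       formE (\<lambda>x. U m x - U k x) (\<lambda>x. U m x - U k x) +
       inner_L2 M (\<lambda>x. U m x - U k x) (\<lambda>x. U m x - U k x) < \<epsilon> / 2"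
      using Cau[of "\<epsilon> / 2"] by auto
    have "norm (formE (\<lambda>x. U m x - u x) (\<lambda>x. U m x - u x) +
            inner_L2 M (\<lambda>x. U m x - u x) (\<lambda>x. U m x - u x) - 0) < \<epsilon>" if m: "m \<ge> K" for m
    proof -
      let ?N = "formE (\<lambda>x. U m x - u x) (\<lambda>x. U m x - u x) + inner_L2 M (\<lambda>x. U m x - u x) (\<lambda>x. U m x - u x)"
      have s: "(\<lambda>n. (lam n + 1) * (coeff (U m) n - c n)\<^sup>2) sums ?N"
        using N_sums[OF diff[OF U uF], of m] by (simp add: coeff_diff UL u)
      have "(\<Sum>n<k. (lam n + 1) * (coeff (U m) n - c n)\<^sup>2) \<le> \<epsilon> / 2" for k
        by (rule tail) (use K m in auto)
      then have "?N \<le> \<epsilon> / 2" using s unfolding sums_def by (intro LIMSEQ_le_const2) auto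
      moreover have "0 \<le> ?N"
        using s lam_pos by (intro sums_le[OF _ sums_zero s]) (auto simp: less_imp_le add_nonneg_nonneg)
      ultimately show ?thesis using \<open>\<epsilon> > 0\<close> by simp
    qed
    then show "\<exists>K. \<forall>m\<ge>K. norm (formE (\<lambda>x. U m x - u x) (\<lambda>x. U m x - u x) +
            inner_L2 M (\<lambda>x. U m x - u x) (\<lambda>x. U m x - u x) - 0) < \<epsilon>" by blast
  qed
  with uF show "\<exists>u\<in>formD. (\<lambda>n. formE (\<lambda>x. U n x - u x) (\<lambda>x. U n x - u x) +
            inner_L2 M (\<lambda>x. U n x - u x) (\<lambda>x. U n x - u x)) \<longlonglongrightarrow> 0" by blast
qed

lemma generator_formE: "generator_of_form M formD formE opD opL"
  unfolding generator_of_form_def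
proof (intro allI ballI)
  fix u w assume w: "w \<in> Lp 2 M"
  show "u \<in> opD \<and> ae_eq M (opL u) w \<longleftrightarrow> u \<in> formD \<and> (\<forall>v\<in>formD. formE u v = inner_L2 M w v)"
  proof (cases "u \<in> Lp 2 M")
    case False
    then show ?thesis by (auto simp: opD_def formD_def)
  next
    case u: True
    show ?thesis unfolding opL_eq_iff[OF u w]
    proof safe
      assume *: "\<forall>n. coeff w n = lam n * coeff u n"
      have "summable (\<lambda>n. 1 * coeff u n * coeff w n)"
        by (rule summable_weighted_product) (use Bessel_summable u w in auto)
      then show uF: "u \<in> formD"
        using u * by (simp add: formD_def power2_eq_square mult.left_commute mult.commute)
      fix v assume v: "v \<in> formD"
      have "(\<lambda>n. lam n * coeff u n * coeff v n) sums inner_L2 M w v"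
        using Parseval[OF w formD_L2[OF v]] * by simp
      then show "formE u v = inner_L2 M w v" by (simp add: formE_def sums_iff)
    next
      fix n assume *: "\<forall>v\<in>formD. formE u v = inner_L2 M w v"
      have "formE u (e n) = (\<Sum>m\<in>{n}. lam m * coeff u m * coeff (e n) m)"
        unfolding formE_def by (rule suminf_finite) (auto simp: coeff_e)
      also have "\<dots> = lam n * coeff u n" by (simp add: coeff_e)
      finally show "coeff w n = lam n * coeff u n"
        using * e_formD[of n] by (simp add: coeff_def)
    qed
  qed
qed

subsection \<open>The heat semigroup\<close>

definition diagonal_semigroup :: "(real \<Rightarrow> ('a \<Rightarrow> real) \<Rightarrow> 'a \<Rightarrow> real) \<Rightarrow> bool" where
  "diagonal_semigroup T \<longleftrightarrow> (\<forall>t\<ge>0. \<forall>f\<in>Lp 2 M. T t f \<in> Lp 2 M \<and>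
      (\<forall>n. coeff (T t f) n = exp (- lam n * t) * coeff f n))"

lemma diff_quotient_exp_tendsto:
  "((\<lambda>t. (1 - exp (- a * t)) / t) \<longlongrightarrow> (a::real)) (at_right 0)"
proof -
  have "((\<lambda>t. exp (- a * t)) has_real_derivative - a) (at 0)"
    by (auto intro!: derivative_eq_intros)
  then have "((\<lambda>t. (exp (- a * t) - 1) / t) \<longlongrightarrow> - a) (at 0)"
    by (simp add: has_field_derivative_iff)
  from tendsto_minus[OF tendsto_mono[OF at_le this, of "{0<..}"]]
  show ?thesis by (simp add: minus_divide_left)
qed

lemma one_minus_exp_le: "a \<ge> 0 \<Longrightarrow> t > 0 \<Longrightarrow> (1 - exp (- a * t)) / t \<le> (a::real)"
  using exp_ge_add_one_self[of "- a * t"] by (simp add: field_simps)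

lemma series_tendsto_0:
  fixes a :: "real \<Rightarrow> nat \<Rightarrow> real"
  assumes bound: "\<And>t n. t > 0 \<Longrightarrow> \<bar>a t n\<bar> \<le> b n" and b: "summable b"
    and lim: "\<And>n. ((\<lambda>t. a t n) \<longlongrightarrow> 0) (at_right 0)"
  shows "((\<lambda>t. \<Sum>n. a t n) \<longlongrightarrow> 0) (at_right 0)"
proof -
  have "((\<lambda>t. \<Sum>n. a t n) \<longlongrightarrow> (\<Sum>n. 0::real)) (at_right 0)"
  proof (rule tannerys_theorem[THEN conjunct2, THEN conjunct2, OF lim _ b])
    have "\<forall>\<^sub>F t in at_right (0::real). t > 0" by (auto simp: eventually_at_filter)
    then show "\<forall>\<^sub>F (k, t) in sequentially \<times>\<^sub>F at_right (0::real). norm (a t k) \<le> b k"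
      unfolding eventually_prod_filter
      by (intro exI[of _ "\<lambda>_. True"] exI[of _ "\<lambda>t. t > 0"]) (use bound in auto)
  qed simp
  then show ?thesis by simp
qed

text \<open>Both limits at \<open>t = 0\<close> are limits of series whose terms are dominated uniformly in \<open>t\<close>: by the
  squared coefficients for strong continuity, and by those of \<open>L u\<close> for the difference quotients, since
  \<open>0 \<le> (1 - exp (- a * t)) / t \<le> a\<close>. Conversely, convergence in norm determines each coefficient of
  the limit.\<close>

theorem heat_semigroup_diagonal:
  assumes T: "diagonal_semigroup T"
  shows "heat_semigroup M opD opL T"
proof -
  have TL: "T t f \<in> Lp 2 M" and Tc: "coeff (T t f) n = exp (- lam n * t) * coeff f n"
    if "t \<ge> 0" "f \<in> Lp 2 M" for t f n
    using T that by (auto simp: diagonal_semigroup_def)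
  have dq_nonneg: "0 \<le> (1 - exp (- lam n * t)) / t" if "t > 0" for t n
    using that lam_pos[of n] by (simp add: less_imp_le)
  show ?thesis unfolding heat_semigroup_def
  proof (intro conjI allI impI ballI)
    fix t :: real assume t: "t \<ge> 0"
    show "linear_L2 M (Lp 2 M) (T t)" unfolding linear_L2_def
    proof (intro conjI ballI allI impI)
      fix f g a b assume f: "f \<in> Lp 2 M" and g: "g \<in> Lp 2 M"
      show "T t f \<in> Lp 2 M" by (rule TL[OF t f])
      show "ae_eq M (T t f) (T t g)" if "ae_eq M f g"
        using that f g t TL by (subst ae_eq_iff_coeff) (auto simp: Tc ae_eq_iff_coeff)
      show "ae_eq M (T t (\<lambda>x. a * f x + b * g x)) (\<lambda>x. a * T t f x + b * T t g x)"
        using f g t TL by (subst ae_eq_iff_coeff) (auto simp: Tc L2_lincomb coeff_lincomb algebra_simps)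
    qed
    fix f assume f: "f \<in> Lp 2 M"
    have "inner_L2 M (T t f) (T t f) \<le> inner_L2 M f f"
    proof (rule sums_le[OF _ Parseval_norm[OF TL[OF t f]] Parseval_norm[OF f]])
      fix n
      have "exp (- lam n * t) \<le> 1" using lam_pos[of n] t by simp
      then have "(exp (- lam n * t))\<^sup>2 \<le> 1" by (simp add: power_le_one)
      from mult_right_mono[OF this, of "(coeff f n)\<^sup>2"]
      show "(coeff (T t f) n)\<^sup>2 \<le> (coeff f n)\<^sup>2" by (simp add: Tc[OF t f] power_mult_distrib)
    qed
    then show "norm_L2 M (T t f) \<le> norm_L2 M f" by (simp add: norm_L2_def)
  next
    fix f assume f: "f \<in> Lp 2 M"
    show "ae_eq M (T 0 f) f"
      using f TL by (subst ae_eq_iff_coeff) (auto simp: Tc)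
    show "ae_eq M (T (s + t) f) (T s (T t f))" if "s \<ge> 0" "t \<ge> 0" for s t
      using f that TL
      by (subst ae_eq_iff_coeff) (auto simp: Tc algebra_simps simp flip: exp_add)
    have "((\<lambda>t. \<Sum>n. ((exp (- lam n * t) - 1) * coeff f n)\<^sup>2) \<longlongrightarrow> 0) (at_right 0)"
    proof (rule series_tendsto_0[OF _ Bessel_summable[OF f]])
      fix n and t :: real assume "t > 0"
      then have "exp (- lam n * t) \<le> 1" "0 \<le> exp (- lam n * t)" using lam_pos[of n] by auto
      then have "\<bar>exp (- lam n * t) - 1\<bar> \<le> 1" by linarith
      then have "(exp (- lam n * t) - 1)\<^sup>2 \<le> 1" by (simp add: abs_square_le_1)
      from mult_right_mono[OF this, of "(coeff f n)\<^sup>2"]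
      show "\<bar>((exp (- lam n * t) - 1) * coeff f n)\<^sup>2\<bar> \<le> (coeff f n)\<^sup>2"
        by (simp add: power_mult_distrib)
    next
      fix n
      have "((\<lambda>t. ((exp (- lam n * t) - 1) * coeff f n)\<^sup>2) \<longlongrightarrow> ((exp (- lam n * 0) - 1) * coeff f n)\<^sup>2) (at_right 0)"
        by (intro tendsto_intros)
      then show "((\<lambda>t. ((exp (- lam n * t) - 1) * coeff f n)\<^sup>2) \<longlongrightarrow> 0) (at_right 0)" by simp
    qed
    then have "((\<lambda>t. sqrt (\<Sum>n. ((exp (- lam n * t) - 1) * coeff f n)\<^sup>2)) \<longlongrightarrow> 0) (at_right 0)"
      using tendsto_real_sqrt by fastforce
    moreover have "\<forall>\<^sub>F t in at_right 0. sqrt (\<Sum>n. ((exp (- lam n * t) - 1) * coeff f n)\<^sup>2)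
        = norm_L2 M (\<lambda>x. T t f x - f x)"
    proof -
      have "sqrt (\<Sum>n. ((exp (- lam n * t) - 1) * coeff f n)\<^sup>2) = norm_L2 M (\<lambda>x. T t f x - f x)" if "t > 0" for t
      proof -
        have "(\<lambda>n. (coeff (\<lambda>x. T t f x - f x) n)\<^sup>2) sums inner_L2 M (\<lambda>x. T t f x - f x) (\<lambda>x. T t f x - f x)"
          by (rule Parseval_norm) (use TL f that in \<open>auto intro!: L2_diff\<close>)
        then show ?thesis using that f TL
          by (simp add: coeff_diff Tc norm_L2_def sums_iff left_diff_distrib)
      qed
      then show ?thesis by (auto simp: eventually_at_filter)
    qed
    ultimately show "((\<lambda>t. norm_L2 M (\<lambda>x. T t f x - f x)) \<longlongrightarrow> 0) (at_right 0)"
      by (rule Lim_transform_eventually)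
  next
    fix u w assume u: "u \<in> Lp 2 M" and w: "w \<in> Lp 2 M"
    have qL: "(\<lambda>x. (u x - T t u x) / t) \<in> Lp 2 M" if "t > 0" for t
      using L2_lincomb[OF u TL[OF _ u], of t "1/t" "- 1/t"] that by (simp add: diff_divide_distrib)
    have qc: "coeff (\<lambda>x. (u x - T t u x) / t) n = (1 - exp (- lam n * t)) / t * coeff u n" if "t > 0" for t n
      using coeff_lincomb[OF u TL[OF _ u], of t "1/t" "- 1/t" n] that Tc[OF _ u, of t n]
      by (simp add: diff_divide_distrib left_diff_distrib)
    have dL: "(\<lambda>x. (u x - T t u x) / t - w x) \<in> Lp 2 M" if "t > 0" for t
      by (intro L2_diff qL w that)
    have norm_eq: "norm_L2 M (\<lambda>x. (u x - T t u x) / t - w x)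
       = sqrt (\<Sum>n. ((1 - exp (- lam n * t)) / t * coeff u n - coeff w n)\<^sup>2)" if "t > 0" for t
      using Parseval_norm[OF dL[OF that]] that
      by (simp add: coeff_diff[OF qL[OF that] w] qc norm_L2_def sums_iff)
    have "((\<lambda>t. norm_L2 M (\<lambda>x. (u x - T t u x) / t - w x)) \<longlongrightarrow> 0) (at_right 0)
       \<longleftrightarrow> (\<forall>n. coeff w n = lam n * coeff u n)"
    proof safe
      assume *: "\<forall>n. coeff w n = lam n * coeff u n"
      have "((\<lambda>t. \<Sum>n. ((1 - exp (- lam n * t)) / t * coeff u n - coeff w n)\<^sup>2) \<longlongrightarrow> 0) (at_right 0)"
      proof (rule series_tendsto_0[OF _ Bessel_summable[OF w]])
        fix n and t :: real assume t: "t > 0"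
        define r where "r = (1 - exp (- lam n * t)) / t"
        have "0 \<le> r" "r \<le> lam n"
          using dq_nonneg[OF t] one_minus_exp_le[of "lam n" t] lam_pos[of n] t by (auto simp: r_def)
        then have "\<bar>r - lam n\<bar> \<le> \<bar>lam n\<bar>" by linarith
        then have "(r - lam n)\<^sup>2 \<le> (lam n)\<^sup>2" by (rule abs_le_square_iff[THEN iffD1])
        from mult_right_mono[OF this, of "(coeff u n)\<^sup>2"]
        have "((r - lam n) * coeff u n)\<^sup>2 \<le> (lam n * coeff u n)\<^sup>2" by (simp add: power_mult_distrib)
        then show "\<bar>((1 - exp (- lam n * t)) / t * coeff u n - coeff w n)\<^sup>2\<bar> \<le> (coeff w n)\<^sup>2"
          unfolding r_def[symmetric] by (simp add: * left_diff_distrib)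
      next
        fix n
        have "((\<lambda>t. ((1 - exp (- lam n * t)) / t * coeff u n - coeff w n)\<^sup>2)
           \<longlongrightarrow> (lam n * coeff u n - coeff w n)\<^sup>2) (at_right 0)"
          by (intro tendsto_intros diff_quotient_exp_tendsto)
        then show "((\<lambda>t. ((1 - exp (- lam n * t)) / t * coeff u n - coeff w n)\<^sup>2) \<longlongrightarrow> 0) (at_right 0)"
          using * by simp
      qed
      then have "((\<lambda>t. sqrt (\<Sum>n. ((1 - exp (- lam n * t)) / t * coeff u n - coeff w n)\<^sup>2)) \<longlongrightarrow> 0) (at_right 0)"
        using tendsto_real_sqrt by fastforce
      then show "((\<lambda>t. norm_L2 M (\<lambda>x. (u x - T t u x) / t - w x)) \<longlongrightarrow> 0) (at_right 0)"
        by (rule Lim_transform_eventually) (auto simp: eventually_at_filter norm_eq)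
    next
      fix n
      assume *: "((\<lambda>t. norm_L2 M (\<lambda>x. (u x - T t u x) / t - w x)) \<longlongrightarrow> 0) (at_right 0)"
      have "((\<lambda>t. (1 - exp (- lam n * t)) / t * coeff u n - coeff w n) \<longlongrightarrow> 0) (at_right 0)"
      proof (rule Lim_null_comparison[OF _ *])
        have "norm ((1 - exp (- lam n * t)) / t * coeff u n - coeff w n)
           \<le> norm_L2 M (\<lambda>x. (u x - T t u x) / t - w x)" if t: "t > 0" for t
        proof -
          have "(1 - exp (- lam n * t)) / t * coeff u n - coeff w n
             = inner_L2 M (\<lambda>x. (u x - T t u x) / t - w x) (e n)"
            using coeff_diff[OF qL[OF t] w, of n] by (simp add: qc[OF t] coeff_def)
          also have "\<bar>\<dots>\<bar> \<le> norm_L2 M (\<lambda>x. (u x - T t u x) / t - w x) * norm_L2 M (e n)"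
            by (rule Cauchy_Schwarz_L2[OF dL[OF t] e_L2])
          finally show ?thesis by (simp add: norm_L2_def e_orthonormal)
        qed
        then show "\<forall>\<^sub>F t in at_right 0. norm ((1 - exp (- lam n * t)) / t * coeff u n - coeff w n)
           \<le> norm_L2 M (\<lambda>x. (u x - T t u x) / t - w x)" by (auto simp: eventually_at_filter)
      qed
      moreover have "((\<lambda>t. (1 - exp (- lam n * t)) / t * coeff u n - coeff w n)
          \<longlongrightarrow> lam n * coeff u n - coeff w n) (at_right 0)"
        by (intro tendsto_intros diff_quotient_exp_tendsto)
      ultimately show "coeff w n = lam n * coeff u n"
        using tendsto_unique[OF trivial_limit_at_right_real] by fastforce
    qed
    then show "u \<in> opD \<and> ae_eq M (opL u) w \<longleftrightarrow>
       ((\<lambda>t. norm_L2 M (\<lambda>x. (u x - T t u x) / t - w x)) \<longlongrightarrow> 0) (at_right 0)"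
      using opL_eq_iff[OF u w] by blast
  qed
qed

text \<open>The form is the increasing limit of the approximating forms
  \<open>(u - T t u, u) / t\<close>, so a bound for all of these passes to the form.\<close>

lemma formE_le_if_semigroup:
  assumes T: "diagonal_semigroup T" and u: "u \<in> formD" and v: "v \<in> Lp 2 M"
    and le: "\<And>t. t > 0 \<Longrightarrow> inner_L2 M v v - inner_L2 M (T t v) v \<le> inner_L2 M u u - inner_L2 M (T t u) u"
  shows "v \<in> formD \<and> formE v v \<le> formE u u"
proof -
  have uL: "u \<in> Lp 2 M" using u formD_L2 by blast
  have approx: "(\<lambda>n. (1 - exp (- lam n * t)) / t * (coeff f n)\<^sup>2) sums
      ((inner_L2 M f f - inner_L2 M (T t f) f) / t)" if f: "f \<in> Lp 2 M" and t: "t > 0" for f t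
  proof -
    have Tf: "T t f \<in> Lp 2 M" "\<And>n. coeff (T t f) n = exp (- lam n * t) * coeff f n"
      using T that by (auto simp: diagonal_semigroup_def)
    show ?thesis
      using sums_divide[OF sums_diff[OF Parseval[OF f f] Parseval[OF Tf(1) f]], of t]
      by (simp add: Tf(2) algebra_simps power2_eq_square diff_divide_distrib)
  qed
  have su: "summable (\<lambda>n. lam n * (coeff u n)\<^sup>2)" using u by (simp add: formD_def)
  have fin: "(\<Sum>n<N. lam n * (coeff v n)\<^sup>2) \<le> formE u u" for N
  proof (rule tendsto_upperbound[where F="at_right (0::real)"])
    show "((\<lambda>t. \<Sum>n<N. (1 - exp (- lam n * t)) / t * (coeff v n)\<^sup>2)
       \<longlongrightarrow> (\<Sum>n<N. lam n * (coeff v n)\<^sup>2)) (at_right 0)"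
      by (intro tendsto_intros diff_quotient_exp_tendsto)
    have "(\<Sum>n<N. (1 - exp (- lam n * t)) / t * (coeff v n)\<^sup>2) \<le> formE u u" if t: "t > 0" for t
    proof -
      have "(\<Sum>n<N. (1 - exp (- lam n * t)) / t * (coeff v n)\<^sup>2)
          \<le> (inner_L2 M v v - inner_L2 M (T t v) v) / t"
        unfolding sums_unique[OF approx[OF v t]]
        by (rule sum_le_suminf[OF sums_summable[OF approx[OF v t]]])
           (use t lam_pos in \<open>auto simp: less_imp_le\<close>)
      also have "\<dots> \<le> (inner_L2 M u u - inner_L2 M (T t u) u) / t"
        using le[OF t] t by (simp add: divide_right_mono)
      also have "\<dots> \<le> formE u u"
        unfolding formE_self
        by (rule sums_le[OF _ approx[OF uL t] summable_sums[OF su]])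
           (rule mult_right_mono[OF one_minus_exp_le[OF less_imp_le[OF lam_pos] t]], simp)
      finally show ?thesis .
    qed
    then show "\<forall>\<^sub>F t in at_right 0. (\<Sum>n<N. (1 - exp (- lam n * t)) / t * (coeff v n)\<^sup>2) \<le> formE u u"
      by (auto simp: eventually_at_filter)
  qed simp
  have sv: "summable (\<lambda>n. lam n * (coeff v n)\<^sup>2)"
    by (rule summableI_nonneg_bounded[OF _ fin]) (use lam_pos in \<open>simp add: less_imp_le\<close>)
  moreover have "formE v v \<le> formE u u"
    unfolding formE_self[of v] by (rule suminf_le_const[OF sv fin])
  ultimately show ?thesis using v by (simp add: formD_def)
qed

end

section \<open>Functions determined by integrals\<close>

text \<open>The positive and the negative part of \<open>\<rho>\<close> are densities of finite measures that agree on all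
  half-lines, hence are equal.\<close>

lemma AE_zero_if_tail_integrals_zero:
  fixes \<rho> :: "real \<Rightarrow> real"
  assumes int: "integrable lborel \<rho>"
    and zero: "\<And>c. (\<integral>x. indicator {c<..} x * \<rho> x \<partial>lborel) = 0"
  shows "AE x in lborel. \<rho> x = 0"
proof -
  have [measurable]: "\<rho> \<in> borel_measurable lborel" using int by auto
  define f g where "f x = ennreal (max 0 (\<rho> x))" and "g x = ennreal (max 0 (- \<rho> x))" for x
  have [measurable]: "f \<in> borel_measurable lborel" "g \<in> borel_measurable lborel"
    unfolding f_def g_def by measurable
  have intp: "integrable lborel (\<lambda>x. indicator {c<..} x * max 0 (\<rho> x))"
    and intn: "integrable lborel (\<lambda>x. indicator {c<..} x * max 0 (- \<rho> x))" for c
    by (rule Bochner_Integration.integrable_bound[OF int]; auto simp: indicator_def)+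
  have f: "emeasure (density lborel f) {c<..} = ennreal (\<integral>x. indicator {c<..} x * max 0 (\<rho> x) \<partial>lborel)" for c
  proof -
    have "emeasure (density lborel f) {c<..} = (\<integral>\<^sup>+x. ennreal (indicator {c<..} x * max 0 (\<rho> x)) \<partial>lborel)"
      by (subst emeasure_density) (auto simp: f_def indicator_def intro!: nn_integral_cong)
    also have "\<dots> = ennreal (\<integral>x. indicator {c<..} x * max 0 (\<rho> x) \<partial>lborel)"
      by (rule nn_integral_eq_integral[OF intp]) auto
    finally show ?thesis .
  qed
  have g: "emeasure (density lborel g) {c<..} = ennreal (\<integral>x. indicator {c<..} x * max 0 (- \<rho> x) \<partial>lborel)" for c
  proof -
    have "emeasure (density lborel g) {c<..} = (\<integral>\<^sup>+x. ennreal (indicator {c<..} x * max 0 (- \<rho> x)) \<partial>lborel)"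
      by (subst emeasure_density) (auto simp: g_def indicator_def intro!: nn_integral_cong)
    also have "\<dots> = ennreal (\<integral>x. indicator {c<..} x * max 0 (- \<rho> x) \<partial>lborel)"
      by (rule nn_integral_eq_integral[OF intn]) auto
    finally show ?thesis .
  qed
  have eq: "(\<integral>x. indicator {c<..} x * max 0 (\<rho> x) \<partial>lborel) = (\<integral>x. indicator {c<..} x * max 0 (- \<rho> x) \<partial>lborel)" for c
  proof -
    have "(\<integral>x. indicator {c<..} x * max 0 (\<rho> x) \<partial>lborel) - (\<integral>x. indicator {c<..} x * max 0 (- \<rho> x) \<partial>lborel)
        = (\<integral>x. indicator {c<..} x * max 0 (\<rho> x) - indicator {c<..} x * max 0 (- \<rho> x) \<partial>lborel)"
      by (rule Bochner_Integration.integral_diff[OF intp intn, symmetric])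
    also have "\<dots> = (\<integral>x. indicator {c<..} x * \<rho> x \<partial>lborel)"
      by (rule Bochner_Integration.integral_cong) (auto simp: max_def)
    finally show ?thesis using zero by simp
  qed
  have "density lborel f = density lborel g"
    by (rule measure_eqI_lessThan) (simp_all add: f g eq)
  then have "AE x in lborel. f x = g x"
    by (intro sigma_finite_measure.density_unique[OF sigma_finite_lborel]) auto
  then show ?thesis by eventually_elim (auto simp: f_def g_def max_def split: if_splits)
qed

text \<open>In the variable \<open>X = exp (- \<delta> x)\<close> the hypothesis says that \<open>\<rho>\<close> annihilates all polynomials,
  so by Weierstrass it annihilates all continuous functions on \<open>[0,1]\<close>.\<close>

lemma AE_zero_if_exp_integrals_zero:
  fixes \<rho> :: "real \<Rightarrow> real"
  assumes int: "integrable lborel \<rho>" and supp: "\<And>x. x \<le> 0 \<Longrightarrow> \<rho> x = 0" and \<delta>: "\<delta> > 0"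
    and zero: "\<And>m::nat. (\<integral>x. \<rho> x * exp (- (\<delta> * m * x)) \<partial>lborel) = 0"
  shows "AE x in lborel. \<rho> x = 0"
proof -
  have [measurable]: "\<rho> \<in> borel_measurable borel" using int by auto
  define X where "X x = exp (- (\<delta> * x))" for x
  have [measurable]: "X \<in> borel_measurable borel" unfolding X_def by measurable
  have X01: "0 \<le> X x" "X x \<le> 1" if "x > 0" for x using that \<delta> by (auto simp: X_def)
  have bdd: "integrable lborel (\<lambda>x. \<rho> x * g (X x))"
    if [measurable]: "g \<in> borel_measurable borel" and b: "\<And>z. 0 \<le> z \<Longrightarrow> z \<le> 1 \<Longrightarrow> \<bar>g z\<bar> \<le> B" for g B
  proof (rule Bochner_Integration.integrable_bound)
    show "integrable lborel (\<lambda>x. B * \<rho> x)" using int by simp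
    show "AE x in lborel. norm (\<rho> x * g (X x)) \<le> norm (B * \<rho> x)"
    proof (rule AE_I2)
      fix x show "norm (\<rho> x * g (X x)) \<le> norm (B * \<rho> x)"
      proof (cases "x > 0")
        case True
        then have "\<bar>g (X x)\<bar> \<le> \<bar>B\<bar>" using b[OF X01] by fastforce
        from mult_left_mono[OF this, of "\<bar>\<rho> x\<bar>"] show ?thesis by (simp add: abs_mult mult.commute)
      qed (simp add: supp)
    qed
  qed measurable
  have pow: "integrable lborel (\<lambda>x. \<rho> x * (X x ^ i * (1 - X x) ^ j))" for i j
    by (rule bdd[where B=1]) (auto simp: abs_mult power_le_one intro!: mult_le_one)
  have mono0: "(\<integral>x. \<rho> x * (X x ^ i * (1 - X x) ^ j) \<partial>lborel) = 0" for i j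
  proof (induction j arbitrary: i)
    case 0
    have "X x ^ i = exp (- (\<delta> * i * x))" for x
      by (simp add: X_def exp_of_nat_mult[symmetric] algebra_simps)
    then show ?case using zero[of i] by simp
  next
    case (Suc j)
    have "(\<lambda>x. \<rho> x * (X x ^ i * (1 - X x) ^ Suc j))
        = (\<lambda>x. \<rho> x * (X x ^ i * (1 - X x) ^ j) - \<rho> x * (X x ^ Suc i * (1 - X x) ^ j))"
      by (simp add: fun_eq_iff algebra_simps)
    then show ?case using pow[of i j] pow[of "Suc i" j] Suc[of i] Suc[of "Suc i"] by simp
  qed
  have cont0: "(\<integral>x. \<rho> x * \<phi> (X x) \<partial>lborel) = 0" if c: "continuous_on {0..1} \<phi>"
    and [measurable]: "\<phi> \<in> borel_measurable borel" for \<phi> :: "real \<Rightarrow> real"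
  proof -
    have "compact (\<phi> ` {0..1})" by (rule compact_continuous_image[OF c]) simp
    then obtain B where B: "\<And>z. z \<in> {0..1} \<Longrightarrow> \<bar>\<phi> z\<bar> \<le> B"
      using compact_imp_bounded bounded_iff by (metis imageI real_norm_def)
    have int\<phi>: "integrable lborel (\<lambda>x. \<rho> x * \<phi> (X x))" by (rule bdd[where B=B]) (use B in auto)
    have le: "\<bar>\<integral>x. \<rho> x * \<phi> (X x) \<partial>lborel\<bar> \<le> \<epsilon> * (\<integral>x. \<bar>\<rho> x\<bar> \<partial>lborel)" if \<epsilon>: "\<epsilon> > 0" for \<epsilon>
    proof -
      obtain n where n: "\<And>z. z \<in> {0..1} \<Longrightarrow> \<bar>\<phi> z - (\<Sum>k\<le>n. \<phi> (k/n) * Bernstein n k z)\<bar> < \<epsilon>"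
        using Bernstein_Weierstrass[OF c \<epsilon>] by blast
      define P where "P z = (\<Sum>k\<le>n. \<phi> (k/n) * Bernstein n k z)" for z
      have Pe: "\<rho> x * P (X x) = (\<Sum>k\<le>n. \<phi> (k/n) * (n choose k) * (\<rho> x * (X x ^ k * (1 - X x) ^ (n - k))))" for x
        by (simp add: P_def Bernstein_def sum_distrib_left algebra_simps)
      have intP: "integrable lborel (\<lambda>x. \<rho> x * P (X x))"
        unfolding Pe by (intro Bochner_Integration.integrable_sum integrable_mult_right pow)
      have "(\<integral>x. \<rho> x * P (X x) \<partial>lborel) = 0"
        unfolding Pe by (subst Bochner_Integration.integral_sum) (auto intro!: integrable_mult_right pow simp: mono0)
      then have "\<bar>\<integral>x. \<rho> x * \<phi> (X x) \<partial>lborel\<bar> = \<bar>\<integral>x. \<rho> x * \<phi> (X x) - \<rho> x * P (X x) \<partial>lborel\<bar>"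
        using Bochner_Integration.integral_diff[OF int\<phi> intP] by simp
      also have "\<dots> \<le> (\<integral>x. \<bar>\<rho> x * \<phi> (X x) - \<rho> x * P (X x)\<bar> \<partial>lborel)"
        by (rule integral_abs_bound)
      also have "\<dots> \<le> (\<integral>x. \<epsilon> * \<bar>\<rho> x\<bar> \<partial>lborel)"
      proof (rule integral_mono)
        show "integrable lborel (\<lambda>x. \<bar>\<rho> x * \<phi> (X x) - \<rho> x * P (X x)\<bar>)"
          using int\<phi> intP by auto
        show "integrable lborel (\<lambda>x. \<epsilon> * \<bar>\<rho> x\<bar>)" using int by auto
        fix x :: real
        show "\<bar>\<rho> x * \<phi> (X x) - \<rho> x * P (X x)\<bar> \<le> \<epsilon> * \<bar>\<rho> x\<bar>"
        proof (cases "x > 0")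
          case True
          then have "\<bar>\<phi> (X x) - P (X x)\<bar> \<le> \<epsilon>" using n[of "X x"] X01 by (simp add: P_def less_imp_le)
          from mult_left_mono[OF this, of "\<bar>\<rho> x\<bar>"] show ?thesis
            by (simp add: abs_mult[symmetric] right_diff_distrib mult.commute)
        qed (simp add: supp)
      qed
      finally show ?thesis by simp
    qed
    have "\<bar>\<integral>x. \<rho> x * \<phi> (X x) \<partial>lborel\<bar> \<le> 0"
    proof (rule field_le_epsilon)
      fix \<epsilon> :: real assume \<epsilon>: "\<epsilon> > 0"
      define I where "I = (\<integral>x. \<bar>\<rho> x\<bar> \<partial>lborel)"
      have I: "I \<ge> 0" by (simp add: I_def)
      have "\<bar>\<integral>x. \<rho> x * \<phi> (X x) \<partial>lborel\<bar> \<le> \<epsilon> / (I + 1) * I"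
        using le[of "\<epsilon> / (I + 1)"] \<epsilon> I by (simp add: I_def[symmetric] divide_pos_pos)
      also have "\<dots> \<le> \<epsilon>" using \<epsilon> I by (simp add: field_simps)
      finally show "\<bar>\<integral>x. \<rho> x * \<phi> (X x) \<partial>lborel\<bar> \<le> 0 + \<epsilon>" by simp
    qed
    then show ?thesis by simp
  qed
  show ?thesis
  proof (rule AE_zero_if_tail_integrals_zero[OF int])
    fix c :: real
    show "(\<integral>x. indicator {c<..} x * \<rho> x \<partial>lborel) = 0"
    proof (cases "c \<ge> 0")
      case False
      have "(\<integral>x. indicator {c<..} x * \<rho> x \<partial>lborel) = (\<integral>x. \<rho> x * exp (- (\<delta> * real 0 * x)) \<partial>lborel)"
        by (rule Bochner_Integration.integral_cong) (use False supp in \<open>auto simp: indicator_def\<close>)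
      then show ?thesis using zero[of 0] by simp
    next
      case True
      define w where "w = exp (- (\<delta> * c))"
      \<comment> \<open>Continuous approximation of the indicator of \<open>X x < w\<close>, which is the indicator of \<open>x > c\<close>.\<close>
      define \<phi> where "\<phi> n z = max 0 (min 1 (real n * (w - z)))" for n z
      have [measurable]: "\<phi> n \<in> borel_measurable borel" for n unfolding \<phi>_def by measurable
      have "(\<lambda>n. \<integral>x. \<rho> x * \<phi> n (X x) \<partial>lborel) \<longlonglongrightarrow> (\<integral>x. indicator {c<..} x * \<rho> x \<partial>lborel)"
      proof (rule integral_dominated_convergence)
        show "integrable lborel (\<lambda>x. \<bar>\<rho> x\<bar>)" using int by auto
        show "AE x in lborel. (\<lambda>n. \<rho> x * \<phi> n (X x)) \<longlonglongrightarrow> indicator {c<..} x * \<rho> x"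
        proof (rule AE_I2)
          fix x
          have "(\<lambda>n. \<phi> n (X x)) \<longlonglongrightarrow> indicator {c<..} x"
          proof (cases "x > c")
            case True
            then have pos: "w - X x > 0" using \<delta> by (simp add: w_def X_def)
            obtain N where N: "1 / (w - X x) < real N" using reals_Archimedean2 by blast
            have "\<phi> n (X x) = 1" if "n \<ge> N" for n
            proof -
              have "1 / (w - X x) < real n" using N that by simp
              then have "1 < real n * (w - X x)" using pos by (simp add: field_simps)
              then show ?thesis by (simp add: \<phi>_def)
            qed
            then show ?thesis using True by (intro tendsto_eventually) (auto simp: eventually_sequentially)
          next
            case False
            then have "w - X x \<le> 0" using \<delta> by (simp add: w_def X_def)
            then have "real n * (w - X x) \<le> 0" for n by (simp add: mult_nonneg_nonpos)
            then have "\<phi> n (X x) = 0" for n by (simp add: \<phi>_def min.coboundedI2 max_absorb1)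
            then show ?thesis using False by simp
          qed
          from tendsto_mult_left[OF this, of "\<rho> x"]
          show "(\<lambda>n. \<rho> x * \<phi> n (X x)) \<longlonglongrightarrow> indicator {c<..} x * \<rho> x" by (simp add: mult.commute)
        qed
        show "AE x in lborel. norm (\<rho> x * \<phi> n (X x)) \<le> \<bar>\<rho> x\<bar>" for n
        proof (rule AE_I2)
          fix x
          have "\<bar>\<phi> n (X x)\<bar> \<le> 1" by (simp add: \<phi>_def)
          from mult_left_mono[OF this, of "\<bar>\<rho> x\<bar>"] show "norm (\<rho> x * \<phi> n (X x)) \<le> \<bar>\<rho> x\<bar>"
            by (simp add: abs_mult)
        qed
      qed measurable
      moreover have "(\<integral>x. \<rho> x * \<phi> n (X x) \<partial>lborel) = 0" for n
        by (rule cont0) (auto simp: \<phi>_def intro!: continuous_intros)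
      ultimately show ?thesis by (simp add: LIMSEQ_const_iff)
    qed
  qed
qed

text \<open>The exponential moment justifies the termwise integration of the series of \<open>exp (- \<delta> * x)\<close>. This
  yields vanishing moments for \<open>\<rho> x * exp (- \<delta> * x)\<close>, which satisfies the same hypotheses, so the
  argument can be iterated and leads to all factors \<open>exp (- (\<delta> * m * x))\<close>.\<close>

lemma AE_zero_if_moments_zero:
  fixes \<rho> :: "real \<Rightarrow> real"
  assumes meas [measurable]: "\<rho> \<in> borel_measurable borel"
    and supp: "\<And>x. x \<le> 0 \<Longrightarrow> \<rho> x = 0" and \<delta>: "\<delta> > 0"
    and int: "\<And>k::nat. integrable lborel (\<lambda>x. \<rho> x * x ^ k * exp (\<delta> * x))"
    and zero: "\<And>k::nat. (\<integral>x. \<rho> x * x ^ k \<partial>lborel) = 0"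
  shows "AE x in lborel. \<rho> x = 0"
proof -
  have int0: "integrable lborel (\<lambda>x. \<rho> x * x ^ k * exp (- (\<delta> * real m * x)))" for k m
  proof (rule Bochner_Integration.integrable_bound[OF int[of k]])
    show "AE x in lborel. norm (\<rho> x * x ^ k * exp (- (\<delta> * real m * x))) \<le> norm (\<rho> x * x ^ k * exp (\<delta> * x))"
    proof (rule AE_I2)
      fix x
      show "norm (\<rho> x * x ^ k * exp (- (\<delta> * real m * x))) \<le> norm (\<rho> x * x ^ k * exp (\<delta> * x))"
      proof (cases "x > 0")
        case True
        have "- (\<delta> * real m * x) \<le> 0" using True \<delta> by simp
        also have "0 \<le> \<delta> * x" using True \<delta> by simp
        finally have "exp (- (\<delta> * real m * x)) \<le> exp (\<delta> * x)" by simp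
        then show ?thesis by (simp add: abs_mult mult_left_mono)
      qed (simp add: supp)
    qed
  qed measurable
  have step: "(\<integral>x. \<rho> x * x ^ k * exp (- (\<delta> * real m * x)) \<partial>lborel) = 0" for k m
  proof (induction m arbitrary: k)
    case 0
    then show ?case using zero[of k] by simp
  next
    case (Suc m)
    define E where "E n x = (\<Sum>i<n. (- (\<delta> * x)) ^ i /\<^sub>R fact i)" for n x
    have [measurable]: "E n \<in> borel_measurable borel" for n unfolding E_def by measurable
    let ?s = "\<lambda>n x. \<rho> x * x ^ k * exp (- (\<delta> * real m * x)) * E n x"
    have "(\<lambda>n. \<integral>x. ?s n x \<partial>lborel) \<longlonglongrightarrow> (\<integral>x. \<rho> x * x ^ k * exp (- (\<delta> * real (Suc m) * x)) \<partial>lborel)"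
    proof (rule integral_dominated_convergence)
      show "integrable lborel (\<lambda>x. \<bar>\<rho> x * x ^ k * exp (\<delta> * x)\<bar>)" using int[of k] by auto
      show "AE x in lborel. (\<lambda>n. ?s n x) \<longlonglongrightarrow> \<rho> x * x ^ k * exp (- (\<delta> * real (Suc m) * x))"
      proof (rule AE_I2)
        fix x
        have "(\<lambda>n. E n x) \<longlonglongrightarrow> exp (- (\<delta> * x))"
          unfolding E_def using exp_converges[of "- (\<delta> * x)"] by (simp add: sums_def)
        from tendsto_mult_left[OF this, of "\<rho> x * x ^ k * exp (- (\<delta> * real m * x))"]
        show "(\<lambda>n. ?s n x) \<longlonglongrightarrow> \<rho> x * x ^ k * exp (- (\<delta> * real (Suc m) * x))"
          by (simp add: mult.assoc exp_add[symmetric] algebra_simps)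
      qed
      show "AE x in lborel. norm (?s n x) \<le> \<bar>\<rho> x * x ^ k * exp (\<delta> * x)\<bar>" for n
      proof (rule AE_I2)
        fix x
        show "norm (?s n x) \<le> \<bar>\<rho> x * x ^ k * exp (\<delta> * x)\<bar>"
        proof (cases "x > 0")
          case True
          have "\<bar>E n x\<bar> \<le> (\<Sum>i<n. \<bar>(- (\<delta> * x)) ^ i /\<^sub>R fact i\<bar>)" unfolding E_def by (rule sum_abs)
          also have "\<dots> = (\<Sum>i<n. (\<delta> * x) ^ i /\<^sub>R fact i)"
            using True \<delta> by (intro sum.cong) (auto simp: abs_mult power_abs)
          also have "\<dots> \<le> exp (\<delta> * x)"
            unfolding exp_def using True \<delta>
            by (intro sum_le_suminf summable_exp_generic) auto
          finally have E: "\<bar>E n x\<bar> \<le> exp (\<delta> * x)" .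
          have "exp (- (\<delta> * real m * x)) \<le> 1" using True \<delta> by simp
          from mult_mono[OF this E] have "exp (- (\<delta> * real m * x)) * \<bar>E n x\<bar> \<le> exp (\<delta> * x)" by simp
          from mult_left_mono[OF this, of "\<bar>\<rho> x * x ^ k\<bar>"] show ?thesis by (simp add: abs_mult mult.assoc)
        qed (simp add: supp)
      qed
    qed measurable
    moreover have "(\<integral>x. ?s n x \<partial>lborel) = 0" for n
    proof -
      have "?s n x = (\<Sum>i<n. ((- \<delta>) ^ i / fact i) * (\<rho> x * x ^ (k + i) * exp (- (\<delta> * real m * x))))" for x
        unfolding E_def sum_distrib_left
        by (intro sum.cong refl) (simp add: power_add power_mult_distrib[symmetric] field_simps)
      then have "(\<integral>x. ?s n x \<partial>lborel)
         = (\<Sum>i<n. ((- \<delta>) ^ i / fact i) * (\<integral>x. \<rho> x * x ^ (k + i) * exp (- (\<delta> * real m * x)) \<partial>lborel))"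
        using int0 by simp
      then show ?thesis using Suc by simp
    qed
    ultimately show ?case by (simp add: LIMSEQ_const_iff)
  qed
  show ?thesis
  proof (rule AE_zero_if_exp_integrals_zero[OF _ supp \<delta>])
    show "integrable lborel \<rho>" using int0[of 0 0] by simp
    show "(\<integral>x. \<rho> x * exp (- (\<delta> * real m * x)) \<partial>lborel) = 0" for m using step[of 0 m] by simp
  qed
qed

section \<open>The Laguerre system\<close>

subsection \<open>Gamma integrals\<close>

definition gamma_density :: "real \<Rightarrow> real \<Rightarrow> real \<Rightarrow> real" where
  "gamma_density z b x = indicator {0<..} x * (x powr (z - 1) * exp (- (b * x)))"

lemma gamma_density_nonneg: "0 \<le> gamma_density z b x"
  by (simp add: gamma_density_def)

lemma gamma_density_measurable [measurable]: "gamma_density z b \<in> borel_measurable borel"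
  unfolding gamma_density_def by measurable

lemma nn_integral_gamma_density:
  assumes z: "z > 0" and b: "b > 0"
  shows "(\<integral>\<^sup>+x. ennreal (gamma_density z b x) \<partial>lborel) = ennreal (Gamma z / b powr z)"
proof -
  have "ennreal (Gamma z) = (\<integral>\<^sup>+t. ennreal (indicator {0..} t * t powr (z - 1) / exp t) \<partial>lborel)"
    by (rule Gamma_conv_nn_integral_real[OF z])
  also have "\<dots> = ennreal \<bar>b\<bar> * (\<integral>\<^sup>+x. ennreal (indicator {0..} (0 + b * x) * (0 + b * x) powr (z - 1) / exp (0 + b * x)) \<partial>lborel)"
    by (rule nn_integral_real_affine) (use b in auto)
  also have "\<dots> = (\<integral>\<^sup>+x. ennreal (b powr z) * ennreal (gamma_density z b x) \<partial>lborel)"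
  proof (subst nn_integral_cmult [symmetric], measurable, intro nn_integral_cong)
    fix x :: real
    have "b * (indicator {0..} (b * x) * (b * x) powr (z - 1) / exp (b * x)) = b powr z * gamma_density z b x"
    proof (cases "x > 0")
      case True
      then show ?thesis using b
        by (simp add: gamma_density_def powr_mult exp_minus field_simps powr_mult_base flip: powr_diff)
    next
      case False
      then show ?thesis using b by (cases "x = 0") (auto simp: gamma_density_def indicator_def zero_le_mult_iff)
    qed
    then show "ennreal \<bar>b\<bar> * ennreal (indicator {0..} (0 + b * x) * (0 + b * x) powr (z - 1) / exp (0 + b * x))
         = ennreal (b powr z) * ennreal (gamma_density z b x)"
      using b by (simp add: ennreal_mult'[symmetric])
  qed
  also have "\<dots> = ennreal (b powr z) * (\<integral>\<^sup>+x. ennreal (gamma_density z b x) \<partial>lborel)"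
    by (rule nn_integral_cmult) measurable
  finally have "ennreal (Gamma z) = ennreal (b powr z) * (\<integral>\<^sup>+x. ennreal (gamma_density z b x) \<partial>lborel)" .
  then have "ennreal (1 / b powr z) * ennreal (Gamma z)
     = ennreal (1 / b powr z) * ennreal (b powr z) * (\<integral>\<^sup>+x. ennreal (gamma_density z b x) \<partial>lborel)"
    by (simp add: mult.assoc)
  also have "ennreal (1 / b powr z) * ennreal (b powr z) = 1"
    using b by (simp add: ennreal_mult'[symmetric])
  finally show ?thesis using b z Gamma_real_nonneg[of z]
    by (simp add: ennreal_mult'[symmetric])
qed

lemma has_bochner_integral_gamma_density:
  assumes z: "z > 0" and b: "b > 0"
  shows "has_bochner_integral lborel (gamma_density z b) (Gamma z / b powr z)"
  using nn_integral_gamma_density[OF assms] Gamma_real_nonneg[of z] z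
  by (intro has_bochner_integral_nn_integral) (auto simp: gamma_density_nonneg)

lemma integrable_gamma_density: "z > 0 \<Longrightarrow> b > 0 \<Longrightarrow> integrable lborel (gamma_density z b)"
  and integral_gamma_density: "z > 0 \<Longrightarrow> b > 0 \<Longrightarrow> integral\<^sup>L lborel (gamma_density z b) = Gamma z / b powr z"
  using has_bochner_integral_gamma_density by (auto simp: has_bochner_integral_iff)

subsection \<open>The measure\<close>

text \<open>The negative number represents the point at infinity, which compactifies the half-line. The measure
  gives it no mass.\<close>

definition half_line :: "real set" where
  "half_line = insert (-1) {0..}"

definition speed_density :: "real \<Rightarrow> real \<Rightarrow> real" where
  "speed_density \<nu> = gamma_density (1 - \<nu>) 1"

definition speed_measure :: "real \<Rightarrow> real measure" where
  "speed_measure \<nu> = restrict_space (density lborel (\<lambda>x. ennreal (speed_density \<nu> x))) half_line"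

lemma half_line_borel [measurable]: "half_line \<in> sets borel"
  unfolding half_line_def by simp

lemma space_speed: "space (speed_measure \<nu>) = half_line"
  by (simp add: speed_measure_def space_restrict_space)

lemma sets_speed: "sets (speed_measure \<nu>) = sets (restrict_space borel half_line)"
  by (simp add: speed_measure_def sets_restrict_space)

lemma speed_measurable_borel: "f \<in> borel_measurable borel \<Longrightarrow> f \<in> borel_measurable (speed_measure \<nu>)"
  by (simp add: speed_measure_def measurable_restrict_space1)

lemma speed_density_measurable [measurable]: "speed_density \<nu> \<in> borel_measurable borel"
  unfolding speed_density_def by measurable

lemma speed_density_nonneg: "0 \<le> speed_density \<nu> x"
  by (simp add: speed_density_def gamma_density_nonneg)

lemma speed_density_pos: "x > 0 \<Longrightarrow> speed_density \<nu> x = x powr (- \<nu>) * exp (- x)"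
  by (simp add: speed_density_def gamma_density_def)

lemma speed_density_nonpos: "x \<le> 0 \<Longrightarrow> speed_density \<nu> x = 0"
  by (simp add: speed_density_def gamma_density_def)

lemma speed_density_indicator: "speed_density \<nu> x * (indicator half_line x * a) = speed_density \<nu> x * a"
  by (cases "x > 0") (auto simp: speed_density_nonpos half_line_def)

lemma speed_measurable_indicator:
  assumes "f \<in> borel_measurable (speed_measure \<nu>)"
  shows "(\<lambda>x. indicator half_line x * f x :: real) \<in> borel_measurable borel"
  using assms unfolding speed_measure_def
  by (simp add: borel_measurable_restrict_space_iff mult.commute)

lemma speed_measurable_times_density:
  assumes "f \<in> borel_measurable (speed_measure \<nu>)"
  shows "(\<lambda>x. speed_density \<nu> x * f x :: real) \<in> borel_measurable borel"
proof -
  have "(\<lambda>x. speed_density \<nu> x * (indicator half_line x * f x)) \<in> borel_measurable borel"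
    using speed_measurable_indicator[OF assms] by measurable
  also have "(\<lambda>x. speed_density \<nu> x * (indicator half_line x * f x)) = (\<lambda>x. speed_density \<nu> x * f x)"
    by (simp only: speed_density_indicator)
  finally show ?thesis .
qed

lemma integrable_speed_iff:
  assumes f: "f \<in> borel_measurable (speed_measure \<nu>)"
  shows "integrable (speed_measure \<nu>) f \<longleftrightarrow> integrable lborel (\<lambda>x. speed_density \<nu> x * f x)"
proof -
  have "integrable (speed_measure \<nu>) f
      \<longleftrightarrow> integrable (density lborel (\<lambda>x. ennreal (speed_density \<nu> x))) (\<lambda>x. indicator half_line x * f x)"
    unfolding speed_measure_def by (subst integrable_restrict_space) auto
  also have "\<dots> \<longleftrightarrow> integrable lborel (\<lambda>x. speed_density \<nu> x * (indicator half_line x * f x))"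
    using speed_measurable_indicator[OF f]
    by (subst integrable_density) (auto simp: speed_density_nonneg)
  also have "(\<lambda>x. speed_density \<nu> x * (indicator half_line x * f x)) = (\<lambda>x. speed_density \<nu> x * f x)"
    by (simp only: speed_density_indicator)
  finally show ?thesis .
qed

lemma integrable_speedD:
  "integrable (speed_measure \<nu>) f \<Longrightarrow> integrable lborel (\<lambda>x. speed_density \<nu> x * f x)"
  using integrable_speed_iff[of f \<nu>] by auto

lemma integral_speed:
  assumes f: "f \<in> borel_measurable (speed_measure \<nu>)"
  shows "integral\<^sup>L (speed_measure \<nu>) f = (\<integral>x. speed_density \<nu> x * f x \<partial>lborel)"
proof -
  have "integral\<^sup>L (speed_measure \<nu>) f
      = integral\<^sup>L (density lborel (\<lambda>x. ennreal (speed_density \<nu> x))) (\<lambda>x. indicator half_line x * f x)"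
    unfolding speed_measure_def by (subst integral_restrict_space) auto
  also have "\<dots> = (\<integral>x. speed_density \<nu> x * (indicator half_line x * f x) \<partial>lborel)"
    using speed_measurable_indicator[OF f]
    by (subst integral_density) (auto simp: speed_density_nonneg)
  also have "(\<lambda>x. speed_density \<nu> x * (indicator half_line x * f x)) = (\<lambda>x. speed_density \<nu> x * f x)"
    by (simp only: speed_density_indicator)
  finally show ?thesis .
qed

lemma nn_integral_speed:
  assumes f [measurable]: "f \<in> borel_measurable borel"
  shows "integral\<^sup>N (speed_measure \<nu>) f = (\<integral>\<^sup>+x. ennreal (speed_density \<nu> x) * f x \<partial>lborel)"
proof -
  have "integral\<^sup>N (speed_measure \<nu>) f
      = (\<integral>\<^sup>+x. f x * indicator half_line x \<partial>density lborel (\<lambda>x. ennreal (speed_density \<nu> x)))"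
    unfolding speed_measure_def by (subst nn_integral_restrict_space) auto
  also have "\<dots> = (\<integral>\<^sup>+x. ennreal (speed_density \<nu> x) * (f x * indicator half_line x) \<partial>lborel)"
    by (subst nn_integral_density) auto
  also have "(\<lambda>x. ennreal (speed_density \<nu> x) * (f x * indicator half_line x)) = (\<lambda>x. ennreal (speed_density \<nu> x) * f x)"
  proof
    fix x show "ennreal (speed_density \<nu> x) * (f x * indicator half_line x) = ennreal (speed_density \<nu> x) * f x"
      by (cases "x > 0") (auto simp: speed_density_nonpos half_line_def)
  qed
  finally show ?thesis .
qed

lemma AE_speed_iff:
  "(AE x in speed_measure \<nu>. P x) \<longleftrightarrow> (AE x in lborel. x > 0 \<longrightarrow> P x)"
proof -
  have "(AE x in speed_measure \<nu>. P x)
    \<longleftrightarrow> (AE x in density lborel (\<lambda>x. ennreal (speed_density \<nu> x)). x \<in> half_line \<longrightarrow> P x)"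
    unfolding speed_measure_def by (subst AE_restrict_space_iff) auto
  also have "\<dots> \<longleftrightarrow> (AE x in lborel. 0 < ennreal (speed_density \<nu> x) \<longrightarrow> x \<in> half_line \<longrightarrow> P x)"
    by (subst AE_density) auto
  also have "(\<lambda>x. 0 < ennreal (speed_density \<nu> x) \<longrightarrow> x \<in> half_line \<longrightarrow> P x) = (\<lambda>x. x > 0 \<longrightarrow> P x)"
  proof
    fix x show "(0 < ennreal (speed_density \<nu> x) \<longrightarrow> x \<in> half_line \<longrightarrow> P x) = (x > 0 \<longrightarrow> P x)"
      by (cases "x > 0") (auto simp: speed_density_nonpos speed_density_pos half_line_def)
  qed
  finally show ?thesis .
qed

lemma finite_measure_speed:
  assumes "\<nu> < 1" shows "finite_measure (speed_measure \<nu>)"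
proof
  have "emeasure (speed_measure \<nu>) (space (speed_measure \<nu>)) = (\<integral>\<^sup>+x. 1 \<partial>speed_measure \<nu>)" by simp
  also have "\<dots> = (\<integral>\<^sup>+x. ennreal (speed_density \<nu> x) \<partial>lborel)" by (subst nn_integral_speed) auto
  also have "\<dots> = ennreal (Gamma (1 - \<nu>) / 1 powr (1 - \<nu>))"
    unfolding speed_density_def by (rule nn_integral_gamma_density) (use assms in auto)
  finally show "emeasure (speed_measure \<nu>) (space (speed_measure \<nu>)) \<noteq> \<infinity>" by simp
qed

subsection \<open>Monomials and exponentials\<close>

text \<open>To leading order at the origin \<open>x powr \<nu>\<close> is the harmonic function that vanishes there. The
  eigenfunctions and the images of exponentials under the semigroup inherit this factor.\<close>

definition mono_exp :: "real \<Rightarrow> nat \<Rightarrow> real \<Rightarrow> real \<Rightarrow> real" where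
  "mono_exp \<nu> k s x = x powr \<nu> * x ^ k * exp (- (s * x))"

lemma mono_exp_measurable [measurable]: "mono_exp \<nu> k s \<in> borel_measurable borel"
  unfolding mono_exp_def by measurable

lemma speed_density_mono_exp_mult:
  "speed_density \<nu> x * (mono_exp \<nu> j s x * mono_exp \<nu> k r x) = gamma_density (1 + \<nu> + j + k) (1 + s + r) x"
proof (cases "x > 0")
  case True
  then show ?thesis
    by (simp add: speed_density_pos mono_exp_def gamma_density_def powr_realpow[symmetric] exp_add[symmetric]
        powr_add[symmetric] mult_ac algebra_simps)
qed (simp add: speed_density_nonpos gamma_density_def)

lemma mono_exp_L2:
  assumes "\<nu> > 0" "s > - 1/2"
  shows "mono_exp \<nu> k s \<in> Lp 2 (speed_measure \<nu>)"
proof -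
  have "integrable (speed_measure \<nu>) (\<lambda>x. mono_exp \<nu> k s x * mono_exp \<nu> k s x)"
  proof (subst integrable_speed_iff)
    show "(\<lambda>x. mono_exp \<nu> k s x * mono_exp \<nu> k s x) \<in> borel_measurable (speed_measure \<nu>)"
      by (rule speed_measurable_borel) measurable
    show "integrable lborel (\<lambda>x. speed_density \<nu> x * (mono_exp \<nu> k s x * mono_exp \<nu> k s x))"
      unfolding speed_density_mono_exp_mult using assms by (intro integrable_gamma_density) auto
  qed
  then show ?thesis by (simp add: Lp_2_iff power2_eq_square speed_measurable_borel)
qed

lemma inner_mono_exp:
  assumes "\<nu> > 0" "s > - 1/2" "r > - 1/2"
  shows "inner_L2 (speed_measure \<nu>) (mono_exp \<nu> j s) (mono_exp \<nu> k r)
    = Gamma (1 + \<nu> + j + k) / (1 + s + r) powr (1 + \<nu> + j + k)"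
proof -
  have "inner_L2 (speed_measure \<nu>) (mono_exp \<nu> j s) (mono_exp \<nu> k r)
     = integral\<^sup>L lborel (gamma_density (1 + \<nu> + j + k) (1 + s + r))"
    unfolding inner_L2_def
    by (subst integral_speed) (auto intro!: speed_measurable_borel simp: speed_density_mono_exp_mult)
  then show ?thesis using assms by (simp add: integral_gamma_density)
qed

subsection \<open>Laguerre polynomials\<close>

text \<open>The functions \<open>lag \<nu> n\<close> are \<open>x powr \<nu>\<close> times the Laguerre polynomials of parameter \<open>\<nu>\<close>,
  normalised to the value \<open>1\<close> at \<open>0\<close>.\<close>

definition lag_coeff :: "real \<Rightarrow> nat \<Rightarrow> nat \<Rightarrow> real" where
  "lag_coeff \<nu> n k = (-1) ^ k * real (n choose k) / pochhammer (1 + \<nu>) k"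

definition lag :: "real \<Rightarrow> nat \<Rightarrow> real \<Rightarrow> real" where
  "lag \<nu> n x = (\<Sum>k\<le>n. lag_coeff \<nu> n k * mono_exp \<nu> k 0 x)"

lemma lag_coeff_Suc:
  assumes "\<nu> > 0" "i < n"
  shows "lag_coeff \<nu> n (Suc i) * (real i + 1) * (real i + 1 + \<nu>) = (real i - real n) * lag_coeff \<nu> n i"
proof -
  have "Suc i * (n choose Suc i) = (n - i) * (n choose i)"
    using binomial_absorb_comp[of n i] Suc_times_binomial[of i "n - 1"] assms by simp
  then have b: "(real i + 1) * real (n choose Suc i) = (real n - real i) * real (n choose i)"
    using assms by (metis of_nat_Suc of_nat_diff of_nat_mult less_imp_le add.commute)
  have p: "pochhammer (1 + \<nu>) i > 0" using assms by (intro pochhammer_pos) simp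
  define d where "d = 1 + \<nu> + real i"
  have d: "d > 0" "real i + 1 + \<nu> = d" using assms by (auto simp: d_def)
  have "pochhammer (1 + \<nu>) (Suc i) = pochhammer (1 + \<nu>) i * d" by (simp add: pochhammer_Suc d_def)
  then have "lag_coeff \<nu> n (Suc i) * (real i + 1) * (real i + 1 + \<nu>)
     = - ((-1) ^ i) * ((real i + 1) * real (n choose Suc i)) / pochhammer (1 + \<nu>) i"
    using d p by (simp add: lag_coeff_def)
  also have "\<dots> = (real i - real n) * lag_coeff \<nu> n i"
    unfolding b using p by (simp add: lag_coeff_def field_simps)
  finally show ?thesis .
qed

text \<open>The energy \<open>\<integral> x powr (1 - \<nu>) * exp (- x) * f' * g' dx\<close> of \<open>f = x powr (\<nu> + j)\<close> and
  \<open>g = x powr (\<nu> + k)\<close>.\<close>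

definition form_entry :: "real \<Rightarrow> nat \<Rightarrow> nat \<Rightarrow> real" where
  "form_entry \<nu> j k = (\<nu> + j) * (\<nu> + k) * Gamma (\<nu> + j + k)"

text \<open>The operator \<open>- (x f'' + (1 - \<nu> - x) f')\<close> sends \<open>x powr (\<nu> + j)\<close> to
  \<open>(\<nu> + j) * x powr (\<nu> + j)\<close> minus \<open>j * (j + \<nu>) * x powr (\<nu> + j - 1)\<close>. The recursion of the coefficients cancels the
  lower order terms except for the eigenvalue.\<close>

lemma lag_eigenvector:
  assumes \<nu>: "\<nu> > 0"
  shows "(\<Sum>j\<le>n. lag_coeff \<nu> n j * form_entry \<nu> j k)
    = (\<nu> + n) * (\<Sum>j\<le>n. lag_coeff \<nu> n j * Gamma (1 + \<nu> + j + k))"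
proof -
  define B where "B j = Gamma (1 + \<nu> + real j + real k)" for j
  define c where "c = lag_coeff \<nu> n"
  have rec: "B j = (\<nu> + j + k) * Gamma (\<nu> + j + k)" for j
    using Gamma_plus1[of "\<nu> + real j + real k"] \<nu> nonpos_Ints_nonpos[of "\<nu> + real j + real k"]
    by (force simp: B_def algebra_simps)
  have entry: "form_entry \<nu> j k = (\<nu> + j) * B j - j * (j + \<nu>) * Gamma (\<nu> + j + k)" for j
    unfolding rec form_entry_def by (simp add: algebra_simps)
  have "(\<Sum>j\<le>n. c j * (j * (j + \<nu>) * Gamma (\<nu> + j + k)))
      = (\<Sum>i<n. c (Suc i) * (Suc i * (Suc i + \<nu>) * Gamma (\<nu> + Suc i + k)))"
    by (subst sum.atMost_shift) simp
  also have "\<dots> = (\<Sum>i<n. (real i - real n) * c i * B i)"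
  proof (rule sum.cong[OF refl])
    fix i assume "i \<in> {..<n}"
    then have "c (Suc i) * (real i + 1) * (real i + 1 + \<nu>) = (real i - real n) * c i"
      unfolding c_def by (intro lag_coeff_Suc \<nu>) simp
    moreover have "Gamma (\<nu> + real (Suc i) + real k) = B i" by (simp add: B_def algebra_simps)
    ultimately show "c (Suc i) * (Suc i * (Suc i + \<nu>) * Gamma (\<nu> + Suc i + k)) = (real i - real n) * c i * B i"
      by (simp add: mult.assoc[symmetric] add.commute)
  qed
  also have "\<dots> = (\<Sum>i\<le>n. (real i - real n) * c i * B i)"
    by (simp add: lessThan_Suc_atMost[symmetric])
  finally have shift: "(\<Sum>j\<le>n. c j * (j * (j + \<nu>) * Gamma (\<nu> + j + k))) = (\<Sum>i\<le>n. (real i - real n) * c i * B i)" .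
  have "(\<Sum>j\<le>n. c j * form_entry \<nu> j k)
     = (\<Sum>j\<le>n. c j * ((\<nu> + j) * B j)) - (\<Sum>j\<le>n. c j * (j * (j + \<nu>) * Gamma (\<nu> + j + k)))"
    by (simp add: entry right_diff_distrib sum_subtractf)
  also have "\<dots> = (\<Sum>j\<le>n. (\<nu> + n) * (c j * B j))"
    unfolding shift by (simp add: sum_subtractf[symmetric] algebra_simps)
  finally show ?thesis by (simp add: c_def B_def sum_distrib_left)
qed

lemma lag_L2: "\<nu> > 0 \<Longrightarrow> lag \<nu> n \<in> Lp 2 (speed_measure \<nu>)"
  unfolding lag_def by (intro L2_sum mono_exp_L2) auto

lemma inner_lag_left:
  assumes "\<nu> > 0" "f \<in> Lp 2 (speed_measure \<nu>)"
  shows "inner_L2 (speed_measure \<nu>) (lag \<nu> n) f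
    = (\<Sum>k\<le>n. lag_coeff \<nu> n k * inner_L2 (speed_measure \<nu>) (mono_exp \<nu> k 0) f)"
  unfolding lag_def using assms by (intro inner_L2_sum mono_exp_L2) auto

lemma inner_lag_lag:
  assumes \<nu>: "\<nu> > 0"
  shows "inner_L2 (speed_measure \<nu>) (lag \<nu> n) (lag \<nu> m)
    = (\<Sum>k\<le>m. lag_coeff \<nu> m k * (\<Sum>j\<le>n. lag_coeff \<nu> n j * Gamma (1 + \<nu> + j + k)))"
  using \<nu>
  by (subst inner_L2_commute) (simp add: inner_lag_left lag_L2 inner_L2_commute[of _ "mono_exp \<nu> _ 0" "lag \<nu> n"]
     mono_exp_L2 inner_mono_exp)

lemma lag_form:
  assumes \<nu>: "\<nu> > 0"
  shows "(\<Sum>k\<le>m. lag_coeff \<nu> m k * (\<Sum>j\<le>n. lag_coeff \<nu> n j * form_entry \<nu> j k))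
    = (\<nu> + n) * inner_L2 (speed_measure \<nu>) (lag \<nu> n) (lag \<nu> m)"
  by (simp add: inner_lag_lag[OF \<nu>] lag_eigenvector[OF \<nu>] sum_distrib_left mult.left_commute)

text \<open>Two eigenvectors of one symmetric matrix pencil, with different eigenvalues.\<close>

lemma lag_orthogonal:
  assumes \<nu>: "\<nu> > 0" and nm: "n \<noteq> m"
  shows "inner_L2 (speed_measure \<nu>) (lag \<nu> n) (lag \<nu> m) = 0"
proof -
  have sym: "form_entry \<nu> j k = form_entry \<nu> k j" for j k
    by (simp add: form_entry_def add_ac mult.commute)
  have "(\<nu> + n) * inner_L2 (speed_measure \<nu>) (lag \<nu> n) (lag \<nu> m)
     = (\<Sum>k\<le>m. \<Sum>j\<le>n. lag_coeff \<nu> m k * (lag_coeff \<nu> n j * form_entry \<nu> j k))"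
    by (simp add: lag_form[OF \<nu>, symmetric] sum_distrib_left)
  also have "\<dots> = (\<Sum>j\<le>n. \<Sum>k\<le>m. lag_coeff \<nu> n j * (lag_coeff \<nu> m k * form_entry \<nu> k j))"
    by (subst sum.swap) (simp add: sym mult.left_commute)
  also have "\<dots> = (\<nu> + m) * inner_L2 (speed_measure \<nu>) (lag \<nu> m) (lag \<nu> n)"
    by (simp add: lag_form[OF \<nu>, symmetric] sum_distrib_left)
  finally have "(real n - real m) * inner_L2 (speed_measure \<nu>) (lag \<nu> n) (lag \<nu> m) = 0"
    by (simp add: inner_L2_commute[of _ "lag \<nu> m"] algebra_simps)
  then show ?thesis using nm by simp
qed

text \<open>The binomial theorem. This generating function carries all information about the Laguerre functions
  that the semigroup needs.\<close>

lemma inner_lag_exp: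
  assumes \<nu>: "\<nu> > 0" and s: "s \<ge> 0"
  shows "inner_L2 (speed_measure \<nu>) (lag \<nu> n) (mono_exp \<nu> 0 s)
    = Gamma (1 + \<nu>) * (1 + s) powr (- (1 + \<nu>)) * (s / (1 + s)) ^ n"
proof -
  have G: "Gamma (1 + \<nu> + real k) = pochhammer (1 + \<nu>) k * Gamma (1 + \<nu>)" for k
  proof -
    have "1 + \<nu> \<notin> \<int>\<^sub>\<le>\<^sub>0" using \<nu> nonpos_Ints_nonpos[of "1 + \<nu>"] by auto
    moreover have "Gamma (1 + \<nu>) > 0" using \<nu> by (intro Gamma_real_pos) simp
    ultimately show ?thesis using pochhammer_Gamma[of "1 + \<nu>" k] by simp
  qed
  have P: "pochhammer (1 + \<nu>) k > 0" for k using \<nu> by (intro pochhammer_pos) simp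
  have "inner_L2 (speed_measure \<nu>) (lag \<nu> n) (mono_exp \<nu> 0 s)
     = (\<Sum>k\<le>n. lag_coeff \<nu> n k * (Gamma (1 + \<nu> + real k) / (1 + s) powr (1 + \<nu> + real k)))"
    using \<nu> s by (simp add: inner_lag_left mono_exp_L2 inner_mono_exp)
  also have "\<dots> = (\<Sum>k\<le>n. Gamma (1 + \<nu>) * (1 + s) powr (- (1 + \<nu>)) * (real (n choose k) * (- (1 / (1 + s))) ^ k * 1 ^ (n - k)))"
  proof (rule sum.cong[OF refl])
    fix k
    have e1: "(1 + s) powr (1 + \<nu> + real k) = (1 + s) powr (1 + \<nu>) * (1 + s) ^ k"
      using s by (simp add: powr_add powr_realpow)
    have e2: "(- (1 / (1 + s))) ^ k = (-1) ^ k / (1 + s) ^ k"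
      by (metis minus_divide_left power_divide)
    have e3: "(1 + s) powr (- (1 + \<nu>)) = 1 / (1 + s) powr (1 + \<nu>)" by (rule powr_minus_divide)
    show "lag_coeff \<nu> n k * (Gamma (1 + \<nu> + real k) / (1 + s) powr (1 + \<nu> + real k))
      = Gamma (1 + \<nu>) * (1 + s) powr (- (1 + \<nu>)) * (real (n choose k) * (- (1 / (1 + s))) ^ k * 1 ^ (n - k))"
      unfolding e1 e2 e3 G lag_coeff_def using P[of k] s by simp
  qed
  also have "\<dots> = Gamma (1 + \<nu>) * (1 + s) powr (- (1 + \<nu>)) * (- (1 / (1 + s)) + 1) ^ n"
    unfolding binomial_ring by (simp add: sum_distrib_left)
  also have "- (1 / (1 + s)) + 1 = s / (1 + s)" using s by (simp add: field_simps)
  finally show ?thesis .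
qed

lemma lag_norm_pos:
  assumes \<nu>: "\<nu> > 0"
  shows "inner_L2 (speed_measure \<nu>) (lag \<nu> n) (lag \<nu> n) > 0"
proof (rule ccontr)
  assume "\<not> ?thesis"
  then have "norm_L2 (speed_measure \<nu>) (lag \<nu> n) = 0"
    using inner_L2_nonneg[of "speed_measure \<nu>" "lag \<nu> n"] by (simp add: norm_L2_def)
  moreover have "\<bar>inner_L2 (speed_measure \<nu>) (lag \<nu> n) (mono_exp \<nu> 0 1)\<bar>
     \<le> norm_L2 (speed_measure \<nu>) (lag \<nu> n) * norm_L2 (speed_measure \<nu>) (mono_exp \<nu> 0 1)"
    using \<nu> by (intro Cauchy_Schwarz_L2 lag_L2 mono_exp_L2) auto
  moreover have "0 < Gamma (1 + \<nu>) * (1 + 1) powr (- (1 + \<nu>)) * (1 / (1 + 1)) ^ n"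
    using \<nu> by (intro mult_pos_pos Gamma_real_pos) auto
  ultimately show False
    using inner_lag_exp[OF \<nu>, of 1 n] by simp
qed

definition eigfun :: "real \<Rightarrow> nat \<Rightarrow> real \<Rightarrow> real" where
  "eigfun \<nu> n x = (1 / norm_L2 (speed_measure \<nu>) (lag \<nu> n)) * lag \<nu> n x"

lemma norm_lag_pos: "\<nu> > 0 \<Longrightarrow> norm_L2 (speed_measure \<nu>) (lag \<nu> n) > 0"
  using lag_norm_pos[of \<nu> n] by (simp add: norm_L2_def)

lemma lag_measurable [measurable]: "lag \<nu> n \<in> borel_measurable borel"
  unfolding lag_def by measurable

lemma eigfun_measurable [measurable]: "eigfun \<nu> n \<in> borel_measurable borel"
  unfolding eigfun_def by measurable

lemma eigfun_L2: "\<nu> > 0 \<Longrightarrow> eigfun \<nu> n \<in> Lp 2 (speed_measure \<nu>)"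
  unfolding eigfun_def by (intro L2_scale lag_L2)

lemma inner_scale_left:
  assumes "f \<in> Lp 2 M" "g \<in> Lp 2 M"
  shows "inner_L2 M (\<lambda>x. a * f x) g = a * inner_L2 M f g"
  using inner_L2_lincomb[OF assms(1) assms, of a 0] by simp

lemma inner_scale_right:
  assumes "f \<in> Lp 2 M" "g \<in> Lp 2 M"
  shows "inner_L2 M f (\<lambda>x. a * g x) = a * inner_L2 M f g"
  using inner_scale_left[OF assms(2,1)] by (simp add: inner_L2_commute[of M f])

lemma eigfun_orthonormal:
  assumes \<nu>: "\<nu> > 0"
  shows "inner_L2 (speed_measure \<nu>) (eigfun \<nu> m) (eigfun \<nu> n) = (if m = n then 1 else 0)"
proof -
  have "inner_L2 (speed_measure \<nu>) (eigfun \<nu> m) (eigfun \<nu> n)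
    = (1 / norm_L2 (speed_measure \<nu>) (lag \<nu> m)) * ((1 / norm_L2 (speed_measure \<nu>) (lag \<nu> n)) *
       inner_L2 (speed_measure \<nu>) (lag \<nu> m) (lag \<nu> n))"
    unfolding eigfun_def[abs_def] using \<nu>
    by (simp only: inner_scale_left inner_scale_right L2_scale lag_L2)
  then show ?thesis using norm_lag_pos[OF \<nu>, of n] lag_orthogonal[OF \<nu>, of m n]
    by (auto simp: norm_L2_power2[symmetric] power2_eq_square)
qed

subsection \<open>Completeness\<close>

text \<open>The factors \<open>x powr \<nu>\<close> and \<open>x powr (- \<nu>)\<close> of the function and of the measure cancel.\<close>

lemma AE_zero_speed_if_exp_integrals_zero:
  assumes \<nu>: "0 < \<nu>" "\<nu> < 1" and f: "f \<in> Lp 2 (speed_measure \<nu>)"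
    and zero: "\<And>s. s \<ge> 0 \<Longrightarrow> inner_L2 (speed_measure \<nu>) f (mono_exp \<nu> 0 s) = 0"
  shows "ae_eq (speed_measure \<nu>) f (\<lambda>x. 0)"
proof -
  define \<rho> where "\<rho> x = speed_density \<nu> x * (f x * mono_exp \<nu> 0 0 x)" for x
  have ints: "integrable (speed_measure \<nu>) (\<lambda>x. f x * mono_exp \<nu> 0 s x)" if "s \<ge> 0" for s
    using \<nu> that by (intro L2_mult_integrable f mono_exp_L2) auto
  have "AE x in lborel. \<rho> x = 0"
  proof (rule AE_zero_if_exp_integrals_zero[of _ 1])
    show "integrable lborel \<rho>"
      using integrable_speedD[OF ints[of 0]] by (simp add: \<rho>_def[abs_def])
    fix m :: nat
    have "0 = inner_L2 (speed_measure \<nu>) f (mono_exp \<nu> 0 m)" by (simp add: zero)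
    also have "\<dots> = (\<integral>x. speed_density \<nu> x * (f x * mono_exp \<nu> 0 m x) \<partial>lborel)"
      unfolding inner_L2_def using ints[of m] by (subst integral_speed) auto
    also have "\<dots> = (\<integral>x. \<rho> x * exp (- (1 * real m * x)) \<partial>lborel)"
      by (simp add: \<rho>_def mono_exp_def mult_ac)
    finally show "(\<integral>x. \<rho> x * exp (- (1 * real m * x)) \<partial>lborel) = 0" by simp
  qed (auto simp: \<rho>_def speed_density_nonpos)
  then show ?thesis unfolding ae_eq_def AE_speed_iff
    by eventually_elim (auto simp: \<rho>_def speed_density_pos mono_exp_def)
qed

text \<open>Orthogonality to the Laguerre functions is orthogonality to all monomials. Since \<open>f\<close> is square
  integrable for a weight that decays like \<open>exp (- x)\<close>, a small exponential moment is available and the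
  moments determine \<open>f\<close>.\<close>

lemma eigfun_complete:
  assumes \<nu>: "0 < \<nu>" "\<nu> < 1" and f: "f \<in> Lp 2 (speed_measure \<nu>)"
    and zero: "\<And>n. inner_L2 (speed_measure \<nu>) f (eigfun \<nu> n) = 0"
  shows "ae_eq (speed_measure \<nu>) f (\<lambda>x. 0)"
proof -
  have lag0: "inner_L2 (speed_measure \<nu>) (lag \<nu> n) f = 0" for n
  proof -
    have "inner_L2 (speed_measure \<nu>) f (eigfun \<nu> n)
       = 1 / norm_L2 (speed_measure \<nu>) (lag \<nu> n) * inner_L2 (speed_measure \<nu>) f (lag \<nu> n)"
      unfolding eigfun_def[abs_def] by (rule inner_scale_right[OF f lag_L2[OF \<nu>(1)]])
    then show ?thesis using zero[of n] norm_lag_pos[OF \<nu>(1), of n] by (simp add: inner_L2_commute)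
  qed
  have mono0: "inner_L2 (speed_measure \<nu>) (mono_exp \<nu> n 0) f = 0" for n
  proof (induction n rule: less_induct)
    case (less n)
    have "0 = (\<Sum>k\<le>n. lag_coeff \<nu> n k * inner_L2 (speed_measure \<nu>) (mono_exp \<nu> k 0) f)"
      using lag0[of n] by (simp add: inner_lag_left[OF \<nu>(1) f])
    also have "\<dots> = lag_coeff \<nu> n n * inner_L2 (speed_measure \<nu>) (mono_exp \<nu> n 0) f"
      using less by (simp add: lessThan_Suc_atMost[symmetric])
    finally show ?case using \<nu> pochhammer_pos[of "1 + \<nu>" n] by (simp add: lag_coeff_def)
  qed
  have intk: "integrable (speed_measure \<nu>) (\<lambda>x. f x * mono_exp \<nu> k s x)" if "s > - 1/2" for s k
    using \<nu> that by (intro L2_mult_integrable f mono_exp_L2) auto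
  define \<rho> where "\<rho> x = speed_density \<nu> x * (f x * mono_exp \<nu> 0 0 x)" for x
  have "AE x in lborel. \<rho> x = 0"
  proof (rule AE_zero_if_moments_zero[of _ "1/4"])
    have "integrable lborel \<rho>"
      using integrable_speedD[OF intk[of 0 0]] by (simp add: \<rho>_def[abs_def])
    then show "\<rho> \<in> borel_measurable borel" by auto
    fix k :: nat
    have "integrable lborel (\<lambda>x. speed_density \<nu> x * (f x * mono_exp \<nu> k (- 1/4) x))"
      by (rule integrable_speedD[OF intk]) simp
    then show "integrable lborel (\<lambda>x. \<rho> x * x ^ k * exp (1 / 4 * x))"
      by (simp add: \<rho>_def mono_exp_def mult_ac)
    have "0 = inner_L2 (speed_measure \<nu>) f (mono_exp \<nu> k 0)" using mono0[of k] by (simp add: inner_L2_commute)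
    also have "\<dots> = (\<integral>x. speed_density \<nu> x * (f x * mono_exp \<nu> k 0 x) \<partial>lborel)"
      unfolding inner_L2_def using intk[of 0 k] by (subst integral_speed) auto
    also have "\<dots> = (\<integral>x. \<rho> x * x ^ k \<partial>lborel)"
      by (simp add: \<rho>_def mono_exp_def mult_ac)
    finally show "(\<integral>x. \<rho> x * x ^ k \<partial>lborel) = 0" by simp
  qed (auto simp: \<rho>_def speed_density_nonpos)
  then show ?thesis unfolding ae_eq_def AE_speed_iff
    by eventually_elim (auto simp: \<rho>_def speed_density_pos mono_exp_def)
qed

locale laguerre =
  fixes \<nu> :: real
  assumes nu_pos: "0 < \<nu>" and nu_less: "\<nu> < 1"

sublocale laguerre \<subseteq> diagonal_operator "speed_measure \<nu>" "eigfun \<nu>" "\<lambda>n. \<nu> + real n" \<nu>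
proof -
  interpret finite_measure "speed_measure \<nu>" by (rule finite_measure_speed[OF nu_less])
  interpret orthonormal_system "speed_measure \<nu>" "eigfun \<nu>"
    by unfold_locales (simp_all add: eigfun_L2 eigfun_orthonormal nu_pos)
  show "diagonal_operator (speed_measure \<nu>) (eigfun \<nu>) (\<lambda>n. \<nu> + real n) \<nu>"
    by unfold_locales (auto simp: nu_pos coeff_def intro: eigfun_complete[OF nu_pos nu_less])
qed

section \<open>Symmetric sub-Markovian kernels\<close>

locale submarkov_kernel = finite_measure M for M :: "'a measure" +
  fixes K :: "'a \<Rightarrow> 'a \<Rightarrow> real"
  assumes K_meas [measurable]: "(\<lambda>(x, y). K x y) \<in> borel_measurable (M \<Otimes>\<^sub>M M)"
    and K_nonneg: "\<And>x y. 0 \<le> K x y"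
    and K_sym: "\<And>x y. K x y = K y x"
    and K_mass: "\<And>x. x \<in> space M \<Longrightarrow> (\<integral>\<^sup>+y. ennreal (K x y) \<partial>M) \<le> 1"
begin

sublocale P: pair_sigma_finite M M ..

definition kop :: "('a \<Rightarrow> real) \<Rightarrow> 'a \<Rightarrow> real" where
  "kop f x = (\<integral>y. K x y * f y \<partial>M)"

lemma K_meas2 [measurable]: "(\<lambda>p. K (fst p) (snd p)) \<in> borel_measurable (M \<Otimes>\<^sub>M M)"
  using K_meas by (simp add: case_prod_beta')

lemma K_mass_weighted:
  assumes [measurable]: "f \<in> borel_measurable M"
  shows "(\<integral>\<^sup>+x. \<integral>\<^sup>+y. ennreal (K x y) * ennreal ((f x)\<^sup>2) \<partial>M \<partial>M) \<le> (\<integral>\<^sup>+x. ennreal ((f x)\<^sup>2) \<partial>M)"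
proof (rule nn_integral_mono)
  fix x assume x: "x \<in> space M"
  have [measurable]: "(\<lambda>y. K x y) \<in> borel_measurable M"
    using x by measurable
  have "(\<integral>\<^sup>+y. ennreal (K x y) * ennreal ((f x)\<^sup>2) \<partial>M) = (\<integral>\<^sup>+y. ennreal (K x y) \<partial>M) * ennreal ((f x)\<^sup>2)"
    by (rule nn_integral_multc) measurable
  also have "\<dots> \<le> 1 * ennreal ((f x)\<^sup>2)" by (intro mult_right_mono K_mass x) simp
  finally show "(\<integral>\<^sup>+y. ennreal (K x y) * ennreal ((f x)\<^sup>2) \<partial>M) \<le> ennreal ((f x)\<^sup>2)" by simp
qed

lemma L2_nn_finite:
  assumes "f \<in> Lp 2 M" shows "(\<integral>\<^sup>+x. ennreal ((f x)\<^sup>2) \<partial>M) < \<infinity>"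
proof -
  have "integrable M (\<lambda>x. (f x)\<^sup>2)" using assms by (simp add: Lp_2_iff)
  from nn_integral_eq_integral[OF this] show ?thesis by (simp add: less_top)
qed

lemma K_square_fst:
  assumes f: "f \<in> Lp 2 M"
  shows "integrable (M \<Otimes>\<^sub>M M) (\<lambda>p. K (fst p) (snd p) * (f (fst p))\<^sup>2)"
proof (rule integrableI_nonneg)
  have [measurable]: "f \<in> borel_measurable M" using f by (simp add: Lp_2_iff)
  show "(\<lambda>p. K (fst p) (snd p) * (f (fst p))\<^sup>2) \<in> borel_measurable (M \<Otimes>\<^sub>M M)" by measurable
  have "(\<integral>\<^sup>+p. ennreal (K (fst p) (snd p) * (f (fst p))\<^sup>2) \<partial>(M \<Otimes>\<^sub>M M))
      = (\<integral>\<^sup>+x. \<integral>\<^sup>+y. ennreal (K x y) * ennreal ((f x)\<^sup>2) \<partial>M \<partial>M)"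
    by (subst nn_integral_fst[symmetric]) (auto simp: ennreal_mult K_nonneg)
  also have "\<dots> < \<infinity>" using K_mass_weighted[of f] L2_nn_finite[OF f] by (simp add: le_less_trans)
  finally show "(\<integral>\<^sup>+p. ennreal (K (fst p) (snd p) * (f (fst p))\<^sup>2) \<partial>(M \<Otimes>\<^sub>M M)) < \<infinity>" .
qed (auto simp: K_nonneg)

lemma K_square_snd:
  assumes f: "f \<in> Lp 2 M"
  shows "integrable (M \<Otimes>\<^sub>M M) (\<lambda>p. K (fst p) (snd p) * (f (snd p))\<^sup>2)"
  using P.integrable_product_swap[OF K_square_fst[OF f]]
  by (simp add: case_prod_beta' K_sym[of "snd _"])

lemma K_product:
  assumes f: "f \<in> Lp 2 M" and g: "g \<in> Lp 2 M"
  shows "integrable (M \<Otimes>\<^sub>M M) (\<lambda>p. K (fst p) (snd p) * (f (fst p) * g (snd p)))"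
proof (rule Bochner_Integration.integrable_bound)
  have [measurable]: "f \<in> borel_measurable M" "g \<in> borel_measurable M" using f g by (auto simp: Lp_2_iff)
  show "integrable (M \<Otimes>\<^sub>M M) (\<lambda>p. K (fst p) (snd p) * (f (fst p))\<^sup>2 + K (fst p) (snd p) * (g (snd p))\<^sup>2)"
    by (intro Bochner_Integration.integrable_add K_square_fst K_square_snd f g)
  show "(\<lambda>p. K (fst p) (snd p) * (f (fst p) * g (snd p))) \<in> borel_measurable (M \<Otimes>\<^sub>M M)" by measurable
  have "K (fst p) (snd p) * \<bar>f (fst p) * g (snd p)\<bar> \<le> K (fst p) (snd p) * ((f (fst p))\<^sup>2 + (g (snd p))\<^sup>2)" for p
    by (intro mult_left_mono K_nonneg abs_mult_le_sum_squares)
  then show "AE p in M \<Otimes>\<^sub>M M. norm (K (fst p) (snd p) * (f (fst p) * g (snd p)))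
     \<le> norm (K (fst p) (snd p) * (f (fst p))\<^sup>2 + K (fst p) (snd p) * (g (snd p))\<^sup>2)"
    by (intro AE_I2) (simp add: abs_mult K_nonneg distrib_left)
qed

lemma one_L2: "(\<lambda>x. 1) \<in> Lp 2 M" by (simp add: Lp_2_iff)

lemma K_integrable_AE:
  assumes f: "f \<in> Lp 2 M"
  shows "AE x in M. integrable M (\<lambda>y. K x y * f y)"
  using P.AE_integrable_fst[of "\<lambda>x y. K x y * f y"] K_product[OF one_L2 f]
  by (simp add: case_prod_beta')

text \<open>Schur's test: the Cauchy--Schwarz inequality for the measure with density \<open>K x\<close>, then Tonelli and the symmetry of
  \<open>K\<close>.\<close>

lemma kop_L2:
  assumes f: "f \<in> Lp 2 M" shows "kop f \<in> Lp 2 M"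
proof -
  have [measurable]: "f \<in> borel_measurable M" using f by (simp add: Lp_2_iff)
  have [measurable]: "kop f \<in> borel_measurable M"
    unfolding kop_def[abs_def] by measurable
  have le: "ennreal ((kop f x)\<^sup>2) \<le> (\<integral>\<^sup>+y. ennreal (K x y) * ennreal ((f y)\<^sup>2) \<partial>M)" if x: "x \<in> space M" for x
  proof -
    have [measurable]: "(\<lambda>y. K x y) \<in> borel_measurable M" using x by measurable
    have "ennreal \<bar>kop f x\<bar> \<le> (\<integral>\<^sup>+y. ennreal \<bar>K x y * f y\<bar> \<partial>M)"
      using integral_norm_bound_ennreal[of M "\<lambda>y. K x y * f y"] not_integrable_integral_eq[of M "\<lambda>y. K x y * f y"]
      unfolding kop_def by (cases "integrable M (\<lambda>y. K x y * f y)") auto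
    also have "\<dots> = (\<integral>\<^sup>+y. ennreal (sqrt (K x y)) * ennreal (sqrt (K x y) * \<bar>f y\<bar>) \<partial>M)"
      by (intro nn_integral_cong) (simp add: ennreal_mult[symmetric] K_nonneg abs_mult mult.assoc[symmetric])
    finally have "(ennreal \<bar>kop f x\<bar>)\<^sup>2
        \<le> (\<integral>\<^sup>+y. ennreal (sqrt (K x y)) * ennreal (sqrt (K x y) * \<bar>f y\<bar>) \<partial>M)\<^sup>2" by (rule power_mono) simp
    also have "\<dots> \<le> (\<integral>\<^sup>+y. (ennreal (sqrt (K x y)))\<^sup>2 \<partial>M) * (\<integral>\<^sup>+y. (ennreal (sqrt (K x y) * \<bar>f y\<bar>))\<^sup>2 \<partial>M)"
      by (rule Cauchy_Schwarz_nn_integral) measurable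
    also have "(\<integral>\<^sup>+y. (ennreal (sqrt (K x y)))\<^sup>2 \<partial>M) = (\<integral>\<^sup>+y. ennreal (K x y) \<partial>M)"
      by (simp add: ennreal_power K_nonneg)
    also have "(\<integral>\<^sup>+y. (ennreal (sqrt (K x y) * \<bar>f y\<bar>))\<^sup>2 \<partial>M) = (\<integral>\<^sup>+y. ennreal (K x y) * ennreal ((f y)\<^sup>2) \<partial>M)"
      by (simp add: ennreal_power K_nonneg power_mult_distrib ennreal_mult)
    also have "(\<integral>\<^sup>+y. ennreal (K x y) \<partial>M) * (\<integral>\<^sup>+y. ennreal (K x y) * ennreal ((f y)\<^sup>2) \<partial>M)
        \<le> 1 * (\<integral>\<^sup>+y. ennreal (K x y) * ennreal ((f y)\<^sup>2) \<partial>M)"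
      by (intro mult_right_mono K_mass x) simp
    finally show ?thesis by (simp add: ennreal_power)
  qed
  have "(\<integral>\<^sup>+x. ennreal ((kop f x)\<^sup>2) \<partial>M) \<le> (\<integral>\<^sup>+x. \<integral>\<^sup>+y. ennreal (K x y) * ennreal ((f y)\<^sup>2) \<partial>M \<partial>M)"
    by (intro nn_integral_mono le)
  also have "\<dots> = (\<integral>\<^sup>+y. \<integral>\<^sup>+x. ennreal (K x y) * ennreal ((f y)\<^sup>2) \<partial>M \<partial>M)"
    by (rule P.Fubini') measurable
  also have "\<dots> = (\<integral>\<^sup>+y. \<integral>\<^sup>+x. ennreal (K y x) * ennreal ((f y)\<^sup>2) \<partial>M \<partial>M)"
    by (subst K_sym) (rule refl)
  also have "\<dots> \<le> (\<integral>\<^sup>+x. ennreal ((f x)\<^sup>2) \<partial>M)" by (rule K_mass_weighted) measurable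
  finally have "(\<integral>\<^sup>+x. ennreal ((kop f x)\<^sup>2) \<partial>M) < \<infinity>" using L2_nn_finite[OF f] by (simp add: le_less_trans)
  then have "integrable M (\<lambda>x. (kop f x)\<^sup>2)" by (intro integrableI_nonneg) auto
  then show ?thesis by (simp add: Lp_2_iff)
qed

lemma inner_kop:
  assumes f: "f \<in> Lp 2 M" and g: "g \<in> Lp 2 M"
  shows "inner_L2 M (kop f) g = (\<integral>p. K (fst p) (snd p) * (g (fst p) * f (snd p)) \<partial>(M \<Otimes>\<^sub>M M))"
proof -
  have "(\<integral>p. K (fst p) (snd p) * (g (fst p) * f (snd p)) \<partial>(M \<Otimes>\<^sub>M M))
     = (\<integral>x. \<integral>y. K x y * (g x * f y) \<partial>M \<partial>M)"
    using P.integral_fst'[OF K_product[OF g f]] by simp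
  also have "\<dots> = (\<integral>x. kop f x * g x \<partial>M)"
  proof (rule Bochner_Integration.integral_cong[OF refl])
    fix x
    have "(\<lambda>y. K x y * (g x * f y)) = (\<lambda>y. g x * (K x y * f y))" by (simp add: fun_eq_iff)
    then show "(\<integral>y. K x y * (g x * f y) \<partial>M) = kop f x * g x" by (simp add: kop_def)
  qed
  finally show ?thesis by (simp add: inner_L2_def)
qed

lemma kop_symmetric:
  assumes f: "f \<in> Lp 2 M" and g: "g \<in> Lp 2 M"
  shows "inner_L2 M (kop f) g = inner_L2 M f (kop g)"
proof -
  have "inner_L2 M (kop f) g = (\<integral>p. K (fst p) (snd p) * (g (fst p) * f (snd p)) \<partial>(M \<Otimes>\<^sub>M M))"
    by (rule inner_kop[OF f g])
  also have "\<dots> = (\<integral>(x, y). K (fst (y, x)) (snd (y, x)) * (g (fst (y, x)) * f (snd (y, x))) \<partial>(M \<Otimes>\<^sub>M M))"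
    by (rule P.integral_product_swap[symmetric]) (rule borel_measurable_integrable[OF K_product[OF g f]])
  also have "\<dots> = (\<integral>p. K (fst p) (snd p) * (f (fst p) * g (snd p)) \<partial>(M \<Otimes>\<^sub>M M))"
    by (rule Bochner_Integration.integral_cong)
       (simp_all add: case_prod_beta' K_sym[of "snd _" "fst _"] mult.commute)
  also have "\<dots> = inner_L2 M (kop g) f" by (rule inner_kop[OF g f, symmetric])
  finally show ?thesis by (simp add: inner_L2_commute)
qed

text \<open>The Beurling--Deny decomposition into a killing part and a jump part. Both are integrals of
  squares against nonnegative weights, so they decrease under normal contractions.\<close>

lemma energy_kop:
  assumes u: "u \<in> Lp 2 M"
  shows "inner_L2 M u u - inner_L2 M (kop u) u
    = (\<integral>x. (1 - (\<integral>y. K x y \<partial>M)) * (u x)\<^sup>2 \<partial>M)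
      + (\<integral>p. K (fst p) (snd p) * (u (fst p) - u (snd p))\<^sup>2 \<partial>(M \<Otimes>\<^sub>M M)) / 2"
    and "integrable M (\<lambda>x. (1 - (\<integral>y. K x y \<partial>M)) * (u x)\<^sup>2)"
    and "integrable (M \<Otimes>\<^sub>M M) (\<lambda>p. K (fst p) (snd p) * (u (fst p) - u (snd p))\<^sup>2)"
proof -
  define A where "A = (\<integral>p. K (fst p) (snd p) * (u (fst p))\<^sup>2 \<partial>(M \<Otimes>\<^sub>M M))"
  define B where "B = (\<integral>p. K (fst p) (snd p) * (u (fst p) * u (snd p)) \<partial>(M \<Otimes>\<^sub>M M))"
  have A2: "(\<integral>p. K (fst p) (snd p) * (u (snd p))\<^sup>2 \<partial>(M \<Otimes>\<^sub>M M)) = A"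
    unfolding A_def using P.integral_product_swap[OF borel_measurable_integrable[OF K_square_fst[OF u]]]
    by (simp add: case_prod_beta' K_sym[of "snd _"])
  have expand: "(\<lambda>p. K (fst p) (snd p) * (u (fst p) - u (snd p))\<^sup>2)
    = (\<lambda>p. K (fst p) (snd p) * (u (fst p))\<^sup>2 + K (fst p) (snd p) * (u (snd p))\<^sup>2
          - 2 * (K (fst p) (snd p) * (u (fst p) * u (snd p))))"
    by (simp add: fun_eq_iff power2_eq_square algebra_simps)
  show int_jump: "integrable (M \<Otimes>\<^sub>M M) (\<lambda>p. K (fst p) (snd p) * (u (fst p) - u (snd p))\<^sup>2)"
    unfolding expand
    by (intro Bochner_Integration.integrable_diff Bochner_Integration.integrable_add
        integrable_mult_right K_square_fst K_square_snd K_product u)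
  have jump: "(\<integral>p. K (fst p) (snd p) * (u (fst p) - u (snd p))\<^sup>2 \<partial>(M \<Otimes>\<^sub>M M)) = 2 * A - 2 * B"
    unfolding expand
    using K_square_fst[OF u] K_square_snd[OF u] K_product[OF u u]
    by (simp add: A2 A_def[symmetric] B_def[symmetric])
  have u2: "integrable M (\<lambda>x. (u x)\<^sup>2)" using u by (simp add: Lp_2_iff)
  have intA: "integrable M (\<lambda>x. (\<integral>y. K x y \<partial>M) * (u x)\<^sup>2)"
    using P.integrable_fst'[OF K_square_fst[OF u]] by simp
  have A: "(\<integral>x. (\<integral>y. K x y \<partial>M) * (u x)\<^sup>2 \<partial>M) = A"
    unfolding A_def using P.integral_fst'[OF K_square_fst[OF u]] by simp
  show int_kill: "integrable M (\<lambda>x. (1 - (\<integral>y. K x y \<partial>M)) * (u x)\<^sup>2)"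
    using Bochner_Integration.integrable_diff[OF u2 intA] by (simp add: left_diff_distrib)
  have "(\<integral>x. (1 - (\<integral>y. K x y \<partial>M)) * (u x)\<^sup>2 \<partial>M) = (\<integral>x. (u x)\<^sup>2 \<partial>M) - A"
    using Bochner_Integration.integral_diff[OF u2 intA] by (simp add: left_diff_distrib A)
  then show "inner_L2 M u u - inner_L2 M (kop u) u
    = (\<integral>x. (1 - (\<integral>y. K x y \<partial>M)) * (u x)\<^sup>2 \<partial>M)
      + (\<integral>p. K (fst p) (snd p) * (u (fst p) - u (snd p))\<^sup>2 \<partial>(M \<Otimes>\<^sub>M M)) / 2"
    unfolding jump inner_kop[OF u u] B_def[symmetric] by (simp add: inner_L2_def power2_eq_square diff_divide_distrib)
qed

lemma energy_kop_contraction: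
  assumes u: "u \<in> Lp 2 M" and v: "v \<in> Lp 2 M"
    and abs_le: "\<And>x. \<bar>v x\<bar> \<le> \<bar>u x\<bar>" and diff_le: "\<And>x y. \<bar>v x - v y\<bar> \<le> \<bar>u x - u y\<bar>"
  shows "inner_L2 M v v - inner_L2 M (kop v) v \<le> inner_L2 M u u - inner_L2 M (kop u) u"
proof -
  have mass: "(\<integral>y. K x y \<partial>M) \<le> 1" if x: "x \<in> space M" for x
  proof -
    have [measurable]: "(\<lambda>y. K x y) \<in> borel_measurable M" using x by measurable
    have "(\<integral>y. K x y \<partial>M) = enn2real (\<integral>\<^sup>+y. ennreal (K x y) \<partial>M)"
      by (rule integral_eq_nn_integral) (auto simp: K_nonneg)
    also have "\<dots> \<le> enn2real 1" by (rule enn2real_mono[OF K_mass[OF x]]) simp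
    finally show ?thesis by simp
  qed
  have "(\<integral>x. (1 - (\<integral>y. K x y \<partial>M)) * (v x)\<^sup>2 \<partial>M) \<le> (\<integral>x. (1 - (\<integral>y. K x y \<partial>M)) * (u x)\<^sup>2 \<partial>M)"
    using mass abs_le
    by (intro integral_mono energy_kop(2) u v mult_left_mono) (auto intro!: abs_le_square_iff[THEN iffD1])
  moreover have "(\<integral>p. K (fst p) (snd p) * (v (fst p) - v (snd p))\<^sup>2 \<partial>(M \<Otimes>\<^sub>M M))
      \<le> (\<integral>p. K (fst p) (snd p) * (u (fst p) - u (snd p))\<^sup>2 \<partial>(M \<Otimes>\<^sub>M M))"
    using diff_le
    by (intro integral_mono energy_kop(3) u v mult_left_mono) (auto intro!: abs_le_square_iff[THEN iffD1] simp: K_nonneg)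
  ultimately show ?thesis by (simp add: energy_kop(1)[OF u] energy_kop(1)[OF v])
qed

end

section \<open>The heat kernel\<close>

text \<open>The Hille--Hardy formula with the modified Bessel function written as a power series; here
  \<open>q\<close> is \<open>exp (- t)\<close>. All terms are nonnegative, which makes the kernel positive and
  allows sums and integrals to be exchanged.\<close>

definition kernel_term :: "real \<Rightarrow> real \<Rightarrow> real \<Rightarrow> real \<Rightarrow> nat \<Rightarrow> real" where
  "kernel_term \<nu> q x y k = exp (- (q * (x + y) / (1 - q))) * (q * x * y) ^ k
     / (fact k * Gamma (1 + \<nu> + k) * (1 - q) ^ k * (1 - q) ^ k * (1 - q) powr (1 + \<nu>))"

definition heat_ker :: "real \<Rightarrow> real \<Rightarrow> real \<Rightarrow> real \<Rightarrow> real" where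
  "heat_ker \<nu> t x y = (if t > 0 \<and> x > 0 \<and> y > 0
     then exp (- \<nu> * t) * x powr \<nu> * y powr \<nu> * (\<Sum>k. kernel_term \<nu> (exp (- t)) x y k) else 0)"

lemma Gamma_ge_Gamma:
  assumes "\<nu> > 0" shows "Gamma (1 + \<nu>) \<le> Gamma (1 + \<nu> + real k)"
proof (induction k)
  case (Suc k)
  have pos: "1 + \<nu> + real k > 0" using assms by simp
  then have "1 + \<nu> + real k \<notin> \<int>\<^sub>\<le>\<^sub>0" using nonpos_Ints_nonpos[of "1 + \<nu> + real k"] by auto
  have "Gamma (1 + \<nu> + real (Suc k)) = (1 + \<nu> + real k) * Gamma (1 + \<nu> + real k)"
    using Gamma_plus1[OF \<open>1 + \<nu> + real k \<notin> _\<close>] by (simp add: algebra_simps)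
  moreover have "1 * Gamma (1 + \<nu> + real k) \<le> (1 + \<nu> + real k) * Gamma (1 + \<nu> + real k)"
    using assms pos by (intro mult_right_mono) (auto intro: less_imp_le Gamma_real_pos)
  ultimately show ?case using Suc by simp
qed simp

lemma kernel_term_nonneg:
  assumes "\<nu> > 0" "0 < q" "q < 1" "0 \<le> x" "0 \<le> y"
  shows "0 \<le> kernel_term \<nu> q x y k"
  unfolding kernel_term_def using assms Gamma_real_nonneg[of "1 + \<nu> + real k"]
  by (intro divide_nonneg_nonneg mult_nonneg_nonneg zero_le_power) auto

lemma kernel_term_summable:
  assumes "\<nu> > 0" "0 < q" "q < 1" "0 \<le> x" "0 \<le> y"
  shows "summable (kernel_term \<nu> q x y)"
proof (rule summable_comparison_test')
  define z where "z = q * x * y / (1 - q) / (1 - q)"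
  define c where "c = exp (- (q * (x + y) / (1 - q))) / (Gamma (1 + \<nu>) * (1 - q) powr (1 + \<nu>))"
  have z: "z \<ge> 0" using assms by (simp add: z_def)
  show "summable (\<lambda>k. c * (z ^ k /\<^sub>R fact k))" by (intro summable_mult summable_exp_generic)
  fix k :: nat
  have G: "Gamma (1 + \<nu>) > 0" using assms by (intro Gamma_real_pos) simp
  have Gk: "Gamma (1 + \<nu> + real k) > 0" using assms by (intro Gamma_real_pos) simp
  have "kernel_term \<nu> q x y k = (Gamma (1 + \<nu>) / Gamma (1 + \<nu> + real k)) * (c * (z ^ k /\<^sub>R fact k))"
  proof -
    define p where "p = 1 - q"
    have "p > 0" using assms by (simp add: p_def)
    then show ?thesis using G Gk
      unfolding kernel_term_def c_def z_def p_def[symmetric] by (simp add: power_divide divide_simps)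
  qed
  also have "\<dots> \<le> 1 * (c * (z ^ k /\<^sub>R fact k))"
    using Gamma_ge_Gamma[OF assms(1), of k] G Gk assms z
    by (intro mult_right_mono) (auto simp: c_def)
  finally show "norm (kernel_term \<nu> q x y k) \<le> c * (z ^ k /\<^sub>R fact k)"
    using kernel_term_nonneg[OF assms] by simp
qed

lemma heat_ker_nonneg:
  assumes "\<nu> > 0" shows "0 \<le> heat_ker \<nu> t x y"
  unfolding heat_ker_def using assms
  by (auto intro!: mult_nonneg_nonneg suminf_nonneg kernel_term_summable kernel_term_nonneg)

lemma heat_ker_sym: "heat_ker \<nu> t x y = heat_ker \<nu> t y x"
  unfolding heat_ker_def kernel_term_def by (simp add: mult_ac add.commute)

lemma heat_ker_measurable [measurable]:
  assumes [measurable]: "T \<in> borel_measurable N" "X \<in> borel_measurable N" "Y \<in> borel_measurable N"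
  shows "(\<lambda>p. heat_ker \<nu> (T p) (X p) (Y p)) \<in> borel_measurable N"
  unfolding heat_ker_def kernel_term_def by measurable

text \<open>The factor that remains of a term of the series when the Gamma density in the second variable, the
  measure included, is split off.\<close>

definition ker_weight :: "real \<Rightarrow> real \<Rightarrow> real \<Rightarrow> nat \<Rightarrow> real" where
  "ker_weight \<nu> t x k = (let q = exp (- t) in exp (- \<nu> * t) * x powr \<nu> * exp (- (q * x / (1 - q))) * (q * x) ^ k
     / (fact k * Gamma (1 + \<nu> + k) * (1 - q) ^ k * (1 - q) ^ k * (1 - q) powr (1 + \<nu>)))"

lemma ker_weight_nonneg:
  assumes "\<nu> > 0" "t > 0" "x > 0"
  shows "0 \<le> ker_weight \<nu> t x k"
  unfolding ker_weight_def Let_def using assms Gamma_real_nonneg[of "1 + \<nu> + real k"]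
  by (intro divide_nonneg_nonneg mult_nonneg_nonneg zero_le_power) auto

lemma nn_integral_heat_ker:
  assumes \<nu>: "\<nu> > 0" and t: "t > 0" and x: "x > 0"
    and f [measurable]: "f \<in> borel_measurable borel" and f0: "\<And>y. y > 0 \<Longrightarrow> 0 \<le> f y"
  shows "(\<integral>\<^sup>+y. ennreal (heat_ker \<nu> t x y * f y) \<partial>speed_measure \<nu>)
     = (\<Sum>k. ennreal (ker_weight \<nu> t x k) *
         (\<integral>\<^sup>+y. ennreal (gamma_density (real k + 1) (1 / (1 - exp (- t))) y * f y) \<partial>lborel))"
proof -
  define q where "q = exp (- t)"
  have q: "0 < q" "q < 1" using t by (auto simp: q_def)
  have "(\<integral>\<^sup>+y. ennreal (heat_ker \<nu> t x y * f y) \<partial>speed_measure \<nu>)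
     = (\<integral>\<^sup>+y. ennreal (speed_density \<nu> y) * ennreal (heat_ker \<nu> t x y * f y) \<partial>lborel)"
    by (rule nn_integral_speed) measurable
  also have "\<dots> = (\<integral>\<^sup>+y. (\<Sum>k. ennreal (ker_weight \<nu> t x k) * ennreal (gamma_density (real k + 1) (1 / (1 - q)) y * f y)) \<partial>lborel)"
  proof (rule nn_integral_cong)
    fix y :: real
    show "ennreal (speed_density \<nu> y) * ennreal (heat_ker \<nu> t x y * f y)
        = (\<Sum>k. ennreal (ker_weight \<nu> t x k) * ennreal (gamma_density (real k + 1) (1 / (1 - q)) y * f y))"
    proof (cases "y > 0")
      case False
      then show ?thesis by (simp add: speed_density_nonpos gamma_density_def)
    next
      case y: True
      have e: "exp (- (q * (x + y) / (1 - q))) * exp (- y) = exp (- (q * x / (1 - q))) * exp (- (1 / (1 - q) * y))"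
      proof -
        have "q * (x + y) / (1 - q) + y = q * x / (1 - q) + 1 / (1 - q) * y"
          using q by (simp add: divide_simps) (simp add: algebra_simps)
        then show ?thesis by (simp add: exp_add[symmetric])
      qed
      have term_eq: "speed_density \<nu> y * (exp (- \<nu> * t) * x powr \<nu> * y powr \<nu> * kernel_term \<nu> q x y k * f y)
         = ker_weight \<nu> t x k * (gamma_density (real k + 1) (1 / (1 - q)) y * f y)" for k
      proof -
        have "y powr (- \<nu>) * y powr \<nu> = 1" using y by (simp add: powr_add[symmetric])
        moreover have "y powr real k = y ^ k" using y by (simp add: powr_realpow)
        ultimately have "speed_density \<nu> y * (exp (- \<nu> * t) * x powr \<nu> * y powr \<nu> * kernel_term \<nu> q x y k * f y)
          = exp (- \<nu> * t) * x powr \<nu> * (exp (- (q * (x + y) / (1 - q))) * exp (- y)) * (q * x * y) ^ k * f y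
             / (fact k * Gamma (1 + \<nu> + k) * (1 - q) ^ k * (1 - q) ^ k * (1 - q) powr (1 + \<nu>))"
          using y by (simp add: speed_density_pos kernel_term_def mult_ac)
        also have "\<dots> = ker_weight \<nu> t x k * (gamma_density (real k + 1) (1 / (1 - q)) y * f y)"
          unfolding e using y \<open>y powr real k = y ^ k\<close>
          by (simp add: ker_weight_def Let_def q_def[symmetric] gamma_density_def power_mult_distrib mult_ac)
        finally show ?thesis .
      qed
      have summ: "summable (\<lambda>k. ker_weight \<nu> t x k * (gamma_density (real k + 1) (1 / (1 - q)) y * f y))"
        unfolding term_eq[symmetric]
        by (intro summable_mult summable_mult2 kernel_term_summable) (use \<nu> q x y in auto)
      have "speed_density \<nu> y * (heat_ker \<nu> t x y * f y)
         = (\<Sum>k. ker_weight \<nu> t x k * (gamma_density (real k + 1) (1 / (1 - q)) y * f y))"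
      proof -
        have s: "summable (kernel_term \<nu> q x y)" by (rule kernel_term_summable) (use \<nu> q x y in auto)
        have "(\<Sum>k. speed_density \<nu> y * (exp (- \<nu> * t) * x powr \<nu> * y powr \<nu> * kernel_term \<nu> q x y k * f y))
          = (\<Sum>k. (speed_density \<nu> y * f y * exp (- \<nu> * t) * x powr \<nu> * y powr \<nu>) * kernel_term \<nu> q x y k)"
          by (simp add: mult_ac)
        also have "\<dots> = (speed_density \<nu> y * f y * exp (- \<nu> * t) * x powr \<nu> * y powr \<nu>) * (\<Sum>k. kernel_term \<nu> q x y k)"
          by (rule suminf_mult[OF s])
        finally show ?thesis unfolding term_eq using t x y
          by (simp add: heat_ker_def q_def[symmetric] mult_ac)
      qed
      then have "ennreal (speed_density \<nu> y) * ennreal (heat_ker \<nu> t x y * f y)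
         = ennreal (\<Sum>k. ker_weight \<nu> t x k * (gamma_density (real k + 1) (1 / (1 - q)) y * f y))"
        by (simp add: ennreal_mult[symmetric] speed_density_nonneg heat_ker_nonneg[OF \<nu>] f0[OF y])
      also have "\<dots> = (\<Sum>k. ennreal (ker_weight \<nu> t x k * (gamma_density (real k + 1) (1 / (1 - q)) y * f y)))"
        by (rule suminf_ennreal2[symmetric, OF _ summ])
           (auto intro!: mult_nonneg_nonneg ker_weight_nonneg gamma_density_nonneg f0[OF y] \<nu> t x)
      finally show ?thesis
        by (simp add: ennreal_mult ker_weight_nonneg[OF \<nu> t x] gamma_density_nonneg f0[OF y])
    qed
  qed
  also have "\<dots> = (\<Sum>k. \<integral>\<^sup>+y. ennreal (ker_weight \<nu> t x k) * ennreal (gamma_density (real k + 1) (1 / (1 - q)) y * f y) \<partial>lborel)"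
    by (rule nn_integral_suminf) measurable
  also have "\<dots> = (\<Sum>k. ennreal (ker_weight \<nu> t x k) * (\<integral>\<^sup>+y. ennreal (gamma_density (real k + 1) (1 / (1 - q)) y * f y) \<partial>lborel))"
    by (intro suminf_cong nn_integral_cmult) measurable
  finally show ?thesis by (simp add: q_def)
qed

lemma gamma_density_mono_exp_mult:
  "gamma_density (real k + 1) b y * mono_exp \<nu> m s y = gamma_density (1 + \<nu> + k + m) (b + s) y"
proof (cases "y > 0")
  case True
  have "y powr (\<nu> + real k + real m) = y powr real k * y powr \<nu> * y ^ m"
    using True by (simp add: powr_add powr_realpow)
  moreover have "exp (- ((b + s) * y)) = exp (- (b * y)) * exp (- (s * y))"
    by (simp add: exp_add[symmetric] distrib_right)
  ultimately show ?thesis using True by (simp add: gamma_density_def mono_exp_def add_ac)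
qed (simp add: gamma_density_def)

lemma mono_exp_nonneg: "y > 0 \<Longrightarrow> 0 \<le> mono_exp \<nu> k s y"
  by (simp add: mono_exp_def)

lemma Gamma_Suc_shift:
  assumes "z > 0" shows "Gamma (z + 1) = z * Gamma (z :: real)"
  using assms nonpos_Ints_nonpos[of z] by (intro Gamma_plus1) auto

context
  fixes \<nu> t x s q p B \<theta> :: real
  assumes \<nu>: "\<nu> > 0" and t: "t > 0" and x: "x > 0" and s: "s \<ge> 0"
    and q: "q = exp (- t)" and p: "p = 1 - q" and B: "B = 1 + s * p" and \<theta>: "\<theta> = q * x / p"
begin

lemma qpB: "0 < q" "q < 1" "0 < p" "1 \<le> B" "0 < \<theta>"
proof -
  show "0 < q" "q < 1" using t by (auto simp: q)
  then show "0 < p" by (simp add: p)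
  then show "1 \<le> B" "0 < \<theta>" using s x \<open>0 < q\<close> by (auto simp: B \<theta>)
qed

lemma weight_gamma_integral:
  "ker_weight \<nu> t x k * (Gamma (1 + \<nu> + k + m) / (1 / p + s) powr (1 + \<nu> + k + m))
   = exp (- \<nu> * t) * x powr \<nu> * exp (- \<theta>) * B powr (- (1 + \<nu>)) * (p / B) ^ m
      * (Gamma (1 + \<nu> + k + m) / Gamma (1 + \<nu> + k)) * ((\<theta> / B) ^ k / fact k)"
proof -
  have G: "Gamma (1 + \<nu> + real k) > 0" using \<nu> by (intro Gamma_real_pos) simp
  have "1 / p + s = B / p" using qpB by (simp add: B field_simps)
  then have e1: "(1 / p + s) powr (1 + \<nu> + k + m) = B powr (1 + \<nu>) / p powr (1 + \<nu>) * (B / p) ^ k * (B / p) ^ m"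
    using qpB by (simp add: powr_add powr_realpow powr_divide power_divide)
  have e2: "B powr (- (1 + \<nu>)) = 1 / B powr (1 + \<nu>)" by (rule powr_minus_divide)
  have e3: "(\<theta> / B) ^ k = (q * x) ^ k / (p ^ k * B ^ k)" by (simp add: \<theta> power_divide power_mult_distrib)
  show ?thesis
    unfolding ker_weight_def Let_def q[symmetric] p[symmetric] e1 e2 e3
    using qpB G by (simp add: \<theta> power_divide field_simps)
qed

lemma heat_ker_mono_exp_sums:
  assumes sums: "(\<lambda>k. (Gamma (1 + \<nu> + real k + real m) / Gamma (1 + \<nu> + real k)) * ((\<theta> / B) ^ k / fact k)) sums S"
  shows "has_bochner_integral (speed_measure \<nu>) (\<lambda>y. heat_ker \<nu> t x y * mono_exp \<nu> m s y)
    (exp (- \<nu> * t) * x powr \<nu> * exp (- \<theta>) * B powr (- (1 + \<nu>)) * (p / B) ^ m * S)"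
proof (rule has_bochner_integral_nn_integral)
  define c where "c = exp (- \<nu> * t) * x powr \<nu> * exp (- \<theta>) * B powr (- (1 + \<nu>)) * (p / B) ^ m"
  define a where "a k = (Gamma (1 + \<nu> + real k + real m) / Gamma (1 + \<nu> + real k)) * ((\<theta> / B) ^ k / fact k)" for k
  have c: "c \<ge> 0" using qpB by (simp add: c_def)
  have a: "a k \<ge> 0" for k using \<nu> qpB
    unfolding a_def by (intro mult_nonneg_nonneg divide_nonneg_nonneg zero_le_power Gamma_real_nonneg) auto
  have sums': "(\<lambda>k. c * a k) sums (c * S)" using sums_mult[OF sums, of c] by (simp add: a_def)
  show "(\<lambda>y. heat_ker \<nu> t x y * mono_exp \<nu> m s y) \<in> borel_measurable (speed_measure \<nu>)"
    by (rule speed_measurable_borel) measurable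
  show "AE y in speed_measure \<nu>. 0 \<le> heat_ker \<nu> t x y * mono_exp \<nu> m s y"
    unfolding AE_speed_iff using heat_ker_nonneg[OF \<nu>] mono_exp_nonneg by (intro AE_I2) auto
  have S: "S \<ge> 0" using sums a by (intro sums_le[OF _ sums_zero sums]) (auto simp: a_def)
  then show "0 \<le> exp (- \<nu> * t) * x powr \<nu> * exp (- \<theta>) * B powr (- (1 + \<nu>)) * (p / B) ^ m * S"
    using c unfolding c_def[symmetric] by simp
  have "(\<integral>\<^sup>+y. ennreal (heat_ker \<nu> t x y * mono_exp \<nu> m s y) \<partial>speed_measure \<nu>)
    = (\<Sum>k. ennreal (ker_weight \<nu> t x k) * (\<integral>\<^sup>+y. ennreal (gamma_density (real k + 1) (1 / (1 - exp (- t))) y * mono_exp \<nu> m s y) \<partial>lborel))"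
    by (rule nn_integral_heat_ker[OF \<nu> t x]) (auto intro: mono_exp_nonneg)
  also have "\<dots> = (\<Sum>k. ennreal (c * a k))"
  proof (rule suminf_cong)
    fix k
    have b: "1 / p + s > 0" using qpB s by (simp add: add_pos_nonneg)
    have G: "Gamma (1 + \<nu> + real k + real m) > 0" using \<nu> by (intro Gamma_real_pos) simp
    have "(\<integral>\<^sup>+y. ennreal (gamma_density (real k + 1) (1 / (1 - exp (- t))) y * mono_exp \<nu> m s y) \<partial>lborel)
       = ennreal (Gamma (1 + \<nu> + k + m) / (1 / p + s) powr (1 + \<nu> + k + m))"
      unfolding q[symmetric] p[symmetric] gamma_density_mono_exp_mult
      by (rule nn_integral_gamma_density) (use \<nu> b in auto)
    then have "ennreal (ker_weight \<nu> t x k) * (\<integral>\<^sup>+y. ennreal (gamma_density (real k + 1) (1 / (1 - exp (- t))) y * mono_exp \<nu> m s y) \<partial>lborel)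
       = ennreal (ker_weight \<nu> t x k * (Gamma (1 + \<nu> + k + m) / (1 / p + s) powr (1 + \<nu> + k + m)))"
      using ker_weight_nonneg[OF \<nu> t x, of k] by (simp only: ennreal_mult')
    also have "\<dots> = ennreal (c * a k)" unfolding weight_gamma_integral by (simp add: c_def a_def mult.assoc)
    finally show "ennreal (ker_weight \<nu> t x k) * (\<integral>\<^sup>+y. ennreal (gamma_density (real k + 1) (1 / (1 - exp (- t))) y * mono_exp \<nu> m s y) \<partial>lborel)
       = ennreal (c * a k)" .
  qed
  also have "\<dots> = ennreal (c * S)"
    using sums' a c by (subst suminf_ennreal2) (auto simp: sums_iff)
  finally show "(\<integral>\<^sup>+y. ennreal (heat_ker \<nu> t x y * mono_exp \<nu> m s y) \<partial>speed_measure \<nu>)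
    = ennreal (exp (- \<nu> * t) * x powr \<nu> * exp (- \<theta>) * B powr (- (1 + \<nu>)) * (p / B) ^ m * S)"
    by (simp add: c_def)
qed

lemma exp_shift: "exp (- \<theta>) * exp (\<theta> / B) = exp (- (s * q / B * x))"
proof -
  have "\<theta> / B - \<theta> = - (\<theta> * (s * p) / B)" using qpB by (simp add: B field_simps)
  also have "\<theta> * (s * p) / B = s * q / B * x" using qpB by (simp add: \<theta>)
  finally show ?thesis by (simp add: exp_add[symmetric])
qed

lemma mono_exp_shift: "mono_exp \<nu> 0 (s * q / B) x = x powr \<nu> * (exp (- \<theta>) * exp (\<theta> / B))"
  unfolding exp_shift by (simp add: mono_exp_def)

text \<open>Integration against an exponential replaces the Gamma densities by powers of \<open>\<theta> / B\<close>, and the series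
  becomes an exponential series.\<close>

lemma heat_ker_exp:
  "has_bochner_integral (speed_measure \<nu>) (\<lambda>y. heat_ker \<nu> t x y * mono_exp \<nu> 0 s y)
    (exp (- \<nu> * t) * B powr (- (1 + \<nu>)) * mono_exp \<nu> 0 (s * q / B) x)"
proof -
  have G: "Gamma (1 + \<nu> + real k) > 0" for k using \<nu> by (intro Gamma_real_pos) simp
  have "(\<lambda>k. (Gamma (1 + \<nu> + real k + real 0) / Gamma (1 + \<nu> + real k)) * ((\<theta> / B) ^ k / fact k)) sums exp (\<theta> / B)"
    using exp_converges[of "\<theta> / B"] G by (simp add: less_imp_neq[symmetric] divide_inverse mult.commute)
  from heat_ker_mono_exp_sums[OF this]
  show ?thesis unfolding mono_exp_shift by (simp add: mult_ac)
qed

lemma sums_affine_exp: "(\<lambda>k. (a + real k) * (z ^ k / fact k)) sums ((a + z) * exp z)" for a z :: real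
proof -
  have e: "(\<lambda>k. z ^ k / fact k) sums exp z"
    using exp_converges[of z] by (simp add: divide_inverse mult.commute)
  have "(\<lambda>k. real (Suc k) * (z ^ Suc k / fact (Suc k))) sums (z * exp z)"
  proof -
    have "real (Suc k) * (z ^ Suc k / fact (Suc k)) = z * (z ^ k / fact k)" for k
      by (simp add: fact_Suc del: of_nat_Suc)
    then show ?thesis using sums_mult[OF e, of z] by simp
  qed
  then have "(\<lambda>k. real k * (z ^ k / fact k)) sums (z * exp z)"
    by (subst (asm) sums_Suc_iff) simp
  from sums_add[OF sums_mult[OF e, of a] this] show ?thesis by (simp only: distrib_right)
qed

lemma heat_ker_mono_exp_1:
  "has_bochner_integral (speed_measure \<nu>) (\<lambda>y. heat_ker \<nu> t x y * mono_exp \<nu> 1 s y)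
    (exp (- \<nu> * t) * B powr (- (1 + \<nu>)) * ((1 + \<nu>) * p / B + q * x / B\<^sup>2) * mono_exp \<nu> 0 (s * q / B) x)"
proof -
  have G: "Gamma (1 + \<nu> + real k + real 1) / Gamma (1 + \<nu> + real k) = 1 + \<nu> + real k" for k
  proof -
    have "Gamma (1 + \<nu> + real k) > 0" using \<nu> by (intro Gamma_real_pos) simp
    moreover have "Gamma (1 + \<nu> + real k + 1) = (1 + \<nu> + real k) * Gamma (1 + \<nu> + real k)"
      using \<nu> by (intro Gamma_Suc_shift) simp
    ultimately show ?thesis by simp
  qed
  have "(\<lambda>k. (Gamma (1 + \<nu> + real k + real 1) / Gamma (1 + \<nu> + real k)) * ((\<theta> / B) ^ k / fact k))
      sums ((1 + \<nu> + \<theta> / B) * exp (\<theta> / B))"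
    unfolding G by (rule sums_affine_exp)
  from heat_ker_mono_exp_sums[OF this]
  have "has_bochner_integral (speed_measure \<nu>) (\<lambda>y. heat_ker \<nu> t x y * mono_exp \<nu> 1 s y)
    (exp (- \<nu> * t) * x powr \<nu> * exp (- \<theta>) * B powr (- (1 + \<nu>)) * (p / B) ^ 1 * ((1 + \<nu> + \<theta> / B) * exp (\<theta> / B)))" .
  moreover have "exp (- \<nu> * t) * x powr \<nu> * exp (- \<theta>) * B powr (- (1 + \<nu>)) * (p / B) ^ 1 * ((1 + \<nu> + \<theta> / B) * exp (\<theta> / B))
    = exp (- \<nu> * t) * B powr (- (1 + \<nu>)) * ((1 + \<nu>) * p / B + q * x / B\<^sup>2) * mono_exp \<nu> 0 (s * q / B) x"
  proof -
    have "(p / B) * (1 + \<nu> + \<theta> / B) = (1 + \<nu>) * p / B + q * x / B\<^sup>2"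
      using qpB by (simp add: \<theta> field_simps power2_eq_square)
    moreover have "exp (- \<nu> * t) * x powr \<nu> * exp (- \<theta>) * B powr (- (1 + \<nu>)) * (p / B) ^ 1 * ((1 + \<nu> + \<theta> / B) * exp (\<theta> / B))
      = exp (- \<nu> * t) * B powr (- (1 + \<nu>)) * ((p / B) * (1 + \<nu> + \<theta> / B)) * (x powr \<nu> * (exp (- \<theta>) * exp (\<theta> / B)))"
      by (simp only: mult_ac power_one_right)
    ultimately show ?thesis unfolding mono_exp_shift by (simp only:)
  qed
  ultimately show ?thesis by simp
qed

end

subsection \<open>Sub-Markovian mass\<close>

text \<open>Integration by parts: the terms of the sum are \<open>D j - D (j + 1)\<close> integrated up to \<open>x\<close>, where
  \<open>D j\<close> is the normalised Gamma density of shape \<open>\<nu> + j\<close>. The sum telescopes, and what remains is at most the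
  total mass of \<open>D 0\<close>.\<close>

lemma incomplete_gamma_partial_sum_le_1:
  assumes \<nu>: "\<nu> > 0" and x: "x > 0"
  shows "(\<Sum>j<N. exp (- x) * x powr (\<nu> + real j) / Gamma (1 + \<nu> + real j)) \<le> 1"
proof -
  define F where "F x = (\<Sum>j<N. exp (- x) * x powr (\<nu> + real j) / Gamma (1 + \<nu> + real j))" for x
  define D where "D j x = exp (- x) * x powr (\<nu> + real j - 1) / Gamma (\<nu> + real j)" for j x
  have G: "Gamma (\<nu> + real j) > 0" for j using \<nu> by (intro Gamma_real_pos) simp
  have G1: "Gamma (1 + \<nu> + real j) = (\<nu> + real j) * Gamma (\<nu> + real j)" for j
    using Gamma_Suc_shift[of "\<nu> + real j"] \<nu> by (simp add: add_ac)
  have deriv: "(F has_real_derivative (D 0 x - D N x)) (at x)" if "x > 0" for x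
  proof -
    have "((\<lambda>x. exp (- x) * x powr (\<nu> + real j) / Gamma (1 + \<nu> + real j)) has_real_derivative
        (D j x - D (Suc j) x)) (at x)" for j
    proof -
      have nz: "\<nu> + real j \<noteq> 0" using \<nu> by simp
      have Dj: "D j x = exp (- x) * ((\<nu> + real j) * x powr (\<nu> + real j - 1)) / Gamma (1 + \<nu> + real j)"
        unfolding D_def G1 using nz G[of j] by simp
      have DS: "D (Suc j) x = exp (- x) * x powr (\<nu> + real j) / Gamma (1 + \<nu> + real j)"
        unfolding D_def by (simp add: add_ac)
      have "((\<lambda>x. exp (- x) * x powr (\<nu> + real j) / Gamma (1 + \<nu> + real j)) has_real_derivative
        ((- exp (- x)) * x powr (\<nu> + real j) + ((\<nu> + real j) * x powr (\<nu> + real j - 1)) * exp (- x)) / Gamma (1 + \<nu> + real j)) (at x)"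
        by (intro DERIV_cdivide DERIV_mult has_real_derivative_powr that)
           (auto intro!: derivative_eq_intros)
      then show ?thesis unfolding Dj DS by (simp add: diff_divide_distrib add_divide_distrib mult.commute)
    qed
    then have "(F has_real_derivative (\<Sum>j<N. D j x - D (Suc j) x)) (at x)"
      unfolding F_def by (intro DERIV_sum) auto
    then show ?thesis using sum_lessThan_telescope'[of "\<lambda>j. D j x" N] by simp
  qed
  have step: "F x \<le> 1 + F \<epsilon>" if \<epsilon>: "0 < \<epsilon>" "\<epsilon> < x" for \<epsilon>
  proof -
    have cont: "isCont (\<lambda>x. D 0 x - D N x) y" if "y > 0" for y
      unfolding D_def using that G[of 0] G[of N] by (auto intro!: continuous_intros)
    have FTC: "(\<integral>y. (D 0 y - D N y) * indicator {\<epsilon>..x} y \<partial>lborel) = F x - F \<epsilon>"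
      by (rule integral_FTC_Icc_real) (use \<epsilon> deriv cont in auto)
    have intg: "integrable lborel (\<lambda>y. (D 0 y - D N y) * indicator {\<epsilon>..x} y)"
    proof -
      have "set_integrable lborel {\<epsilon>..x} (\<lambda>y. D 0 y - D N y)"
        by (rule borel_integrable_atLeastAtMost') (use \<epsilon> cont in \<open>auto intro!: continuous_at_imp_continuous_on\<close>)
      then show ?thesis by (simp add: set_integrable_def mult.commute)
    qed
    have "F x - F \<epsilon> \<le> (\<integral>y. gamma_density \<nu> 1 y / Gamma \<nu> \<partial>lborel)"
      unfolding FTC[symmetric]
    proof (rule integral_mono[OF intg])
      show "integrable lborel (\<lambda>y. gamma_density \<nu> 1 y / Gamma \<nu>)"
        using integrable_gamma_density[OF \<nu>, of 1] by simp
      fix y :: real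
      show "(D 0 y - D N y) * indicator {\<epsilon>..x} y \<le> gamma_density \<nu> 1 y / Gamma \<nu>"
      proof (cases "y \<in> {\<epsilon>..x}")
        case True
        have "0 \<le> D N y" unfolding D_def using G[of N] by simp
        moreover have "D 0 y = gamma_density \<nu> 1 y / Gamma \<nu>"
          using True \<epsilon> by (simp add: D_def gamma_density_def mult.commute)
        ultimately show ?thesis using True by simp
      qed (use G[of 0] gamma_density_nonneg[of \<nu> 1 y] in simp)
    qed
    also have "\<dots> = 1" using G[of 0] by (simp add: integral_gamma_density[OF \<nu>])
    finally show ?thesis by simp
  qed
  have "(F \<longlongrightarrow> 0) (at_right 0)"
  proof -
    have "((\<lambda>x. \<Sum>j<N. exp (- x) * x powr (\<nu> + real j) / Gamma (1 + \<nu> + real j))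
      \<longlongrightarrow> (\<Sum>j<N. exp (- 0) * 0 / Gamma (1 + \<nu> + real j))) (at_right 0)"
    proof (intro tendsto_intros)
      fix j
      show "((\<lambda>x. x powr (\<nu> + real j)) \<longlongrightarrow> 0) (at_right 0)"
        by (rule tendsto_zero_powrI[OF tendsto_ident_at tendsto_const])
           (use \<nu> in \<open>auto simp: eventually_at_filter\<close>)
      show "Gamma (1 + \<nu> + real j) \<noteq> 0"
        by (rule less_imp_neq[THEN not_sym], rule Gamma_real_pos) (use \<nu> in simp)
    qed
    then show ?thesis by (simp add: F_def[abs_def])
  qed
  from tendsto_add[OF tendsto_const[of 1] this]
  have "((\<lambda>\<epsilon>. 1 + F \<epsilon>) \<longlongrightarrow> 1) (at_right 0)" by simp
  moreover have "\<forall>\<^sub>F \<epsilon> in at_right 0. F x \<le> 1 + F \<epsilon>"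
    using eventually_at_right_real[OF x] by eventually_elim (auto intro: step)
  ultimately have "F x \<le> 1" by (intro tendsto_lowerbound) auto
  then show ?thesis by (simp add: F_def)
qed

text \<open>The mass is the probability that a Gamma variable of shape \<open>\<nu>\<close> is at most \<open>\<theta>\<close>, which is the
  probability that the diffusion started at \<open>x\<close> has not yet reached the origin.\<close>

lemma heat_ker_mass:
  assumes \<nu>: "\<nu> > 0" and t: "t > 0" and x: "x > 0"
  shows "(\<integral>\<^sup>+y. ennreal (heat_ker \<nu> t x y) \<partial>speed_measure \<nu>) \<le> 1"
proof -
  define q where "q = exp (- t)"
  define p where "p = 1 - q"
  define \<theta> where "\<theta> = q * x / p"
  have q: "0 < q" "q < 1" using t by (auto simp: q_def)
  have p: "0 < p" using q by (simp add: p_def)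
  have \<theta>: "0 < \<theta>" using q p x by (simp add: \<theta>_def)
  define a where "a k = exp (- \<theta>) * \<theta> powr (\<nu> + real k) / Gamma (1 + \<nu> + real k)" for k
  have a: "a k \<ge> 0" for k
    unfolding a_def using Gamma_real_pos[of "1 + \<nu> + real k"] \<nu> by simp
  have "(\<integral>\<^sup>+y. ennreal (heat_ker \<nu> t x y) \<partial>speed_measure \<nu>)
    = (\<integral>\<^sup>+y. ennreal (heat_ker \<nu> t x y * 1) \<partial>speed_measure \<nu>)" by simp
  also have "\<dots> = (\<Sum>k. ennreal (ker_weight \<nu> t x k) *
         (\<integral>\<^sup>+y. ennreal (gamma_density (real k + 1) (1 / (1 - exp (- t))) y * 1) \<partial>lborel))"
    by (rule nn_integral_heat_ker[OF \<nu> t x]) auto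
  also have "\<dots> = (\<Sum>k. ennreal (a k))"
  proof (rule suminf_cong)
    fix k
    have G: "Gamma (1 + \<nu> + real k) > 0" using \<nu> by (intro Gamma_real_pos) simp
    have "(\<integral>\<^sup>+y. ennreal (gamma_density (real k + 1) (1 / (1 - exp (- t))) y * 1) \<partial>lborel)
      = ennreal (Gamma (real k + 1) / (1 / p) powr (real k + 1))"
      unfolding q_def[symmetric] p_def[symmetric] mult_1_right
      by (rule nn_integral_gamma_density) (use p in auto)
    also have "Gamma (real k + 1) / (1 / p) powr (real k + 1) = fact k * p ^ k * p"
      using p by (simp add: Gamma_fact[of k, symmetric] add.commute powr_add powr_realpow powr_divide field_simps)
    finally have I: "(\<integral>\<^sup>+y. ennreal (gamma_density (real k + 1) (1 / (1 - exp (- t))) y * 1) \<partial>lborel)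
      = ennreal (fact k * p ^ k * p)" .
    have "ker_weight \<nu> t x k * (fact k * p ^ k * p) = a k"
    proof -
      have x_eq: "exp (- \<nu> * t) * x powr \<nu> = \<theta> powr \<nu> * p powr \<nu>"
      proof -
        have "\<theta> powr \<nu> * p powr \<nu> = (q * x) powr \<nu>"
          using q p x by (simp add: \<theta>_def powr_mult[symmetric])
        also have "\<dots> = q powr \<nu> * x powr \<nu>" using q x by (simp add: powr_mult)
        also have "q powr \<nu> = exp (- \<nu> * t)" by (simp add: q_def powr_def)
        finally show ?thesis by simp
      qed
      have e1: "\<theta> powr (\<nu> + real k) = \<theta> powr \<nu> * ((q * x) ^ k / p ^ k)"
        using \<theta> by (simp add: powr_add powr_realpow) (simp add: \<theta>_def power_divide)
      have e2: "p powr (1 + \<nu>) = p * p powr \<nu>" using p by (simp add: powr_add)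
      have pn: "p powr \<nu> > 0" using p by simp
      show ?thesis
        unfolding ker_weight_def Let_def q_def[symmetric] p_def[symmetric] x_eq a_def e1 e2 \<theta>_def[symmetric]
        using p pn G by (simp add: divide_simps)
    qed
    then show "ennreal (ker_weight \<nu> t x k) *
         (\<integral>\<^sup>+y. ennreal (gamma_density (real k + 1) (1 / (1 - exp (- t))) y * 1) \<partial>lborel) = ennreal (a k)"
      unfolding I using ker_weight_nonneg[OF \<nu> t x, of k] by (simp add: ennreal_mult'[symmetric])
  qed
  also have "\<dots> \<le> 1"
  proof (rule suminf_le_const)
    show "(\<Sum>k<n. ennreal (a k)) \<le> 1" for n
      using incomplete_gamma_partial_sum_le_1[OF \<nu> \<theta>, of n] a
      by (simp add: sum_ennreal a_def[symmetric])
  qed simp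
  finally show ?thesis .
qed

subsection \<open>The semigroup of the Laguerre operator\<close>

definition heat_op :: "real \<Rightarrow> real \<Rightarrow> (real \<Rightarrow> real) \<Rightarrow> real \<Rightarrow> real" where
  "heat_op \<nu> t f x = (if t = 0 then f x else \<integral>y. heat_ker \<nu> t x y * f y \<partial>speed_measure \<nu>)"

lemma speed_fst: "fst \<in> borel_measurable (speed_measure \<nu> \<Otimes>\<^sub>M N)"
  by (rule measurable_compose[OF measurable_fst, of "\<lambda>x. x"]) (auto intro: speed_measurable_borel)

lemma speed_snd: "snd \<in> borel_measurable (N \<Otimes>\<^sub>M speed_measure \<nu>)"
  by (rule measurable_compose[OF measurable_snd, of "\<lambda>x. x"]) (auto intro: speed_measurable_borel)

context laguerre
begin

lemma submarkov_heat_ker: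
  assumes t: "t > 0" shows "submarkov_kernel (speed_measure \<nu>) (heat_ker \<nu> t)"
proof unfold_locales
  have [measurable]: "fst \<in> borel_measurable (speed_measure \<nu> \<Otimes>\<^sub>M speed_measure \<nu>)"
    "snd \<in> borel_measurable (speed_measure \<nu> \<Otimes>\<^sub>M speed_measure \<nu>)"
    by (rule speed_fst, rule speed_snd)
  show "(\<lambda>(x, y). heat_ker \<nu> t x y) \<in> borel_measurable (speed_measure \<nu> \<Otimes>\<^sub>M speed_measure \<nu>)"
    unfolding case_prod_beta' by measurable
  show "0 \<le> heat_ker \<nu> t x y" for x y by (rule heat_ker_nonneg[OF nu_pos])
  show "heat_ker \<nu> t x y = heat_ker \<nu> t y x" for x y by (rule heat_ker_sym)
  show "(\<integral>\<^sup>+y. ennreal (heat_ker \<nu> t x y) \<partial>speed_measure \<nu>) \<le> 1" for x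
  proof (cases "x > 0")
    case True
    then show ?thesis by (rule heat_ker_mass[OF nu_pos t])
  qed (simp add: heat_ker_def)
qed

lemma heat_op_kop:
  assumes t: "t > 0"
  shows "heat_op \<nu> t f = submarkov_kernel.kop (speed_measure \<nu>) (heat_ker \<nu> t) f"
  using t by (simp add: fun_eq_iff heat_op_def submarkov_kernel.kop_def[OF submarkov_heat_ker[OF t]])

lemma heat_op_L2: "t \<ge> 0 \<Longrightarrow> f \<in> Lp 2 (speed_measure \<nu>) \<Longrightarrow> heat_op \<nu> t f \<in> Lp 2 (speed_measure \<nu>)"
proof (cases "t = 0")
  case True
  then show "f \<in> Lp 2 (speed_measure \<nu>) \<Longrightarrow> ?thesis" by (simp add: heat_op_def[abs_def])
next
  case False
  assume "t \<ge> 0" "f \<in> Lp 2 (speed_measure \<nu>)"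
  with False show ?thesis
    using submarkov_kernel.kop_L2[OF submarkov_heat_ker] by (simp add: heat_op_kop)
qed

lemma heat_op_symmetric:
  "t > 0 \<Longrightarrow> f \<in> Lp 2 (speed_measure \<nu>) \<Longrightarrow> g \<in> Lp 2 (speed_measure \<nu>) \<Longrightarrow>
    inner_L2 (speed_measure \<nu>) (heat_op \<nu> t f) g = inner_L2 (speed_measure \<nu>) f (heat_op \<nu> t g)"
  using submarkov_kernel.kop_symmetric[OF submarkov_heat_ker] by (simp add: heat_op_kop)

lemma heat_op_exp:
  assumes t: "t > 0" and s: "s \<ge> 0" and x: "x > 0"
  shows "heat_op \<nu> t (mono_exp \<nu> 0 s) x = exp (- \<nu> * t) * (1 + s * (1 - exp (- t))) powr (- (1 + \<nu>))
    * mono_exp \<nu> 0 (s * exp (- t) / (1 + s * (1 - exp (- t)))) x"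
  using heat_ker_exp[OF nu_pos t x s refl refl refl refl] t
  by (simp add: heat_op_def has_bochner_integral_iff)

text \<open>The map \<open>s \<mapsto> s * q / B\<close> multiplies \<open>s / (1 + s)\<close> by \<open>q = exp (- t)\<close>; its \<open>n\<close>-th power is
  what the \<open>n\<close>-th Laguerre function sees.\<close>

lemma inner_lag_heat_op_exp:
  assumes t: "t > 0" and s: "s \<ge> 0"
  shows "inner_L2 (speed_measure \<nu>) (lag \<nu> n) (heat_op \<nu> t (mono_exp \<nu> 0 s))
    = exp (- (\<nu> + n) * t) * inner_L2 (speed_measure \<nu>) (lag \<nu> n) (mono_exp \<nu> 0 s)"
proof -
  define q where "q = exp (- t)"
  define B where "B = 1 + s * (1 - q)"
  define s' where "s' = s * q / B"
  have q: "0 < q" "q < 1" using t by (auto simp: q_def)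
  have B: "B \<ge> 1" using s q by (simp add: B_def)
  have s': "s' \<ge> 0" using s q B by (simp add: s'_def)
  have s1: "1 + s' = (1 + s) / B" using B by (simp add: s'_def field_simps) (simp add: B_def algebra_simps)
  have s2: "s' / (1 + s') = q * (s / (1 + s))" unfolding s1 using B s by (simp add: s'_def)
  have mL: "mono_exp \<nu> 0 r \<in> Lp 2 (speed_measure \<nu>)" if "r \<ge> 0" for r
    using that nu_pos by (intro mono_exp_L2) auto
  have ae: "ae_eq (speed_measure \<nu>) (heat_op \<nu> t (mono_exp \<nu> 0 s))
     (\<lambda>x. (exp (- \<nu> * t) * B powr (- (1 + \<nu>))) * mono_exp \<nu> 0 s' x)"
    unfolding ae_eq_def AE_speed_iff using t s
    by (intro AE_I2) (simp add: heat_op_exp B_def s'_def q_def)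
  have "inner_L2 (speed_measure \<nu>) (lag \<nu> n) (heat_op \<nu> t (mono_exp \<nu> 0 s))
    = inner_L2 (speed_measure \<nu>) (\<lambda>x. (exp (- \<nu> * t) * B powr (- (1 + \<nu>))) * mono_exp \<nu> 0 s' x) (lag \<nu> n)"
    unfolding inner_L2_commute[of _ "lag \<nu> n"]
    by (intro inner_L2_cong_ae ae L2_measurable heat_op_L2 L2_scale mL lag_L2 nu_pos s s' less_imp_le[OF t])
  also have "\<dots> = (exp (- \<nu> * t) * B powr (- (1 + \<nu>))) * inner_L2 (speed_measure \<nu>) (lag \<nu> n) (mono_exp \<nu> 0 s')"
    by (subst inner_scale_left[OF mL[OF s'] lag_L2[OF nu_pos]]) (simp add: inner_L2_commute)
  also have "\<dots> = exp (- \<nu> * t) * (B powr (- (1 + \<nu>)) * ((1 + s) / B) powr (- (1 + \<nu>))) * Gamma (1 + \<nu>) * (q * (s / (1 + s))) ^ n"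
    unfolding inner_lag_exp[OF nu_pos s'] s2 unfolding s1 by simp
  also have "B powr (- (1 + \<nu>)) * ((1 + s) / B) powr (- (1 + \<nu>)) = (1 + s) powr (- (1 + \<nu>))"
    using B s by (subst powr_mult[symmetric]) auto
  also have "exp (- \<nu> * t) * (1 + s) powr (- (1 + \<nu>)) * Gamma (1 + \<nu>) * (q * (s / (1 + s))) ^ n
     = (exp (- \<nu> * t) * q ^ n) * (Gamma (1 + \<nu>) * (1 + s) powr (- (1 + \<nu>)) * (s / (1 + s)) ^ n)"
    unfolding power_mult_distrib by (simp only: mult_ac)
  also have "exp (- \<nu> * t) * q ^ n = exp (- (\<nu> + n) * t)"
    by (simp add: q_def exp_of_nat_mult[symmetric] exp_add[symmetric] algebra_simps)
  finally show ?thesis by (simp add: inner_lag_exp[OF nu_pos s])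
qed

lemma heat_op_lag:
  assumes t: "t > 0"
  shows "ae_eq (speed_measure \<nu>) (heat_op \<nu> t (lag \<nu> n)) (\<lambda>x. exp (- (\<nu> + n) * t) * lag \<nu> n x)"
proof -
  have L: "lag \<nu> n \<in> Lp 2 (speed_measure \<nu>)" by (rule lag_L2[OF nu_pos])
  have TL: "heat_op \<nu> t (lag \<nu> n) \<in> Lp 2 (speed_measure \<nu>)" using t by (intro heat_op_L2 L) simp
  have "ae_eq (speed_measure \<nu>) (\<lambda>x. heat_op \<nu> t (lag \<nu> n) x - exp (- (\<nu> + n) * t) * lag \<nu> n x) (\<lambda>x. 0)"
  proof (rule AE_zero_speed_if_exp_integrals_zero[OF nu_pos nu_less])
    show "(\<lambda>x. heat_op \<nu> t (lag \<nu> n) x - exp (- (\<nu> + n) * t) * lag \<nu> n x) \<in> Lp 2 (speed_measure \<nu>)"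
      by (intro L2_diff L2_scale L TL)
    fix s :: real assume s: "s \<ge> 0"
    have m: "mono_exp \<nu> 0 s \<in> Lp 2 (speed_measure \<nu>)" using s nu_pos by (intro mono_exp_L2) auto
    have "inner_L2 (speed_measure \<nu>) (\<lambda>x. heat_op \<nu> t (lag \<nu> n) x - exp (- (\<nu> + n) * t) * lag \<nu> n x) (mono_exp \<nu> 0 s)
      = inner_L2 (speed_measure \<nu>) (heat_op \<nu> t (lag \<nu> n)) (mono_exp \<nu> 0 s)
        - exp (- (\<nu> + n) * t) * inner_L2 (speed_measure \<nu>) (lag \<nu> n) (mono_exp \<nu> 0 s)"
      by (simp add: inner_L2_diff[OF TL L2_scale[OF L] m] inner_scale_left[OF L m])
    then show "inner_L2 (speed_measure \<nu>) (\<lambda>x. heat_op \<nu> t (lag \<nu> n) x - exp (- (\<nu> + n) * t) * lag \<nu> n x) (mono_exp \<nu> 0 s) = 0"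
      by (simp only: heat_op_symmetric[OF t L m] inner_lag_heat_op_exp[OF t s] diff_self)
  qed
  then show ?thesis by (simp add: ae_eq_def)
qed

text \<open>Symmetry of the kernel moves the semigroup to the eigenfunction.\<close>

lemma diagonal_heat_op: "diagonal_semigroup (heat_op \<nu>)"
  unfolding diagonal_semigroup_def
proof (intro allI impI ballI conjI)
  fix t f n assume t: "t \<ge> (0::real)" and f: "f \<in> Lp 2 (speed_measure \<nu>)"
  show "heat_op \<nu> t f \<in> Lp 2 (speed_measure \<nu>)" by (rule heat_op_L2[OF t f])
  show "coeff (heat_op \<nu> t f) n = exp (- (\<nu> + real n) * t) * coeff f n"
  proof (cases "t = 0")
    case True
    then show ?thesis by (simp add: heat_op_def[abs_def])
  next
    case False
    with t have t: "t > 0" by simp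
    define N where "N = norm_L2 (speed_measure \<nu>) (lag \<nu> n)"
    have L: "lag \<nu> n \<in> Lp 2 (speed_measure \<nu>)" by (rule lag_L2[OF nu_pos])
    have TL: "heat_op \<nu> t f \<in> Lp 2 (speed_measure \<nu>)" using t by (intro heat_op_L2 f) simp
    have c: "coeff g n = 1 / N * inner_L2 (speed_measure \<nu>) g (lag \<nu> n)" if "g \<in> Lp 2 (speed_measure \<nu>)" for g
    proof -
      have "eigfun \<nu> n = (\<lambda>x. 1 / N * lag \<nu> n x)" by (simp add: fun_eq_iff eigfun_def N_def)
      then show ?thesis by (simp only: coeff_def inner_scale_right[OF that L])
    qed
    have "inner_L2 (speed_measure \<nu>) (heat_op \<nu> t f) (lag \<nu> n) = inner_L2 (speed_measure \<nu>) f (heat_op \<nu> t (lag \<nu> n))"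
      by (rule heat_op_symmetric[OF t f L])
    also have "\<dots> = inner_L2 (speed_measure \<nu>) (\<lambda>x. exp (- (\<nu> + n) * t) * lag \<nu> n x) f"
      unfolding inner_L2_commute[of _ f]
      by (intro inner_L2_cong_ae heat_op_lag t L2_measurable heat_op_L2 L2_scale L f less_imp_le[OF t])
    also have "\<dots> = exp (- (\<nu> + n) * t) * inner_L2 (speed_measure \<nu>) f (lag \<nu> n)"
      by (subst inner_scale_left[OF L f]) (simp add: inner_L2_commute)
    finally show ?thesis by (simp add: c f TL)
  qed
qed

lemma heat_kernel_heat_ker: "heat_kernel (speed_measure \<nu>) opD opL (heat_ker \<nu>)"
  unfolding heat_kernel_def
proof (intro conjI allI impI ballI exI[of _ "heat_op \<nu>"])
  let ?N = "restrict_space borel {0<..} \<Otimes>\<^sub>M speed_measure \<nu> \<Otimes>\<^sub>M speed_measure \<nu> :: (real \<times> real \<times> real) measure"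
  have [measurable]: "fst \<in> borel_measurable ?N"
    by (rule measurable_compose[OF measurable_fst, of "\<lambda>x. x"]) (auto intro: measurable_restrict_space1)
  have [measurable]: "(\<lambda>p. fst (snd p)) \<in> borel_measurable ?N" "(\<lambda>p. snd (snd p)) \<in> borel_measurable ?N"
    by (rule measurable_compose[OF measurable_snd], rule speed_fst,
        rule measurable_compose[OF measurable_snd], rule speed_snd)
  show "(\<lambda>(t, x, y). heat_ker \<nu> t x y) \<in> borel_measurable ?N"
    unfolding case_prod_beta' by measurable
  show "0 \<le> heat_ker \<nu> t x y" for t x y by (rule heat_ker_nonneg[OF nu_pos])
  show "heat_semigroup (speed_measure \<nu>) opD opL (heat_op \<nu>)"
    by (rule heat_semigroup_diagonal[OF diagonal_heat_op])
  fix t :: real and f assume t: "t > 0" and f: "f \<in> Lp 2 (speed_measure \<nu>)"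
  show "AE x in speed_measure \<nu>. integrable (speed_measure \<nu>) (\<lambda>y. heat_ker \<nu> t x y * f y) \<and>
       heat_op \<nu> t f x = (\<integral>y. heat_ker \<nu> t x y * f y \<partial>speed_measure \<nu>)"
    using submarkov_kernel.K_integrable_AE[OF submarkov_heat_ker[OF t] f] t
    by (simp add: heat_op_def)
qed

lemma markovian_formE: "markovian formD formE"
  unfolding markovian_def Let_def
proof
  fix u assume u: "u \<in> formD"
  define v where "v = (\<lambda>x. min (max (u x) 0) 1)"
  have uL: "u \<in> Lp 2 (speed_measure \<nu>)" using u formD_L2 by blast
  have [measurable]: "u \<in> borel_measurable (speed_measure \<nu>)" using uL by (simp add: Lp_2_iff)
  have abs_le: "\<bar>v x\<bar> \<le> \<bar>u x\<bar>" for x by (auto simp: v_def min_def max_def)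
  have diff_le: "\<bar>v x - v y\<bar> \<le> \<bar>u x - u y\<bar>" for x y by (auto simp: v_def min_def max_def)
  have "integrable (speed_measure \<nu>) (\<lambda>x. (v x)\<^sup>2)"
  proof (rule Bochner_Integration.integrable_bound)
    show "integrable (speed_measure \<nu>) (\<lambda>x. (u x)\<^sup>2)" using uL by (simp add: Lp_2_iff)
    show "(\<lambda>x. (v x)\<^sup>2) \<in> borel_measurable (speed_measure \<nu>)" unfolding v_def by measurable
    show "AE x in speed_measure \<nu>. norm ((v x)\<^sup>2) \<le> norm ((u x)\<^sup>2)"
      using abs_le by (intro AE_I2) (simp add: abs_le_square_iff)
  qed
  then have vL: "v \<in> Lp 2 (speed_measure \<nu>)" unfolding Lp_2_iff by (simp add: v_def)
  have "v \<in> formD \<and> formE v v \<le> formE u u"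
  proof (rule formE_le_if_semigroup[OF diagonal_heat_op u vL])
    fix t :: real assume t: "t > 0"
    show "inner_L2 (speed_measure \<nu>) v v - inner_L2 (speed_measure \<nu>) (heat_op \<nu> t v) v
       \<le> inner_L2 (speed_measure \<nu>) u u - inner_L2 (speed_measure \<nu>) (heat_op \<nu> t u) u"
      unfolding heat_op_kop[OF t]
      by (rule submarkov_kernel.energy_kop_contraction[OF submarkov_heat_ker[OF t] uL vL abs_le diff_le])
  qed
  then show "(\<lambda>x. min (max (u x) 0) 1) \<in> formD \<and> formE (\<lambda>x. min (max (u x) 0) 1) (\<lambda>x. min (max (u x) 0) 1) \<le> formE u u"
    by (simp add: v_def)
qed

end

section \<open>The form as an energy integral\<close>

subsection \<open>Differentiating the Laguerre system\<close>

definition energy_measure :: "real \<Rightarrow> real measure" where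
  "energy_measure \<nu> = density lborel (\<lambda>x. ennreal (gamma_density (2 - \<nu>) 1 x))"

text \<open>The derivative of \<open>x powr (\<nu> + k)\<close> on the open half-line.\<close>

definition dmono :: "real \<Rightarrow> nat \<Rightarrow> real \<Rightarrow> real" where
  "dmono \<nu> k x = (\<nu> + k) * (x powr (\<nu> - 1) * x ^ k)"

definition dlag :: "real \<Rightarrow> nat \<Rightarrow> real \<Rightarrow> real" where
  "dlag \<nu> n x = (\<Sum>k\<le>n. lag_coeff \<nu> n k * dmono \<nu> k x)"

definition deig :: "real \<Rightarrow> nat \<Rightarrow> real \<Rightarrow> real" where
  "deig \<nu> n x = (1 / (norm_L2 (speed_measure \<nu>) (lag \<nu> n) * sqrt (\<nu> + n))) * dlag \<nu> n x"

lemma dmono_measurable [measurable]: "dmono \<nu> k \<in> borel_measurable borel"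
  unfolding dmono_def by measurable

lemma dlag_measurable [measurable]: "dlag \<nu> n \<in> borel_measurable borel"
  unfolding dlag_def by measurable

lemma integral_energy:
  assumes "f \<in> borel_measurable borel"
  shows "integral\<^sup>L (energy_measure \<nu>) f = (\<integral>x. gamma_density (2 - \<nu>) 1 x * f x \<partial>lborel)"
  using assms unfolding energy_measure_def by (subst integral_density) (auto simp: gamma_density_nonneg)

lemma integrable_energy_iff:
  assumes "f \<in> borel_measurable borel"
  shows "integrable (energy_measure \<nu>) f \<longleftrightarrow> integrable lborel (\<lambda>x. gamma_density (2 - \<nu>) 1 x * f x)"
  using assms unfolding energy_measure_def by (subst integrable_density) (auto simp: gamma_density_nonneg)

lemma energy_measurable: "f \<in> borel_measurable (energy_measure \<nu>) \<longleftrightarrow> f \<in> borel_measurable borel"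
  by (simp add: energy_measure_def)

lemma energy_density_dmono_mult:
  "gamma_density (2 - \<nu>) 1 x * (dmono \<nu> j x * dmono \<nu> k x)
    = (\<nu> + j) * (\<nu> + k) * gamma_density (\<nu> + j + k) 1 x"
proof (cases "x > 0")
  case True
  have "x powr (\<nu> + real j + real k - 1) = x powr (1 - \<nu>) * (x powr (\<nu> - 1) * x ^ j) * (x powr (\<nu> - 1) * x ^ k)"
    using True by (simp add: powr_realpow[symmetric] powr_add[symmetric] algebra_simps)
  then show ?thesis using True by (simp add: gamma_density_def dmono_def mult_ac)
qed (simp add: gamma_density_def)

lemma dmono_L2:
  assumes "\<nu> > 0" shows "dmono \<nu> k \<in> Lp 2 (energy_measure \<nu>)"
proof -
  have "integrable (energy_measure \<nu>) (\<lambda>x. dmono \<nu> k x * dmono \<nu> k x)"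
    using assms integrable_gamma_density[of "\<nu> + real k + real k" 1]
    by (subst integrable_energy_iff) (simp_all add: energy_density_dmono_mult)
  then show ?thesis by (simp add: Lp_2_iff power2_eq_square energy_measurable)
qed

lemma inner_dmono:
  assumes "\<nu> > 0"
  shows "inner_L2 (energy_measure \<nu>) (dmono \<nu> j) (dmono \<nu> k) = form_entry \<nu> j k"
  using assms integral_gamma_density[of "\<nu> + real j + real k" 1]
  unfolding inner_L2_def
  by (subst integral_energy) (simp_all add: energy_density_dmono_mult form_entry_def)

lemma dlag_L2: "\<nu> > 0 \<Longrightarrow> dlag \<nu> n \<in> Lp 2 (energy_measure \<nu>)"
  unfolding dlag_def by (intro L2_sum dmono_L2) auto

text \<open>In monomials this is the eigenvector equation of the Laguerre coefficients. So the derivatives of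
  the orthonormal basis, divided by the square roots of the eigenvalues, are orthonormal again.\<close>

lemma inner_dlag:
  assumes \<nu>: "\<nu> > 0"
  shows "inner_L2 (energy_measure \<nu>) (dlag \<nu> n) (dlag \<nu> m)
    = (\<nu> + n) * inner_L2 (speed_measure \<nu>) (lag \<nu> n) (lag \<nu> m)"
proof -
  have left: "inner_L2 (energy_measure \<nu>) (dlag \<nu> i) f
     = (\<Sum>k\<le>i. lag_coeff \<nu> i k * inner_L2 (energy_measure \<nu>) (dmono \<nu> k) f)"
    if "f \<in> Lp 2 (energy_measure \<nu>)" for f i
    unfolding dlag_def using that \<nu> by (intro inner_L2_sum dmono_L2) auto
  have "inner_L2 (energy_measure \<nu>) (dlag \<nu> n) (dlag \<nu> m) = inner_L2 (energy_measure \<nu>) (dlag \<nu> m) (dlag \<nu> n)"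
    by (rule inner_L2_commute)
  also have "\<dots> = (\<Sum>k\<le>m. lag_coeff \<nu> m k * inner_L2 (energy_measure \<nu>) (dlag \<nu> n) (dmono \<nu> k))"
    by (subst left[OF dlag_L2[OF \<nu>]]) (simp add: inner_L2_commute)
  also have "\<dots> = (\<Sum>k\<le>m. lag_coeff \<nu> m k * (\<Sum>j\<le>n. lag_coeff \<nu> n j * form_entry \<nu> j k))"
    by (subst left[OF dmono_L2[OF \<nu>]]) (simp add: inner_dmono[OF \<nu>])
  finally show ?thesis by (simp add: lag_form[OF \<nu>])
qed

lemma deig_L2: "\<nu> > 0 \<Longrightarrow> deig \<nu> n \<in> Lp 2 (energy_measure \<nu>)"
  unfolding deig_def by (intro L2_scale dlag_L2)

lemma deig_orthonormal:
  assumes \<nu>: "\<nu> > 0"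
  shows "inner_L2 (energy_measure \<nu>) (deig \<nu> m) (deig \<nu> n) = (if m = n then 1 else 0)"
proof -
  let ?N = "\<lambda>n. norm_L2 (speed_measure \<nu>) (lag \<nu> n)"
  have "deig \<nu> i = (\<lambda>x. (1 / (?N i * sqrt (\<nu> + i))) * dlag \<nu> i x)" for i
    by (simp add: fun_eq_iff deig_def)
  then have "inner_L2 (energy_measure \<nu>) (deig \<nu> m) (deig \<nu> n)
     = (1 / (?N m * sqrt (\<nu> + m))) * ((1 / (?N n * sqrt (\<nu> + n))) * inner_L2 (energy_measure \<nu>) (dlag \<nu> m) (dlag \<nu> n))"
    by (simp only: inner_scale_left inner_scale_right L2_scale dlag_L2[OF \<nu>])
  also have "\<dots> = (if m = n then 1 else 0)"
  proof (cases "m = n")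
    case True
    have "?N n > 0" "\<nu> + n > 0" using norm_lag_pos[OF \<nu>] \<nu> by auto
    moreover have "inner_L2 (speed_measure \<nu>) (lag \<nu> n) (lag \<nu> n) = ?N n * ?N n"
      by (simp add: norm_L2_power2[symmetric] power2_eq_square)
    ultimately show ?thesis using True by (simp add: inner_dlag[OF \<nu>])
  qed (simp add: inner_dlag[OF \<nu>] lag_orthogonal[OF \<nu>])
  finally show ?thesis .
qed

lemma has_derivative_lag:
  assumes "x > 0" shows "(lag \<nu> n has_real_derivative dlag \<nu> n x) (at x)"
proof -
  have "(mono_exp \<nu> k 0 has_real_derivative dmono \<nu> k x) (at x)" for k
  proof -
    have "((\<lambda>x. x powr (\<nu> + real k)) has_real_derivative (\<nu> + real k) * x powr (\<nu> + real k - 1)) (at x)"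
      by (rule has_real_derivative_powr[OF assms])
    moreover have "(\<nu> + real k) * x powr (\<nu> + real k - 1) = dmono \<nu> k x"
      using assms by (simp add: dmono_def powr_realpow[symmetric] powr_add[symmetric] algebra_simps)
    moreover have "x powr (\<nu> + real k) = mono_exp \<nu> k 0 x" if "x \<in> {0<..}" for x
      using that by (simp add: mono_exp_def powr_add powr_realpow)
    ultimately show ?thesis
      using has_field_derivative_transform_within_open[of "\<lambda>x. x powr (\<nu> + real k)" _ x "{0<..}" "mono_exp \<nu> k 0"] assms
      by auto
  qed
  then show ?thesis unfolding lag_def[abs_def] dlag_def
    by (intro DERIV_sum DERIV_cmult) auto
qed

lemma isCont_dlag: "x > 0 \<Longrightarrow> isCont (dlag \<nu> n) x"
  unfolding dlag_def[abs_def] dmono_def by (auto intro!: continuous_intros)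

text \<open>Lindelof: countably many of the neighbourhoods suffice.\<close>

lemma AE_on_open_if_locally:
  fixes U :: "real set"
  assumes "\<And>z. z \<in> U \<Longrightarrow> \<exists>V. open V \<and> z \<in> V \<and> (AE x in lborel. x \<in> V \<longrightarrow> P x)"
  shows "AE x in lborel. x \<in> U \<longrightarrow> P x"
proof -
  define \<F> where "\<F> = {V. open V \<and> (AE x in lborel. x \<in> V \<longrightarrow> P x)}"
  obtain \<G> where \<G>: "\<G> \<subseteq> \<F>" "countable \<G>" "\<Union>\<G> = \<Union>\<F>"
    using Lindelof[of \<F>] unfolding \<F>_def by blast
  have "AE x in lborel. \<forall>V\<in>\<G>. x \<in> V \<longrightarrow> P x"
    using \<G> by (subst AE_ball_countable) (auto simp: \<F>_def)
  moreover have "U \<subseteq> \<Union>\<G>" using assms unfolding \<G>(3) \<F>_def by blast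
  ultimately show ?thesis by (auto elim!: eventually_mono)
qed

context laguerre
begin

lemma energy_system: "orthonormal_system (energy_measure \<nu>) (deig \<nu>)"
proof -
  have "emeasure (energy_measure \<nu>) (space (energy_measure \<nu>)) = ennreal (Gamma (2 - \<nu>) / 1 powr (2 - \<nu>))"
    using nn_integral_gamma_density[of "2 - \<nu>" 1] nu_less
    by (simp add: energy_measure_def emeasure_density)
  then have "finite_measure (energy_measure \<nu>)" by (intro finite_measureI) simp
  then interpret finite_measure "energy_measure \<nu>" .
  show ?thesis by unfold_locales (simp_all add: deig_L2 deig_orthonormal nu_pos)
qed

sublocale energy: orthonormal_system "energy_measure \<nu>" "deig \<nu>" by (rule energy_system)

text \<open>The limit of the derivatives of the partial sums of \<open>u\<close> in the energy space.\<close>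

definition is_weak_deriv :: "(real \<Rightarrow> real) \<Rightarrow> (real \<Rightarrow> real) \<Rightarrow> bool" where
  "is_weak_deriv u g \<longleftrightarrow> g \<in> Lp 2 (energy_measure \<nu>) \<and>
     (\<lambda>N. norm_L2 (energy_measure \<nu>) (\<lambda>x. energy.psum (\<lambda>n. sqrt (\<nu> + n) * coeff u n) N x - g x)) \<longlonglongrightarrow> 0"

lemma weak_deriv_exists:
  assumes u: "u \<in> formD" shows "\<exists>g. is_weak_deriv u g"
proof -
  have "summable (\<lambda>n. (sqrt (\<nu> + n) * coeff u n)\<^sup>2)"
    using u nu_pos by (simp add: formD_def power_mult_distrib)
  from energy.Riesz_Fischer[OF this] show ?thesis by (auto simp: is_weak_deriv_def)
qed

lemma formE_weak_deriv:
  assumes u: "u \<in> formD" "is_weak_deriv u g" and v: "v \<in> formD" "is_weak_deriv v k"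
  shows "formE u v = inner_L2 (energy_measure \<nu>) g k"
proof (rule LIMSEQ_unique)
  let ?S = "\<lambda>u. energy.psum (\<lambda>n. sqrt (\<nu> + n) * coeff u n)"
  show "(\<lambda>N. inner_L2 (energy_measure \<nu>) (?S u N) (?S v N)) \<longlonglongrightarrow> inner_L2 (energy_measure \<nu>) g k"
    using u(2) v(2) by (intro inner_L2_tendsto2 energy.psum_L2) (auto simp: is_weak_deriv_def)
  have "inner_L2 (energy_measure \<nu>) (?S u N) (?S v N) = (\<Sum>n<N. (\<nu> + n) * coeff u n * coeff v n)" for N
  proof -
    have "inner_L2 (energy_measure \<nu>) (?S u N) (?S v N)
       = (\<Sum>n<N. (sqrt (\<nu> + n) * coeff u n) * energy.coeff (?S v N) n)"
      unfolding energy.psum_def[of "\<lambda>n. sqrt (\<nu> + n) * coeff u n", abs_def]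
      by (rule energy.inner_comb) (auto intro: energy.psum_L2)
    also have "\<dots> = (\<Sum>n<N. (\<nu> + n) * coeff u n * coeff v n)"
    proof (rule sum.cong[OF refl])
      fix n assume "n \<in> {..<N}"
      then have "(sqrt (\<nu> + n) * coeff u n) * energy.coeff (?S v N) n
         = (sqrt (\<nu> + n) * sqrt (\<nu> + n)) * coeff u n * coeff v n"
        by (simp add: energy.coeff_psum mult_ac)
      then show "(sqrt (\<nu> + n) * coeff u n) * energy.coeff (?S v N) n = (\<nu> + n) * coeff u n * coeff v n"
        using nu_pos by simp
    qed
    finally show ?thesis .
  qed
  then show "(\<lambda>N. inner_L2 (energy_measure \<nu>) (?S u N) (?S v N)) \<longlonglongrightarrow> formE u v"
    using summable_LIMSEQ[OF formE_summable[OF u(1) v(1)]] by (simp add: formE_def)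
qed

lemma psum_derivative:
  assumes "x > 0"
  shows "(psum c N has_real_derivative energy.psum (\<lambda>n. sqrt (\<nu> + n) * c n) N x) (at x)"
proof -
  have "(eigfun \<nu> n has_real_derivative sqrt (\<nu> + n) * deig \<nu> n x) (at x)" for n
  proof -
    have "sqrt (\<nu> + n) > 0" using nu_pos by simp
    then have "sqrt (\<nu> + n) * deig \<nu> n x = (1 / norm_L2 (speed_measure \<nu>) (lag \<nu> n)) * dlag \<nu> n x"
      by (simp add: deig_def)
    then show ?thesis unfolding eigfun_def[abs_def]
      by (simp only: DERIV_cmult[OF has_derivative_lag[OF assms]])
  qed
  then have "((\<lambda>x. \<Sum>n<N. c n * eigfun \<nu> n x) has_real_derivative
     (\<Sum>n<N. c n * (sqrt (\<nu> + n) * deig \<nu> n x))) (at x)"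
    by (intro DERIV_sum DERIV_cmult) auto
  then show ?thesis by (simp add: psum_def[abs_def] energy.psum_def mult_ac)
qed

text \<open>Away from the origin the indicator of an interval divided by the weight belongs to the energy space,
  so integration over the interval is a continuous functional there.\<close>

lemma psum_increment_tendsto:
  assumes g: "is_weak_deriv u g" and a: "0 < a" "a \<le> b"
  shows "(\<lambda>N. psum (coeff u) N b - psum (coeff u) N a) \<longlonglongrightarrow> (\<integral>x. g x * indicator {a..b} x \<partial>lborel)"
    and "integrable lborel (\<lambda>x. g x * indicator {a..b} x)"
proof -
  let ?w = "gamma_density (2 - \<nu>) 1"
  have gL: "g \<in> Lp 2 (energy_measure \<nu>)" using g by (simp add: is_weak_deriv_def)
  define \<kappa> where "\<kappa> x = indicator {a..b} x / ?w x" for x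
  have [measurable]: "\<kappa> \<in> borel_measurable borel" unfolding \<kappa>_def by measurable
  have wpos: "?w x > 0" if "x > 0" for x using that by (simp add: gamma_density_def)
  have w\<kappa>: "?w x * (f x * \<kappa> x) = f x * indicator {a..b} x" for f :: "real \<Rightarrow> real" and x
    using a wpos[of x] by (auto simp: \<kappa>_def indicator_def)
  have \<kappa>L: "\<kappa> \<in> Lp 2 (energy_measure \<nu>)"
  proof -
    have "set_integrable lborel {a..b} (\<lambda>x. 1 / (x powr (1 - \<nu>) * exp (- x)))"
      using a by (intro borel_integrable_atLeastAtMost') (auto intro!: continuous_intros)
    then have "integrable lborel (\<lambda>x. indicator {a..b} x * (1 / (x powr (1 - \<nu>) * exp (- x))))"
      by (simp add: set_integrable_def)
    also have "(\<lambda>x. indicator {a..b} x * (1 / (x powr (1 - \<nu>) * exp (- x)))) = (\<lambda>x. ?w x * (\<kappa> x * \<kappa> x))"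
      using a by (auto simp: fun_eq_iff w\<kappa> \<kappa>_def indicator_def gamma_density_def)
    finally have "integrable (energy_measure \<nu>) (\<lambda>x. \<kappa> x * \<kappa> x)"
      by (subst integrable_energy_iff) auto
    then show ?thesis by (simp add: Lp_2_iff power2_eq_square energy_measurable)
  qed
  have inner\<kappa>: "inner_L2 (energy_measure \<nu>) f \<kappa> = (\<integral>x. f x * indicator {a..b} x \<partial>lborel)"
    if "f \<in> borel_measurable borel" for f
    unfolding inner_L2_def using that by (subst integral_energy) (auto simp: w\<kappa>)
  have gm: "g \<in> borel_measurable borel" using gL by (simp add: Lp_2_iff energy_measurable)
  show "integrable lborel (\<lambda>x. g x * indicator {a..b} x)"
    using L2_mult_integrable[OF gL \<kappa>L] gm by (subst (asm) integrable_energy_iff) (auto simp: w\<kappa>)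
  let ?D = "energy.psum (\<lambda>n. sqrt (\<nu> + n) * coeff u n)"
  have "inner_L2 (energy_measure \<nu>) (?D N) \<kappa> = psum (coeff u) N b - psum (coeff u) N a" for N
  proof -
    have Dm: "?D N \<in> borel_measurable borel"
      using energy.psum_L2 by (simp add: Lp_2_iff energy_measurable)
    have "isCont (?D N) x" if "x > 0" for x
      unfolding energy.psum_def[abs_def] deig_def using isCont_dlag[OF that]
      by (intro continuous_intros) auto
    then have "(\<integral>x. ?D N x * indicator {a..b} x \<partial>lborel) = psum (coeff u) N b - psum (coeff u) N a"
      using a by (intro integral_FTC_Icc_real psum_derivative) auto
    then show ?thesis by (simp add: inner\<kappa>[OF Dm])
  qed
  moreover have "(\<lambda>N. inner_L2 (energy_measure \<nu>) (?D N) \<kappa>) \<longlonglongrightarrow> inner_L2 (energy_measure \<nu>) g \<kappa>"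
    using g by (intro inner_L2_tendsto energy.psum_L2 \<kappa>L) (auto simp: is_weak_deriv_def)
  ultimately show "(\<lambda>N. psum (coeff u) N b - psum (coeff u) N a) \<longlonglongrightarrow> (\<integral>x. g x * indicator {a..b} x \<partial>lborel)"
    by (simp add: inner\<kappa>[OF gm])
qed

lemma psum_AE_subseq:
  assumes u: "u \<in> Lp 2 (speed_measure \<nu>)"
  shows "\<exists>r. strict_mono r \<and> (AE x in lborel. x > 0 \<longrightarrow> (\<lambda>k. psum (coeff u) (r k) x) \<longlonglongrightarrow> u x)"
proof -
  let ?d = "\<lambda>N x. (psum (coeff u) N x - u x)\<^sup>2"
  have dL: "(\<lambda>x. psum (coeff u) N x - u x) \<in> Lp 2 (speed_measure \<nu>)" for N
    by (intro L2_diff psum_L2 u)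
  have "(\<lambda>N. (norm_L2 (speed_measure \<nu>) (\<lambda>x. psum (coeff u) N x - u x))\<^sup>2) \<longlonglongrightarrow> 0\<^sup>2"
    by (intro tendsto_power psum_tendsto u)
  moreover have "(norm_L2 (speed_measure \<nu>) (\<lambda>x. psum (coeff u) N x - u x))\<^sup>2
     = (\<integral>x. norm (?d N x) \<partial>speed_measure \<nu>)" for N
    unfolding norm_L2_power2 inner_L2_def by (simp add: power2_eq_square)
  ultimately have lim: "(\<lambda>N. \<integral>x. norm (?d N x) \<partial>speed_measure \<nu>) \<longlonglongrightarrow> 0" by simp
  obtain r :: "nat \<Rightarrow> nat" where r: "strict_mono r" "AE x in speed_measure \<nu>. (\<lambda>k. ?d (r k) x) \<longlonglongrightarrow> 0"
    using tendsto_L1_AE_subseq[OF _ lim] dL by (auto simp: Lp_2_iff)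
  have "AE x in speed_measure \<nu>. (\<lambda>k. psum (coeff u) (r k) x) \<longlonglongrightarrow> u x"
    using r(2)
  proof eventually_elim
    case (elim x)
    then have "(\<lambda>k. sqrt (?d (r k) x)) \<longlonglongrightarrow> sqrt 0" by (intro tendsto_real_sqrt)
    then have "(\<lambda>k. psum (coeff u) (r k) x - u x) \<longlonglongrightarrow> 0" by (simp add: tendsto_rabs_zero_iff)
    then show ?case by (simp add: LIM_zero_iff)
  qed
  with r show ?thesis unfolding AE_speed_iff by blast
qed

text \<open>A subsequence of the partial sums converges to \<open>c\<close> on a dense subset \<open>D\<close> of \<open>U\<close>, so the integral
  of \<open>g\<close> between two points of \<open>D\<close> in a common interval vanishes. Dominated convergence extends this to all
  end points.\<close>

lemma weak_deriv_zero:
  assumes u: "u \<in> formD" and g: "is_weak_deriv u g"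
    and U: "open U" "U \<subseteq> {0<..}" and const: "AE x in lborel. x \<in> U \<longrightarrow> u x = c"
  shows "AE x in lborel. x \<in> U \<longrightarrow> g x = 0"
proof (rule AE_on_open_if_locally)
  fix z assume z: "z \<in> U"
  obtain r where r: "strict_mono r" "AE x in lborel. x > 0 \<longrightarrow> (\<lambda>k. psum (coeff u) (r k) x) \<longlonglongrightarrow> u x"
    using psum_AE_subseq[OF formD_L2[OF u]] by blast
  define D where "D = {x. (\<lambda>k. psum (coeff u) (r k) x) \<longlonglongrightarrow> c}"
  have AED: "AE x in lborel. x \<in> U \<longrightarrow> x \<in> D"
    using r(2) const by eventually_elim (use U in \<open>auto simp: D_def\<close>)
  have dense: "\<exists>y\<in>D. a < y \<and> y < b" if ab: "a < b" "{a<..<b} \<subseteq> U" for a b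
  proof (rule ccontr)
    assume *: "\<not> ?thesis"
    have "AE x in lborel. x \<notin> {a<..<b}"
      using AED by eventually_elim (use * ab in auto)
    moreover have "{x \<in> space lborel. \<not> x \<notin> {a<..<b}} = {a<..<b}" by auto
    ultimately have "emeasure lborel {a<..<b} = 0"
      using AE_iff_measurable[of "{a<..<b}" lborel "\<lambda>x. x \<notin> {a<..<b}"] by simp
    then show False using ab by simp
  qed
  have zero: "(\<integral>x. g x * indicator {a..b} x \<partial>lborel) = 0" if "a \<in> D" "b \<in> D" "0 < a" "a \<le> b" for a b
  proof (rule LIMSEQ_unique)
    have "(\<lambda>N. psum (coeff u) N b - psum (coeff u) N a) \<longlonglongrightarrow> (\<integral>x. g x * indicator {a..b} x \<partial>lborel)"
      by (rule psum_increment_tendsto[OF g that(3,4)])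
    from LIMSEQ_subseq_LIMSEQ[OF this r(1)]
    show "(\<lambda>k. psum (coeff u) (r k) b - psum (coeff u) (r k) a) \<longlonglongrightarrow> (\<integral>x. g x * indicator {a..b} x \<partial>lborel)"
      by (simp add: o_def)
    show "(\<lambda>k. psum (coeff u) (r k) b - psum (coeff u) (r k) a) \<longlonglongrightarrow> 0"
      using tendsto_diff[of _ c _ _ c] that by (fastforce simp: D_def)
  qed
  obtain \<epsilon> where \<epsilon>: "\<epsilon> > 0" "{z - \<epsilon><..<z + \<epsilon>} \<subseteq> U"
    using openE[OF U(1) z] by (metis ball_eq_greaterThanLessThan)
  obtain a where a: "a \<in> D" "z - \<epsilon> < a" "a < z" using dense[of "z - \<epsilon>" z] \<epsilon> by fastforce
  obtain b where b: "b \<in> D" "z < b" "b < z + \<epsilon>" using dense[of z "z + \<epsilon>"] \<epsilon> by fastforce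
  have abU: "{a..b} \<subseteq> U" using a b \<epsilon> by auto
  then have a0: "0 < a" using a b U by force
  define \<rho> where "\<rho> x = g x * indicator {a..b} x" for x
  have int: "integrable lborel \<rho>"
    unfolding \<rho>_def using a b by (intro psum_increment_tendsto(2)[OF g a0]) auto
  have "AE x in lborel. \<rho> x = 0"
  proof (rule AE_zero_if_tail_integrals_zero[OF int])
    fix s
    consider "s < a" | "b \<le> s" | "a \<le> s" "s < b" by linarith
    then show "(\<integral>x. indicator {s<..} x * \<rho> x \<partial>lborel) = 0"
    proof cases
      case 1
      then have "(\<lambda>x. indicator {s<..} x * \<rho> x) = (\<lambda>x. g x * indicator {a..b} x)"
        by (auto simp: fun_eq_iff \<rho>_def indicator_def)
      then show ?thesis using zero[OF a(1) b(1) a0] a b by simp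
    next
      case 2
      then have "(\<lambda>x. indicator {s<..} x * \<rho> x) = (\<lambda>x. 0)"
        by (auto simp: fun_eq_iff \<rho>_def indicator_def)
      then show ?thesis by simp
    next
      case 3
      have "\<exists>y\<in>D. s < y \<and> y < min b (s + 1 / Suc n)" for n
        using 3 abU by (intro dense) auto
      then obtain y where y: "\<And>n. y n \<in> D" "\<And>n. s < y n" "\<And>n. y n < min b (s + 1 / Suc n)" by metis
      have ylim: "y \<longlonglongrightarrow> s"
      proof (rule tendsto_sandwich[OF _ _ tendsto_const])
        show "(\<lambda>n. s + 1 / Suc n) \<longlonglongrightarrow> s"
          using tendsto_add[OF tendsto_const LIMSEQ_Suc[OF lim_1_over_n], of s] by simp
        show "\<forall>\<^sub>F n in sequentially. s \<le> y n" using y(2) by (simp add: less_imp_le)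
        show "\<forall>\<^sub>F n in sequentially. y n \<le> s + 1 / Suc n" using y(3) by (simp add: less_imp_le)
      qed
      have "(\<lambda>n. \<integral>x. g x * indicator {y n..b} x \<partial>lborel) \<longlonglongrightarrow> (\<integral>x. indicator {s<..} x * \<rho> x \<partial>lborel)"
      proof (rule integral_dominated_convergence)
        have [measurable]: "g \<in> borel_measurable borel"
          using g by (simp add: is_weak_deriv_def Lp_2_iff energy_measurable)
        show "(\<lambda>x. indicator {s<..} x * \<rho> x) \<in> borel_measurable lborel"
          "\<And>n. (\<lambda>x. g x * indicator {y n..b} x) \<in> borel_measurable lborel"
          unfolding \<rho>_def by measurable
        show "integrable lborel (\<lambda>x. \<bar>\<rho> x\<bar>)" using int by auto
        show "AE x in lborel. norm (g x * indicator {y n..b} x) \<le> \<bar>\<rho> x\<bar>" for n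
          using y(2)[of n] 3 by (intro AE_I2) (auto simp: \<rho>_def indicator_def)
        show "AE x in lborel. (\<lambda>n. g x * indicator {y n..b} x) \<longlonglongrightarrow> indicator {s<..} x * \<rho> x"
        proof (rule AE_I2)
          fix x
          show "(\<lambda>n. g x * indicator {y n..b} x) \<longlonglongrightarrow> indicator {s<..} x * \<rho> x"
          proof (cases "x > s")
            case True
            have "\<forall>\<^sub>F n in sequentially. y n < x" using ylim True by (rule order_tendstoD)
            then have "\<forall>\<^sub>F n in sequentially. g x * indicator {y n..b} x = indicator {s<..} x * \<rho> x"
              by eventually_elim (use True 3 in \<open>auto simp: \<rho>_def indicator_def\<close>)
            then show ?thesis by (rule tendsto_eventually)
          next
            case False
            then have "x < y n" for n using y(2)[of n] by linarith
            then have "(\<lambda>n. g x * indicator {y n..b} x) = (\<lambda>n. 0)"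
              by (simp add: fun_eq_iff indicator_def not_le)
            then show ?thesis using False by simp
          qed
        qed
      qed
      moreover have "(\<integral>x. g x * indicator {y n..b} x \<partial>lborel) = 0" for n
        using y[of n] 3 a0 b by (intro zero) auto
      ultimately show ?thesis by (simp add: LIMSEQ_const_iff)
    qed
  qed
  then have "AE x in lborel. x \<in> {a<..<b} \<longrightarrow> g x = 0"
    by eventually_elim (auto simp: \<rho>_def)
  then show "\<exists>V. open V \<and> z \<in> V \<and> (AE x in lborel. x \<in> V \<longrightarrow> g x = 0)"
    using a b by (intro exI[of _ "{a<..<b}"]) auto
qed

text \<open>On the open half-line the product of the two weak derivatives vanishes: the first is zero on \<open>U\<close>, the
  second on \<open>V\<close>.\<close>

lemma formE_local:
  assumes u: "u \<in> formD" and v: "v \<in> formD"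
    and U: "\<And>x. x \<in> U \<Longrightarrow> \<exists>W. open W \<and> x \<in> W \<and> W \<subseteq> {0<..} \<and> (AE y in lborel. y \<in> W \<longrightarrow> u y = 0)"
    and V: "open V" "V \<subseteq> {0<..}" "AE x in lborel. x \<in> V \<longrightarrow> v x = c"
    and cover: "{0<..} \<subseteq> U \<union> V"
  shows "formE u v = 0"
proof -
  obtain g k where g: "is_weak_deriv u g" and k: "is_weak_deriv v k"
    using weak_deriv_exists u v by metis
  have "AE x in lborel. x \<in> U \<longrightarrow> g x = 0"
  proof (rule AE_on_open_if_locally)
    fix x assume "x \<in> U"
    then obtain W where "open W" "x \<in> W" "W \<subseteq> {0<..}" "AE y in lborel. y \<in> W \<longrightarrow> u y = 0" using U by blast
    then show "\<exists>W. open W \<and> x \<in> W \<and> (AE y in lborel. y \<in> W \<longrightarrow> g y = 0)"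
      using weak_deriv_zero[OF u g] by blast
  qed
  moreover have "AE x in lborel. x \<in> V \<longrightarrow> k x = 0" by (rule weak_deriv_zero[OF v k V])
  ultimately have ae: "AE x in lborel. x > 0 \<longrightarrow> g x * k x = 0"
    by eventually_elim (use cover in auto)
  have gk: "(\<lambda>x. g x * k x) \<in> borel_measurable borel"
    using g k by (auto simp: is_weak_deriv_def Lp_2_iff energy_measurable)
  have "formE u v = (\<integral>x. gamma_density (2 - \<nu>) 1 x * (g x * k x) \<partial>lborel)"
    by (simp add: formE_weak_deriv[OF u g v k] inner_L2_def integral_energy[OF gk])
  also have "\<dots> = 0"
  proof (rule integral_eq_zero_AE)
    show "AE x in lborel. gamma_density (2 - \<nu>) 1 x * (g x * k x) = 0"
      using ae by eventually_elim (auto simp: gamma_density_def)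
  qed
  finally show ?thesis .
qed

end

section \<open>The compact space\<close>

definition speed_line :: "real \<Rightarrow> real measure" where
  "speed_line \<nu> = density lborel (\<lambda>x. ennreal (speed_density \<nu> x))"

definition speed_mass :: "real \<Rightarrow> real" where
  "speed_mass \<nu> = measure (speed_line \<nu>) UNIV"

text \<open>Negative arguments stand for infinity, where the distribution function reaches the total mass.\<close>

definition coord :: "real \<Rightarrow> real \<Rightarrow> real" where
  "coord \<nu> x = (if x < 0 then speed_mass \<nu> else cdf (speed_line \<nu>) x)"

definition half_line_metric :: "real \<Rightarrow> real metric" where
  "half_line_metric \<nu> = metric (half_line, \<lambda>x y. \<bar>coord \<nu> x - coord \<nu> y\<bar>)"

context laguerre
begin

lemma finite_borel_speed_line: "finite_borel_measure (speed_line \<nu>)"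
proof -
  have "emeasure (speed_line \<nu>) UNIV = (\<integral>\<^sup>+x. ennreal (speed_density \<nu> x) \<partial>lborel)"
    by (simp add: speed_line_def emeasure_density)
  also have "\<dots> = ennreal (Gamma (1 - \<nu>) / 1 powr (1 - \<nu>))"
    unfolding speed_density_def by (rule nn_integral_gamma_density) (use nu_less in auto)
  finally have "emeasure (speed_line \<nu>) (space (speed_line \<nu>)) \<noteq> \<infinity>"
    by (simp add: speed_line_def)
  then interpret finite_measure "speed_line \<nu>" by (rule finite_measureI)
  show ?thesis by unfold_locales (simp add: speed_line_def)
qed

sublocale line: finite_borel_measure "speed_line \<nu>" by (rule finite_borel_speed_line)

abbreviation "G \<equiv> cdf (speed_line \<nu>)"

lemma emeasure_speed_line: "A \<in> sets borel \<Longrightarrow> emeasure (speed_line \<nu>) A = (\<integral>\<^sup>+x. ennreal (speed_density \<nu> x) * indicator A x \<partial>lborel)"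
  by (simp add: speed_line_def emeasure_density)

lemma measure_speed_line_nonpos: "A \<in> sets borel \<Longrightarrow> A \<subseteq> {..0} \<Longrightarrow> measure (speed_line \<nu>) A = 0"
proof -
  assume A: "A \<in> sets borel" "A \<subseteq> {..0}"
  have "emeasure (speed_line \<nu>) A = (\<integral>\<^sup>+x. 0 \<partial>(lborel :: real measure))"
    unfolding emeasure_speed_line[OF A(1)]
    using A(2) by (intro nn_integral_cong) (auto simp: indicator_def speed_density_nonpos)
  then show ?thesis by (simp add: measure_def)
qed

lemma G_0: "G 0 = 0" by (simp add: cdf_def measure_speed_line_nonpos)

lemma isCont_G: "isCont G x"
proof -
  have "emeasure (speed_line \<nu>) {x} = (\<integral>\<^sup>+y. 0 \<partial>(lborel :: real measure))"
    unfolding emeasure_speed_line[OF borel_singleton[OF sets.empty_sets]]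
  proof (rule nn_integral_cong_AE)
    show "AE y in lborel. ennreal (speed_density \<nu> y) * indicator {x} y = 0"
      using AE_lborel_singleton[of x] by eventually_elim simp
  qed
  then have "measure (speed_line \<nu>) {x} = 0" by (simp add: measure_def)
  then show ?thesis by (simp add: line.isCont_cdf)
qed

lemma G_strict_mono:
  assumes "0 \<le> x" "x < y" shows "G x < G y"
proof -
  have "G y - G x = measure (speed_line \<nu>) {x<..y}" by (rule line.cdf_diff_eq[OF assms(2)])
  moreover have "measure (speed_line \<nu>) {x<..y} \<noteq> 0"
  proof
    assume "measure (speed_line \<nu>) {x<..y} = 0"
    then have "emeasure (speed_line \<nu>) {x<..y} = 0" by (simp add: line.emeasure_eq_measure)
    then have "AE z in lborel. ennreal (speed_density \<nu> z) * indicator {x<..y} z = 0"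
      by (subst (asm) emeasure_speed_line, simp, subst (asm) nn_integral_0_iff_AE) auto
    then have "AE z in lborel. z \<notin> {x<..y}"
    proof eventually_elim
      case (elim z)
      show ?case
      proof
        assume z: "z \<in> {x<..y}"
        then have "speed_density \<nu> z > 0" using assms by (simp add: speed_density_pos)
        with elim z show False by simp
      qed
    qed
    moreover have "{z \<in> space lborel. \<not> z \<notin> {x<..y}} = {x<..y}" by auto
    ultimately have "emeasure lborel {x<..y} = 0"
      using AE_iff_measurable[of "{x<..y}" lborel "\<lambda>z. z \<notin> {x<..y}"] by simp
    then show False using assms by simp
  qed
  moreover have "0 \<le> measure (speed_line \<nu>) {x<..y}" by simp
  ultimately show ?thesis by linarith
qed

lemma G_less_iff: "0 \<le> x \<Longrightarrow> 0 \<le> y \<Longrightarrow> G x < G y \<longleftrightarrow> x < y"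
  using G_strict_mono[of x y] G_strict_mono[of y x] by (cases x y rule: linorder_cases) auto

lemma G_less_mass: assumes "0 \<le> x" shows "G x < speed_mass \<nu>"
proof -
  have "G x < G (x + 1)" using assms by (intro G_strict_mono) auto
  also have "\<dots> \<le> speed_mass \<nu>" using line.cdf_bounded[of "x + 1"] by (simp add: speed_mass_def speed_line_def)
  finally show ?thesis .
qed

lemma mass_pos: "0 < speed_mass \<nu>"
  using G_less_mass[of 0] G_0 by simp

lemma G_onto:
  assumes "0 \<le> a" "a < speed_mass \<nu>" shows "\<exists>x\<ge>0. G x = a"
proof -
  have "\<forall>\<^sub>F x in at_top. a < G x"
    using line.cdf_lim_at_top assms by (intro order_tendstoD) (auto simp: speed_mass_def speed_line_def)
  then obtain b where b: "\<And>x. x \<ge> b \<Longrightarrow> a < G x" by (auto simp: eventually_at_top_linorder)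
  have "\<exists>x\<ge>0. x \<le> max b 0 \<and> G x = a"
    by (rule IVT) (use assms b[of "max b 0"] isCont_G G_0 in auto)
  then show ?thesis by blast
qed

lemma coord_nonneg_eq: "x \<ge> 0 \<Longrightarrow> coord \<nu> x = G x" by (simp add: coord_def)
lemma coord_inf: "coord \<nu> (- 1) = speed_mass \<nu>" by (simp add: coord_def)

lemma coord_bounds: "x \<in> half_line \<Longrightarrow> 0 \<le> coord \<nu> x \<and> coord \<nu> x \<le> speed_mass \<nu>"
  using G_less_mass[of x] line.cdf_nonneg mass_pos by (auto simp: coord_def half_line_def)

lemma coord_inj:
  assumes "x \<in> half_line" "y \<in> half_line" "coord \<nu> x = coord \<nu> y" shows "x = y"
proof -
  consider "x = -1" "y = -1" | "x = -1" "y \<ge> 0" | "x \<ge> 0" "y = -1" | "x \<ge> 0" "y \<ge> 0"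
    using assms by (auto simp: half_line_def)
  then show ?thesis
  proof cases
    case 2
    then show ?thesis using assms(3) G_less_mass[of y] by (simp add: coord_inf coord_nonneg_eq)
  next
    case 3
    then show ?thesis using assms(3) G_less_mass[of x] by (simp add: coord_inf coord_nonneg_eq)
  next
    case 4
    then show ?thesis using assms(3) G_less_iff[of x y] G_less_iff[of y x]
      by (auto simp: coord_nonneg_eq not_less_iff_gr_or_eq)
  qed simp
qed

lemma coord_surj:
  assumes "0 \<le> a" "a \<le> speed_mass \<nu>" shows "\<exists>x\<in>half_line. coord \<nu> x = a"
proof (cases "a = speed_mass \<nu>")
  case True
  then show ?thesis by (intro bexI[of _ "-1"]) (auto simp: coord_inf half_line_def)
next
  case False
  then obtain x where "x \<ge> 0" "G x = a" using G_onto[of a] assms by auto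
  then show ?thesis by (intro bexI[of _ x]) (auto simp: coord_nonneg_eq half_line_def)
qed

sublocale line_metric: Metric_space half_line "\<lambda>x y. \<bar>coord \<nu> x - coord \<nu> y\<bar>"
  by unfold_locales (auto intro: coord_inj)

abbreviation "X \<equiv> half_line_metric \<nu>"

lemma X_simps: "mspace X = half_line" "mdist X = (\<lambda>x y. \<bar>coord \<nu> x - coord \<nu> y\<bar>)"
  "mtopology_of X = line_metric.mtopology" "mball_of X = line_metric.mball"
  by (simp_all add: half_line_metric_def)

lemma compact_X: "compact_space (mtopology_of X)"
  unfolding X_simps line_metric.compact_space_sequentially
proof (intro allI impI)
  fix \<sigma> :: "nat \<Rightarrow> real" assume \<sigma>: "range \<sigma> \<subseteq> half_line"
  have "seq_compact {0..speed_mass \<nu>}" by (simp add: compact_imp_seq_compact)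
  moreover have "\<forall>n. coord \<nu> (\<sigma> n) \<in> {0..speed_mass \<nu>}" using \<sigma> coord_bounds by auto
  ultimately obtain a r where a: "a \<in> {0..speed_mass \<nu>}" "strict_mono r" "((\<lambda>n. coord \<nu> (\<sigma> n)) \<circ> r) \<longlonglongrightarrow> a"
    by (rule seq_compactE) blast
  then obtain l where l: "l \<in> half_line" "coord \<nu> l = a" using coord_surj[of a] by auto
  have "limitin line_metric.mtopology (\<sigma> \<circ> r) l sequentially"
    unfolding line_metric.limit_metric_sequentially
  proof (intro conjI allI impI l)
    fix \<epsilon> :: real assume "\<epsilon> > 0"
    then obtain N where "\<And>n. n \<ge> N \<Longrightarrow> \<bar>coord \<nu> (\<sigma> (r n)) - a\<bar> < \<epsilon>"
      using LIMSEQ_D[OF a(3)] by (auto simp: o_def)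
    then show "\<exists>N. \<forall>n\<ge>N. (\<sigma> \<circ> r) n \<in> half_line \<and> \<bar>coord \<nu> ((\<sigma> \<circ> r) n) - coord \<nu> l\<bar> < \<epsilon>"
      using \<sigma> l by (intro exI[of _ N]) auto
  qed
  then show "\<exists>l r. l \<in> half_line \<and> strict_mono r \<and> limitin line_metric.mtopology (\<sigma> \<circ> r) l sequentially"
    using l a by blast
qed

lemma pos_half_line: "x > 0 \<Longrightarrow> x \<in> half_line" by (simp add: half_line_def)

lemma openin_trace_open:
  assumes "openin (mtopology_of X) U" shows "open (U \<inter> {0<..})"
proof (rule openI)
  fix x assume x: "x \<in> U \<inter> {0<..}"
  then obtain r where r: "r > 0" "line_metric.mball x r \<subseteq> U"
    using assms unfolding X_simps line_metric.openin_mtopology by blast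
  obtain d where d: "d > 0" "\<And>y. dist y x < d \<Longrightarrow> dist (G y) (G x) < r"
    using isCont_G[of x] r(1) unfolding continuous_at_eps_delta by blast
  have "ball x (min d x) \<subseteq> U \<inter> {0<..}"
  proof
    fix y assume "y \<in> ball x (min d x)"
    then have y: "dist y x < d" "y > 0" using x by (auto simp: dist_real_def)
    then have "y \<in> line_metric.mball x r"
      using d(2)[OF y(1)] x pos_half_line[of x] pos_half_line[of y]
      by (simp add: coord_nonneg_eq dist_real_def abs_minus_commute)
    then show "y \<in> U \<inter> {0<..}" using r y by auto
  qed
  then show "\<exists>e>0. ball x e \<subseteq> U \<inter> {0<..}" using d x by (intro exI[of _ "min d x"]) auto
qed

lemma openin_coord_greater: "openin (mtopology_of X) {x \<in> half_line. c < coord \<nu> x}"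
  unfolding X_simps line_metric.openin_mtopology
proof (intro conjI allI impI)
  fix x assume x: "x \<in> {x \<in> half_line. c < coord \<nu> x}"
  then have "line_metric.mball x (coord \<nu> x - c) \<subseteq> {x \<in> half_line. c < coord \<nu> x}"
    by (auto simp: line_metric.in_mball)
  then show "\<exists>r>0. line_metric.mball x r \<subseteq> {x \<in> half_line. c < coord \<nu> x}"
    using x by (intro exI[of _ "coord \<nu> x - c"]) auto
qed auto

text \<open>On the open half-line the metric topology is the usual one because the coordinate is continuous; the
  two remaining points are closed.\<close>

lemma borel_X: "borel_measure_on X (speed_measure \<nu>)"
  unfolding borel_measure_on_def
proof
  show "space (speed_measure \<nu>) = mspace X" by (simp add: space_speed X_simps)
  let ?O = "{U. openin (mtopology_of X) U}"
  have sub: "?O \<subseteq> Pow half_line"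
    using openin_subset[of "mtopology_of X"] by (auto simp: X_simps)
  show "sets (speed_measure \<nu>) = sigma_sets (mspace X) ?O"
  proof
    show "sigma_sets (mspace X) ?O \<subseteq> sets (speed_measure \<nu>)"
      unfolding X_simps(1) space_speed[of \<nu>, symmetric]
    proof (rule sets.sigma_sets_subset)
      show "?O \<subseteq> sets (speed_measure \<nu>)"
      proof
        fix U assume "U \<in> ?O"
        then have U: "open (U \<inter> {0<..})" "U \<subseteq> half_line" using openin_trace_open sub by auto
        have "U = (U \<inter> {0<..}) \<union> (U \<inter> {-1, 0})" using U(2) by (auto simp: half_line_def)
        moreover have "finite (U \<inter> {-1, 0})" by simp
        ultimately have "U \<in> sets borel"
          using U(1) by (metis borel_open finite_imp_closed borel_closed sets.Un)
        then show "U \<in> sets (speed_measure \<nu>)"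
          using U(2) by (simp add: sets_speed sets_restrict_space_iff)
      qed
    qed
  next
    define \<Sigma> where "\<Sigma> = sigma half_line ?O"
    have space\<Sigma>: "space \<Sigma> = half_line" using sub by (simp add: \<Sigma>_def)
    have sets\<Sigma>: "sets \<Sigma> = sigma_sets half_line ?O" using sub by (simp add: \<Sigma>_def)
    have inf: "{x \<in> half_line. speed_mass \<nu> \<le> coord \<nu> x} = {-1}"
      using G_less_mass by (auto simp: coord_def half_line_def not_le[symmetric])
    have "{-1} \<in> sets \<Sigma>"
    proof -
      \<comment> \<open>The point at infinity is where the coordinate is maximal.\<close>
      have "{x \<in> half_line. c < coord \<nu> x} \<in> sets \<Sigma>" for c
        unfolding sets\<Sigma> using openin_coord_greater by (intro sigma_sets.Basic) simp
      then have "coord \<nu> \<in> borel_measurable \<Sigma>" by (intro borel_measurableI_greater) (simp add: space\<Sigma>)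
      then have "{x \<in> space \<Sigma>. speed_mass \<nu> \<le> coord \<nu> x} \<in> sets \<Sigma>" by measurable
      then show ?thesis by (simp add: space\<Sigma> inf)
    qed
    note inf_meas = this
    have id: "(\<lambda>x. x) \<in> borel_measurable \<Sigma>"
    proof (rule borel_measurableI_greater)
      fix y :: real
      consider "y \<ge> 0" | "-1 \<le> y" "y < 0" | "y < -1" by linarith
      then show "{x \<in> space \<Sigma>. y < x} \<in> sets \<Sigma>"
      proof cases
        case 1
        have "y < x \<longleftrightarrow> G y < coord \<nu> x \<and> x \<noteq> -1" if x: "x \<in> half_line" for x
        proof (cases "x = -1")
          case False
          then have "x \<ge> 0" using x by (auto simp: half_line_def)
          then show ?thesis using 1 G_less_iff[of y x] by (simp add: coord_nonneg_eq)
        qed (use 1 in simp)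
        then have "{x \<in> space \<Sigma>. y < x} = {x \<in> half_line. G y < coord \<nu> x} - {-1}"
          by (auto simp: space\<Sigma>)
        moreover have "{x \<in> half_line. G y < coord \<nu> x} \<in> sets \<Sigma>"
          unfolding sets\<Sigma> using openin_coord_greater by (intro sigma_sets.Basic) simp
        ultimately show ?thesis using inf_meas by auto
      next
        case 2
        then have "{x \<in> space \<Sigma>. y < x} = space \<Sigma> - {-1}" by (auto simp: space\<Sigma> half_line_def)
        then show ?thesis using inf_meas by auto
      next
        case 3
        then have "{x \<in> space \<Sigma>. y < x} = space \<Sigma>" by (auto simp: space\<Sigma> half_line_def)
        then show ?thesis by auto
      qed
    qed
    show "sets (speed_measure \<nu>) \<subseteq> sigma_sets (mspace X) ?O"
    proof
      fix A assume "A \<in> sets (speed_measure \<nu>)"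
      then have A: "A \<in> sets borel" "A \<subseteq> half_line" by (auto simp: sets_speed sets_restrict_space_iff)
      have "(\<lambda>x. x) -` A \<inter> space \<Sigma> \<in> sets \<Sigma>" by (rule measurable_sets[OF id A(1)])
      moreover have "(\<lambda>x. x) -` A \<inter> space \<Sigma> = A" using A by (auto simp: space\<Sigma>)
      ultimately show "A \<in> sigma_sets (mspace X) ?O" by (simp add: sets\<Sigma> X_simps)
    qed
  qed
qed

lemma measure_coord_interval:
  assumes "0 \<le> lo" "lo < hi" "hi \<le> speed_mass \<nu>"
  shows "measure (speed_line \<nu>) {y. 0 < y \<and> lo < G y \<and> G y < hi} = hi - lo"
proof -
  obtain y1 where y1: "y1 \<ge> 0" "G y1 = lo" using G_onto[of lo] assms by auto
  have iff: "G a < G b \<longleftrightarrow> a < b" if "0 \<le> a" "0 \<le> b" for a b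
    using G_less_iff[OF that] .
  show ?thesis
  proof (cases "hi = speed_mass \<nu>")
    case True
    then have "{y. 0 < y \<and> lo < G y \<and> G y < hi} = UNIV - {..y1}"
      using y1 iff[of y1] G_less_mass by auto
    then show ?thesis
      using line.finite_measure_compl[of "{..y1}"] True y1
      by (simp add: cdf_def speed_mass_def speed_line_def)
  next
    case False
    then obtain y2 where y2: "y2 \<ge> 0" "G y2 = hi" using G_onto[of hi] assms by auto
    have lt: "y1 < y2" using iff[of y1 y2] y1 y2 assms by auto
    have "{y. 0 < y \<and> lo < G y \<and> G y < hi} = {y1<..y2} - {y2}"
      using y1 y2 iff by auto
    moreover have "measure (speed_line \<nu>) ({y1<..y2} - {y2}) = measure (speed_line \<nu>) {y1<..y2} - measure (speed_line \<nu>) {y2}"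
      using lt by (intro line.finite_measure_Diff) auto
    moreover have "measure (speed_line \<nu>) {y2} = 0" using isCont_G by (simp add: line.isCont_cdf)
    ultimately show ?thesis using line.cdf_diff_eq[OF lt] y1 y2 by simp
  qed
qed

text \<open>In the coordinate the measure is Lebesgue measure on an interval, and the part of a ball inside the
  interval has length between \<open>r\<close> and \<open>2 * r\<close> as long as \<open>r\<close> is less than the length of the interval.\<close>

lemma ahlfors_X: "ahlfors_regular X (speed_measure \<nu>)"
  unfolding ahlfors_regular_def
proof (rule exI[of _ 1], intro conjI, simp, rule exI[of _ 1], intro conjI, simp, rule exI[of _ 2], intro conjI, simp,
    intro ballI allI impI)
  fix x r :: real assume x: "x \<in> mspace X" and r: "r > 0" and "\<exists>y\<in>mspace X. \<exists>z\<in>mspace X. r < mdist X y z"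
  then obtain y z where yz: "y \<in> half_line" "z \<in> half_line" "r < \<bar>coord \<nu> y - coord \<nu> z\<bar>"
    by (auto simp: X_simps)
  have rT: "r < speed_mass \<nu>" using coord_bounds[OF yz(1)] coord_bounds[OF yz(2)] yz(3) by linarith
  have xS: "x \<in> half_line" using x by (simp add: X_simps)
  define a where "a = coord \<nu> x"
  have a: "0 \<le> a" "a \<le> speed_mass \<nu>" using coord_bounds[OF xS] by (auto simp: a_def)
  define lo hi where "lo = max 0 (a - r)" and "hi = min (speed_mass \<nu>) (a + r)"
  have lohi: "0 \<le> lo" "lo < hi" "hi \<le> speed_mass \<nu>" "r \<le> hi - lo" "hi - lo \<le> 2 * r"
    using a r rT by (auto simp: lo_def hi_def min_def max_def)
  have ball: "mball_of X x r = {y \<in> half_line. \<bar>a - coord \<nu> y\<bar> < r}"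
    using xS by (auto simp: X_simps a_def)
  have ball_borel: "mball_of X x r \<in> sets (speed_measure \<nu>)"
    using borel_X unfolding borel_measure_on_def X_simps
    by (auto intro!: sigma_sets.Basic line_metric.openin_mball)
  have "emeasure (speed_measure \<nu>) (mball_of X x r) = emeasure (speed_line \<nu>) (mball_of X x r)"
    using ball_borel unfolding speed_measure_def speed_line_def
    by (intro emeasure_restrict_space) (auto simp: sets_restrict_space_iff ball)
  also have "\<dots> = emeasure (speed_line \<nu>) {y. 0 < y \<and> lo < G y \<and> G y < hi}"
  proof (rule emeasure_eq_AE)
    show "AE y in speed_line \<nu>. y \<in> mball_of X x r \<longleftrightarrow> y \<in> {y. 0 < y \<and> lo < G y \<and> G y < hi}"
      unfolding speed_line_def
    proof (subst AE_density, measurable, rule AE_I2, rule impI)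
      fix y assume "0 < ennreal (speed_density \<nu> y)"
      then have y: "y > 0" using speed_density_nonpos[of y \<nu>] by (cases "y > 0") auto
      then have "0 < G y" "G y < speed_mass \<nu>" using G_strict_mono[of 0 y] G_0 G_less_mass[of y] by auto
      then show "(y \<in> mball_of X x r) = (y \<in> {y. 0 < y \<and> lo < cdf (density lborel (\<lambda>x. ennreal (speed_density \<nu> x))) y \<and> cdf (density lborel (\<lambda>x. ennreal (speed_density \<nu> x))) y < hi})"
        unfolding ball speed_line_def[symmetric]
        using y by (auto simp: coord_nonneg_eq half_line_def lo_def hi_def)
    qed
    have "mball_of X x r \<in> sets borel"
      using ball_borel by (simp add: sets_speed sets_restrict_space_iff)
    then show "mball_of X x r \<in> sets (speed_line \<nu>)" by (simp add: speed_line_def)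
    have "continuous_on UNIV G" using isCont_G by (simp add: continuous_on_eq_continuous_at)
    then have [measurable]: "G \<in> borel_measurable borel" by (rule borel_measurable_continuous_onI)
    have "{y. 0 < y \<and> lo < G y \<and> G y < hi} \<in> sets borel" by measurable
    then show "{y. 0 < y \<and> lo < G y \<and> G y < hi} \<in> sets (speed_line \<nu>)" by (simp add: line.M_is_borel)
  qed
  also have "\<dots> = ennreal (hi - lo)"
    using measure_coord_interval[OF lohi(1-3)] by (simp add: line.emeasure_eq_measure)
  finally have "emeasure (speed_measure \<nu>) (mball_of X x r) = ennreal (hi - lo)" .
  then show "ennreal (1 * r powr 1) \<le> emeasure (speed_measure \<nu>) (mball_of X x r) \<and>
       emeasure (speed_measure \<nu>) (mball_of X x r) \<le> ennreal (2 * r powr 1)"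
    using lohi r by (auto intro!: ennreal_leI)
qed

lemma strongly_local_formE: "strongly_local X (speed_measure \<nu>) formD formE"
  unfolding strongly_local_def
proof (intro ballI impI)
  fix u v assume u: "u \<in> formD" and v: "v \<in> formD"
    and "\<exists>V c. openin (mtopology_of X) V \<and> ess_support X (speed_measure \<nu>) u \<subseteq> V \<and>
         (AE x in speed_measure \<nu>. x \<in> V \<longrightarrow> v x = c)"
  then obtain V c where V: "openin (mtopology_of X) V" "ess_support X (speed_measure \<nu>) u \<subseteq> V"
    "AE x in speed_measure \<nu>. x \<in> V \<longrightarrow> v x = c" by blast
  define U where "U = (half_line - ess_support X (speed_measure \<nu>) u) \<inter> {0<..}"
  show "formE u v = 0"
  proof (rule formE_local[OF u v, of U "V \<inter> {0<..}" c])
    show "open (V \<inter> {0<..})" by (rule openin_trace_open[OF V(1)])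
    show "AE x in lborel. x \<in> V \<inter> {0<..} \<longrightarrow> v x = c"
      using V(3) unfolding AE_speed_iff by eventually_elim auto
    show "{0<..} \<subseteq> U \<union> V \<inter> {0<..}" using V(2) by (auto simp: U_def half_line_def)
    fix x assume x: "x \<in> U"
    then obtain W where W: "openin (mtopology_of X) W" "AE y in speed_measure \<nu>. y \<in> W \<longrightarrow> u y = 0" "x \<in> W"
      unfolding U_def ess_support_def X_simps by blast
    have "AE y in lborel. y \<in> W \<inter> {0<..} \<longrightarrow> u y = 0"
      using W(2) unfolding AE_speed_iff by eventually_elim auto
    then show "\<exists>W. open W \<and> x \<in> W \<and> W \<subseteq> {0<..} \<and> (AE y in lborel. y \<in> W \<longrightarrow> u y = 0)"
      using openin_trace_open[OF W(1)] W(3) x by (intro exI[of _ "W \<inter> {0<..}"]) (auto simp: U_def)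
  qed auto
qed

end

section \<open>Negative powers\<close>

definition time_weight :: "real \<Rightarrow> real \<Rightarrow> real" where
  "time_weight \<sigma> t = indicator {0<..} t * t powr (\<sigma> - 1)"

lemma time_weight_measurable [measurable]: "time_weight \<sigma> \<in> borel_measurable borel"
  unfolding time_weight_def by measurable

lemma time_weight_nonneg: "0 \<le> time_weight \<sigma> t"
  by (simp add: time_weight_def)

lemma time_weight_exp: "time_weight \<sigma> t * exp (- b * t) = gamma_density \<sigma> b t"
  by (simp add: time_weight_def gamma_density_def)

lemma neg_power_kernel_time_weight:
  "neg_power_kernel h \<sigma> x y = (\<integral>t. time_weight \<sigma> t * h t x y \<partial>lborel) / Gamma \<sigma>"
  by (simp add: neg_power_kernel_def set_lebesgue_integral_def time_weight_def mult.assoc)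

text \<open>The image of \<open>mono_exp \<nu> 0 s\<close> under the differential operator
  \<open>- (x f'' + (1 - \<nu> - x) f')\<close>.\<close>

definition gen_exp :: "real \<Rightarrow> real \<Rightarrow> real \<Rightarrow> real" where
  "gen_exp \<nu> s y = (\<nu> + s * (1 + \<nu>)) * mono_exp \<nu> 0 s y - s * (1 + s) * mono_exp \<nu> 1 s y"

lemma gen_exp_measurable [measurable]: "gen_exp \<nu> s \<in> borel_measurable borel"
  unfolding gen_exp_def by measurable

lemma gen_exp_measurable2 [measurable]:
  assumes [measurable]: "S \<in> borel_measurable N" "Y \<in> borel_measurable N"
  shows "(\<lambda>p. gen_exp \<nu> (S p) (Y p)) \<in> borel_measurable N"
  unfolding gen_exp_def mono_exp_def by measurable

text \<open>With this notation the semigroup sends \<open>mono_exp \<nu> 0 s\<close> to a multiple of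
  \<open>mono_exp \<nu> 0 (s * exp (- t) / flow s t)\<close>.\<close>

definition flow :: "real \<Rightarrow> real \<Rightarrow> real" where
  "flow s t = 1 + s * (1 - exp (- t))"

lemma flow_ge_1: "s \<ge> 0 \<Longrightarrow> t \<ge> 0 \<Longrightarrow> 1 \<le> flow s t"
  by (simp add: flow_def)

lemma flow_measurable [measurable]: "flow s \<in> borel_measurable borel"
  unfolding flow_def by measurable

context laguerre
begin

abbreviation "\<mu> \<equiv> speed_measure \<nu>"
abbreviation "h \<equiv> heat_ker \<nu>"

lemma heat_exp_eq:
  assumes t: "t > 0" and s: "s \<ge> 0" and x: "x > 0"
  shows "has_bochner_integral \<mu> (\<lambda>y. h t x y * mono_exp \<nu> 0 s y)
    (exp (- \<nu> * t) * flow s t powr (- (1 + \<nu>)) * mono_exp \<nu> 0 (s * exp (- t) / flow s t) x)"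
  unfolding flow_def by (rule heat_ker_exp[OF nu_pos t x s refl refl refl refl])

lemma heat_exp_le:
  assumes t: "t > 0" and s: "s \<ge> 0" and x: "x > 0"
  shows "exp (- \<nu> * t) * flow s t powr (- (1 + \<nu>)) * mono_exp \<nu> 0 (s * exp (- t) / flow s t) x
    \<le> exp (- \<nu> * t) * x powr \<nu>"
proof -
  have F: "1 \<le> flow s t" using s t by (intro flow_ge_1) auto
  have "flow s t powr (- (1 + \<nu>)) \<le> flow s t powr 0" using F nu_pos by (intro powr_mono) auto
  then have a: "flow s t powr (- (1 + \<nu>)) \<le> 1" using F by simp
  have b: "exp (- (s * exp (- t) / flow s t * x)) \<le> 1" using F s x by simp
  have "exp (- \<nu> * t) * flow s t powr (- (1 + \<nu>)) * mono_exp \<nu> 0 (s * exp (- t) / flow s t) x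
     = (exp (- \<nu> * t) * x powr \<nu>) * (flow s t powr (- (1 + \<nu>)) * exp (- (s * exp (- t) / flow s t * x)))"
    by (simp add: mono_exp_def)
  also have "\<dots> \<le> (exp (- \<nu> * t) * x powr \<nu>) * (1 * 1)"
    using a b by (intro mult_left_mono mult_mono) auto
  finally show ?thesis by simp
qed

text \<open>The semigroup commutes with its generator, so it acts on the images \<open>gen_exp \<nu> s\<close> as it does on the
  exponentials. At late times the new parameter is bounded, and so is the coefficient in
  \<open>gen_exp\<close>; the images of the two summands of \<open>gen_exp \<nu> s\<close>, taken separately, keep coefficients of order
  \<open>s\<close>.\<close>

lemma gen_exp_heat:
  assumes t: "t > 0" and s: "s \<ge> 0" and x: "x > 0"
  shows "has_bochner_integral \<mu> (\<lambda>y. h t x y * gen_exp \<nu> s y)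
    (exp (- \<nu> * t) * flow s t powr (- (1 + \<nu>)) * gen_exp \<nu> (s * exp (- t) / flow s t) x)"
proof -
  define q where "q = exp (- t)"
  define B where "B = flow s t"
  define c where "c = exp (- \<nu> * t) * B powr (- (1 + \<nu>))"
  define s' where "s' = s * q / B"
  define P where "P = mono_exp \<nu> 0 s' x"
  have B: "B \<ge> 1" unfolding B_def using s t by (intro flow_ge_1) auto
  have Bq: "B = 1 + s * (1 - q)" by (simp add: B_def flow_def q_def)
  have i0: "has_bochner_integral \<mu> (\<lambda>y. h t x y * mono_exp \<nu> 0 s y) (c * P)"
    using heat_exp_eq[OF t s x] by (simp add: c_def B_def P_def s'_def q_def)
  have i1: "has_bochner_integral \<mu> (\<lambda>y. h t x y * mono_exp \<nu> 1 s y)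
      (c * ((1 + \<nu>) * (1 - q) / B + q * x / B\<^sup>2) * P)"
    using heat_ker_mono_exp_1[OF nu_pos t x s refl refl refl refl]
    by (simp add: c_def P_def s'_def q_def Bq)
  have "has_bochner_integral \<mu> (\<lambda>y. (\<nu> + s * (1 + \<nu>)) * (h t x y * mono_exp \<nu> 0 s y)
        - (s * (1 + s)) * (h t x y * mono_exp \<nu> 1 s y))
     ((\<nu> + s * (1 + \<nu>)) * (c * P) - (s * (1 + s)) * (c * ((1 + \<nu>) * (1 - q) / B + q * x / B\<^sup>2) * P))"
    by (intro has_bochner_integral_diff has_bochner_integral_mult_right i0 i1)
  moreover have "(\<lambda>y. (\<nu> + s * (1 + \<nu>)) * (h t x y * mono_exp \<nu> 0 s y)
        - (s * (1 + s)) * (h t x y * mono_exp \<nu> 1 s y)) = (\<lambda>y. h t x y * gen_exp \<nu> s y)"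
    by (simp add: fun_eq_iff gen_exp_def algebra_simps)
  moreover have "(\<nu> + s * (1 + \<nu>)) * (c * P) - (s * (1 + s)) * (c * ((1 + \<nu>) * (1 - q) / B + q * x / B\<^sup>2) * P)
     = c * gen_exp \<nu> s' x"
  proof -
    have m1: "mono_exp \<nu> 1 s' x = x * P" by (simp add: P_def mono_exp_def)
    have "1 + s' = (1 + s) / B" using B by (simp add: s'_def field_simps) (simp add: Bq algebra_simps)
    then have e1: "s' * (1 + s') = s * (1 + s) * q / B\<^sup>2" by (simp add: s'_def power2_eq_square)
    have "s * (1 + \<nu>) - s * (1 + s) * ((1 + \<nu>) * (1 - q) / B) = s * (1 + \<nu>) * (B - (1 + s) * (1 - q)) / B"
      using B by (simp add: field_simps)
    also have "B - (1 + s) * (1 - q) = q" by (simp add: Bq algebra_simps)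
    finally have e2: "s * (1 + \<nu>) - s * (1 + s) * ((1 + \<nu>) * (1 - q) / B) = s' * (1 + \<nu>)"
      by (simp add: s'_def)
    have "(\<nu> + s * (1 + \<nu>)) * (c * P) - (s * (1 + s)) * (c * ((1 + \<nu>) * (1 - q) / B + q * x / B\<^sup>2) * P)
       = c * P * (\<nu> + (s * (1 + \<nu>) - s * (1 + s) * ((1 + \<nu>) * (1 - q) / B)) - (s * (1 + s) * q / B\<^sup>2) * x)"
      by (simp add: algebra_simps)
    also have "\<dots> = c * gen_exp \<nu> s' x"
      unfolding e2 e1[symmetric] gen_exp_def m1 P_def[symmetric] by (simp add: algebra_simps)
    finally show ?thesis .
  qed
  ultimately show ?thesis by (simp add: c_def B_def s'_def q_def mult.assoc)
qed

end

locale laguerre_power = laguerre +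
  fixes \<sigma> :: real
  assumes sigma: "0 < \<sigma>" "\<sigma> < 1"
begin

abbreviation "K \<equiv> neg_power_kernel h \<sigma>"

lemma Gamma_sigma: "Gamma \<sigma> > 0" using sigma by (intro Gamma_real_pos)

lemma K_sym: "K x y = K y x"
  unfolding neg_power_kernel_time_weight by (simp add: heat_ker_sym[of \<nu> _ x y])

lemma K_nonneg: "0 \<le> K x y"
  unfolding neg_power_kernel_time_weight using Gamma_sigma
  by (intro divide_nonneg_pos Bochner_Integration.integral_nonneg mult_nonneg_nonneg time_weight_nonneg heat_ker_nonneg nu_pos)

lemma K_measurable [measurable]:
  assumes [measurable]: "f \<in> borel_measurable N" "g \<in> borel_measurable N"
  shows "(\<lambda>p. K (f p) (g p)) \<in> borel_measurable N"
  unfolding neg_power_kernel_time_weight by measurable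

lemma K_le_nn:
  "ennreal (K x y) \<le> ennreal (1 / Gamma \<sigma>) * (\<integral>\<^sup>+t. ennreal (time_weight \<sigma> t * h t x y) \<partial>lborel)"
proof -
  have "ennreal (\<integral>t. time_weight \<sigma> t * h t x y \<partial>lborel) \<le> (\<integral>\<^sup>+t. ennreal (time_weight \<sigma> t * h t x y) \<partial>lborel)"
  proof (cases "integrable lborel (\<lambda>t. time_weight \<sigma> t * h t x y)")
    case True
    then show ?thesis
      by (subst nn_integral_eq_integral) (auto intro!: mult_nonneg_nonneg time_weight_nonneg heat_ker_nonneg nu_pos)
  qed (simp add: not_integrable_integral_eq)
  then have "ennreal (1 / Gamma \<sigma>) * ennreal (\<integral>t. time_weight \<sigma> t * h t x y \<partial>lborel)
      \<le> ennreal (1 / Gamma \<sigma>) * (\<integral>\<^sup>+t. ennreal (time_weight \<sigma> t * h t x y) \<partial>lborel)"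
    by (rule mult_left_mono) simp
  then show ?thesis using Gamma_sigma
    by (simp add: neg_power_kernel_time_weight ennreal_mult'[symmetric])
qed

lemma snd_speed_measurable [measurable]: "snd \<in> borel_measurable (lborel \<Otimes>\<^sub>M \<mu>)"
  by (rule speed_snd)

lemma fst_lborel_measurable [measurable]: "fst \<in> borel_measurable (lborel \<Otimes>\<^sub>M \<mu>)"
  by (rule measurable_compose[OF measurable_fst, of "\<lambda>x. x"]) auto

lemma exp_potential_le:
  assumes s: "s \<ge> 0" and x: "x > 0"
  shows "(\<integral>\<^sup>+t. \<integral>\<^sup>+y. ennreal (time_weight \<sigma> t * h t x y * mono_exp \<nu> 0 s y) \<partial>\<mu> \<partial>lborel)
    \<le> ennreal (Gamma \<sigma> / \<nu> powr \<sigma> * x powr \<nu>)"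
proof -
  have "(\<integral>\<^sup>+y. ennreal (time_weight \<sigma> t * h t x y * mono_exp \<nu> 0 s y) \<partial>\<mu>)
     \<le> ennreal (gamma_density \<sigma> \<nu> t) * ennreal (x powr \<nu>)" for t
  proof (cases "t > 0")
    case True
    let ?v = "exp (- \<nu> * t) * flow s t powr (- (1 + \<nu>)) * mono_exp \<nu> 0 (s * exp (- t) / flow s t) x"
    have I: "has_bochner_integral \<mu> (\<lambda>y. time_weight \<sigma> t * (h t x y * mono_exp \<nu> 0 s y)) (time_weight \<sigma> t * ?v)"
      by (intro has_bochner_integral_mult_right heat_exp_eq[OF True s x])
    have "(\<integral>\<^sup>+y. ennreal (time_weight \<sigma> t * h t x y * mono_exp \<nu> 0 s y) \<partial>\<mu>) = ennreal (time_weight \<sigma> t * ?v)"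
      using I unfolding mult.assoc
      by (subst nn_integral_eq_integral)
         (auto simp: has_bochner_integral_iff mono_exp_def intro!: mult_nonneg_nonneg time_weight_nonneg heat_ker_nonneg nu_pos)
    also have "\<dots> \<le> ennreal (time_weight \<sigma> t * (exp (- \<nu> * t) * x powr \<nu>))"
      by (intro ennreal_leI mult_left_mono heat_exp_le True s x time_weight_nonneg)
    also have "time_weight \<sigma> t * (exp (- \<nu> * t) * x powr \<nu>) = gamma_density \<sigma> \<nu> t * x powr \<nu>"
      using time_weight_exp[of \<sigma> t \<nu>] by (simp add: mult.assoc[symmetric])
    finally show ?thesis by (simp add: ennreal_mult gamma_density_nonneg)
  qed (simp add: time_weight_def)
  then have "(\<integral>\<^sup>+t. \<integral>\<^sup>+y. ennreal (time_weight \<sigma> t * h t x y * mono_exp \<nu> 0 s y) \<partial>\<mu> \<partial>lborel)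
     \<le> (\<integral>\<^sup>+t. ennreal (gamma_density \<sigma> \<nu> t) * ennreal (x powr \<nu>) \<partial>lborel)"
    by (intro nn_integral_mono)
  also have "\<dots> = ennreal (Gamma \<sigma> / \<nu> powr \<sigma>) * ennreal (x powr \<nu>)"
    using nn_integral_gamma_density[OF sigma(1) nu_pos] by (subst nn_integral_multc) auto
  also have "\<dots> = ennreal (Gamma \<sigma> / \<nu> powr \<sigma> * x powr \<nu>)"
    by (rule ennreal_mult'[symmetric]) (use Gamma_sigma in simp)
  finally show ?thesis .
qed

lemma K_exp_le:
  assumes s: "s \<ge> 0" and x: "x > 0"
  shows "(\<integral>\<^sup>+y. ennreal (K x y * mono_exp \<nu> 0 s y) \<partial>\<mu>) \<le> ennreal (1 / \<nu> powr \<sigma> * x powr \<nu>)"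
proof -
  interpret P: pair_sigma_finite lborel \<mu> ..
  have m0: "0 \<le> mono_exp \<nu> 0 s y" for y by (simp add: mono_exp_def)
  have meas [measurable]: "(\<lambda>y. y) \<in> borel_measurable \<mu>" by (rule speed_measurable_borel) simp
  have "(\<integral>\<^sup>+y. ennreal (K x y * mono_exp \<nu> 0 s y) \<partial>\<mu>)
     \<le> (\<integral>\<^sup>+y. ennreal (1 / Gamma \<sigma>) * (\<integral>\<^sup>+t. ennreal (time_weight \<sigma> t * h t x y * mono_exp \<nu> 0 s y) \<partial>lborel) \<partial>\<mu>)"
  proof (rule nn_integral_mono)
    fix y
    have "ennreal (K x y * mono_exp \<nu> 0 s y) = ennreal (K x y) * ennreal (mono_exp \<nu> 0 s y)"
      by (simp add: ennreal_mult K_nonneg m0)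
    also have "\<dots> \<le> (ennreal (1 / Gamma \<sigma>) * (\<integral>\<^sup>+t. ennreal (time_weight \<sigma> t * h t x y) \<partial>lborel)) * ennreal (mono_exp \<nu> 0 s y)"
      by (intro mult_right_mono K_le_nn) simp
    also have "\<dots> = ennreal (1 / Gamma \<sigma>) * (\<integral>\<^sup>+t. ennreal (time_weight \<sigma> t * h t x y) * ennreal (mono_exp \<nu> 0 s y) \<partial>lborel)"
      by (simp add: mult.assoc nn_integral_multc)
    also have "\<dots> = ennreal (1 / Gamma \<sigma>) * (\<integral>\<^sup>+t. ennreal (time_weight \<sigma> t * h t x y * mono_exp \<nu> 0 s y) \<partial>lborel)"
      by (simp add: ennreal_mult time_weight_nonneg heat_ker_nonneg nu_pos m0)
    finally show "ennreal (K x y * mono_exp \<nu> 0 s y)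
      \<le> ennreal (1 / Gamma \<sigma>) * (\<integral>\<^sup>+t. ennreal (time_weight \<sigma> t * h t x y * mono_exp \<nu> 0 s y) \<partial>lborel)" .
  qed
  also have "\<dots> = ennreal (1 / Gamma \<sigma>) * (\<integral>\<^sup>+y. \<integral>\<^sup>+t. ennreal (time_weight \<sigma> t * h t x y * mono_exp \<nu> 0 s y) \<partial>lborel \<partial>\<mu>)"
    by (rule nn_integral_cmult) measurable
  also have "(\<integral>\<^sup>+y. \<integral>\<^sup>+t. ennreal (time_weight \<sigma> t * h t x y * mono_exp \<nu> 0 s y) \<partial>lborel \<partial>\<mu>)
     = (\<integral>\<^sup>+t. \<integral>\<^sup>+y. ennreal (time_weight \<sigma> t * h t x y * mono_exp \<nu> 0 s y) \<partial>\<mu> \<partial>lborel)"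
    by (rule P.Fubini') (simp add: case_prod_beta', measurable)
  also have "ennreal (1 / Gamma \<sigma>) * \<dots> \<le> ennreal (1 / Gamma \<sigma>) * ennreal (Gamma \<sigma> / \<nu> powr \<sigma> * x powr \<nu>)"
    by (intro mult_left_mono exp_potential_le s x) simp
  also have "\<dots> = ennreal (1 / \<nu> powr \<sigma> * x powr \<nu>)"
    using Gamma_sigma by (simp add: ennreal_mult'[symmetric])
  finally show ?thesis .
qed

text \<open>Fubini. The bound by an exponential makes the double integral absolutely convergent at every point, and not
  only almost everywhere.\<close>

lemma neg_power_time_integral:
  assumes f [measurable]: "f \<in> borel_measurable borel" and s: "s \<ge> 0" and x: "x > 0"
    and le: "\<And>y. y > 0 \<Longrightarrow> \<bar>f y\<bar> \<le> C * mono_exp \<nu> 0 s y"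
  shows "neg_power \<mu> h \<sigma> f x = (\<integral>t. time_weight \<sigma> t * (\<integral>y. h t x y * f y \<partial>\<mu>) \<partial>lborel) / Gamma \<sigma>"
    and "integrable lborel (\<lambda>t. time_weight \<sigma> t * (\<integral>y. h t x y * f y \<partial>\<mu>))"
proof -
  interpret P: pair_sigma_finite lborel \<mu> ..
  have meas [measurable]: "(\<lambda>y. y) \<in> borel_measurable \<mu>" by (rule speed_measurable_borel) simp
  let ?F = "\<lambda>t y. time_weight \<sigma> t * (h t x y * f y)"
  have "0 \<le> C * mono_exp \<nu> 0 s 1" using le[of 1] by (intro order_trans[OF abs_ge_zero]) simp
  then have C0: "C \<ge> 0" by (simp add: mono_exp_def zero_le_mult_iff)
  have bound: "norm (?F t y) \<le> C * (time_weight \<sigma> t * h t x y * mono_exp \<nu> 0 s y)" for t y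
  proof (cases "y > 0")
    case True
    have "norm (?F t y) = (time_weight \<sigma> t * h t x y) * \<bar>f y\<bar>"
      by (simp add: abs_mult time_weight_nonneg heat_ker_nonneg nu_pos)
    also have "\<dots> \<le> (time_weight \<sigma> t * h t x y) * (C * mono_exp \<nu> 0 s y)"
      by (intro mult_left_mono le True mult_nonneg_nonneg time_weight_nonneg heat_ker_nonneg nu_pos)
    finally show ?thesis by (simp add: mult_ac)
  qed (simp add: heat_ker_def)
  have "(\<integral>\<^sup>+p. ennreal (norm (case p of (t, y) \<Rightarrow> ?F t y)) \<partial>(lborel \<Otimes>\<^sub>M \<mu>))
     = (\<integral>\<^sup>+t. \<integral>\<^sup>+y. ennreal (norm (?F t y)) \<partial>\<mu> \<partial>lborel)"
    by (subst nn_integral_fst[symmetric]) (simp_all add: case_prod_beta')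
  also have "\<dots> \<le> (\<integral>\<^sup>+t. \<integral>\<^sup>+y. ennreal C * ennreal (time_weight \<sigma> t * h t x y * mono_exp \<nu> 0 s y) \<partial>\<mu> \<partial>lborel)"
    by (intro nn_integral_mono) (use bound C0 in \<open>simp add: ennreal_mult'[symmetric] ennreal_leI\<close>)
  also have "\<dots> = ennreal C * (\<integral>\<^sup>+t. \<integral>\<^sup>+y. ennreal (time_weight \<sigma> t * h t x y * mono_exp \<nu> 0 s y) \<partial>\<mu> \<partial>lborel)"
    by (simp add: nn_integral_cmult)
  also have "\<dots> \<le> ennreal C * ennreal (Gamma \<sigma> / \<nu> powr \<sigma> * x powr \<nu>)"
    by (intro mult_left_mono exp_potential_le s x) simp
  also have "\<dots> < \<infinity>" by (simp add: ennreal_mult_less_top)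
  finally have int: "integrable (lborel \<Otimes>\<^sub>M \<mu>) (\<lambda>(t, y). ?F t y)"
    by (intro integrableI_bounded) (simp_all add: case_prod_beta')
  show "integrable lborel (\<lambda>t. time_weight \<sigma> t * (\<integral>y. h t x y * f y \<partial>\<mu>))"
    using P.integrable_fst[OF int] by simp
  have "neg_power \<mu> h \<sigma> f x = (\<integral>y. (\<integral>t. ?F t y \<partial>lborel) / Gamma \<sigma> \<partial>\<mu>)"
    unfolding neg_power_def neg_power_kernel_time_weight
    by (intro Bochner_Integration.integral_cong refl) (simp add: mult.assoc[symmetric])
  also have "\<dots> = (\<integral>t. \<integral>y. ?F t y \<partial>\<mu> \<partial>lborel) / Gamma \<sigma>"
    using P.Fubini_integral[OF int] by simp
  finally show "neg_power \<mu> h \<sigma> f x = (\<integral>t. time_weight \<sigma> t * (\<integral>y. h t x y * f y \<partial>\<mu>) \<partial>lborel) / Gamma \<sigma>"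
    by simp
qed

subsection \<open>A function with a power singularity\<close>

text \<open>The ratio of \<open>sing x\<close> and \<open>x powr \<nu>\<close>. The formula also makes sense at \<open>x = 0\<close>, where it gives the
  limit of the ratio.\<close>

definition amp :: "real \<Rightarrow> real" where
  "amp x = (\<integral>t. gamma_density \<sigma> \<nu> t * (flow 1 t powr (- (1 + \<nu>)) * exp (- (exp (- t) / flow 1 t * x))) \<partial>lborel) / Gamma \<sigma>"

definition sing :: "real \<Rightarrow> real" where
  "sing = neg_power \<mu> h \<sigma> (mono_exp \<nu> 0 1)"

lemma sing_eq_time:
  assumes x: "x > 0"
  shows "sing x = (\<integral>t. time_weight \<sigma> t * (exp (- \<nu> * t) * flow 1 t powr (- (1 + \<nu>)) * mono_exp \<nu> 0 (exp (- t) / flow 1 t) x) \<partial>lborel) / Gamma \<sigma>"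
    and "integrable lborel (\<lambda>t. time_weight \<sigma> t * (exp (- \<nu> * t) * flow 1 t powr (- (1 + \<nu>)) * mono_exp \<nu> 0 (exp (- t) / flow 1 t) x))"
proof -
  have eq: "time_weight \<sigma> t * (\<integral>y. h t x y * mono_exp \<nu> 0 1 y \<partial>\<mu>)
      = time_weight \<sigma> t * (exp (- \<nu> * t) * flow 1 t powr (- (1 + \<nu>)) * mono_exp \<nu> 0 (exp (- t) / flow 1 t) x)" for t
    using heat_exp_eq[of t 1 x] x by (cases "t > 0") (auto simp: has_bochner_integral_iff time_weight_def)
  have le: "\<bar>mono_exp \<nu> 0 1 y\<bar> \<le> 1 * mono_exp \<nu> 0 1 y" if "y > 0" for y by (simp add: mono_exp_def)
  show "sing x = (\<integral>t. time_weight \<sigma> t * (exp (- \<nu> * t) * flow 1 t powr (- (1 + \<nu>)) * mono_exp \<nu> 0 (exp (- t) / flow 1 t) x) \<partial>lborel) / Gamma \<sigma>"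
    unfolding sing_def by (subst neg_power_time_integral(1)[OF _ _ x le]) (auto simp: eq)
  show "integrable lborel (\<lambda>t. time_weight \<sigma> t * (exp (- \<nu> * t) * flow 1 t powr (- (1 + \<nu>)) * mono_exp \<nu> 0 (exp (- t) / flow 1 t) x))"
    using neg_power_time_integral(2)[OF _ _ x le] by (simp add: eq)
qed

lemma sing_eq:
  assumes x: "x > 0" shows "sing x = x powr \<nu> * amp x"
proof -
  have eq: "time_weight \<sigma> t * (exp (- \<nu> * t) * flow 1 t powr (- (1 + \<nu>)) * mono_exp \<nu> 0 (exp (- t) / flow 1 t) x)
    = x powr \<nu> * (gamma_density \<sigma> \<nu> t * (flow 1 t powr (- (1 + \<nu>)) * exp (- (exp (- t) / flow 1 t * x))))" for t
    using time_weight_exp[of \<sigma> t \<nu>] by (simp add: mono_exp_def mult_ac)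
  show ?thesis unfolding sing_eq_time(1)[OF x] eq amp_def by simp
qed

lemma amp_integrable:
  assumes x: "x \<ge> 0"
  shows "integrable lborel (\<lambda>t. gamma_density \<sigma> \<nu> t * (flow 1 t powr (- (1 + \<nu>)) * exp (- (exp (- t) / flow 1 t * x))))"
proof (rule Bochner_Integration.integrable_bound[OF integrable_gamma_density[OF sigma(1) nu_pos]])
  show "AE t in lborel. norm (gamma_density \<sigma> \<nu> t * (flow 1 t powr (- (1 + \<nu>)) * exp (- (exp (- t) / flow 1 t * x))))
     \<le> norm (gamma_density \<sigma> \<nu> t)"
  proof (rule AE_I2)
    fix t :: real
    show "norm (gamma_density \<sigma> \<nu> t * (flow 1 t powr (- (1 + \<nu>)) * exp (- (exp (- t) / flow 1 t * x)))) \<le> norm (gamma_density \<sigma> \<nu> t)"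
    proof (cases "t > 0")
      case True
      then have F: "1 \<le> flow 1 t" by (intro flow_ge_1) auto
      have "flow 1 t powr (- (1 + \<nu>)) \<le> flow 1 t powr 0" using F nu_pos by (intro powr_mono) auto
      then have "flow 1 t powr (- (1 + \<nu>)) \<le> 1" using F by simp
      moreover have "exp (- (exp (- t) / flow 1 t * x)) \<le> 1" using F x by simp
      ultimately have "flow 1 t powr (- (1 + \<nu>)) * exp (- (exp (- t) / flow 1 t * x)) \<le> 1"
        by (intro mult_le_one) auto
      from mult_left_mono[OF this gamma_density_nonneg[of \<sigma> \<nu> t]]
      show ?thesis by (simp add: abs_mult gamma_density_nonneg)
    qed (simp add: gamma_density_def)
  qed
qed measurable

lemma amp_bounds:
  assumes x: "x > 0"
  shows "0 \<le> amp x" "amp x \<le> amp 0" "amp 0 - amp x \<le> amp 0 * x"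
proof -
  let ?c = "\<lambda>t. gamma_density \<sigma> \<nu> t * flow 1 t powr (- (1 + \<nu>))"
  let ?z = "\<lambda>t. exp (- t) / flow 1 t"
  have c0: "0 \<le> ?c t" for t by (simp add: gamma_density_nonneg)
  have i: "integrable lborel (\<lambda>t. ?c t * exp (- (?z t * y)))" if "y \<ge> 0" for y
    using amp_integrable[OF that] by (simp add: mult.assoc)
  have amp: "amp y = (\<integral>t. ?c t * exp (- (?z t * y)) \<partial>lborel) / Gamma \<sigma>" for y
    by (simp add: amp_def mult.assoc)
  have z: "0 \<le> ?z t" "?z t \<le> 1" if "t > 0" for t
  proof -
    have "1 \<le> flow 1 t" using that by (intro flow_ge_1) auto
    then show "0 \<le> ?z t" by simp
    have "exp (- t) \<le> 1" using that by simp
    then have "exp (- t) \<le> flow 1 t" using \<open>1 \<le> flow 1 t\<close> by (rule order_trans)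
    then show "?z t \<le> 1" using \<open>1 \<le> flow 1 t\<close> by (simp add: divide_le_eq)
  qed
  have c_neg: "?c t = 0" if "t \<le> 0" for t using that by (simp add: gamma_density_def)
  have "0 \<le> (\<integral>t. ?c t * exp (- (?z t * x)) \<partial>lborel)"
    by (rule Bochner_Integration.integral_nonneg) (rule mult_nonneg_nonneg[OF c0], simp)
  then show "0 \<le> amp x" unfolding amp using Gamma_sigma by (intro divide_nonneg_pos)
  have "(\<integral>t. ?c t * exp (- (?z t * x)) \<partial>lborel) \<le> (\<integral>t. ?c t * exp (- (?z t * 0)) \<partial>lborel)"
  proof (rule integral_mono[OF i i])
    fix t
    show "?c t * exp (- (?z t * x)) \<le> ?c t * exp (- (?z t * 0))"
    proof (cases "t > 0")
      case True
      then have "0 \<le> ?z t * x" using z(1) x by (intro mult_nonneg_nonneg) auto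
      then have "exp (- (?z t * x)) \<le> exp (- (?z t * 0))"
        by (simp only: mult_zero_right exp_le_cancel_iff neg_le_iff_le)
      then show ?thesis by (rule mult_left_mono[OF _ c0])
    next
      case False
      then show ?thesis by (simp only: c_neg[OF leI[OF False]] mult_zero_left order_refl)
    qed
  qed (use x in auto)
  then show "amp x \<le> amp 0" unfolding amp using Gamma_sigma by (simp add: divide_right_mono)
  have "(\<integral>t. ?c t * exp (- (?z t * 0)) \<partial>lborel) - (\<integral>t. ?c t * exp (- (?z t * x)) \<partial>lborel)
      = (\<integral>t. ?c t * exp (- (?z t * 0)) - ?c t * exp (- (?z t * x)) \<partial>lborel)"
    by (rule Bochner_Integration.integral_diff[symmetric, OF i i]) (use x in auto)
  also have "\<dots> \<le> (\<integral>t. x * (?c t * exp (- (?z t * 0))) \<partial>lborel)"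
  proof (rule integral_mono)
    show "integrable lborel (\<lambda>t. ?c t * exp (- (?z t * 0)) - ?c t * exp (- (?z t * x)))"
      by (rule Bochner_Integration.integrable_diff[OF i i]) (use x in auto)
    show "integrable lborel (\<lambda>t. x * (?c t * exp (- (?z t * 0))))" using i[of 0] by simp
    fix t
    show "?c t * exp (- (?z t * 0)) - ?c t * exp (- (?z t * x)) \<le> x * (?c t * exp (- (?z t * 0)))"
    proof (cases "t > 0")
      case True
      have "1 - exp (- (?z t * x)) \<le> ?z t * x" using exp_ge_add_one_self[of "- (?z t * x)"] by simp
      also have "\<dots> \<le> 1 * x" by (intro mult_right_mono z True less_imp_le x)
      finally have "?c t * (1 - exp (- (?z t * x))) \<le> ?c t * x" using c0 by (intro mult_left_mono) auto
      then show ?thesis by (simp add: algebra_simps)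
    qed (simp add: gamma_density_def)
  qed
  finally show "amp 0 - amp x \<le> amp 0 * x"
    unfolding amp using Gamma_sigma by (simp add: diff_divide_distrib[symmetric] divide_right_mono mult.commute)
qed

lemma amp_0_pos: "0 < amp 0"
proof -
  let ?f = "\<lambda>t. gamma_density \<sigma> \<nu> t * (flow 1 t powr (- (1 + \<nu>)) * exp (- (exp (- t) / flow 1 t * 0)))"
  have f0: "0 \<le> ?f t" for t by (simp add: gamma_density_nonneg)
  have "(\<integral>t. ?f t \<partial>lborel) \<noteq> 0"
  proof
    assume "(\<integral>t. ?f t \<partial>lborel) = 0"
    then have "AE t in lborel. ?f t = 0"
      using integral_nonneg_eq_0_iff_AE[OF amp_integrable[of 0]] f0 by auto
    then have "AE t in lborel. t \<notin> {0<..<1::real}"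
    proof eventually_elim
      case (elim t)
      show ?case
      proof
        assume "t \<in> {0<..<1}"
        then have "1 \<le> flow 1 t" "0 < gamma_density \<sigma> \<nu> t" by (auto intro!: flow_ge_1 simp: gamma_density_def)
        then show False using elim by simp
      qed
    qed
    moreover have "{t \<in> space lborel. \<not> t \<notin> {0<..<1::real}} = {0<..<1}" by auto
    ultimately have "emeasure lborel {0<..<1::real} = 0"
      using AE_iff_measurable[of "{0<..<1::real}" lborel "\<lambda>t. t \<notin> {0<..<1}"] by simp
    then show False by simp
  qed
  moreover have "0 \<le> (\<integral>t. ?f t \<partial>lborel)" using f0 by (intro Bochner_Integration.integral_nonneg) auto
  ultimately show ?thesis unfolding amp_def using Gamma_sigma by (intro divide_pos_pos) auto
qed

text \<open>With \<open>z = exp (- t) * x\<close>, the derivative of \<open>1 / (\<nu> * (1 + z powr \<nu>))\<close> in \<open>t\<close> is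
  \<open>z powr \<nu> / (1 + z powr \<nu>)\<^sup>2\<close>, which dominates \<open>z powr \<nu> * exp (- z / 2)\<close> up to a constant.\<close>

lemma time_integral_le:
  assumes x: "x > 0"
  shows "(\<integral>\<^sup>+t. ennreal ((exp (- t) * x) powr \<nu> / (1 + (exp (- t) * x) powr \<nu>)\<^sup>2) * indicator {0..} t \<partial>lborel) \<le> ennreal (1 / \<nu>)"
proof -
  define F where "F t = 1 / (\<nu> * (1 + (exp (- t) * x) powr \<nu>))" for t
  have z: "(exp (- t) * x) powr \<nu> = exp (- \<nu> * t) * x powr \<nu>" for t
    using x by (simp add: powr_mult) (simp add: powr_def)
  have pos: "0 < 1 + exp (- \<nu> * t) * x powr \<nu>" for t by (simp add: add_pos_nonneg)
  have "(\<integral>\<^sup>+t. ennreal ((exp (- t) * x) powr \<nu> / (1 + (exp (- t) * x) powr \<nu>)\<^sup>2) * indicator {0..} t \<partial>lborel)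
     = ennreal (1 / \<nu> - F 0)"
  proof (rule nn_integral_FTC_atLeast)
    fix t
    have "((\<lambda>t. inverse (\<nu> * (1 + exp (- \<nu> * t) * x powr \<nu>))) has_real_derivative
       - (inverse (\<nu> * (1 + exp (- \<nu> * t) * x powr \<nu>)) * (\<nu> * (- \<nu> * exp (- \<nu> * t) * x powr \<nu>)) * inverse (\<nu> * (1 + exp (- \<nu> * t) * x powr \<nu>)))) (at t)"
      using pos[of t] nu_pos by (intro DERIV_inverse') (auto intro!: derivative_eq_intros)
    moreover have "- (inverse (\<nu> * (1 + exp (- \<nu> * t) * x powr \<nu>)) * (\<nu> * (- \<nu> * exp (- \<nu> * t) * x powr \<nu>)) * inverse (\<nu> * (1 + exp (- \<nu> * t) * x powr \<nu>)))
      = exp (- \<nu> * t) * x powr \<nu> / (1 + exp (- \<nu> * t) * x powr \<nu>)\<^sup>2"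
    proof -
      have "- (inverse (\<nu> * d) * (\<nu> * (- \<nu> * b * c)) * inverse (\<nu> * d)) = b * c / d\<^sup>2" if "d > 0" for b c d :: real
        using that nu_pos by (simp add: divide_simps power2_eq_square)
      from this[OF pos] show ?thesis .
    qed
    ultimately show "(F has_real_derivative (exp (- t) * x) powr \<nu> / (1 + (exp (- t) * x) powr \<nu>)\<^sup>2) (at t)"
      unfolding F_def z by (simp add: inverse_eq_divide)
    show "0 \<le> (exp (- t) * x) powr \<nu> / (1 + (exp (- t) * x) powr \<nu>)\<^sup>2" by simp
  next
    have "((\<lambda>t. exp (- \<nu> * t)) \<longlongrightarrow> 0) at_top"
      using nu_pos by real_asymp
    then have "((\<lambda>t. 1 / (\<nu> * (1 + exp (- \<nu> * t) * x powr \<nu>))) \<longlongrightarrow> 1 / (\<nu> * (1 + 0 * x powr \<nu>))) at_top"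
      using nu_pos by (intro tendsto_intros) auto
    then show "(F \<longlongrightarrow> 1 / \<nu>) at_top" unfolding F_def z by simp
  qed measurable
  also have "\<dots> \<le> ennreal (1 / \<nu>)" using nu_pos by (intro ennreal_leI) (simp add: F_def)
  finally show ?thesis .
qed

lemma powr_le_one_plus: "0 \<le> z \<Longrightarrow> z powr \<nu> \<le> 1 + z"
proof (cases "z \<le> 1")
  case True
  assume "0 \<le> z"
  then have "z powr \<nu> \<le> 1" using True nu_pos by (simp add: powr_le1)
  then show ?thesis using \<open>0 \<le> z\<close> by simp
next
  case False
  then have "z powr \<nu> \<le> z powr 1" using nu_less by (intro powr_mono) auto
  then show ?thesis using False by simp
qed

text \<open>For \<open>t \<le> 1\<close> the semigroup is bounded and the time weight is integrable. For \<open>t \<ge> 1\<close> the time weight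
  is bounded and the semigroup depends essentially on \<open>z = exp (- t) * x\<close>, whose contribution is integrable in \<open>t\<close>
  uniformly in \<open>x\<close>.\<close>

lemma sing_bounded: "\<exists>C. \<forall>x>0. \<bar>sing x\<bar> \<le> C"
proof (intro exI allI impI)
  define D where "D = 2 * exp \<nu> * (Gamma \<sigma> / \<nu> powr \<sigma>) + 64 * (1 / \<nu>)"
  fix x :: real assume x: "x > 0"
  let ?f = "\<lambda>t. time_weight \<sigma> t * (exp (- \<nu> * t) * flow 1 t powr (- (1 + \<nu>)) * mono_exp \<nu> 0 (exp (- t) / flow 1 t) x)"
  let ?g = "\<lambda>t. (exp (- t) * x) powr \<nu> / (1 + (exp (- t) * x) powr \<nu>)\<^sup>2"
  have f0: "0 \<le> ?f t" for t by (simp add: time_weight_nonneg mono_exp_def)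
  have le: "?f t \<le> 2 * exp \<nu> * gamma_density \<sigma> \<nu> t + 64 * (?g t * indicator {0..} t)" for t
  proof (cases "t > 0")
    case t: True
    define z where "z = exp (- t) * x"
    have z: "z > 0" using x by (simp add: z_def)
    have F: "1 \<le> flow 1 t" "flow 1 t \<le> 2" using t by (auto simp: flow_def)
    have zn: "exp (- \<nu> * t) * x powr \<nu> = z powr \<nu>" unfolding z_def using x by (simp add: powr_mult) (simp add: powr_def)
    have "flow 1 t powr (- (1 + \<nu>)) \<le> flow 1 t powr 0" using F nu_pos by (intro powr_mono) auto
    then have a: "flow 1 t powr (- (1 + \<nu>)) \<le> 1" using F by simp
    have "z / 2 \<le> z / flow 1 t" using F z by (intro divide_left_mono) auto
    then have b: "exp (- (exp (- t) / flow 1 t * x)) \<le> exp (- (z / 2))" by (simp add: z_def)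
    have "exp (- \<nu> * t) * flow 1 t powr (- (1 + \<nu>)) * mono_exp \<nu> 0 (exp (- t) / flow 1 t) x
       = z powr \<nu> * (flow 1 t powr (- (1 + \<nu>)) * exp (- (exp (- t) / flow 1 t * x)))"
      by (simp add: mono_exp_def zn[symmetric])
    also have "\<dots> \<le> z powr \<nu> * (1 * exp (- (z / 2)))"
      using a b by (intro mult_left_mono mult_mono) auto
    finally have v: "exp (- \<nu> * t) * flow 1 t powr (- (1 + \<nu>)) * mono_exp \<nu> 0 (exp (- t) / flow 1 t) x \<le> z powr \<nu> * exp (- (z / 2))"
      by simp
    show ?thesis
    proof (cases "t \<le> 1")
      case True
      have "z powr \<nu> \<le> 2 * exp (z / 2)"
        using powr_le_one_plus[OF less_imp_le[OF z]] exp_ge_add_one_self[of "z / 2"] by linarith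
      then have "z powr \<nu> * exp (- (z / 2)) \<le> 2 * exp (z / 2) * exp (- (z / 2))" by (intro mult_right_mono) auto
      also have "\<dots> = 2" by (simp add: mult.assoc exp_add[symmetric])
      finally have "?f t \<le> time_weight \<sigma> t * 2" using v by (intro mult_left_mono time_weight_nonneg) auto
      also have "\<dots> \<le> time_weight \<sigma> t * (2 * (exp \<nu> * exp (- \<nu> * t)))"
        using True nu_pos by (intro mult_left_mono time_weight_nonneg) (auto simp: exp_add[symmetric])
      also have "\<dots> = 2 * exp \<nu> * gamma_density \<sigma> \<nu> t"
        using time_weight_exp[of \<sigma> t \<nu>] by (simp add: mult_ac)
      finally show ?thesis by (simp add: add_increasing2)
    next
      case False
      have "1 + z powr \<nu> \<le> 8 * exp (z / 4)"
        using powr_le_one_plus[OF less_imp_le[OF z]] exp_ge_add_one_self[of "z / 4"] z by linarith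
      then have "(1 + z powr \<nu>)\<^sup>2 \<le> (8 * exp (z / 4))\<^sup>2" by (rule power_mono) (simp add: add_nonneg_nonneg)
      also have "\<dots> = 64 * exp (z / 2)" by (simp add: power2_eq_square exp_add[symmetric] mult_exp_exp)
      finally have "(1 + z powr \<nu>)\<^sup>2 * exp (- (z / 2)) \<le> 64 * exp (z / 2) * exp (- (z / 2))"
        by (intro mult_right_mono) auto
      then have "(1 + z powr \<nu>)\<^sup>2 * exp (- (z / 2)) \<le> 64" by (simp add: mult.assoc exp_add[symmetric])
      moreover have p: "(1 + z powr \<nu>)\<^sup>2 > 0" by (rule zero_less_power, rule add_pos_nonneg) auto
      ultimately have "exp (- (z / 2)) \<le> 64 / (1 + z powr \<nu>)\<^sup>2" by (simp add: field_simps)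
      then have "z powr \<nu> * exp (- (z / 2)) \<le> z powr \<nu> * (64 / (1 + z powr \<nu>)\<^sup>2)" by (intro mult_left_mono) auto
      also have "\<dots> = 64 * ?g t" by (simp add: z_def)
      finally have v2: "exp (- \<nu> * t) * flow 1 t powr (- (1 + \<nu>)) * mono_exp \<nu> 0 (exp (- t) / flow 1 t) x \<le> 64 * ?g t"
        by (rule order_trans[OF v])
      have "t powr (\<sigma> - 1) \<le> 1" using False sigma powr_mono[of "\<sigma> - 1" 0 t] by simp
      then have tw: "time_weight \<sigma> t \<le> 1" by (simp add: time_weight_def indicator_def)
      have "?f t \<le> 1 * (64 * ?g t)"
        by (rule mult_mono[OF tw v2]) (auto simp: mono_exp_def)
      then show ?thesis using t by (simp add: gamma_density_nonneg add_increasing)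
    qed
  qed (simp add: time_weight_def gamma_density_nonneg)
  have "ennreal (\<integral>t. ?f t \<partial>lborel) = (\<integral>\<^sup>+t. ennreal (?f t) \<partial>lborel)"
    by (rule nn_integral_eq_integral[symmetric, OF sing_eq_time(2)[OF x]]) (use f0 in auto)
  also have "\<dots> \<le> (\<integral>\<^sup>+t. ennreal (2 * exp \<nu>) * ennreal (gamma_density \<sigma> \<nu> t) + ennreal 64 * (ennreal (?g t) * indicator {0..} t) \<partial>lborel)"
  proof (rule nn_integral_mono)
    fix t
    have "ennreal (?f t) \<le> ennreal (2 * exp \<nu> * gamma_density \<sigma> \<nu> t + 64 * (?g t * indicator {0..} t))"
      by (rule ennreal_leI[OF le])
    also have "\<dots> = ennreal (2 * exp \<nu> * gamma_density \<sigma> \<nu> t) + ennreal (64 * (?g t * indicator {0..} t))"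
      by (rule ennreal_plus) (auto simp: gamma_density_nonneg)
    also have "ennreal (64 * (?g t * indicator {0..} t)) = ennreal 64 * (ennreal (?g t) * indicator {0..} t)"
      using ennreal_mult'[of 64 "?g t"] by (simp add: indicator_def)
    also have "ennreal (2 * exp \<nu> * gamma_density \<sigma> \<nu> t) = ennreal (2 * exp \<nu>) * ennreal (gamma_density \<sigma> \<nu> t)"
      by (rule ennreal_mult') simp
    finally show "ennreal (?f t) \<le> ennreal (2 * exp \<nu>) * ennreal (gamma_density \<sigma> \<nu> t) + ennreal 64 * (ennreal (?g t) * indicator {0..} t)" .
  qed
  also have "\<dots> = ennreal (2 * exp \<nu>) * ennreal (Gamma \<sigma> / \<nu> powr \<sigma>) + ennreal 64 * (\<integral>\<^sup>+t. ennreal (?g t) * indicator {0..} t \<partial>lborel)"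
    using nn_integral_gamma_density[OF sigma(1) nu_pos]
    by (simp add: nn_integral_add nn_integral_cmult)
  also have "\<dots> \<le> ennreal (2 * exp \<nu>) * ennreal (Gamma \<sigma> / \<nu> powr \<sigma>) + ennreal 64 * ennreal (1 / \<nu>)"
    by (intro add_left_mono mult_left_mono time_integral_le x) simp
  also have "\<dots> = ennreal D"
  proof -
    have n: "0 \<le> 2 * exp \<nu> * (Gamma \<sigma> / \<nu> powr \<sigma>)" "0 \<le> 64 * (1 / \<nu>)" "0 \<le> 2 * exp \<nu>" "(0::real) \<le> 64"
      using nu_pos Gamma_sigma by auto
    show ?thesis unfolding D_def
      by (simp only: ennreal_plus[OF n(1,2)] ennreal_mult'[OF n(3)] ennreal_mult'[OF n(4)])
  qed
  finally have "(\<integral>t. ?f t \<partial>lborel) \<le> D"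
    using nu_pos Gamma_sigma by (subst (asm) ennreal_le_iff) (auto simp: D_def intro!: add_nonneg_nonneg)
  moreover have "0 \<le> (\<integral>t. ?f t \<partial>lborel)" using f0 by (intro Bochner_Integration.integral_nonneg)
  ultimately show "\<bar>sing x\<bar> \<le> D / Gamma \<sigma>"
    unfolding sing_eq_time(1)[OF x] using Gamma_sigma by (simp add: divide_right_mono)
qed

lemma neg_power_measurable:
  assumes f [measurable]: "f \<in> borel_measurable \<mu>"
  shows "neg_power \<mu> h \<sigma> f \<in> borel_measurable \<mu>"
proof -
  have [measurable]: "fst \<in> borel_measurable (\<mu> \<Otimes>\<^sub>M \<mu>)" "snd \<in> borel_measurable (\<mu> \<Otimes>\<^sub>M \<mu>)"
    by (rule speed_fst, rule speed_snd)
  have "(\<lambda>(x, y). K x y * f y) \<in> borel_measurable (\<mu> \<Otimes>\<^sub>M \<mu>)"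
    unfolding case_prod_beta' by measurable
  then show ?thesis unfolding neg_power_def[abs_def] by (rule borel_measurable_lebesgue_integral)
qed

end

section \<open>Failure of the algebra property\<close>

text \<open>Compare \<open>b\<close> with \<open>a powr (P - 1)\<close>.\<close>

lemma Young_crude:
  fixes a b P :: real
  assumes "0 \<le> a" "0 \<le> b" and P: "1 < P"
  shows "a * b \<le> a powr P + b powr (P / (P - 1))"
proof (cases "a = 0 \<or> b = 0")
  case False
  then have ab: "a > 0" "b > 0" using assms by auto
  show ?thesis
  proof (cases "b \<le> a powr (P - 1)")
    case True
    then have "a * b \<le> a powr 1 * a powr (P - 1)" using ab by simp
    also have "\<dots> = a powr (1 + (P - 1))" by (rule powr_add[symmetric])
    finally show ?thesis by (simp add: add_increasing2)
  next
    case False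
    have "a = (a powr (P - 1)) powr (1 / (P - 1))" using ab P by (simp add: powr_powr)
    also have "\<dots> \<le> b powr (1 / (P - 1))" using False P by (intro powr_mono2) auto
    finally have "a * b \<le> b powr (1 / (P - 1)) * b powr 1" using ab by simp
    also have "\<dots> = b powr (1 / (P - 1) + 1)" by (simp add: powr_add)
    also have "1 / (P - 1) + 1 = P / (P - 1)" using P by (simp add: field_simps)
    finally show ?thesis by (simp add: add_increasing)
  qed
qed auto

lemma speed_density_mono_exp:
  "speed_density \<nu> y * mono_exp \<nu> k s y = gamma_density (1 + real k) (1 + s) y"
proof (cases "y > 0")
  case True
  have "y powr (- \<nu>) * y powr \<nu> = 1" using True by (simp add: powr_add[symmetric])
  moreover have "exp (- ((1 + s) * y)) = exp (- y) * exp (- (s * y))"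
    by (simp add: exp_add[symmetric] algebra_simps)
  ultimately show ?thesis using True
    by (simp add: speed_density_pos mono_exp_def gamma_density_def powr_realpow mult_ac)
qed (simp add: speed_density_nonpos gamma_density_def)

lemma speed_density_powr_mono_exp:
  assumes "y > 0"
  shows "speed_density \<nu> y * (y powr a * mono_exp \<nu> k s y) = gamma_density (1 + a + real k) (1 + s) y"
proof -
  have "y powr (- \<nu>) * y powr \<nu> = 1" using assms by (simp add: powr_add[symmetric])
  moreover have "exp (- ((1 + s) * y)) = exp (- y) * exp (- (s * y))"
    by (simp add: exp_add[symmetric] algebra_simps)
  moreover have "y powr (a + real k) = y powr a * y ^ k" using assms by (simp add: powr_add powr_realpow)
  ultimately show ?thesis using assms
    by (simp add: speed_density_pos mono_exp_def gamma_density_def mult_ac)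
qed

definition inv_exponent :: "ennreal \<Rightarrow> real" where
  "inv_exponent p = (if p = \<infinity> then 0 else 1 / enn2real p)"

context laguerre
begin

lemma exp_weight_integral:
  assumes T: "T \<ge> 1"
  shows "(\<integral>\<^sup>+y. ennreal ((1 + T * y) * mono_exp \<nu> 0 (T - 1) y) \<partial>\<mu>) = ennreal (2 / T)"
proof -
  have "(\<integral>\<^sup>+y. ennreal ((1 + T * y) * mono_exp \<nu> 0 (T - 1) y) \<partial>\<mu>)
     = (\<integral>\<^sup>+y. ennreal (gamma_density 1 T y) + ennreal T * ennreal (gamma_density 2 T y) \<partial>lborel)"
  proof (subst nn_integral_speed, measurable, rule nn_integral_cong)
    fix y
    have "ennreal (speed_density \<nu> y) * ennreal ((1 + T * y) * mono_exp \<nu> 0 (T - 1) y)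
       = ennreal (speed_density \<nu> y * ((1 + T * y) * mono_exp \<nu> 0 (T - 1) y))"
      by (rule ennreal_mult'[symmetric]) (rule speed_density_nonneg)
    also have "speed_density \<nu> y * ((1 + T * y) * mono_exp \<nu> 0 (T - 1) y)
        = speed_density \<nu> y * mono_exp \<nu> 0 (T - 1) y + T * (speed_density \<nu> y * mono_exp \<nu> 1 (T - 1) y)"
      by (simp add: mono_exp_def algebra_simps)
    also have "\<dots> = gamma_density 1 T y + T * gamma_density 2 T y"
      unfolding speed_density_mono_exp by simp
    finally show "ennreal (speed_density \<nu> y) * ennreal ((1 + T * y) * mono_exp \<nu> 0 (T - 1) y)
       = ennreal (gamma_density 1 T y) + ennreal T * ennreal (gamma_density 2 T y)"
      using T by (simp add: gamma_density_nonneg ennreal_mult)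
  qed
  also have "\<dots> = ennreal (Gamma 1 / T powr 1) + ennreal T * ennreal (Gamma 2 / T powr 2)"
    using T nn_integral_gamma_density[of 1 T] nn_integral_gamma_density[of 2 T]
    by (simp add: nn_integral_add nn_integral_cmult)
  also have "\<dots> = ennreal (1 / T + T * (1 / T\<^sup>2))"
    using T Gamma_fact[of 1, where 'a=real] by (simp add: ennreal_mult'[symmetric] ennreal_plus[symmetric] del: ennreal_plus)
  also have "1 / T + T * (1 / T\<^sup>2) = 2 / T" using T by (simp add: field_simps power2_eq_square)
  finally show ?thesis .
qed

text \<open>Hoelder's inequality against the weights \<open>(1 + T y) y powr \<nu> exp (- (T - 1) y)\<close>, which live
  at the scale \<open>1 / T\<close>.\<close>

lemma Lp_exp_weight_le:
  assumes p: "1 < p" and k: "k \<in> Lp p \<mu>"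
  shows "\<exists>C\<ge>0. \<forall>T\<ge>1. (\<integral>\<^sup>+y. ennreal (\<bar>k y\<bar> * ((1 + T * y) * mono_exp \<nu> 0 (T - 1) y)) \<partial>\<mu>)
     \<le> ennreal (C * T powr (- (1 - (1 - \<nu>) * inv_exponent p)))"
proof (cases "p = \<infinity>")
  case True
  then obtain C0 where C0: "AE y in \<mu>. \<bar>k y\<bar> \<le> C0" using k by (auto simp: Lp_def)
  define C where "C = max C0 0"
  have C: "C \<ge> 0" "AE y in \<mu>. \<bar>k y\<bar> \<le> C" using C0 by (auto simp: C_def elim!: eventually_mono)
  have "(\<integral>\<^sup>+y. ennreal (\<bar>k y\<bar> * ((1 + T * y) * mono_exp \<nu> 0 (T - 1) y)) \<partial>\<mu>)
     \<le> ennreal (2 * C * T powr (- (1 - (1 - \<nu>) * inv_exponent p)))" if T: "T \<ge> 1" for T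
  proof -
    have "(\<integral>\<^sup>+y. ennreal (\<bar>k y\<bar> * ((1 + T * y) * mono_exp \<nu> 0 (T - 1) y)) \<partial>\<mu>)
       \<le> (\<integral>\<^sup>+y. ennreal C * ennreal ((1 + T * y) * mono_exp \<nu> 0 (T - 1) y) \<partial>\<mu>)"
    proof (rule nn_integral_mono_AE)
      have pos: "AE y in \<mu>. y > 0" by (simp add: AE_speed_iff)
      show "AE y in \<mu>. ennreal (\<bar>k y\<bar> * ((1 + T * y) * mono_exp \<nu> 0 (T - 1) y))
         \<le> ennreal C * ennreal ((1 + T * y) * mono_exp \<nu> 0 (T - 1) y)"
        using C(2) pos
      proof eventually_elim
        case (elim y)
        have "0 \<le> (1 + T * y) * mono_exp \<nu> 0 (T - 1) y"
          using elim T by (intro mult_nonneg_nonneg mono_exp_nonneg) auto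
        from mult_right_mono[OF elim(1) this] show ?case
          using C(1) by (simp add: ennreal_mult'[symmetric] ennreal_leI)
      qed
    qed
    also have "\<dots> = ennreal C * ennreal (2 / T)"
      unfolding exp_weight_integral[OF T, symmetric]
      by (rule nn_integral_cmult) (rule measurable_compose[OF _ measurable_ennreal], rule speed_measurable_borel, measurable)
    also have "\<dots> = ennreal (2 * C * T powr (- (1 - (1 - \<nu>) * inv_exponent p)))"
      using C(1) T True by (simp add: inv_exponent_def ennreal_mult'[symmetric] powr_minus_divide mult.commute)
    finally show ?thesis .
  qed
  then show ?thesis using C(1) by (intro exI[of _ "2 * C"]) auto
next
  case False
  define P where "P = enn2real p"
  have pP: "p = ennreal P" using False by (simp add: P_def less_top)
  have P: "P > 1"
  proof -
    have "ennreal 1 < ennreal P" using p pP by simp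
    then show ?thesis by (subst (asm) ennreal_less_iff) auto
  qed
  define r where "r = P / (P - 1)"
  have r: "r > 1" "r - 1 = 1 / (P - 1)" using P by (auto simp: r_def field_simps)
  define \<theta> where "\<theta> = 1 - (1 - \<nu>) * inv_exponent p"
  have ip: "inv_exponent p = 1 / P" using False by (simp add: inv_exponent_def P_def)
  define g where "g = 1 + \<nu> * (r - 1)"
  have \<theta>r: "\<theta> * r = g"
    unfolding \<theta>_def ip g_def r(2) unfolding r_def using P by (simp add: field_simps)
  have g: "g > 0" unfolding g_def using r(1) nu_pos by (intro add_pos_pos mult_pos_pos) auto
  have intk: "integrable \<mu> (\<lambda>y. \<bar>k y\<bar> powr P)" using k False by (simp add: Lp_def P_def)
  have km: "k \<in> borel_measurable \<mu>" using k by (simp add: Lp_def)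
  define A where "A = (\<integral>y. \<bar>k y\<bar> powr P \<partial>\<mu>)"
  have A: "A \<ge> 0" unfolding A_def by (intro Bochner_Integration.integral_nonneg) simp
  define D where "D = (2 * r) powr r * Gamma g * 2 powr g"
  have G: "Gamma g > 0" using g by (rule Gamma_real_pos)
  have D: "D \<ge> 0" using G r by (simp add: D_def)
  have "(\<integral>\<^sup>+y. ennreal (\<bar>k y\<bar> * ((1 + T * y) * mono_exp \<nu> 0 (T - 1) y)) \<partial>\<mu>)
     \<le> ennreal ((A + D) * T powr (- \<theta>))" if T: "T \<ge> 1" for T
  proof -
    define V where "V y = (1 + T * y) * mono_exp \<nu> 0 (T - 1) y" for y
    have V0: "0 \<le> V y" if "y > 0" for y
      unfolding V_def using T that by (intro mult_nonneg_nonneg mono_exp_nonneg) auto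
    have Vm [measurable]: "V \<in> borel_measurable borel" unfolding V_def by measurable
    have Vr: "speed_density \<nu> y * ((T powr \<theta> * V y) powr r) \<le> T powr g * (2 * r) powr r * gamma_density g (T / 2) y" if y: "y > 0" for y
    proof -
      have z: "T * y \<ge> 0" using T y by simp
      \<comment> \<open>The constant \<open>2 * r\<close> is chosen such that the \<open>r\<close>-th power of the linear factor costs only half of the exponent \<open>T * y\<close>.\<close>
      have "1 + T * y / (2 * r) \<le> exp (T * y / (2 * r))" by (rule exp_ge_add_one_self)
      then have "2 * r * (1 + T * y / (2 * r)) \<le> 2 * r * exp (T * y / (2 * r))" using r by (intro mult_left_mono) auto
      moreover have "2 * r * (1 + T * y / (2 * r)) = 2 * r + T * y" using r(1) by (simp add: field_simps)
      ultimately have "1 + T * y \<le> 2 * r * exp (T * y / (2 * r))" using r by linarith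
      then have "(1 + T * y) powr r \<le> (2 * r * exp (T * y / (2 * r))) powr r" using r z by (intro powr_mono2) auto
      also have "\<dots> = (2 * r) powr r * exp (T * y / 2)"
        using r by (simp add: powr_mult exp_powr_real)
      finally have v1: "(1 + T * y) powr r \<le> (2 * r) powr r * exp (T * y / 2)" .
      have "(T powr \<theta> * V y) powr r = T powr g * ((1 + T * y) powr r * (y powr (\<nu> * r) * exp (- ((T - 1) * y * r))))"
        using z y T unfolding V_def mono_exp_def
        by (simp add: powr_mult powr_powr \<theta>r exp_powr_real)
      also have "\<dots> \<le> T powr g * (((2 * r) powr r * exp (T * y / 2)) * (y powr (\<nu> * r) * exp (- ((T - 1) * y * r))))"
        by (intro mult_left_mono mult_right_mono v1) auto
      finally have "speed_density \<nu> y * (T powr \<theta> * V y) powr r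
         \<le> speed_density \<nu> y * (T powr g * (((2 * r) powr r * exp (T * y / 2)) * (y powr (\<nu> * r) * exp (- ((T - 1) * y * r)))))"
        by (intro mult_left_mono speed_density_nonneg)
      also have "\<dots> = T powr g * (2 * r) powr r * ((y powr (- \<nu>) * y powr (\<nu> * r)) * (exp (- y) * exp (T * y / 2) * exp (- ((T - 1) * y * r))))"
        using y by (simp add: speed_density_pos mult_ac)
      also have "y powr (- \<nu>) * y powr (\<nu> * r) = y powr (g - 1)"
        by (simp add: powr_add[symmetric] g_def algebra_simps)
      also have "exp (- y) * exp (T * y / 2) * exp (- ((T - 1) * y * r)) = exp (- y + T * y / 2 - (T - 1) * y * r)"
        by (simp add: exp_add[symmetric] exp_diff exp_minus field_simps)
      also have "T powr g * (2 * r) powr r * (y powr (g - 1) * exp (- y + T * y / 2 - (T - 1) * y * r))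
         \<le> T powr g * (2 * r) powr r * (y powr (g - 1) * exp (- (T / 2 * y)))"
      proof -
        have "(T - 1) * y * 1 \<le> (T - 1) * y * r" using T y r by (intro mult_left_mono) auto
        then have "- y + T * y / 2 - (T - 1) * y * r \<le> - (T / 2 * y)" by (simp add: algebra_simps)
        then show ?thesis by (intro mult_left_mono) auto
      qed
      finally show ?thesis using y by (simp add: gamma_density_def)
    qed
    have Vint: "(\<integral>\<^sup>+y. ennreal ((T powr \<theta> * V y) powr r) \<partial>\<mu>) \<le> ennreal D"
    proof -
      have "(\<integral>\<^sup>+y. ennreal ((T powr \<theta> * V y) powr r) \<partial>\<mu>)
         = (\<integral>\<^sup>+y. ennreal (speed_density \<nu> y) * ennreal ((T powr \<theta> * V y) powr r) \<partial>lborel)"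
        by (rule nn_integral_speed) measurable
      also have "\<dots> \<le> (\<integral>\<^sup>+y. ennreal (T powr g * (2 * r) powr r) * ennreal (gamma_density g (T / 2) y) \<partial>lborel)"
      proof (rule nn_integral_mono)
        fix y
        show "ennreal (speed_density \<nu> y) * ennreal ((T powr \<theta> * V y) powr r)
            \<le> ennreal (T powr g * (2 * r) powr r) * ennreal (gamma_density g (T / 2) y)"
          using Vr[of y]
          by (cases "y > 0") (auto simp: ennreal_mult'[symmetric] speed_density_nonneg speed_density_nonpos intro!: ennreal_leI)
      qed
      also have "\<dots> = ennreal (T powr g * (2 * r) powr r) * ennreal (Gamma g / (T / 2) powr g)"
        using T g by (simp add: nn_integral_cmult nn_integral_gamma_density)
      also have "\<dots> = ennreal D"
      proof -
        have "T powr g * (2 * r) powr r * (Gamma g / (T / 2) powr g) = D"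
          using T by (simp add: D_def powr_divide)
        then show ?thesis using r by (simp add: ennreal_mult'[symmetric])
      qed
      finally show ?thesis .
    qed
    have "(\<integral>\<^sup>+y. ennreal (\<bar>k y\<bar> * V y) \<partial>\<mu>)
       \<le> (\<integral>\<^sup>+y. ennreal (T powr (- \<theta>)) * (ennreal (\<bar>k y\<bar> powr P) + ennreal ((T powr \<theta> * V y) powr r)) \<partial>\<mu>)"
    proof (rule nn_integral_mono_AE)
      have pos: "AE y in \<mu>. y > 0" by (simp add: AE_speed_iff)
      then show "AE y in \<mu>. ennreal (\<bar>k y\<bar> * V y)
         \<le> ennreal (T powr (- \<theta>)) * (ennreal (\<bar>k y\<bar> powr P) + ennreal ((T powr \<theta> * V y) powr r))"
      proof eventually_elim
        case (elim y)
        have "\<bar>k y\<bar> * V y = T powr (- \<theta>) * (\<bar>k y\<bar> * (T powr \<theta> * V y))"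
          using T by (simp add: powr_minus field_simps)
        also have "\<dots> \<le> T powr (- \<theta>) * (\<bar>k y\<bar> powr P + (T powr \<theta> * V y) powr r)"
          unfolding r_def using V0[OF elim] P by (intro mult_left_mono Young_crude) auto
        finally show ?case
          by (simp add: ennreal_mult'[symmetric] ennreal_plus[symmetric] ennreal_leI del: ennreal_plus)
      qed
    qed
    also have "\<dots> = ennreal (T powr (- \<theta>)) * ((\<integral>\<^sup>+y. ennreal (\<bar>k y\<bar> powr P) \<partial>\<mu>) + (\<integral>\<^sup>+y. ennreal ((T powr \<theta> * V y) powr r) \<partial>\<mu>))"
    proof -
      have [measurable]: "V \<in> borel_measurable \<mu>" by (rule speed_measurable_borel[OF Vm])
      note km [measurable]
      show ?thesis by (simp add: nn_integral_cmult nn_integral_add)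
    qed
    also have "\<dots> \<le> ennreal (T powr (- \<theta>)) * (ennreal A + ennreal D)"
      unfolding A_def using nn_integral_eq_integral[OF intk] by (intro mult_left_mono add_mono Vint) auto
    also have "\<dots> = ennreal ((A + D) * T powr (- \<theta>))"
      using A D by (simp add: ennreal_mult'[symmetric] ennreal_plus[symmetric] mult.commute del: ennreal_plus)
    finally show ?thesis by (simp add: V_def)
  qed
  then show ?thesis using A D unfolding \<theta>_def by (intro exI[of _ "A + D"]) auto
qed

lemma gen_exp_abs_le:
  assumes y: "y > 0" and s: "s \<ge> 0"
  shows "\<bar>gen_exp \<nu> s y\<bar> \<le> 2 * (1 + s) * ((1 + (1 + s) * y) * mono_exp \<nu> 0 s y)"
proof -
  let ?m = "mono_exp \<nu> 0 s y"
  have m: "0 \<le> ?m" using y by (rule mono_exp_nonneg)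
  have "gen_exp \<nu> s y = ((\<nu> + s * (1 + \<nu>)) - s * (1 + s) * y) * ?m"
    by (simp add: gen_exp_def mono_exp_def algebra_simps)
  then have "\<bar>gen_exp \<nu> s y\<bar> = \<bar>(\<nu> + s * (1 + \<nu>)) - s * (1 + s) * y\<bar> * ?m"
    using m by (simp add: abs_mult)
  also have "\<dots> \<le> (2 * (1 + s) * (1 + (1 + s) * y)) * ?m"
  proof (rule mult_right_mono[OF _ m])
    have a: "0 \<le> \<nu> + s * (1 + \<nu>)" using nu_pos s by simp
    have "s * \<nu> \<le> s * 1" using nu_less s by (intro mult_left_mono) auto
    then have b: "\<nu> + s * (1 + \<nu>) \<le> 2 * (1 + s)" using nu_less s by (simp add: algebra_simps)
    have c: "0 \<le> s * (1 + s) * y" using s y by simp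
    have "s * ((1 + s) * y) \<le> (2 * (1 + s)) * ((1 + s) * y)" using s y by (intro mult_right_mono) auto
    then have d: "s * (1 + s) * y \<le> 2 * (1 + s) * ((1 + s) * y)" by (simp add: mult.assoc)
    have "\<bar>(\<nu> + s * (1 + \<nu>)) - s * (1 + s) * y\<bar> \<le> (\<nu> + s * (1 + \<nu>)) + s * (1 + s) * y"
      using a c by linarith
    also have "\<dots> \<le> 2 * (1 + s) + 2 * (1 + s) * ((1 + s) * y)" using b d by linarith
    finally show "\<bar>(\<nu> + s * (1 + \<nu>)) - s * (1 + s) * y\<bar> \<le> 2 * (1 + s) * (1 + (1 + s) * y)"
      by (simp add: algebra_simps)
  qed
  finally show ?thesis by (simp only: mult.assoc)
qed

lemma gen_exp_abs_le_exp:
  assumes y: "y > 0" and s: "s > 0"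
  shows "\<bar>gen_exp \<nu> s y\<bar> \<le> (\<nu> + s * (1 + \<nu>) + 2 * (1 + s)) * mono_exp \<nu> 0 (s / 2) y"
proof -
  let ?m = "mono_exp \<nu> 0 (s / 2) y"
  have m: "0 \<le> ?m" using y by (rule mono_exp_nonneg)
  have e: "mono_exp \<nu> 0 s y = ?m * exp (- (s / 2 * y))"
    by (simp add: mono_exp_def exp_add[symmetric] mult.assoc) 
  have e1: "exp (- (s / 2 * y)) \<le> 1" using s y by simp
  have "s / 2 * y \<le> exp (s / 2 * y)" using exp_ge_add_one_self[of "s / 2 * y"] by linarith
  then have "s / 2 * y * exp (- (s / 2 * y)) \<le> exp (s / 2 * y) * exp (- (s / 2 * y))"
    by (intro mult_right_mono) auto
  also have "\<dots> = 1" by (simp add: exp_add[symmetric])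
  finally have e2: "s * y * exp (- (s / 2 * y)) \<le> 2" by simp
  have "\<bar>gen_exp \<nu> s y\<bar> \<le> (\<nu> + s * (1 + \<nu>)) * mono_exp \<nu> 0 s y + s * (1 + s) * (y * mono_exp \<nu> 0 s y)"
  proof -
    have "0 \<le> (\<nu> + s * (1 + \<nu>)) * mono_exp \<nu> 0 s y" "0 \<le> s * (1 + s) * (y * mono_exp \<nu> 0 s y)"
      using nu_pos s y mono_exp_nonneg[OF y] by (auto intro!: mult_nonneg_nonneg)
    moreover have "gen_exp \<nu> s y = (\<nu> + s * (1 + \<nu>)) * mono_exp \<nu> 0 s y - s * (1 + s) * (y * mono_exp \<nu> 0 s y)"
      by (simp add: gen_exp_def mono_exp_def mult_ac)
    ultimately show ?thesis by linarith
  qed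
  also have "\<dots> = ?m * ((\<nu> + s * (1 + \<nu>)) * exp (- (s / 2 * y)) + (1 + s) * (s * y * exp (- (s / 2 * y))))"
    unfolding e by (simp add: algebra_simps)
  also have "\<dots> \<le> ?m * ((\<nu> + s * (1 + \<nu>)) * 1 + (1 + s) * 2)"
    using nu_pos s e1 e2 m by (intro mult_left_mono add_mono) auto
  finally show ?thesis by (simp add: algebra_simps)
qed

end

context laguerre_power
begin

text \<open>By symmetry \<open>neg_power\<close> moves to the test function, where it is a time integral of the semigroup. At
  time \<open>t\<close> the test function has become \<open>gen_exp \<nu> r\<close> with \<open>1 + r = (1 + s) / flow s t\<close>, and Hoelder's inequality
  bounds its pairing with \<open>k\<close> by \<open>(1 + r) powr ((1 - \<nu>) * inv_exponent p)\<close>. The factor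
  \<open>flow s t powr (- (1 + \<nu>))\<close> decays in \<open>s * t\<close>; part of that decay, the exponent \<open>\<sigma> - \<nu>\<close>, gives the power of \<open>s\<close>
  and leaves the integrable time weight \<open>t powr (\<nu> - 1)\<close>.\<close>

lemma pairing_upper_bound:
  assumes p: "1 < p" and k: "k \<in> Lp p \<mu>" and sn: "\<nu> < \<sigma>"
  shows "\<exists>C\<ge>0. \<forall>s\<ge>1. \<bar>\<integral>x. gen_exp \<nu> s x * neg_power \<mu> h \<sigma> k x \<partial>\<mu>\<bar>
     \<le> C * ((1 + s) powr ((1 - \<nu>) * inv_exponent p) * s powr (- (\<sigma> - \<nu>)))"
proof -
  define \<theta>' where "\<theta>' = (1 - \<nu>) * inv_exponent p"
  have \<theta>': "\<theta>' \<ge> 0" unfolding \<theta>'_def using nu_less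
    by (intro mult_nonneg_nonneg) (auto simp: inv_exponent_def)
  obtain C where C: "C \<ge> 0" and H: "\<And>T. T \<ge> 1 \<Longrightarrow>
     (\<integral>\<^sup>+y. ennreal (\<bar>k y\<bar> * ((1 + T * y) * mono_exp \<nu> 0 (T - 1) y)) \<partial>\<mu>) \<le> ennreal (C * T powr (- (1 - \<theta>')))"
    using Lp_exp_weight_le[OF p k] unfolding \<theta>'_def by blast
  have km [measurable]: "k \<in> borel_measurable \<mu>" using k by (simp add: Lp_def)
  have idm [measurable]: "(\<lambda>x. x) \<in> borel_measurable \<mu>" by (rule speed_measurable_borel) simp
  have fm [measurable]: "fst \<in> borel_measurable (\<mu> \<Otimes>\<^sub>M \<mu>)" and sm [measurable]: "snd \<in> borel_measurable (\<mu> \<Otimes>\<^sub>M \<mu>)"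
    by (rule speed_fst, rule speed_snd)
  have pos: "AE y in \<mu>. y > 0" by (simp add: AE_speed_iff)
  interpret P2: pair_sigma_finite \<mu> \<mu> ..
  interpret PL: pair_sigma_finite lborel \<mu> ..
  have k_weight: "(\<integral>\<^sup>+y. ennreal (\<bar>k y\<bar> * y powr \<nu>) \<partial>\<mu>) < \<infinity>"
  proof -
    have "(\<integral>\<^sup>+y. ennreal (\<bar>k y\<bar> * y powr \<nu>) \<partial>\<mu>) \<le> (\<integral>\<^sup>+y. ennreal (\<bar>k y\<bar> * ((1 + 1 * y) * mono_exp \<nu> 0 (1 - 1) y)) \<partial>\<mu>)"
    proof (rule nn_integral_mono_AE, use pos in eventually_elim)
      case (elim y)
      have "1 * y powr \<nu> \<le> (1 + 1 * y) * y powr \<nu>" using elim by (intro mult_right_mono) auto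
      then show ?case by (intro ennreal_leI mult_left_mono) (auto simp: mono_exp_def)
    qed
    also have "\<dots> < \<infinity>" using H[of 1] by (simp add: le_less_trans)
    finally show ?thesis .
  qed
  define J where "J = Gamma \<nu> / \<nu> powr \<nu> + Gamma (\<nu> + 1) / \<nu> powr (\<nu> + 1)"
  have J: "J \<ge> 0" unfolding J_def using nu_pos by (intro add_nonneg_nonneg divide_nonneg_nonneg Gamma_real_nonneg) auto
  have main: "\<bar>\<integral>x. gen_exp \<nu> s x * neg_power \<mu> h \<sigma> k x \<partial>\<mu>\<bar>
      \<le> (1 / Gamma \<sigma> * (2 * C * J)) * ((1 + s) powr \<theta>' * s powr (- (\<sigma> - \<nu>)))" if s: "s \<ge> 1" for s
  proof -
    let ?w = "gen_exp \<nu> s"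
    define C1 where "C1 = \<nu> + s * (1 + \<nu>) + 2 * (1 + s)"
    have C1: "C1 \<ge> 0" using s nu_pos by (simp add: C1_def)
    have w_le: "\<bar>?w x\<bar> \<le> C1 * mono_exp \<nu> 0 (s / 2) x" if "x > 0" for x
      unfolding C1_def using that s by (intro gen_exp_abs_le_exp) auto
    have wm [measurable]: "?w \<in> borel_measurable \<mu>" by (rule speed_measurable_borel) measurable
    have int: "integrable (\<mu> \<Otimes>\<^sub>M \<mu>) (\<lambda>(x, y). ?w x * (K x y * k y))"
    proof (rule integrableI_bounded)
      show m: "(\<lambda>(x, y). ?w x * (K x y * k y)) \<in> borel_measurable (\<mu> \<Otimes>\<^sub>M \<mu>)"
        unfolding case_prod_beta' by measurable
      have "(\<integral>\<^sup>+p. ennreal (norm (case p of (x, y) \<Rightarrow> ?w x * (K x y * k y))) \<partial>(\<mu> \<Otimes>\<^sub>M \<mu>))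
         = (\<integral>\<^sup>+y. \<integral>\<^sup>+x. ennreal (norm (?w x * (K x y * k y))) \<partial>\<mu> \<partial>\<mu>)"
        using m by (subst P2.nn_integral_snd[symmetric]) (auto simp: case_prod_beta')
      also have "\<dots> \<le> (\<integral>\<^sup>+y. ennreal (C1 * (1 / \<nu> powr \<sigma>)) * ennreal (\<bar>k y\<bar> * y powr \<nu>) \<partial>\<mu>)"
      proof (rule nn_integral_mono_AE, use pos in eventually_elim)
        case (elim y)
        have "(\<integral>\<^sup>+x. ennreal (norm (?w x * (K x y * k y))) \<partial>\<mu>)
           \<le> (\<integral>\<^sup>+x. ennreal (C1 * \<bar>k y\<bar>) * ennreal (K y x * mono_exp \<nu> 0 (s / 2) x) \<partial>\<mu>)"
        proof (rule nn_integral_mono_AE, use pos in eventually_elim)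
          case (elim x)
          have "norm (?w x * (K x y * k y)) = \<bar>?w x\<bar> * (K y x * \<bar>k y\<bar>)"
            by (simp add: abs_mult K_nonneg K_sym[of x y])
          also have "\<dots> \<le> (C1 * mono_exp \<nu> 0 (s / 2) x) * (K y x * \<bar>k y\<bar>)"
            by (intro mult_right_mono w_le elim mult_nonneg_nonneg K_nonneg) simp
          finally show ?case using C1
            by (subst ennreal_mult'[symmetric]) (auto intro!: ennreal_leI simp: mult_ac)
        qed
        also have "\<dots> = ennreal (C1 * \<bar>k y\<bar>) * (\<integral>\<^sup>+x. ennreal (K y x * mono_exp \<nu> 0 (s / 2) x) \<partial>\<mu>)"
        proof (rule nn_integral_cmult)
          have "(\<lambda>x. K y x * mono_exp \<nu> 0 (s / 2) x) \<in> borel_measurable borel" by measurable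
          then show "(\<lambda>x. ennreal (K y x * mono_exp \<nu> 0 (s / 2) x)) \<in> borel_measurable \<mu>"
            by (intro measurable_compose[OF _ measurable_ennreal] speed_measurable_borel)
        qed
        also have "\<dots> \<le> ennreal (C1 * \<bar>k y\<bar>) * ennreal (1 / \<nu> powr \<sigma> * y powr \<nu>)"
          using s by (intro mult_left_mono K_exp_le elim) auto
        also have "\<dots> = ennreal (C1 * (1 / \<nu> powr \<sigma>)) * ennreal (\<bar>k y\<bar> * y powr \<nu>)"
          using C1 by (simp add: ennreal_mult'[symmetric] mult_ac)
        finally show ?case .
      qed
      also have "\<dots> = ennreal (C1 * (1 / \<nu> powr \<sigma>)) * (\<integral>\<^sup>+y. ennreal (\<bar>k y\<bar> * y powr \<nu>) \<partial>\<mu>)"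
        by (rule nn_integral_cmult) measurable
      also have "\<dots> < \<infinity>" using k_weight by (simp add: ennreal_mult_less_top)
      finally show "(\<integral>\<^sup>+p. ennreal (norm (case p of (x, y) \<Rightarrow> ?w x * (K x y * k y))) \<partial>(\<mu> \<Otimes>\<^sub>M \<mu>)) < \<infinity>" .
    qed
    have swap: "(\<integral>x. ?w x * neg_power \<mu> h \<sigma> k x \<partial>\<mu>) = (\<integral>y. k y * neg_power \<mu> h \<sigma> ?w y \<partial>\<mu>)"
    proof -
      have "(\<integral>x. ?w x * neg_power \<mu> h \<sigma> k x \<partial>\<mu>) = (\<integral>x. \<integral>y. ?w x * (K x y * k y) \<partial>\<mu> \<partial>\<mu>)"
        by (simp add: neg_power_def)
      also have "\<dots> = (\<integral>y. \<integral>x. ?w x * (K x y * k y) \<partial>\<mu> \<partial>\<mu>)"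
        by (rule P2.Fubini_integral[OF int, symmetric])
      also have "\<dots> = (\<integral>y. k y * neg_power \<mu> h \<sigma> ?w y \<partial>\<mu>)"
      proof (rule Bochner_Integration.integral_cong[OF refl])
        fix y
        have "(\<lambda>x. ?w x * (K x y * k y)) = (\<lambda>x. k y * (K y x * ?w x))"
          by (simp add: fun_eq_iff K_sym[of _ y])
        then show "(\<integral>x. ?w x * (K x y * k y) \<partial>\<mu>) = k y * neg_power \<mu> h \<sigma> ?w y"
          by (simp add: neg_power_def)
      qed
      finally show ?thesis .
    qed
    define c where "c t = exp (- \<nu> * t) * flow s t powr (- (1 + \<nu>))" for t
    define st where "st t = s * exp (- t) / flow s t" for t
    have cm [measurable]: "c \<in> borel_measurable borel" "st \<in> borel_measurable borel"
      unfolding c_def st_def by measurable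
    have c0: "c t \<ge> 0" for t by (simp add: c_def)
    have neg_le: "ennreal \<bar>neg_power \<mu> h \<sigma> ?w y\<bar>
       \<le> ennreal (1 / Gamma \<sigma>) * (\<integral>\<^sup>+t. ennreal (time_weight \<sigma> t * c t * \<bar>gen_exp \<nu> (st t) y\<bar>) \<partial>lborel)" if y: "y > 0" for y
    proof -
      have eq: "time_weight \<sigma> t * (\<integral>x. h t y x * ?w x \<partial>\<mu>) = time_weight \<sigma> t * (c t * gen_exp \<nu> (st t) y)" for t
        using gen_exp_heat[of t s y] s y
        by (cases "t > 0") (auto simp: has_bochner_integral_iff time_weight_def c_def st_def)
      note I = neg_power_time_integral[of ?w "s / 2" y C1, OF _ _ y w_le]
      have I2: "integrable lborel (\<lambda>t. time_weight \<sigma> t * (c t * gen_exp \<nu> (st t) y))"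
        using I(2) s unfolding eq by simp
      have "neg_power \<mu> h \<sigma> ?w y = (\<integral>t. time_weight \<sigma> t * (c t * gen_exp \<nu> (st t) y) \<partial>lborel) / Gamma \<sigma>"
        using I(1) s unfolding eq by simp
      then have "ennreal \<bar>neg_power \<mu> h \<sigma> ?w y\<bar>
        = ennreal (1 / Gamma \<sigma>) * ennreal \<bar>\<integral>t. time_weight \<sigma> t * (c t * gen_exp \<nu> (st t) y) \<partial>lborel\<bar>"
        using Gamma_sigma by (simp add: ennreal_mult'[symmetric] abs_divide)
      also have "\<dots> \<le> ennreal (1 / Gamma \<sigma>) * (\<integral>\<^sup>+t. ennreal (norm (time_weight \<sigma> t * (c t * gen_exp \<nu> (st t) y))) \<partial>lborel)"
        using integral_norm_bound_ennreal[OF I2] by (intro mult_left_mono) auto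
      finally show ?thesis
        by (simp add: abs_mult time_weight_nonneg c0 mult.assoc)
    qed
    have inner_le: "(\<integral>\<^sup>+y. ennreal (time_weight \<sigma> t * c t * \<bar>gen_exp \<nu> (st t) y\<bar> * \<bar>k y\<bar>) \<partial>\<mu>)
        \<le> ennreal (2 * C * ((1 + s) powr \<theta>' * s powr (- (\<sigma> - \<nu>)))) * (ennreal (gamma_density \<nu> \<nu> t) + ennreal (gamma_density (\<nu> + 1) \<nu> t))" for t
    proof (cases "t > 0")
      case False
      then show ?thesis by (simp add: time_weight_def)
    next
      case t: True
      have F: "1 \<le> flow s t" using s t by (intro flow_ge_1) auto
      have st0: "0 \<le> st t" using s F by (simp add: st_def)
      define T where "T = 1 + st t"
      have T: "T \<ge> 1" "T - 1 = st t" using st0 by (auto simp: T_def)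
      have Teq: "T = (1 + s) / flow s t"
        using F by (simp add: T_def st_def field_simps) (simp add: flow_def algebra_simps)
      have Tle: "T \<le> 1 + s" unfolding Teq using F s by (simp add: divide_le_eq)
      have gen: "(\<integral>\<^sup>+y. ennreal (\<bar>gen_exp \<nu> (st t) y\<bar> * \<bar>k y\<bar>) \<partial>\<mu>) \<le> ennreal (2 * C * (1 + s) powr \<theta>')"
      proof -
        have "(\<integral>\<^sup>+y. ennreal (\<bar>gen_exp \<nu> (st t) y\<bar> * \<bar>k y\<bar>) \<partial>\<mu>)
           \<le> (\<integral>\<^sup>+y. ennreal (2 * T) * ennreal (\<bar>k y\<bar> * ((1 + T * y) * mono_exp \<nu> 0 (T - 1) y)) \<partial>\<mu>)"
        proof (rule nn_integral_mono_AE, use pos in eventually_elim)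
          case (elim y)
          have "\<bar>gen_exp \<nu> (st t) y\<bar> \<le> 2 * T * ((1 + T * y) * mono_exp \<nu> 0 (T - 1) y)"
            using gen_exp_abs_le[OF elim st0] unfolding T(2) by (simp add: T_def)
          then have "\<bar>gen_exp \<nu> (st t) y\<bar> * \<bar>k y\<bar> \<le> 2 * T * ((1 + T * y) * mono_exp \<nu> 0 (T - 1) y) * \<bar>k y\<bar>"
            by (rule mult_right_mono) simp
          then show ?case using T by (subst ennreal_mult'[symmetric]) (auto intro!: ennreal_leI simp: mult_ac)
        qed
        also have "\<dots> = ennreal (2 * T) * (\<integral>\<^sup>+y. ennreal (\<bar>k y\<bar> * ((1 + T * y) * mono_exp \<nu> 0 (T - 1) y)) \<partial>\<mu>)"
        proof (rule nn_integral_cmult)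
          have [measurable]: "mono_exp \<nu> 0 (T - 1) \<in> borel_measurable \<mu>" by (rule speed_measurable_borel) measurable
          show "(\<lambda>y. ennreal (\<bar>k y\<bar> * ((1 + T * y) * mono_exp \<nu> 0 (T - 1) y))) \<in> borel_measurable \<mu>" by measurable
        qed
        also have "\<dots> \<le> ennreal (2 * T) * ennreal (C * T powr (- (1 - \<theta>')))"
          by (intro mult_left_mono H T) simp
        also have "\<dots> = ennreal (2 * C * T powr \<theta>')"
        proof -
          have "T * T powr (- (1 - \<theta>')) = T powr \<theta>'" using T by (simp add: powr_mult_base)
          then have "2 * T * (C * T powr (- (1 - \<theta>'))) = 2 * C * T powr \<theta>'"
            by (metis mult.assoc mult.left_commute)
          moreover have "ennreal (2 * T) * ennreal (C * T powr (- (1 - \<theta>'))) = ennreal (2 * T * (C * T powr (- (1 - \<theta>'))))"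
            by (rule ennreal_mult'[symmetric]) (use T in simp)
          ultimately show ?thesis by (simp only:)
        qed
        also have "\<dots> \<le> ennreal (2 * C * (1 + s) powr \<theta>')"
          using C \<theta>' T Tle by (intro ennreal_leI mult_left_mono powr_mono2) auto
        finally show ?thesis .
      qed
      have time: "time_weight \<sigma> t * c t \<le> s powr (- (\<sigma> - \<nu>)) * (gamma_density \<nu> \<nu> t + gamma_density (\<nu> + 1) \<nu> t)"
      proof -
        have "exp (- t) \<le> 1 / (1 + t)"
          using exp_ge_add_one_self[of t] t by (simp add: exp_minus inverse_eq_divide frac_le)
        then have "s * (1 - 1 / (1 + t)) \<le> s * (1 - exp (- t))" using s by (intro mult_left_mono) auto
        moreover have "1 - 1 / (1 + t) = t / (1 + t)" using t by (simp add: field_simps)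
        ultimately have Fl: "s * t / (1 + t) \<le> flow s t" by (simp add: flow_def)
        have stp: "0 < s * t / (1 + t)" using s t by simp
        have "flow s t powr (- (1 + \<nu>)) \<le> flow s t powr (- (\<sigma> - \<nu>))"
          using F sigma nu_pos by (intro powr_mono) auto
        also have "\<dots> \<le> (s * t / (1 + t)) powr (- (\<sigma> - \<nu>))"
          using sn Fl stp by (intro powr_mono2') auto
        also have "\<dots> = s powr (- (\<sigma> - \<nu>)) * (t powr (- (\<sigma> - \<nu>)) * (1 + t) powr (\<sigma> - \<nu>))"
        proof -
          have e: "(1 + t) powr (\<sigma> - \<nu>) = 1 / (1 + t) powr (- (\<sigma> - \<nu>))"
            using powr_minus_divide[of "1 + t" "- (\<sigma> - \<nu>)"] by simp
          show ?thesis unfolding e using s t by (simp add: powr_divide powr_mult)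
        qed
        also have "\<dots> \<le> s powr (- (\<sigma> - \<nu>)) * (t powr (- (\<sigma> - \<nu>)) * (1 + t) powr 1)"
          using sigma nu_pos t by (intro mult_left_mono powr_mono) auto
        finally have "flow s t powr (- (1 + \<nu>)) \<le> s powr (- (\<sigma> - \<nu>)) * (t powr (- (\<sigma> - \<nu>)) * (1 + t))"
          using t by simp
        then have "time_weight \<sigma> t * (exp (- \<nu> * t) * flow s t powr (- (1 + \<nu>)))
           \<le> time_weight \<sigma> t * (exp (- \<nu> * t) * (s powr (- (\<sigma> - \<nu>)) * (t powr (- (\<sigma> - \<nu>)) * (1 + t))))"
          by (intro mult_left_mono time_weight_nonneg) auto
        also have "\<dots> = s powr (- (\<sigma> - \<nu>)) * (exp (- \<nu> * t) * ((t powr (\<sigma> - 1) * t powr (- (\<sigma> - \<nu>))) * (1 + t)))"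
          using t by (simp add: time_weight_def mult_ac)
        also have "t powr (\<sigma> - 1) * t powr (- (\<sigma> - \<nu>)) = t powr (\<nu> - 1)"
          by (simp add: powr_add[symmetric])
        also have "t powr (\<nu> - 1) * (1 + t) = t powr (\<nu> - 1) + t powr \<nu>"
        proof -
          have "t * t powr (\<nu> - 1) = t powr \<nu>" using t by (simp add: powr_mult_base)
          then show ?thesis
            by (simp only: distrib_left mult_1_right mult.commute[of "t powr (\<nu> - 1)" t])
        qed
        finally show ?thesis using t by (simp add: c_def gamma_density_def algebra_simps)
      qed
      have "(\<integral>\<^sup>+y. ennreal (time_weight \<sigma> t * c t * \<bar>gen_exp \<nu> (st t) y\<bar> * \<bar>k y\<bar>) \<partial>\<mu>)
         = (\<integral>\<^sup>+y. ennreal (time_weight \<sigma> t * c t) * ennreal (\<bar>gen_exp \<nu> (st t) y\<bar> * \<bar>k y\<bar>) \<partial>\<mu>)"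
        by (simp add: ennreal_mult'[symmetric] time_weight_nonneg c0 mult.assoc)
      also have "\<dots> = ennreal (time_weight \<sigma> t * c t) * (\<integral>\<^sup>+y. ennreal (\<bar>gen_exp \<nu> (st t) y\<bar> * \<bar>k y\<bar>) \<partial>\<mu>)"
      proof (rule nn_integral_cmult)
        have [measurable]: "gen_exp \<nu> (st t) \<in> borel_measurable \<mu>" by (rule speed_measurable_borel) measurable
        show "(\<lambda>y. ennreal (\<bar>gen_exp \<nu> (st t) y\<bar> * \<bar>k y\<bar>)) \<in> borel_measurable \<mu>" by measurable
      qed
      also have "\<dots> \<le> ennreal (s powr (- (\<sigma> - \<nu>)) * (gamma_density \<nu> \<nu> t + gamma_density (\<nu> + 1) \<nu> t)) * ennreal (2 * C * (1 + s) powr \<theta>')"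
        by (intro mult_mono ennreal_leI time gen) auto
      also have "\<dots> = ennreal ((2 * C * ((1 + s) powr \<theta>' * s powr (- (\<sigma> - \<nu>)))) * (gamma_density \<nu> \<nu> t + gamma_density (\<nu> + 1) \<nu> t))"
        by (subst ennreal_mult'[symmetric]) (auto simp: gamma_density_nonneg mult_ac)
      also have "\<dots> = ennreal (2 * C * ((1 + s) powr \<theta>' * s powr (- (\<sigma> - \<nu>)))) * ennreal (gamma_density \<nu> \<nu> t + gamma_density (\<nu> + 1) \<nu> t)"
        by (rule ennreal_mult') (use C in auto)
      finally show ?thesis by (simp add: gamma_density_nonneg)
    qed
    have time_total: "(\<integral>\<^sup>+t. \<integral>\<^sup>+y. ennreal (time_weight \<sigma> t * c t * \<bar>gen_exp \<nu> (st t) y\<bar> * \<bar>k y\<bar>) \<partial>\<mu> \<partial>lborel)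
       \<le> ennreal (2 * C * ((1 + s) powr \<theta>' * s powr (- (\<sigma> - \<nu>)))) * ennreal J"
    proof -
      have "(\<integral>\<^sup>+t. \<integral>\<^sup>+y. ennreal (time_weight \<sigma> t * c t * \<bar>gen_exp \<nu> (st t) y\<bar> * \<bar>k y\<bar>) \<partial>\<mu> \<partial>lborel)
       \<le> (\<integral>\<^sup>+t. ennreal (2 * C * ((1 + s) powr \<theta>' * s powr (- (\<sigma> - \<nu>)))) * (ennreal (gamma_density \<nu> \<nu> t) + ennreal (gamma_density (\<nu> + 1) \<nu> t)) \<partial>lborel)"
      by (intro nn_integral_mono inner_le)
    also have "\<dots> = ennreal (2 * C * ((1 + s) powr \<theta>' * s powr (- (\<sigma> - \<nu>)))) * (ennreal (Gamma \<nu> / \<nu> powr \<nu>) + ennreal (Gamma (\<nu> + 1) / \<nu> powr (\<nu> + 1)))"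
      using nu_pos by (simp add: nn_integral_cmult nn_integral_add nn_integral_gamma_density)
    also have "ennreal (Gamma \<nu> / \<nu> powr \<nu>) + ennreal (Gamma (\<nu> + 1) / \<nu> powr (\<nu> + 1)) = ennreal J"
      unfolding J_def using nu_pos by (intro ennreal_plus[symmetric] divide_nonneg_nonneg Gamma_real_nonneg) auto
      finally show ?thesis .
    qed
    have "ennreal \<bar>\<integral>x. ?w x * neg_power \<mu> h \<sigma> k x \<partial>\<mu>\<bar> \<le> (\<integral>\<^sup>+y. ennreal \<bar>k y * neg_power \<mu> h \<sigma> ?w y\<bar> \<partial>\<mu>)"
      unfolding swap
      using integral_norm_bound_ennreal[of \<mu> "\<lambda>y. k y * neg_power \<mu> h \<sigma> ?w y"]
      by (cases "integrable \<mu> (\<lambda>y. k y * neg_power \<mu> h \<sigma> ?w y)") (auto simp: not_integrable_integral_eq)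
    also have "\<dots> \<le> (\<integral>\<^sup>+y. ennreal (1 / Gamma \<sigma>) * (\<integral>\<^sup>+t. ennreal (time_weight \<sigma> t * c t * \<bar>gen_exp \<nu> (st t) y\<bar> * \<bar>k y\<bar>) \<partial>lborel) \<partial>\<mu>)"
    proof (rule nn_integral_mono_AE, use pos in eventually_elim)
      case (elim y)
      have "ennreal \<bar>k y * neg_power \<mu> h \<sigma> ?w y\<bar> = ennreal \<bar>neg_power \<mu> h \<sigma> ?w y\<bar> * ennreal \<bar>k y\<bar>"
        by (simp add: abs_mult ennreal_mult mult.commute)
      also have "\<dots> \<le> (ennreal (1 / Gamma \<sigma>) * (\<integral>\<^sup>+t. ennreal (time_weight \<sigma> t * c t * \<bar>gen_exp \<nu> (st t) y\<bar>) \<partial>lborel)) * ennreal \<bar>k y\<bar>"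
        by (intro mult_right_mono neg_le elim) simp
      also have "\<dots> = ennreal (1 / Gamma \<sigma>) * (\<integral>\<^sup>+t. ennreal (time_weight \<sigma> t * c t * \<bar>gen_exp \<nu> (st t) y\<bar>) * ennreal \<bar>k y\<bar> \<partial>lborel)"
        by (simp add: mult.assoc nn_integral_multc)
      also have "\<dots> = ennreal (1 / Gamma \<sigma>) * (\<integral>\<^sup>+t. ennreal (time_weight \<sigma> t * c t * \<bar>gen_exp \<nu> (st t) y\<bar> * \<bar>k y\<bar>) \<partial>lborel)"
        by (simp add: ennreal_mult time_weight_nonneg c0)
      finally show ?case .
    qed
    also have "\<dots> = ennreal (1 / Gamma \<sigma>) * (\<integral>\<^sup>+y. \<integral>\<^sup>+t. ennreal (time_weight \<sigma> t * c t * \<bar>gen_exp \<nu> (st t) y\<bar> * \<bar>k y\<bar>) \<partial>lborel \<partial>\<mu>)"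
      by (rule nn_integral_cmult) measurable
    also have "(\<integral>\<^sup>+y. \<integral>\<^sup>+t. ennreal (time_weight \<sigma> t * c t * \<bar>gen_exp \<nu> (st t) y\<bar> * \<bar>k y\<bar>) \<partial>lborel \<partial>\<mu>)
       = (\<integral>\<^sup>+t. \<integral>\<^sup>+y. ennreal (time_weight \<sigma> t * c t * \<bar>gen_exp \<nu> (st t) y\<bar> * \<bar>k y\<bar>) \<partial>\<mu> \<partial>lborel)"
      by (rule PL.Fubini') (simp add: case_prod_beta', measurable)
    also have "ennreal (1 / Gamma \<sigma>) * \<dots> \<le> ennreal (1 / Gamma \<sigma>) * (ennreal (2 * C * ((1 + s) powr \<theta>' * s powr (- (\<sigma> - \<nu>)))) * ennreal J)"
      by (intro mult_left_mono time_total) simp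
    also have "\<dots> = ennreal ((1 / Gamma \<sigma> * (2 * C * J)) * ((1 + s) powr \<theta>' * s powr (- (\<sigma> - \<nu>))))"
      using C J Gamma_sigma by (simp add: ennreal_mult'[symmetric] mult_ac)
    finally have le: "ennreal \<bar>\<integral>x. ?w x * neg_power \<mu> h \<sigma> k x \<partial>\<mu>\<bar>
       \<le> ennreal ((1 / Gamma \<sigma> * (2 * C * J)) * ((1 + s) powr \<theta>' * s powr (- (\<sigma> - \<nu>))))" .
    have nn: "0 \<le> (1 / Gamma \<sigma> * (2 * C * J)) * ((1 + s) powr \<theta>' * s powr (- (\<sigma> - \<nu>)))"
      using C J Gamma_sigma by (intro mult_nonneg_nonneg) auto
    from le show ?thesis unfolding ennreal_le_iff[OF nn] .
  qed
  have "0 \<le> 1 / Gamma \<sigma> * (2 * C * J)" using C J Gamma_sigma by simp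
  with main show ?thesis unfolding \<theta>'_def by blast
qed

end

context laguerre_power
begin

lemma sing_measurable: "sing \<in> borel_measurable \<mu>"
  unfolding sing_def by (rule neg_power_measurable) (rule speed_measurable_borel, measurable)

text \<open>Near the origin \<open>sing\<^sup>2\<close> is \<open>(amp 0)\<^sup>2 * x powr (2 * \<nu>)\<close>, whose pairing with \<open>gen_exp \<nu> s\<close>
  is computed exactly from Gamma integrals; the remainder is one order smaller in \<open>s\<close>.\<close>

lemma pairing_lower_bound:
  "\<exists>A>0. \<exists>E\<ge>0. \<forall>s\<ge>1. (1 + s) powr (- (1 + 2 * \<nu>)) * (A * (s - 1) - E)
     \<le> \<bar>\<integral>x. gen_exp \<nu> s x * (sing x)\<^sup>2 \<partial>\<mu>\<bar>"
proof -
  define a where "a = (amp 0)\<^sup>2"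
  have a: "a > 0" using amp_0_pos by (simp add: a_def)
  define G1 where "G1 = Gamma (1 + 2 * \<nu>)"
  have G1: "G1 > 0" unfolding G1_def using nu_pos by (intro Gamma_real_pos) simp
  have G2: "Gamma (2 + 2 * \<nu>) = (1 + 2 * \<nu>) * G1"
    using Gamma_Suc_shift[of "1 + 2 * \<nu>"] nu_pos by (simp add: G1_def add_ac)
  have G3: "Gamma (3 + 2 * \<nu>) \<ge> 0" using nu_pos by (intro Gamma_real_nonneg) simp
  define E where "E = 2 * a * (2 * Gamma (2 + 2 * \<nu>) + Gamma (3 + 2 * \<nu>))"
  have E: "E \<ge> 0" unfolding E_def G2 using a G1 G3 nu_pos by (intro mult_nonneg_nonneg add_nonneg_nonneg) auto
  have "(1 + s) powr (- (1 + 2 * \<nu>)) * (a * G1 * \<nu> * (s - 1) - E) \<le> \<bar>\<integral>x. gen_exp \<nu> s x * (sing x)\<^sup>2 \<partial>\<mu>\<bar>"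
    if s: "s \<ge> 1" for s
  proof -
    define b where "b = 1 + s"
    define c where "c = \<nu> + s * (1 + \<nu>)"
    have b: "b \<ge> 2" using s by (simp add: b_def)
    have c: "0 \<le> c" using s nu_pos by (simp add: c_def)
    have "s * \<nu> \<le> s * 1" using nu_less s by (intro mult_left_mono) auto
    then have cb: "c \<le> 2 * b" using nu_less by (simp add: c_def b_def algebra_simps)
    let ?w = "gen_exp \<nu> s"
    define g where "g x = c * gamma_density (1 + 2 * \<nu>) b x - s * b * gamma_density (2 + 2 * \<nu>) b x" for x
    define G where "G x = c * gamma_density (2 + 2 * \<nu>) b x + s * b * gamma_density (3 + 2 * \<nu>) b x" for x
    have int: "integrable lborel (gamma_density (1 + 2 * \<nu>) b)" "integrable lborel (gamma_density (2 + 2 * \<nu>) b)"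
      "integrable lborel (gamma_density (3 + 2 * \<nu>) b)"
      using nu_pos b by (auto intro!: integrable_gamma_density)
    have ig: "integrable lborel g" unfolding g_def using int by auto
    have iG: "integrable lborel G" unfolding G_def using int by auto
    have bp: "b powr (2 + 2 * \<nu>) = b * b powr (1 + 2 * \<nu>)" "b powr (3 + 2 * \<nu>) = b * (b * b powr (1 + 2 * \<nu>))"
      using b powr_mult_base[of b "1 + 2 * \<nu>"] powr_mult_base[of b "2 + 2 * \<nu>"] by (simp_all add: add_ac)
    have bpos: "b powr (1 + 2 * \<nu>) > 0" using b by simp
    have bm: "b powr (- (1 + 2 * \<nu>)) = 1 / b powr (1 + 2 * \<nu>)" by (rule powr_minus_divide)
    have Ig: "integral\<^sup>L lborel g = b powr (- (1 + 2 * \<nu>)) * (G1 * \<nu> * (1 - s))"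
    proof -
      have "integral\<^sup>L lborel g = c * (G1 / b powr (1 + 2 * \<nu>)) - s * b * (Gamma (2 + 2 * \<nu>) / b powr (2 + 2 * \<nu>))"
        unfolding g_def G1_def using int nu_pos b by (simp add: integral_gamma_density)
      also have "\<dots> = (c - s * (1 + 2 * \<nu>)) * G1 / b powr (1 + 2 * \<nu>)"
        unfolding G2 bp using b bpos by (simp add: diff_divide_distrib left_diff_distrib mult.assoc)
      also have "c - s * (1 + 2 * \<nu>) = \<nu> * (1 - s)" by (simp add: c_def algebra_simps)
      finally show ?thesis unfolding bm by simp
    qed
    have IG: "integral\<^sup>L lborel G \<le> b powr (- (1 + 2 * \<nu>)) * (2 * Gamma (2 + 2 * \<nu>) + Gamma (3 + 2 * \<nu>))"
    proof -
      have "integral\<^sup>L lborel G = c * (Gamma (2 + 2 * \<nu>) / b powr (2 + 2 * \<nu>)) + s * b * (Gamma (3 + 2 * \<nu>) / b powr (3 + 2 * \<nu>))"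
        unfolding G_def using int nu_pos b by (simp add: integral_gamma_density)
      also have "\<dots> = (c / b) * (Gamma (2 + 2 * \<nu>) / b powr (1 + 2 * \<nu>)) + (s / b) * (Gamma (3 + 2 * \<nu>) / b powr (1 + 2 * \<nu>))"
        unfolding bp using b bpos by simp
      also have "\<dots> \<le> 2 * (Gamma (2 + 2 * \<nu>) / b powr (1 + 2 * \<nu>)) + 1 * (Gamma (3 + 2 * \<nu>) / b powr (1 + 2 * \<nu>))"
      proof (intro add_mono mult_right_mono)
        show "c / b \<le> 2" using cb b by (simp add: divide_le_eq)
        show "s / b \<le> 1" using s by (simp add: b_def)
        show "0 \<le> Gamma (2 + 2 * \<nu>) / b powr (1 + 2 * \<nu>)" unfolding G2 using G1 nu_pos by simp
        show "0 \<le> Gamma (3 + 2 * \<nu>) / b powr (1 + 2 * \<nu>)" using G3 by simp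
      qed
      finally show ?thesis unfolding bm by (simp add: add_divide_distrib)
    qed
    have wg: "speed_density \<nu> x * (x powr (2 * \<nu>) * ?w x) = g x" for x
    proof (cases "x > 0")
      case True
      have "speed_density \<nu> x * (x powr (2 * \<nu>) * ?w x)
        = c * (speed_density \<nu> x * (x powr (2 * \<nu>) * mono_exp \<nu> 0 s x)) - s * b * (speed_density \<nu> x * (x powr (2 * \<nu>) * mono_exp \<nu> 1 s x))"
        by (simp add: gen_exp_def c_def b_def algebra_simps)
      then show ?thesis by (simp add: speed_density_powr_mono_exp[OF True] g_def b_def add_ac)
    qed (simp add: speed_density_nonpos g_def gamma_density_def)
    have gG: "x * \<bar>g x\<bar> \<le> G x" if x: "x > 0" for x
    proof -
      have shift: "x * gamma_density (1 + 2 * \<nu>) b x = gamma_density (2 + 2 * \<nu>) b x"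
         "x * gamma_density (2 + 2 * \<nu>) b x = gamma_density (3 + 2 * \<nu>) b x"
        using x powr_mult_base[of x "2 * \<nu>"] powr_mult_base[of x "1 + 2 * \<nu>"]
        by (simp_all add: gamma_density_def mult.assoc[symmetric] add_ac)
      have "\<bar>g x\<bar> \<le> c * gamma_density (1 + 2 * \<nu>) b x + s * b * gamma_density (2 + 2 * \<nu>) b x"
      proof -
        have "0 \<le> c * gamma_density (1 + 2 * \<nu>) b x" "0 \<le> s * b * gamma_density (2 + 2 * \<nu>) b x"
          using c s b by (auto intro!: mult_nonneg_nonneg gamma_density_nonneg)
        then show ?thesis unfolding g_def by linarith
      qed
      from mult_left_mono[OF this, of x] x
      have "x * \<bar>g x\<bar> \<le> c * (x * gamma_density (1 + 2 * \<nu>) b x) + s * b * (x * gamma_density (2 + 2 * \<nu>) b x)"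
        by (simp add: algebra_simps)
      then show ?thesis unfolding shift G_def .
    qed
    define F where "F x = speed_density \<nu> x * (?w x * (sing x)\<^sup>2)" for x
    have wm: "(\<lambda>x. ?w x * (sing x)\<^sup>2) \<in> borel_measurable \<mu>"
    proof -
      have [measurable]: "?w \<in> borel_measurable \<mu>" by (rule speed_measurable_borel) measurable
      note sing_measurable [measurable]
      show ?thesis by measurable
    qed
    have Fm [measurable]: "F \<in> borel_measurable borel" unfolding F_def by (rule speed_measurable_times_density[OF wm])
    have diff: "\<bar>F x - a * g x\<bar> \<le> 2 * a * G x" for x
    proof (cases "x > 0")
      case x: True
      have A: "0 \<le> amp x" "amp x \<le> amp 0" "amp 0 - amp x \<le> amp 0 * x" by (rule amp_bounds[OF x])+
      have "(sing x)\<^sup>2 = x powr (2 * \<nu>) * (amp x)\<^sup>2"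
        unfolding sing_eq[OF x] by (simp add: power_mult_distrib power2_eq_square powr_add[symmetric])
      then have "F x = g x * (amp x)\<^sup>2" unfolding F_def wg[symmetric] by (simp add: mult_ac)
      then have "\<bar>F x - a * g x\<bar> = \<bar>g x\<bar> * \<bar>a - (amp x)\<^sup>2\<bar>"
        by (simp add: abs_mult[symmetric] abs_minus_commute algebra_simps)
      also have "\<bar>a - (amp x)\<^sup>2\<bar> = (amp 0 - amp x) * (amp 0 + amp x)"
      proof -
        have "(amp x)\<^sup>2 \<le> (amp 0)\<^sup>2" using A by (intro power_mono)
        then show ?thesis by (simp add: a_def power2_eq_square algebra_simps)
      qed
      also have "\<dots> \<le> (amp 0 * x) * (amp 0 + amp 0)" using A x amp_0_pos by (intro mult_mono) auto
      also have "\<dots> = 2 * a * x" by (simp add: a_def power2_eq_square algebra_simps)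
      finally have "\<bar>F x - a * g x\<bar> \<le> \<bar>g x\<bar> * (2 * a * x)" by (simp add: mult_left_mono)
      also have "\<dots> = 2 * a * (x * \<bar>g x\<bar>)" by simp
      also have "\<dots> \<le> 2 * a * G x" using a by (intro mult_left_mono gG x) auto
      finally show ?thesis .
    next
      case False
      then show ?thesis by (simp add: F_def g_def G_def speed_density_nonpos gamma_density_def)
    qed
    have iF: "integrable lborel (\<lambda>x. F x - a * g x)"
    proof (rule Bochner_Integration.integrable_bound)
      show "integrable lborel (\<lambda>x. 2 * a * G x)" using iG by simp
      show "(\<lambda>x. F x - a * g x) \<in> borel_measurable lborel" unfolding g_def by measurable
      show "AE x in lborel. norm (F x - a * g x) \<le> norm (2 * a * G x)"
        using diff by (intro AE_I2) (auto intro: order_trans[OF _ abs_ge_self])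
    qed
    have iF2: "integrable lborel F"
      using Bochner_Integration.integrable_add[OF iF, of "\<lambda>x. a * g x"] ig by simp
    have "\<bar>integral\<^sup>L lborel F - a * integral\<^sup>L lborel g\<bar> = \<bar>\<integral>x. F x - a * g x \<partial>lborel\<bar>"
      using iF2 ig by simp
    also have "\<dots> \<le> (\<integral>x. \<bar>F x - a * g x\<bar> \<partial>lborel)" by (rule integral_abs_bound)
    also have "\<dots> \<le> (\<integral>x. 2 * a * G x \<partial>lborel)"
      using iF iG diff by (intro integral_mono) auto
    also have "\<dots> \<le> 2 * a * (b powr (- (1 + 2 * \<nu>)) * (2 * Gamma (2 + 2 * \<nu>) + Gamma (3 + 2 * \<nu>)))"
      using IG a by simp
    also have "\<dots> = b powr (- (1 + 2 * \<nu>)) * E" by (simp add: E_def)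
    finally have near: "\<bar>integral\<^sup>L lborel F - a * integral\<^sup>L lborel g\<bar> \<le> b powr (- (1 + 2 * \<nu>)) * E" .
    have "b powr (- (1 + 2 * \<nu>)) * (a * G1 * \<nu> * (s - 1) - E)
       = - (a * integral\<^sup>L lborel g) - b powr (- (1 + 2 * \<nu>)) * E"
      unfolding Ig by (simp add: algebra_simps)
    also have "\<dots> \<le> \<bar>integral\<^sup>L lborel F\<bar>" using near by linarith
    also have "integral\<^sup>L lborel F = (\<integral>x. ?w x * (sing x)\<^sup>2 \<partial>\<mu>)"
      unfolding F_def by (rule integral_speed[OF wm, symmetric])
    finally show ?thesis by (simp add: b_def)
  qed
  moreover have "a * G1 * \<nu> > 0" using a G1 nu_pos by simp
  ultimately show ?thesis using E by blast
qed

text \<open>The lower bound is of order \<open>s powr (- 2 * \<nu>)\<close> and the upper bound at most of order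
  \<open>s powr (- 3 * \<nu>)\<close>, because \<open>inv_exponent p - \<sigma> \<le> - 4 * \<nu>\<close>.\<close>

theorem sing_squared_not_neg_power:
  assumes p: "1 < p" and k: "k \<in> Lp p \<mu>" and small: "inv_exponent p + 4 * \<nu> \<le> \<sigma>"
  shows "\<not> ae_eq \<mu> (\<lambda>x. (sing x)\<^sup>2) (neg_power \<mu> h \<sigma> k)"
proof
  assume eq: "ae_eq \<mu> (\<lambda>x. (sing x)\<^sup>2) (neg_power \<mu> h \<sigma> k)"
  have ip: "inv_exponent p \<ge> 0" by (simp add: inv_exponent_def)
  have sn: "\<nu> < \<sigma>" using small ip nu_pos by linarith
  obtain C where C: "C \<ge> 0" and up: "\<And>s. s \<ge> 1 \<Longrightarrow> \<bar>\<integral>x. gen_exp \<nu> s x * neg_power \<mu> h \<sigma> k x \<partial>\<mu>\<bar>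
     \<le> C * ((1 + s) powr ((1 - \<nu>) * inv_exponent p) * s powr (- (\<sigma> - \<nu>)))"
    using pairing_upper_bound[OF p k sn] by blast
  obtain A E where A: "A > 0" and low: "\<And>s. s \<ge> 1 \<Longrightarrow> (1 + s) powr (- (1 + 2 * \<nu>)) * (A * (s - 1) - E)
     \<le> \<bar>\<integral>x. gen_exp \<nu> s x * (sing x)\<^sup>2 \<partial>\<mu>\<bar>"
    using pairing_lower_bound by blast
  have km: "k \<in> borel_measurable \<mu>" using k by (simp add: Lp_def)
  have same: "(\<integral>x. gen_exp \<nu> s x * (sing x)\<^sup>2 \<partial>\<mu>) = (\<integral>x. gen_exp \<nu> s x * neg_power \<mu> h \<sigma> k x \<partial>\<mu>)" for s
  proof (rule integral_cong_AE)
    have [measurable]: "gen_exp \<nu> s \<in> borel_measurable \<mu>" by (rule speed_measurable_borel) measurable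
    note sing_measurable [measurable] neg_power_measurable[OF km, measurable]
    show "(\<lambda>x. gen_exp \<nu> s x * (sing x)\<^sup>2) \<in> borel_measurable \<mu>"
      "(\<lambda>x. gen_exp \<nu> s x * neg_power \<mu> h \<sigma> k x) \<in> borel_measurable \<mu>" by measurable
    show "AE x in \<mu>. gen_exp \<nu> s x * (sing x)\<^sup>2 = gen_exp \<nu> s x * neg_power \<mu> h \<sigma> k x"
      using eq unfolding ae_eq_def by eventually_elim simp
  qed
  define \<beta> where "\<beta> = 1 + 2 * \<nu> + (1 - \<nu>) * inv_exponent p"
  have \<beta>0: "\<beta> \<ge> 0" using nu_pos nu_less ip by (simp add: \<beta>_def)
  have "(1 - \<nu>) * inv_exponent p \<le> 1 * inv_exponent p" using ip nu_pos by (intro mult_right_mono) auto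
  then have \<beta>: "\<beta> - (\<sigma> - \<nu>) \<le> 1 - \<nu>" using small by (simp add: \<beta>_def)
  have "A - (A + E) * inverse s \<le> C * 2 powr \<beta> * s powr (- \<nu>)" if s: "s \<ge> 1" for s
  proof -
    have "(1 + s) powr (- (1 + 2 * \<nu>)) * (A * (s - 1) - E)
       \<le> C * ((1 + s) powr ((1 - \<nu>) * inv_exponent p) * s powr (- (\<sigma> - \<nu>)))"
      using low[OF s] up[OF s] by (simp add: same)
    then have "(1 + s) powr (1 + 2 * \<nu>) * ((1 + s) powr (- (1 + 2 * \<nu>)) * (A * (s - 1) - E))
       \<le> (1 + s) powr (1 + 2 * \<nu>) * (C * ((1 + s) powr ((1 - \<nu>) * inv_exponent p) * s powr (- (\<sigma> - \<nu>))))"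
      by (rule mult_left_mono) simp
    also have "(1 + s) powr (1 + 2 * \<nu>) * ((1 + s) powr (- (1 + 2 * \<nu>)) * (A * (s - 1) - E)) = A * (s - 1) - E"
    proof -
      have "(1 + s) powr (1 + 2 * \<nu>) * (1 + s) powr (- (1 + 2 * \<nu>)) = 1"
        using s by (simp only: powr_add[symmetric]) simp
      then show ?thesis by (metis mult.assoc mult_1_left)
    qed
    also have "(1 + s) powr (1 + 2 * \<nu>) * (C * ((1 + s) powr ((1 - \<nu>) * inv_exponent p) * s powr (- (\<sigma> - \<nu>))))
      = C * ((1 + s) powr \<beta> * s powr (- (\<sigma> - \<nu>)))"
      by (simp add: \<beta>_def powr_add mult_ac)
    also have "\<dots> \<le> C * ((2 powr \<beta> * s powr \<beta>) * s powr (- (\<sigma> - \<nu>)))"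
    proof -
      have "(1 + s) powr \<beta> \<le> (2 * s) powr \<beta>" using s \<beta>0 by (intro powr_mono2) auto
      then have "(1 + s) powr \<beta> \<le> 2 powr \<beta> * s powr \<beta>" using s by (simp add: powr_mult)
      then show ?thesis using C by (intro mult_left_mono mult_right_mono) auto
    qed
    also have "\<dots> = C * 2 powr \<beta> * s powr (\<beta> - (\<sigma> - \<nu>))"
    proof -
      have "s powr (\<beta> - (\<sigma> - \<nu>)) = s powr \<beta> * s powr (- (\<sigma> - \<nu>))"
        by (simp only: powr_add[symmetric] add_uminus_conv_diff)
      then show ?thesis by (simp only: mult.assoc)
    qed
    also have "\<dots> \<le> C * 2 powr \<beta> * s powr (1 - \<nu>)"
      using C s \<beta> by (intro mult_left_mono powr_mono) auto
    also have "s powr (1 - \<nu>) = s * s powr (- \<nu>)" using s by (simp add: powr_mult_base)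
    finally have "A * (s - 1) - E \<le> s * (C * 2 powr \<beta> * s powr (- \<nu>))" by (simp add: mult_ac)
    then have "(A * (s - 1) - E) / s \<le> C * 2 powr \<beta> * s powr (- \<nu>)"
      using s by (simp add: divide_le_eq mult.commute)
    moreover have "(A * (s - 1) - E) / s = A - (A + E) * inverse s"
      using s by (simp add: field_simps)
    ultimately show ?thesis by simp
  qed
  then have ev: "\<forall>\<^sub>F s in at_top. A - (A + E) * inverse s \<le> C * 2 powr \<beta> * s powr (- \<nu>)"
    unfolding eventually_at_top_linorder by blast
  have "((\<lambda>s::real. A - (A + E) * inverse s) \<longlongrightarrow> A - (A + E) * 0) at_top"
    by (intro tendsto_intros tendsto_inverse_0_at_top filterlim_ident)
  moreover have "((\<lambda>s::real. C * 2 powr \<beta> * s powr (- \<nu>)) \<longlongrightarrow> C * 2 powr \<beta> * 0) at_top"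
    using nu_pos by (intro tendsto_intros tendsto_neg_powr filterlim_ident) auto
  ultimately have "A - (A + E) * 0 \<le> C * 2 powr \<beta> * 0"
    using ev by (intro tendsto_le[OF trivial_limit_at_top_linorder])
  then show False using A by simp
qed

lemma bounded_in_Lp:
  assumes f: "f \<in> borel_measurable \<mu>" and b: "AE x in \<mu>. \<bar>f x\<bar> \<le> C"
  shows "f \<in> Lp p \<mu>"
proof (cases "p = \<infinity>")
  case True
  then show ?thesis using f b by (auto simp: Lp_def)
next
  case False
  have "integrable \<mu> (\<lambda>x. \<bar>f x\<bar> powr enn2real p)"
  proof (rule integrable_const_bound)
    note f [measurable]
    show "(\<lambda>x. \<bar>f x\<bar> powr enn2real p) \<in> borel_measurable \<mu>" by measurable
    show "AE x in \<mu>. norm (\<bar>f x\<bar> powr enn2real p) \<le> C powr enn2real p"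
      using b by eventually_elim (auto intro!: powr_mono2)
  qed
  then show ?thesis using f False by (simp add: Lp_def)
qed

lemma sing_Lp: "sing \<in> Lp p \<mu>"
proof -
  obtain C where C: "\<And>x. x > 0 \<Longrightarrow> \<bar>sing x\<bar> \<le> C" using sing_bounded by blast
  show ?thesis by (rule bounded_in_Lp[OF sing_measurable, of C]) (auto simp: AE_speed_iff C)
qed

lemma sing_Lp_loc: "sing \<in> Lp_loc p X \<mu>"
  unfolding Lp_loc_def
proof (intro CollectI conjI allI impI sing_measurable)
  fix K assume K: "compactin (mtopology_of X) K"
  then have "closedin (mtopology_of X) K"
    unfolding X_simps by (rule compactin_imp_closedin[OF line_metric.Hausdorff_space_mtopology])
  then have "openin (mtopology_of X) (half_line - K)"
    using openin_diff[OF openin_topspace, of "mtopology_of X" K] by (simp add: X_simps)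
  then have "half_line - K \<in> sets \<mu>"
    using borel_X unfolding borel_measure_on_def by (auto intro: sigma_sets.Basic)
  then have "space \<mu> - (half_line - K) \<in> sets \<mu>" by (rule sets.compl_sets)
  moreover have "space \<mu> - (half_line - K) = K"
    using compactin_subset_topspace[OF K] by (auto simp: space_speed X_simps)
  ultimately have [measurable]: "K \<in> sets \<mu>" by simp
  obtain C where C: "\<And>x. x > 0 \<Longrightarrow> \<bar>sing x\<bar> \<le> C" using sing_bounded by blast
  have C0: "0 \<le> C" using C[of 1] abs_ge_zero[of "sing 1"] by linarith
  show "(\<lambda>x. indicator K x * sing x) \<in> Lp p \<mu>"
  proof (rule bounded_in_Lp[of _ C])
    note sing_measurable [measurable]
    show "(\<lambda>x. indicator K x * sing x) \<in> borel_measurable \<mu>" by measurable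
    show "AE x in \<mu>. \<bar>indicator K x * sing x\<bar> \<le> C"
      using C C0 by (simp add: AE_speed_iff indicator_def)
  qed
qed

lemma mono_exp_Lp: "mono_exp \<nu> 0 1 \<in> Lp p \<mu>"
proof (rule bounded_in_Lp[of _ 1])
  show "mono_exp \<nu> 0 1 \<in> borel_measurable \<mu>" by (rule speed_measurable_borel) measurable
  have "\<bar>mono_exp \<nu> 0 1 x\<bar> \<le> 1" if x: "x > 0" for x
  proof -
    have "x powr \<nu> \<le> exp x" using powr_le_one_plus[of x] exp_ge_add_one_self[of x] x by linarith
    then have "x powr \<nu> * exp (- x) \<le> exp x * exp (- x)" by (intro mult_right_mono) auto
    then show ?thesis by (simp add: mono_exp_def exp_add[symmetric])
  qed
  then show "AE x in \<mu>. \<bar>mono_exp \<nu> 0 1 x\<bar> \<le> 1" by (simp add: AE_speed_iff)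
qed

lemma not_algebra:
  assumes p: "1 < p" and small: "inv_exponent p + 4 * \<nu> \<le> \<sigma>"
  shows "\<not> closed_under_mult (sobolev \<mu> h (2 * \<sigma>) p)"
    and "\<not> closed_under_mult (sobolev_homogeneous X \<mu> h (2 * \<sigma>) p \<inter> Lp \<infinity> \<mu>)"
proof -
  have g: "\<exists>g\<in>Lp p \<mu>. ae_eq \<mu> sing (neg_power \<mu> h (2 * \<sigma> / 2) g)"
    using mono_exp_Lp by (intro bexI[of _ "mono_exp \<nu> 0 1"]) (simp_all add: sing_def ae_eq_refl)
  have no: "\<not> (\<exists>k\<in>Lp p \<mu>. ae_eq \<mu> (\<lambda>x. sing x * sing x) (neg_power \<mu> h (2 * \<sigma> / 2) k))"
    using sing_squared_not_neg_power[OF p _ small] by (simp add: power2_eq_square)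
  have "sing \<in> sobolev \<mu> h (2 * \<sigma>) p" using g sing_Lp by (simp add: sobolev_def)
  moreover have "(\<lambda>x. sing x * sing x) \<notin> sobolev \<mu> h (2 * \<sigma>) p" using no by (simp add: sobolev_def)
  ultimately show "\<not> closed_under_mult (sobolev \<mu> h (2 * \<sigma>) p)" unfolding closed_under_mult_def by blast
  have "sing \<in> sobolev_homogeneous X \<mu> h (2 * \<sigma>) p \<inter> Lp \<infinity> \<mu>"
    using g sing_Lp sing_Lp_loc by (simp add: sobolev_homogeneous_def)
  moreover have "(\<lambda>x. sing x * sing x) \<notin> sobolev_homogeneous X \<mu> h (2 * \<sigma>) p \<inter> Lp \<infinity> \<mu>"
    using no by (simp add: sobolev_homogeneous_def)
  ultimately show "\<not> closed_under_mult (sobolev_homogeneous X \<mu> h (2 * \<sigma>) p \<inter> Lp \<infinity> \<mu>)"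
    unfolding closed_under_mult_def by blast
qed

end

lemma inv_exponent_less:
  assumes "0 < \<alpha>" and p: "1 < p" and "ennreal \<alpha> * p > 2"
  shows "inv_exponent p < \<alpha> / 2"
proof (cases "p = \<infinity>")
  case False
  define P where "P = enn2real p"
  have pP: "p = ennreal P" using False by (simp add: P_def less_top)
  have P: "P > 1"
  proof -
    have "ennreal 1 < ennreal P" using p pP by simp
    then show ?thesis by (subst (asm) ennreal_less_iff) auto
  qed
  have "ennreal 2 < ennreal (\<alpha> * P)" using assms P by (simp add: pP ennreal_mult)
  then have "2 < \<alpha> * P" by (subst (asm) ennreal_less_iff) auto
  then show ?thesis using False P by (simp add: inv_exponent_def P_def[symmetric] field_simps)
qed (use assms in \<open>simp add: inv_exponent_def\<close>)

theorem theorem1p3: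
  fixes \<alpha> :: real and p :: ennreal
  assumes "1 < \<alpha>" and "\<alpha> < 2" and "1 < p" and "ennreal \<alpha> * p > 2"
  shows "\<exists>(X :: real metric) \<mu> D L h.
    compact_space (mtopology_of X) \<and> borel_measure_on X \<mu> \<and> ahlfors_regular X \<mu> \<and>
    operator_L2 \<mu> D L \<and> dense_L2 \<mu> D \<and> nonneg_definite \<mu> D L \<and> self_adjoint \<mu> D L \<and>
    (\<exists>F E. dirichlet_form \<mu> F E \<and> strongly_local X \<mu> F E \<and> generator_of_form \<mu> F E D L) \<and>
    (\<exists>l>0. spectrum_L2 \<mu> D L \<subseteq> {l..}) \<and> heat_kernel \<mu> D L h \<and>
    \<not> closed_under_mult (sobolev \<mu> h \<alpha> p) \<and>
    \<not> closed_under_mult (sobolev_homogeneous X \<mu> h \<alpha> p \<inter> Lp \<infinity> \<mu>)"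
proof -
  define \<sigma> where "\<sigma> = \<alpha> / 2"
  define \<nu> where "\<nu> = (\<sigma> - inv_exponent p) / 4"
  have ip: "0 \<le> inv_exponent p" "inv_exponent p < \<sigma>"
    using inv_exponent_less[of \<alpha> p] assms by (auto simp: inv_exponent_def \<sigma>_def)
  have \<sigma>: "0 < \<sigma>" "\<sigma> < 1" using assms by (auto simp: \<sigma>_def)
  interpret laguerre_power \<nu> \<sigma>
    by unfold_locales (use ip \<sigma> in \<open>auto simp: \<nu>_def\<close>)
  have small: "inv_exponent p + 4 * \<nu> \<le> \<sigma>" unfolding \<nu>_def by (simp add: field_simps)
  have \<alpha>: "\<alpha> = 2 * \<sigma>" by (simp add: \<sigma>_def)
  have "dirichlet_form (speed_measure \<nu>) formD formE"
    unfolding dirichlet_form_def using closed_formE markovian_formE by blast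
  then have form: "\<exists>F E. dirichlet_form (speed_measure \<nu>) F E \<and> strongly_local (half_line_metric \<nu>) (speed_measure \<nu>) F E
      \<and> generator_of_form (speed_measure \<nu>) F E opD opL"
    using strongly_local_formE generator_formE by blast
  have gap: "\<exists>l>0. spectrum_L2 (speed_measure \<nu>) opD opL \<subseteq> {l..}"
    using spectrum_opL nu_pos by blast
  have dense: "dense_L2 (speed_measure \<nu>) opD" by (rule dense_if_psum) (rule psum_opD)
  show ?thesis unfolding \<alpha>
    by (rule exI[of _ "half_line_metric \<nu>"], rule exI[of _ "speed_measure \<nu>"], rule exI[of _ opD],
        rule exI[of _ opL], rule exI[of _ "heat_ker \<nu>"])
       (intro conjI compact_X borel_X ahlfors_X operator_opL dense nonneg_opL self_adjoint_opL form gap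
        heat_kernel_heat_ker not_algebra[OF assms(3) small])
qed

end
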